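(* Two convex polyhedral cusps with particles with the same metric on the boundary and the same singular curvatures are isometric. That is: let $g$ be a hyperbolic metric with conical singularities of positive singular curvature on the torus $\mathbb{T}$, with singular set $\Sigma$, and let $M,M'$ be convex polyhedral cusps with particles whose boundaries are identified isometrically with $(\mathbb{T},g)$. If $\kappa_i(M)=\kappa_i(M')$ for all $i\in\Sigma$, then $M$ and $M'$ are isometric.
   Context: A hyperbolic metric with conical singularities of positive singular curvature on $\mathbb{T}$ is a metric locally isometric to the hyperbolic plane away from a finite set $\Sigma$ of points, near each of which it is a hyperbolic cone of angle in $(0,2\pi)$. A semi-ideal pyramid in $\mathbb{H}^3$ is the convex hull of a convex polygon $A$ (its base) and a point $a\in\partial\overline{\mathbb{H}^3}$ (its apex) not coplanar to $A$; its lateral edges are the half-lines from the vertices of $A$ to $a$. A cuspidal complex is a collection of semi-ideal pyramids glued isometrically along some pairs of faces so that combinatorially the gluing is the cone with an ideal apex over a polyhedral decomposition of the torus. For a horoball $B$ centered at the apex of a pyramid $\Delta$ and disjoint from its base, $\Delta\setminus B$ is called a truncated semi-ideal pyramid. The complex is compatible if every pyramid can be truncated so that the gluing isometries restrict to the faces of the truncated pyramids. A polyhedral cusp with particles is the hyperbolic cone-manifold defined by a compatible cuspidal complex. Its boundary is the union of the bases of the pyramids, with the induced metric; when the boundary is $(\mathbb{T},g)$, the vertices of the decomposition are the points of $\Sigma$. The half-lines coming from the lateral edges of the pyramids are called particles, one starting at each $i\in\Sigma$. The cusp is convex if the total dihedral angle at every boundary edge is $\le\pi$. If $\omega_i$ is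 the total dihedral angle around the particle starting at $i$, the singular curvature of that particle is $\kappa_i=2\pi-\omega_i$. *)

theory Defs
  imports "HOL-Analysis.Analysis"
begin

text \<open>
  Hyperbolic space is taken in the Klein (projective) model: the open unit ball, with the unit
  sphere as ideal boundary.  Hyperbolic planes, convex hulls, polytopes and faces are then the
  intersections of the affine ones with the ball, so the library's \<^const>\<open>convex\<close>,
  \<^const>\<open>face_of\<close>, \<^const>\<open>edge_of\<close> etc. have their hyperbolic meaning.
\<close>

abbreviation hyp_space :: "'a::euclidean_space set" where
  "hyp_space \<equiv> ball 0 1"

definition hyp_dist :: "'a::euclidean_space \<Rightarrow> 'a \<Rightarrow> real" where
  "hyp_dist x y = arcosh ((1 - x \<bullet> y) / sqrt ((1 - x \<bullet> x) * (1 - y \<bullet> y)))"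

text \<open>
  The level sets of the function below are the horospheres centred at the ideal point \<open>a\<close>: it
  is minus the Lorentz product of the hyperboloid lift of \<open>x\<close> and the light-like vector \<open>(a, 1)\<close>.
\<close>

definition horoball :: "'a::euclidean_space \<Rightarrow> real \<Rightarrow> 'a set" where
  "horoball a c = {x \<in> hyp_space. (1 - x \<bullet> a) / sqrt (1 - x \<bullet> x) < c}"

definition isometry_between ::
    "'a set \<Rightarrow> ('a \<Rightarrow> 'a \<Rightarrow> real) \<Rightarrow> 'b set \<Rightarrow> ('b \<Rightarrow> 'b \<Rightarrow> real) \<Rightarrow> ('a \<Rightarrow> 'b) \<Rightarrow> bool" where
  "isometry_between X dX Y dY f \<longleftrightarrow>
     bij_betw f X Y \<and> (\<forall>x\<in>X. \<forall>y\<in>X. dY (f x) (f y) = dX x y)"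


subsection \<open>Hyperbolic metrics with conical singularities on the torus\<close>

definition torus :: "(complex \<times> complex) set" where
  "torus = sphere 0 1 \<times> sphere 0 1"

text \<open>
  The hyperbolic cone of angle \<open>\<alpha>\<close> in polar coordinates \<open>(r, \<theta>)\<close>, the apex being \<open>(0, 0)\<close>.  The
  distance is given by the hyperbolic law of cosines.  It is only used for \<open>\<alpha> < 2 * pi\<close>, when the
  angle between two rays is less than \<open>pi\<close>, so that geodesics through the apex need no separate
  treatment.
\<close>

definition hyp_cone :: "real \<Rightarrow> (real \<times> real) set" where
  "hyp_cone \<alpha> = {(r, \<theta>). 0 < r \<and> 0 \<le> \<theta> \<and> \<theta> < \<alpha>} \<union> {(0, 0)}"

definition hyp_cone_dist :: "real \<Rightarrow> real \<times> real \<Rightarrow> real \<times> real \<Rightarrow> real" where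
  "hyp_cone_dist \<alpha> = (\<lambda>(r, \<theta>) (s, \<eta>).
     arcosh (cosh r * cosh s - sinh r * sinh s * cos (min \<bar>\<theta> - \<eta>\<bar> (\<alpha> - \<bar>\<theta> - \<eta>\<bar>))))"

definition curve_length :: "('a \<Rightarrow> 'a \<Rightarrow> real) \<Rightarrow> (real \<Rightarrow> 'a) \<Rightarrow> ereal" where
  "curve_length d c =
     (SUP ts \<in> {ts. sorted ts \<and> set ts \<subseteq> {0..1}}.
        ereal (\<Sum>k<length ts - 1. d (c (ts ! k)) (c (ts ! Suc k))))"

definition length_metric :: "'a set \<Rightarrow> ('a \<Rightarrow> 'a \<Rightarrow> real) \<Rightarrow> bool" where
  "length_metric X d \<longleftrightarrow>
     (\<forall>x\<in>X. \<forall>y\<in>X. ereal (d x y) =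
        (INF c \<in> {c. pathin (Metric_space.mtopology X d) c \<and> c 0 = x \<and> c 1 = y}.
           curve_length d c))"

text \<open>
  The metric is recorded by its distance function.  Requiring this to be a length metric excludes
  distances that are only locally those of a hyperbolic cone-metric.
\<close>

definition hyp_cone_metric_on_torus ::
    "(complex \<times> complex \<Rightarrow> complex \<times> complex \<Rightarrow> real) \<Rightarrow> (complex \<times> complex) set \<Rightarrow> bool" where
  "hyp_cone_metric_on_torus g Sing \<longleftrightarrow>
     Metric_space torus g \<and>
     Metric_space.mtopology torus g = top_of_set torus \<and>
     length_metric torus g \<and>
     finite Sing \<and> Sing \<subseteq> torus \<and>
     (\<forall>x \<in> torus - Sing. \<exists>\<epsilon>>0. \<exists>y \<in> (hyp_space :: (real^2) set). \<exists>f.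
        isometry_between (Metric_space.mball torus g x \<epsilon>) g
          {z \<in> hyp_space. hyp_dist y z < \<epsilon>} hyp_dist f) \<and>
     (\<forall>x \<in> Sing. \<exists>\<epsilon>>0. \<exists>\<alpha>. 0 < \<alpha> \<and> \<alpha> < 2 * pi \<and> (\<exists>f.
        isometry_between (Metric_space.mball torus g x \<epsilon>) g
          {p \<in> hyp_cone \<alpha>. fst p < \<epsilon>} (hyp_cone_dist \<alpha>) f \<and> f x = (0, 0)))"


subsection \<open>Dihedral angles\<close>

text \<open>
  The plane \<open>{x. n \<bullet> x = c}\<close> meets the ball iff \<open>n \<bullet> n - c\<^sup>2 > 0\<close>, and is the plane Lorentz-orthogonal
  to the space-like vector \<open>(n, c)\<close>.  The outer normal of a facet is normalised to have Lorentz
  square 1; the interior dihedral angle is \<open>pi\<close> minus the angle between the outer normals.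
\<close>

definition lorentz :: "'a::euclidean_space \<times> real \<Rightarrow> 'a \<times> real \<Rightarrow> real" where
  "lorentz = (\<lambda>(m, b) (n, c). m \<bullet> n - b * c)"

definition outer_normal :: "'a::euclidean_space set \<Rightarrow> 'a set \<Rightarrow> 'a \<times> real" where
  "outer_normal P F = (THE u. lorentz u u = 1 \<and>
     P \<subseteq> {x. fst u \<bullet> x \<le> snd u} \<and> F = P \<inter> {x. fst u \<bullet> x = snd u})"

definition dihedral_angle :: "'a::euclidean_space set \<Rightarrow> 'a set \<Rightarrow> 'a set \<Rightarrow> real" where
  "dihedral_angle P F G = arccos (- lorentz (outer_normal P F) (outer_normal P G))"


subsection \<open>Semi-ideal pyramids\<close>

definition convex_polygon :: "(real^3) set \<Rightarrow> bool" where
  "convex_polygon A \<longleftrightarrow> polytope A \<and> aff_dim A = 2 \<and> A \<subseteq> hyp_space"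

definition semi_ideal_pyramid :: "(real^3) set \<Rightarrow> real^3 \<Rightarrow> bool" where
  "semi_ideal_pyramid A a \<longleftrightarrow> convex_polygon A \<and> a \<in> sphere 0 1 \<and> a \<notin> affine hull A"

text \<open>\<open>pyramid A a\<close> includes the ideal point \<open>a\<close>, which is removed wherever points matter.
  Applied to an edge of the base it gives the lateral face over that edge.\<close>

definition pyramid :: "(real^3) set \<Rightarrow> real^3 \<Rightarrow> (real^3) set" where
  "pyramid A a = convex hull (insert a A)"

definition base_angle :: "(real^3) set \<Rightarrow> real^3 \<Rightarrow> (real^3) set \<Rightarrow> real" where
  "base_angle A a e = dihedral_angle (pyramid A a) A (pyramid e a)"

definition lateral_angle :: "(real^3) set \<Rightarrow> real^3 \<Rightarrow> real^3 \<Rightarrow> real" where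
  "lateral_angle A a v = (THE \<omega>. \<exists>e f. e edge_of A \<and> f edge_of A \<and> e \<noteq> f \<and> v \<in> e \<and> v \<in> f \<and>
     \<omega> = dihedral_angle (pyramid A a) (pyramid e a) (pyramid f a))"


subsection \<open>Cuspidal complexes\<close>

text \<open>
  A side \<open>(i, e)\<close> is an edge \<open>e\<close> of the base of the \<open>i\<close>-th pyramid; it also stands for the lateral
  face over \<open>e\<close>.  The lateral face over \<open>s\<close> is glued to the one over \<open>mate s\<close> by \<open>gluing s\<close>.
\<close>

record 'i cuspidal_complex =
  cells :: "'i set"
  base :: "'i \<Rightarrow> (real^3) set"
  apex :: "'i \<Rightarrow> real^3"
  mate :: "'i \<times> (real^3) set \<Rightarrow> 'i \<times> (real^3) set"
  gluing :: "'i \<times> (real^3) set \<Rightarrow> real^3 \<Rightarrow> real^3"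

definition sides :: "'i cuspidal_complex \<Rightarrow> ('i \<times> (real^3) set) set" where
  "sides C = {(i, e). i \<in> cells C \<and> e edge_of base C i}"

definition lateral_face :: "'i cuspidal_complex \<Rightarrow> 'i \<times> (real^3) set \<Rightarrow> (real^3) set" where
  "lateral_face C s = pyramid (snd s) (apex C (fst s)) - {apex C (fst s)}"

definition pyramid_points :: "'i cuspidal_complex \<Rightarrow> ('i \<times> (real^3)) set" where
  "pyramid_points C = (SIGMA i : cells C. pyramid (base C i) (apex C i) - {apex C i})"

definition base_points :: "'i cuspidal_complex \<Rightarrow> ('i \<times> (real^3)) set" where
  "base_points C = (SIGMA i : cells C. base C i)"

text \<open>
  The gluing is symmetric, because \<open>gluing (mate s)\<close> is required to be inverse to \<open>gluing s\<close>, so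
  its reflexive transitive closure is the generated equivalence relation.
\<close>

definition glued :: "'i cuspidal_complex \<Rightarrow> (('i \<times> (real^3)) \<times> ('i \<times> (real^3))) set" where
  "glued C = {((fst s, x), (fst (mate C s), gluing C s x)) | s x.
                s \<in> sides C \<and> x \<in> lateral_face C s}\<^sup>*"

definition cuspidal_complex :: "'i cuspidal_complex \<Rightarrow> bool" where
  "cuspidal_complex C \<longleftrightarrow>
     finite (cells C) \<and>
     (\<forall>i \<in> cells C. semi_ideal_pyramid (base C i) (apex C i)) \<and>
     (\<forall>s \<in> sides C. mate C s \<in> sides C \<and> mate C s \<noteq> s \<and> mate C (mate C s) = s) \<and>
     (\<forall>s \<in> sides C.
        isometry_between (lateral_face C s) hyp_dist (lateral_face C (mate C s)) hyp_dist
          (gluing C s) \<and>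
        gluing C s ` snd s = snd (mate C s) \<and>
        (\<forall>x \<in> lateral_face C s. gluing C (mate C s) (gluing C s x) = x)) \<and>
     (\<exists>q. quotient_map (sum_topology (\<lambda>i. top_of_set (base C i)) (cells C)) (top_of_set torus) q \<and>
          (\<forall>x \<in> base_points C. \<forall>y \<in> base_points C. q x = q y \<longleftrightarrow> (x, y) \<in> glued C))"

definition compatible :: "'i cuspidal_complex \<Rightarrow> bool" where
  "compatible C \<longleftrightarrow> (\<exists>B.
     (\<forall>i \<in> cells C. (\<exists>c>0. B i = horoball (apex C i) c) \<and> B i \<inter> base C i = {}) \<and>
     (\<forall>s \<in> sides C. gluing C s ` (lateral_face C s - B (fst s)) =
        lateral_face C (mate C s) - B (fst (mate C s))))"


subsection \<open>Polyhedral cusps with particles\<close>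

text \<open>
  The quotient metric of a gluing: infimum of the total lengths of chains of segments, each within
  one piece, the end of each being glued to the start of the next.  As the pieces are convex, this
  is the path metric of the glued space.
\<close>

definition gluing_dist ::
    "('i \<times> (real^3)) set \<Rightarrow> (('i \<times> (real^3)) \<times> ('i \<times> (real^3))) set \<Rightarrow>
     ('i \<times> (real^3)) set \<Rightarrow> ('i \<times> (real^3)) set \<Rightarrow> real" where
  "gluing_dist S R X Y =
     Inf {\<Sum>(p, q)\<leftarrow>ch. hyp_dist (snd p) (snd q) | ch.
            ch \<noteq> [] \<and>
            (\<forall>(p, q) \<in> set ch. p \<in> S \<and> q \<in> S \<and> fst p = fst q) \<and>
            successively (\<lambda>(_, q) (p', _). (q, p') \<in> R) ch \<and>
            fst (hd ch) \<in> X \<and> snd (last ch) \<in> Y}"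

definition cusp_space :: "'i cuspidal_complex \<Rightarrow> ('i \<times> (real^3)) set set" where
  "cusp_space C = pyramid_points C // glued C"

definition cusp_dist ::
    "'i cuspidal_complex \<Rightarrow> ('i \<times> (real^3)) set \<Rightarrow> ('i \<times> (real^3)) set \<Rightarrow> real" where
  "cusp_dist C = gluing_dist (pyramid_points C) (glued C)"

text \<open>
  The gluing matches base edges with base edges and vertices with vertices, so the boundary and its
  vertex set are sets of points of \<^term>\<open>cusp_space C\<close>.  The boundary metric is the induced path metric.
\<close>

definition cusp_boundary :: "'i cuspidal_complex \<Rightarrow> ('i \<times> (real^3)) set set" where
  "cusp_boundary C = base_points C // glued C"

definition boundary_dist ::
    "'i cuspidal_complex \<Rightarrow> ('i \<times> (real^3)) set \<Rightarrow> ('i \<times> (real^3)) set \<Rightarrow> real" where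
  "boundary_dist C = gluing_dist (base_points C) (glued C)"

definition base_vertices :: "'i cuspidal_complex \<Rightarrow> ('i \<times> (real^3)) set" where
  "base_vertices C = {(i, v). i \<in> cells C \<and> v extreme_point_of base C i}"

definition boundary_vertices :: "'i cuspidal_complex \<Rightarrow> ('i \<times> (real^3)) set set" where
  "boundary_vertices C = base_vertices C // glued C"

text \<open>
  A particle is given by its starting point \<open>X\<close>, a class of base vertices; a pyramid contributes once
  for each of its lateral edges in the particle.
\<close>

definition particle_angle :: "'i cuspidal_complex \<Rightarrow> ('i \<times> (real^3)) set \<Rightarrow> real" where
  "particle_angle C X =
     (\<Sum>(i, v) \<in> X \<inter> base_vertices C. lateral_angle (base C i) (apex C i) v)"

definition singular_curvature :: "'i cuspidal_complex \<Rightarrow> ('i \<times> (real^3)) set \<Rightarrow> real" where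
  "singular_curvature C X = 2 * pi - particle_angle C X"

definition side_angle :: "'i cuspidal_complex \<Rightarrow> 'i \<times> (real^3) set \<Rightarrow> real" where
  "side_angle C s = base_angle (base C (fst s)) (apex C (fst s)) (snd s)"

definition polyhedral_cusp :: "'i cuspidal_complex \<Rightarrow> bool" where
  "polyhedral_cusp C \<longleftrightarrow> cuspidal_complex C \<and> compatible C"

definition convex_cusp :: "'i cuspidal_complex \<Rightarrow> bool" where
  "convex_cusp C \<longleftrightarrow> (\<forall>s \<in> sides C. side_angle C s + side_angle C (mate C s) \<le> pi)"

definition boundary_identification ::
    "(complex \<times> complex \<Rightarrow> complex \<times> complex \<Rightarrow> real) \<Rightarrow> (complex \<times> complex) set \<Rightarrow>
     'i cuspidal_complex \<Rightarrow> (complex \<times> complex \<Rightarrow> ('i \<times> (real^3)) set) \<Rightarrow> bool" where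
  "boundary_identification g Sing C \<phi> \<longleftrightarrow>
     isometry_between torus g (cusp_boundary C) (boundary_dist C) \<phi> \<and>
     \<phi> ` Sing = boundary_vertices C"

definition isometric_cusps :: "'i cuspidal_complex \<Rightarrow> 'j cuspidal_complex \<Rightarrow> bool" where
  "isometric_cusps C D \<longleftrightarrow>
     (\<exists>f. isometry_between (cusp_space C) (cusp_dist C) (cusp_space D) (cusp_dist D) f)"

end

theory Submission
  imports Defs
begin

text \<open>
  On each pyramid, normalise the exponential of the Busemann function of the apex by the truncation;
  compatibility makes it a positive function \<open>F\<close> on the boundary torus.  In polar coordinates at
  \<open>z\<close> it reads \<open>F z * (cosh r + G t * sinh r)\<close>, where \<open>G\<close> is piecewise a sinusoid, convexity of the
  cusp says that its kinks are concave, and the cone angle of the particle is an integral of a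
  function of \<open>G\<close> and \<open>G'\<close>.  If \<open>G0 \<le> G1\<close> have the same integral, then \<open>G0 = G1\<close> or they
  separate in a direction where \<open>G0 \<ge> 0\<close>.

  Let \<open>F\<close> and \<open>F'\<close> belong to two cusps with the same curvatures, scaled so that \<open>F'/F\<close> has minimum 1,
  and let \<open>E\<close> be the set where \<open>F' = F\<close>.  At a point maximising \<open>F\<close> on the frontier of \<open>E\<close> the
  dichotomy gives a ray in the frontier along which \<open>F\<close> increases, a contradiction.  So \<open>F'\<close> is a
  constant multiple of \<open>F\<close>, and matching points over the same boundary point at the same
  depth preserves the lengths of curves.
\<close>

section \<open>Cone angles of piecewise sinusoidal profiles\<close>

text \<open>In the unit sphere of directions at a boundary point take as pole the direction away
  from the apex. The directions in a base polygon trace an arc of a great circle and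
  \<open>G\<close> is the cosine of the distance from the pole. Hence \<open>G\<close> is sinusoidal
  on each corner, and the cone angle is the longitude swept: \<open>angle_density\<close> is the
  angular speed about the pole of a unit-speed curve whose cosine \<open>x\<close> has derivative
  \<open>p\<close>.

  The two cusps may have different decompositions, so they are compared only through functions on
  the torus, and the circles of directions must be recovered from the distance function
  \<open>g\<close> alone.

  The obstacle is that equal cone angles do not force equal profiles: half a great circle that
  misses the poles always subtends \<open>pi\<close>, so a profile can be raised over an arc of
  length \<open>pi\<close> by a positive sinusoid at no cost. Comparison at one point is therefore
  inconclusive, and the exceptional case is excluded globally. At non-singular points the same
  argument runs with the angle \<open>\<alpha>\<close> of the metric, since all corners there are
  half discs.\<close>

definition angle_density :: "real \<Rightarrow> real \<Rightarrow> real" where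
 "angle_density x p = sqrt (1 - x\<^sup>2 - p\<^sup>2) / (1 - x\<^sup>2)"

text \<open>Minus the partial derivative of \<open>angle_density\<close> in \<open>p\<close>: the
  momentum in the first variation of the cone angle.\<close>

definition angle_slope :: "real \<Rightarrow> real \<Rightarrow> real" where
 "angle_slope x p = p / ((1 - x\<^sup>2) * sqrt (1 - x\<^sup>2 - p\<^sup>2))"

text \<open>The spherical law of cosines solved for the angle at the pole, for a side of length
  \<open>\<theta>\<close> whose ends have distances from the pole with cosines \<open>x\<close> and
  \<open>y\<close>.\<close>

definition sector_angle :: "real \<Rightarrow> real \<Rightarrow> real \<Rightarrow> real" where
 "sector_angle \<theta> x y = arccos ((cos \<theta> - x * y) / (sqrt (1 - x\<^sup>2) * sqrt (1 - y\<^sup>2)))"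

lemma rot_norm: "(x * cos t + p * sin t)\<^sup>2 + (p * cos t - x * sin t)\<^sup>2 = x\<^sup>2 + (p::real)\<^sup>2"
proof -
 have "(x * cos t + p * sin t)\<^sup>2 + (p * cos t - x * sin t)\<^sup>2 = (x\<^sup>2 + p\<^sup>2) * ((cos t)\<^sup>2 + (sin t)\<^sup>2)"
  by algebra
 thus ?thesis by simp
qed

text \<open>Up to the factor \<open>(1 - x\<^sup>2) * (1 - y\<^sup>2)\<close>, the quantity
  \<open>1 - W\<^sup>2\<close> is the Gram determinant of three unit vectors with mutual cosines
  \<open>x\<close>, \<open>y\<close> and \<open>cos t\<close>. Along a great circle with initial
  data \<open>x\<close>, \<open>p\<close> it factors.\<close>

lemma sector_cos_sq:
 fixes x p t :: real
 assumes N: "x\<^sup>2 + p\<^sup>2 < 1" and y: "y = x * cos t + p * sin t"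
 defines "W \<equiv> (cos t - x * y) / (sqrt (1 - x\<^sup>2) * sqrt (1 - y\<^sup>2))"
 shows "1 - W\<^sup>2 = (sin t)\<^sup>2 * (1 - x\<^sup>2 - p\<^sup>2) / ((1 - x\<^sup>2) * (1 - y\<^sup>2))"
  and "x\<^sup>2 < 1" and "y\<^sup>2 < 1"
proof -
 show x1: "x\<^sup>2 < 1" using N by (smt (verit) zero_le_power2)
 show y1: "y\<^sup>2 < 1" using rot_norm[of x t p] N y by (smt (verit) zero_le_power2)
 have "W\<^sup>2 = (cos t - x * y)\<^sup>2 / ((1 - x\<^sup>2) * (1 - y\<^sup>2))"
  unfolding W_def power_divide power_mult_distrib using x1 y1 by simp
 moreover have "(1 - x\<^sup>2) * (1 - y\<^sup>2) - (cos t - x * y)\<^sup>2 = (sin t)\<^sup>2 * (1 - x\<^sup>2 - p\<^sup>2)"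
  unfolding y using sin_cos_squared_add[of t] by algebra
 moreover have "(1 - x\<^sup>2) * (1 - y\<^sup>2) \<noteq> 0" using x1 y1 by simp
 ultimately show "1 - W\<^sup>2 = (sin t)\<^sup>2 * (1 - x\<^sup>2 - p\<^sup>2) / ((1 - x\<^sup>2) * (1 - y\<^sup>2))"
  by (simp add: field_simps)
qed

lemma sector_cos_sqrt:
 fixes x p t :: real
 assumes N: "x\<^sup>2 + p\<^sup>2 < 1" and y: "y = x * cos t + p * sin t" and t: "0 < t" "t < pi"
 defines "W \<equiv> (cos t - x * y) / (sqrt (1 - x\<^sup>2) * sqrt (1 - y\<^sup>2))"
 shows "sqrt (1 - W\<^sup>2) = sin t * sqrt (1 - x\<^sup>2 - p\<^sup>2) / (sqrt (1 - x\<^sup>2) * sqrt (1 - y\<^sup>2))"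
  and "-1 < W" "W < 1"
proof -
 have s: "sin t > 0" using t by (simp add: sin_gt_zero)
 show "sqrt (1 - W\<^sup>2) = sin t * sqrt (1 - x\<^sup>2 - p\<^sup>2) / (sqrt (1 - x\<^sup>2) * sqrt (1 - y\<^sup>2))"
  using sector_cos_sq(1)[OF N y] s by (simp add: W_def real_sqrt_divide real_sqrt_mult)
 have "1 - W\<^sup>2 > 0" using sector_cos_sq[OF N y] N s by (simp add: W_def)
 hence "\<bar>W\<bar> < 1" by (simp add: abs_square_less_1)
 thus "-1 < W" "W < 1" by auto
qed

text \<open>First variation formula. Great circles are extremal for the swept longitude, so only the
  endpoint momenta survive, with opposite signs. The proof differentiates the arccos directly;
  \<open>p\<close> and its rotated value are the slopes of the great circle at its two ends.\<close>

lemma sector_angle_deriv: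
 assumes t: "0 < t" "t < pi"
  and f: "(f has_real_derivative f') (at s)" and g: "(g has_real_derivative g') (at s)"
  and N: "(f s)\<^sup>2 + p\<^sup>2 < 1" and y: "g s = f s * cos t + p * sin t"
 shows "((\<lambda>s. sector_angle t (f s) (g s)) has_real_derivative
   f' * angle_slope (f s) p - g' * angle_slope (g s) (p * cos t - f s * sin t)) (at s)"
proof -
 define x where "x = f s"
 define y where "y = g s"
 define q where "q = p * cos t - x * sin t"
 define W where "W = (cos t - x * y) / (sqrt (1 - x\<^sup>2) * sqrt (1 - y\<^sup>2))"
 have N': "x\<^sup>2 + p\<^sup>2 < 1" and y': "y = x * cos t + p * sin t" using N y by (auto simp: x_def y_def)
 have s: "sin t > 0" using t by (simp add: sin_gt_zero)
 note sq = sector_cos_sq[OF N' y']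
 note sr = sector_cos_sqrt[OF N' y' t, folded W_def]
 define a b n where "a = sqrt (1 - x\<^sup>2)" and "b = sqrt (1 - y\<^sup>2)" and "n = sqrt (1 - x\<^sup>2 - p\<^sup>2)"
 have ab: "a > 0" "b > 0" "n > 0" "a\<^sup>2 = 1 - x\<^sup>2" "b\<^sup>2 = 1 - y\<^sup>2" "n\<^sup>2 = 1 - x\<^sup>2 - p\<^sup>2"
  using sq(2,3) N' by (auto simp: a_def b_def n_def)
 have sr1: "sqrt (1 - W\<^sup>2) = sin t * n / (a * b)" using sr(1) by (simp add: a_def b_def n_def)
 have yq: "1 - y\<^sup>2 - q\<^sup>2 = 1 - x\<^sup>2 - p\<^sup>2" using rot_norm[of x t p] by (simp add: y' q_def)
 have Dt: "((\<lambda>s. (cos t - f s * g s) / (sqrt (1 - (f s)\<^sup>2) * sqrt (1 - (g s)\<^sup>2))) has_real_derivative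
   (- (f' * y + x * g') * (a * b) - (cos t - x * y) * (- (x * f' / a) * b + a * (- (y * g' / b)))) / (a * b)\<^sup>2) (at s)"
  using sq(2,3) unfolding a_def b_def x_def y_def by (auto intro!: derivative_eq_intros f g simp: field_simps power2_eq_square)
 have e: "(- (f' * y + x * g') * (a * b) - (cos t - x * y) * (- (x * f' / a) * b + a * (- (y * g' / b)))) / (a * b)\<^sup>2
  = (f' * (x * cos t - y) * b\<^sup>2 + g' * (y * cos t - x) * a\<^sup>2) / (a ^ 3 * b ^ 3)"
 proof -
  have "- (f' * y + x * g') * (a * b) - (cos t - x * y) * (- (x * f' / a) * b + a * (- (y * g' / b)))
   = (f' * b\<^sup>2 * (- y * a\<^sup>2 + (cos t - x * y) * x) + g' * a\<^sup>2 * (- x * b\<^sup>2 + (cos t - x * y) * y)) / (a * b)"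
   using ab(1,2) by (simp add: field_simps power2_eq_square)
  also have "- y * a\<^sup>2 + (cos t - x * y) * x = x * cos t - y" unfolding ab by algebra
  also have "- x * b\<^sup>2 + (cos t - x * y) * y = y * cos t - x" unfolding ab by algebra
  finally show ?thesis using ab(1,2) by (simp add: field_simps power2_eq_square power3_eq_cube)
 qed
 have xy: "x * cos t - y = - p * sin t" "y * cos t - x = q * sin t"
 proof -
  show "x * cos t - y = - p * sin t" by (simp add: y')
  show "y * cos t - x = q * sin t" unfolding y' q_def using sin_cos_squared_add[of t] by algebra
 qed
 have 1: "((\<lambda>s. sector_angle t (f s) (g s)) has_real_derivative
   inverse (- sqrt (1 - W\<^sup>2)) * ((f' * (x * cos t - y) * b\<^sup>2 + g' * (y * cos t - x) * a\<^sup>2) / (a ^ 3 * b ^ 3))) (at s)"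
  unfolding sector_angle_def
  apply (rule DERIV_chain2[OF _ Dt[unfolded e]]) using DERIV_arccos[of W] sr(2,3) by (simp add: W_def x_def y_def)
 have 2: "inverse (- sqrt (1 - W\<^sup>2)) * ((f' * (x * cos t - y) * b\<^sup>2 + g' * (y * cos t - x) * a\<^sup>2) / (a ^ 3 * b ^ 3))
   = f' * (p / (a\<^sup>2 * n)) - g' * (q / (b\<^sup>2 * n))" unfolding sr1 xy using s ab(1-3)
  by (simp add: field_simps power2_eq_square power3_eq_cube)
 have 3: "angle_slope x p = p / (a\<^sup>2 * n)" "angle_slope y q = q / (b\<^sup>2 * n)"
  unfolding angle_slope_def yq by (simp_all add: ab n_def)
 show ?thesis using 1 unfolding 2 3[symmetric] unfolding x_def y_def q_def .
qed

lemma sector_angle_integral: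
 assumes t: "0 \<le> t" "t < pi" and N: "x\<^sup>2 + p\<^sup>2 < (1::real)"
 shows "((\<lambda>s. angle_density (x * cos s + p * sin s) (p * cos s - x * sin s)) has_integral
   sector_angle t x (x * cos t + p * sin t)) {0..t}"
proof -
 define y where "y s = x * cos s + p * sin s" for s
 define q where "q s = p * cos s - x * sin s" for s
 define a n where "a = sqrt (1 - x\<^sup>2)" and "n = sqrt (1 - x\<^sup>2 - p\<^sup>2)"
 define b where "b s = sqrt (1 - (y s)\<^sup>2)" for s
 have x1: "x\<^sup>2 < 1" using N by (smt (verit) zero_le_power2)
 have y1: "(y s)\<^sup>2 < 1" for s using sector_cos_sq(3)[OF N] by (simp add: y_def)
 have ab: "a > 0" "b s > 0" "n > 0" "a\<^sup>2 = 1 - x\<^sup>2" "(b s)\<^sup>2 = 1 - (y s)\<^sup>2" "n\<^sup>2 = 1 - x\<^sup>2 - p\<^sup>2" for s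
  using x1 y1[of s] N by (auto simp: a_def b_def n_def less_imp_le)
 have yq: "1 - (y s)\<^sup>2 - (q s)\<^sup>2 = 1 - x\<^sup>2 - p\<^sup>2" for s using rot_norm[of x s p] by (simp add: y_def q_def)
 have cont: "continuous_on {0..t} (\<lambda>s. sector_angle s x (y s))" unfolding sector_angle_def
 proof (rule continuous_on_arccos)
  show "continuous_on {0..t} (\<lambda>s. (cos s - x * y s) / (sqrt (1 - x\<^sup>2) * sqrt (1 - (y s)\<^sup>2)))"
   using ab(1,2) unfolding a_def b_def y_def by (intro continuous_intros) (metis mult_eq_0_iff less_irrefl)
  show "\<forall>s\<in>{0..t}. - 1 \<le> (cos s - x * y s) / (sqrt (1 - x\<^sup>2) * sqrt (1 - (y s)\<^sup>2)) \<and>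
    (cos s - x * y s) / (sqrt (1 - x\<^sup>2) * sqrt (1 - (y s)\<^sup>2)) \<le> 1"
  proof
   fix s assume "s \<in> {0..t}"
   have "1 - ((cos s - x * y s) / (sqrt (1 - x\<^sup>2) * sqrt (1 - (y s)\<^sup>2)))\<^sup>2 \<ge> 0"
    using sector_cos_sq[OF N y_def[of s]] N y1[of s] x1 by simp
   thus "- 1 \<le> (cos s - x * y s) / (sqrt (1 - x\<^sup>2) * sqrt (1 - (y s)\<^sup>2)) \<and>
    (cos s - x * y s) / (sqrt (1 - x\<^sup>2) * sqrt (1 - (y s)\<^sup>2)) \<le> 1"
    by (metis abs_le_iff abs_square_le_1 diff_ge_0_iff_ge minus_le_iff)
  qed
 qed
 have der: "((\<lambda>s. sector_angle s x (y s)) has_vector_derivative angle_density (y s) (q s)) (at s)"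
  if s: "s \<in> {0<..<t}" for s
 proof -
  have sp: "0 < s" "s < pi" using s t by auto
  have sn: "sin s > 0" using sp by (simp add: sin_gt_zero)
  define W where "W = (cos s - x * y s) / (sqrt (1 - x\<^sup>2) * sqrt (1 - (y s)\<^sup>2))"
  note sr = sector_cos_sqrt[OF N y_def sp, folded W_def]
  have sr1: "sqrt (1 - W\<^sup>2) = sin s * n / (a * b s)" using sr(1) by (simp add: a_def b_def n_def)
  have D: "((\<lambda>s. (cos s - x * y s) / (sqrt (1 - x\<^sup>2) * sqrt (1 - (y s)\<^sup>2))) has_real_derivative
    ((- sin s - x * q s) * (a * b s) - (cos s - x * y s) * (a * (- (y s * q s / b s)))) / (a * b s)\<^sup>2) (at s)"
  proof -
   have Dy: "(y has_real_derivative q s) (at s)" unfolding y_def[abs_def] q_def by (auto intro!: derivative_eq_intros)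
   have Db: "(b has_real_derivative - (y s * q s / b s)) (at s)"
    unfolding b_def[abs_def] using y1[of s] by (auto intro!: derivative_eq_intros Dy simp: field_simps)
   have "((\<lambda>s. (cos s - x * y s) / (a * b s)) has_real_derivative
     ((- sin s - x * q s) * (a * b s) - (cos s - x * y s) * (a * (- (y s * q s / b s)))) / (a * b s)\<^sup>2) (at s)"
    using ab(1) ab(2)[of s] by (auto intro!: derivative_eq_intros Dy Db simp: power2_eq_square mult_ac)
   thus ?thesis by (simp add: a_def b_def)
  qed
  have e: "((- sin s - x * q s) * (a * b s) - (cos s - x * y s) * (a * (- (y s * q s / b s)))) / (a * b s)\<^sup>2
    = - (sin s * n\<^sup>2) / (a * (b s) ^ 3)"
  proof -
   have "(- sin s - x * q s) * (b s)\<^sup>2 + (cos s - x * y s) * (y s * q s) = - (sin s * n\<^sup>2)"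
    unfolding ab y_def q_def using sin_cos_squared_add[of s] by algebra
   moreover have "((- sin s - x * q s) * (a * b s) - (cos s - x * y s) * (a * (- (y s * q s / b s)))) / (a * b s)\<^sup>2
    = ((- sin s - x * q s) * (b s)\<^sup>2 + (cos s - x * y s) * (y s * q s)) / (a * (b s) ^ 3)"
    using ab(1) ab(2)[of s] by (simp add: field_simps power2_eq_square power3_eq_cube)
   ultimately show ?thesis by simp
  qed
  have 1: "((\<lambda>s. sector_angle s x (y s)) has_real_derivative
   inverse (- sqrt (1 - W\<^sup>2)) * (- (sin s * n\<^sup>2) / (a * (b s) ^ 3))) (at s)" unfolding sector_angle_def
   apply (rule DERIV_chain2[OF _ D[unfolded e]]) using DERIV_arccos[of W] sr(2,3) by (simp add: W_def)
  have 2: "inverse (- sqrt (1 - W\<^sup>2)) * (- (sin s * n\<^sup>2) / (a * (b s) ^ 3)) = n / (b s)\<^sup>2"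
   unfolding sr1 using sn ab(1,3) ab(2)[of s] by (simp add: field_simps power2_eq_square power3_eq_cube)
  have 3: "angle_density (y s) (q s) = n / (b s)\<^sup>2" unfolding angle_density_def yq by (simp add: ab n_def)
  show ?thesis using 1 unfolding 2 3 by (simp add: has_real_derivative_iff_has_vector_derivative)
 qed
 \<comment> \<open>At \<open>s = 0\<close> the argument of arccos is 1, where arccos is not
   differentiable; the interior form of the fundamental theorem needs only continuity there.\<close>
 have "((\<lambda>s. angle_density (y s) (q s)) has_integral (sector_angle t x (y t) - sector_angle 0 x (y 0))) {0..t}"
  by (rule fundamental_theorem_of_calculus_interior[OF t(1) cont der])
 moreover have "sector_angle 0 x (y 0) = 0" using x1 by (simp add: sector_angle_def y_def power2_eq_square)
 ultimately show ?thesis by (simp add: y_def q_def)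
qed

text \<open>Strict concavity of \<open>angle_density\<close> in the slope. The strictness is what
  makes the equality case at a kink rigid.\<close>

lemma angle_slope_strict_mono:
 assumes "x\<^sup>2 + p\<^sup>2 < 1" "x\<^sup>2 + q\<^sup>2 < (1::real)" "p < q"
 shows "angle_slope x p < angle_slope x q"
proof -
 have pos: "0 \<le> u ==> u < v ==> x\<^sup>2 + v\<^sup>2 < 1 ==> u / sqrt (1 - x\<^sup>2 - u\<^sup>2) < v / sqrt (1 - x\<^sup>2 - v\<^sup>2)" for u v
 proof -
  assume u: "0 \<le> u" "u < v" "x\<^sup>2 + v\<^sup>2 < 1"
  have "u\<^sup>2 < v\<^sup>2" using u by (simp add: power_strict_mono)
  hence "sqrt (1 - x\<^sup>2 - v\<^sup>2) < sqrt (1 - x\<^sup>2 - u\<^sup>2)" "0 < sqrt (1 - x\<^sup>2 - v\<^sup>2)" using u by auto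
  thus ?thesis using u by (intro frac_less) auto
 qed
 have "p / sqrt (1 - x\<^sup>2 - p\<^sup>2) < q / sqrt (1 - x\<^sup>2 - q\<^sup>2)"
 proof (cases "0 \<le> p")
  case True thus ?thesis using pos assms by blast
 next
  case False
  show ?thesis
  proof (cases "q \<le> 0")
   case True
   have "-q / sqrt (1 - x\<^sup>2 - (-q)\<^sup>2) < -p / sqrt (1 - x\<^sup>2 - (-p)\<^sup>2)" using True assms by (intro pos) auto
   thus ?thesis by simp
  next
   case F2: False
   have "p / sqrt (1 - x\<^sup>2 - p\<^sup>2) < 0" using False assms by (simp add: divide_neg_pos)
   moreover have "q / sqrt (1 - x\<^sup>2 - q\<^sup>2) > 0" using F2 assms by (simp)
   ultimately show ?thesis by simp
  qed
 qed
 moreover have "x\<^sup>2 < 1" using assms(1) by (smt (verit) zero_le_power2)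
 moreover have "angle_slope x u = (u / sqrt (1 - x\<^sup>2 - u\<^sup>2)) / (1 - x\<^sup>2)" for u by (simp add: angle_slope_def)
 ultimately show ?thesis by (simp add: divide_strict_right_mono del: divide_divide_eq_left)
qed

text \<open>\<open>dp\<close> and \<open>dm\<close> are the right and left slopes, and
  \<open>dp t \<le> dm t\<close> makes the kink concave. The square of the amplitude of a sinusoid
  is the sum of the squares of its value and slope, so the last two bounds say that both great
  circles miss the pole and its antipode.\<close>

definition conc_germ :: "(real \<Rightarrow> real) \<Rightarrow> (real \<Rightarrow> real) \<Rightarrow> (real \<Rightarrow> real) \<Rightarrow> real \<Rightarrow> bool" where
 "conc_germ G dp dm t \<longleftrightarrow>
   (\<exists>\<eta>>0. (\<forall>s\<in>{t..t+\<eta>}. G s = G t * cos (s - t) + dp t * sin (s - t)) \<and>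
      (\<forall>s\<in>{t-\<eta>..t}. G s = G t * cos (s - t) + dm t * sin (s - t))) \<and>
   dp t \<le> dm t \<and> (G t)\<^sup>2 + (dp t)\<^sup>2 < 1 \<and> (G t)\<^sup>2 + (dm t)\<^sup>2 < 1"

lemma sinusoid_recenter:
 "A * cos (s - t) + B * sin (s - t) =
   (A * cos (u - t) + B * sin (u - t)) * cos (s - u) + (B * cos (u - t) - A * sin (u - t)) * sin (s - (u::real))"
proof -
 have e: "s - t = (s - u) + (u - t)" by simp
 show ?thesis unfolding e cos_add sin_add by (simp add: algebra_simps)
qed

lemma sinusoid_germ_eq:
 fixes A B p \<eta> :: real
 assumes "\<eta> > 0" and "\<And>s. 0 \<le> s ==> s \<le> \<eta> ==> A * cos s + B * sin s = A * cos s + p * sin s"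
 shows "B = p"
proof -
 have "sin (min \<eta> 1) > 0" using assms(1) pi_gt3 by (intro sin_gt_zero) auto
 thus ?thesis using assms(2)[of "min \<eta> 1"] assms(1) by auto
qed

text \<open>The half-open intervals are forced: at an end of the interval only the slope pointing
  into it is determined.\<close>

lemma conc_germ_sinusoid:
 assumes germ: "\<And>t. conc_germ G dp dm t"
  and G: "\<And>s. s \<in> {a..b} ==> G s = A * cos (s - t) + B * sin (s - t)"
 shows "u \<in> {a..<b} ==> dp u = B * cos (u - t) - A * sin (u - t)"
  and "u \<in> {a<..b} ==> dm u = B * cos (u - t) - A * sin (u - t)"
proof -
 assume u: "u \<in> {a..<b}"
 obtain \<eta> where \<eta>: "\<eta> > 0" "\<And>s. s\<in>{u..u+\<eta>} ==> G s = G u * cos (s - u) + dp u * sin (s - u)"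
  using germ[of u] unfolding conc_germ_def by blast
 show "dp u = B * cos (u - t) - A * sin (u - t)"
 proof (rule sinusoid_germ_eq[symmetric, of "min \<eta> (b - u)" "G u"])
  show "min \<eta> (b - u) > 0" using \<eta> u by auto
  fix s assume s: "0 \<le> s" "s \<le> min \<eta> (b - u)"
  have "G (u + s) = G u * cos s + dp u * sin s" using \<eta>(2)[of "u + s"] s by auto
  moreover have "G (u + s) = G u * cos s + (B * cos (u - t) - A * sin (u - t)) * sin s"
   using G[of "u + s"] G[of u] s u sinusoid_recenter[of A "u + s" t B u] by auto
  ultimately show "G u * cos s + (B * cos (u - t) - A * sin (u - t)) * sin s = G u * cos s + dp u * sin s" by simp
 qed
next
 assume u: "u \<in> {a<..b}"
 obtain \<eta> where \<eta>: "\<eta> > 0" "\<And>s. s\<in>{u-\<eta>..u} ==> G s = G u * cos (s - u) + dm u * sin (s - u)"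
  using germ[of u] unfolding conc_germ_def by blast
 have "- (B * cos (u - t) - A * sin (u - t)) = - dm u"
 proof (rule sinusoid_germ_eq[of "min \<eta> (u - a)" "G u"])
  show "min \<eta> (u - a) > 0" using \<eta> u by auto
  fix s assume s: "0 \<le> s" "s \<le> min \<eta> (u - a)"
  have "G (u - s) = G u * cos s - dm u * sin s" using \<eta>(2)[of "u - s"] s by auto
  moreover have "G (u - s) = G u * cos s - (B * cos (u - t) - A * sin (u - t)) * sin s"
   using G[of "u - s"] G[of u] s u sinusoid_recenter[of A "u - s" t B u] by auto
  ultimately show "G u * cos s + - (B * cos (u - t) - A * sin (u - t)) * sin s = G u * cos s + - dm u * sin s"
   unfolding mult_minus_left by linarith
 qed
 thus "dm u = B * cos (u - t) - A * sin (u - t)" by simp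
qed

text \<open>Keeps linear interpolations of two profiles inside the disc on which
  \<open>angle_density\<close> and \<open>angle_slope\<close> are smooth.\<close>

lemma convex_disc:
 fixes x p x' p' s :: real
 assumes "x\<^sup>2 + p\<^sup>2 < 1" "x'\<^sup>2 + p'\<^sup>2 < 1" "0 \<le> s" "s \<le> 1"
 shows "(x + s * (x' - x))\<^sup>2 + (p + s * (p' - p))\<^sup>2 < 1"
proof -
 have "(x + s * (x' - x))\<^sup>2 + (p + s * (p' - p))\<^sup>2 + s * (1 - s) * ((x - x')\<^sup>2 + (p - p')\<^sup>2)
   = (1 - s) * (x\<^sup>2 + p\<^sup>2) + s * (x'\<^sup>2 + p'\<^sup>2)" by algebra
 moreover have "s * (1 - s) * ((x - x')\<^sup>2 + (p - p')\<^sup>2) \<ge> 0" using assms by simp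
 moreover have "(1 - s) * (x\<^sup>2 + p\<^sup>2) + s * (x'\<^sup>2 + p'\<^sup>2) < 1"
 proof (cases "s = 0")
  case False
  have "(1 - s) * (x\<^sup>2 + p\<^sup>2) \<le> (1 - s) * 1" using assms by (intro mult_left_mono) auto
  moreover have "s * (x'\<^sup>2 + p'\<^sup>2) < s * 1" using assms False by (intro mult_strict_left_mono) auto
  ultimately show ?thesis by simp
 qed (use assms in auto)
 ultimately show ?thesis by linarith
qed

text \<open>Momentum of the interpolated profile; it is applied both to the right slopes
  \<open>p\<close> and to the left slopes \<open>m\<close>.\<close>

definition slope_interp where
 "slope_interp G0 p0 G1 p1 t s = angle_slope (G0 t + s * (G1 t - G0 t)) (p0 t + s * (p1 t - p0 t))"

text \<open>
 \<open>J s\<close> is the cone angle over \<open>{a..b}\<close> of the interpolation \<open>(1 - s) G0 + s G1\<close>.  Its derivative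
 is a sum over the kinks of the increment \<open>G1 - G0\<close> times the jump of \<open>angle_slope\<close>, plus the
 boundary terms below.
\<close>
definition interp_angle where
 "interp_angle G0 p0 m0 G1 p1 m1 a b \<longleftrightarrow> (\<exists>J::real\<Rightarrow>real.
   ((\<lambda>t. angle_density (G0 t) (p0 t)) has_integral J 0) {a..b} \<and>
   ((\<lambda>t. angle_density (G1 t) (p1 t)) has_integral J 1) {a..b} \<and>
   (\<forall>s\<in>{0..1}. \<exists>D. (J has_real_derivative D) (at s) \<and>
    D \<le> (G1 a - G0 a) * slope_interp G0 p0 G1 p1 a s - (G1 b - G0 b) * slope_interp G0 m0 G1 m1 b s \<and>
    (0 < s --> s < 1 -->
     D = (G1 a - G0 a) * slope_interp G0 p0 G1 p1 a s - (G1 b - G0 b) * slope_interp G0 m0 G1 m1 b s -->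
      (\<forall>t\<in>{a<..<b}. G1 t = G0 t \<or> (p0 t = m0 t \<and> p1 t = m1 t)))))"

text \<open>Without kinks every interpolant is a single great circle arc, so its cone angle is a
  \<open>sector_angle\<close> and the first variation formula holds with equality. The bound
  \<open>b < a + pi\<close> is the range in which that formula is available.\<close>

lemma interp_angle_cell:
 assumes ab: "a < b" "b < a + pi"
  and germ: "\<And>t. conc_germ G0 p0 m0 t" "\<And>t. conc_germ G1 p1 m1 t"
  and S: "\<And>s. s \<in> {a..b} ==> G0 s = A0 * cos (s - t0) + B0 * sin (s - t0)"
   "\<And>s. s \<in> {a..b} ==> G1 s = A1 * cos (s - t0) + B1 * sin (s - t0)"
 shows "interp_angle G0 p0 m0 G1 p1 m1 a b"
proof -
 note d0 = conc_germ_sinusoid[of G0 p0 m0 a b, OF germ(1) S(1)]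
 note d1 = conc_germ_sinusoid[of G1 p1 m1 a b, OF germ(2) S(2)]
 define \<theta> where "\<theta> = b - a"
 have th: "0 < \<theta>" "\<theta> < pi" using ab by (auto simp: \<theta>_def)
 have n0: "(G0 a)\<^sup>2 + (p0 a)\<^sup>2 < 1" and n1: "(G1 a)\<^sup>2 + (p1 a)\<^sup>2 < 1" using germ unfolding conc_germ_def by blast+
 have f0: "G0 (a + s) = G0 a * cos s + p0 a * sin s" if "0 \<le> s" "s \<le> \<theta>" for s
  using S(1)[of a] S(1)[of "a+s"] d0(1)[of a] sinusoid_recenter[of A0 "a+s" t0 B0 a] that ab by (auto simp: \<theta>_def)
 have f1: "G1 (a + s) = G1 a * cos s + p1 a * sin s" if "0 \<le> s" "s \<le> \<theta>" for s
  using S(2)[of a] S(2)[of "a+s"] d1(1)[of a] sinusoid_recenter[of A1 "a+s" t0 B1 a] that ab by (auto simp: \<theta>_def)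
 have S': "\<And>s. s \<in> {a..b} ==> G0 s = G0 a * cos (s - a) + p0 a * sin (s - a)"
   "\<And>s. s \<in> {a..b} ==> G1 s = G1 a * cos (s - a) + p1 a * sin (s - a)"
  using f0 f1 by (force simp: \<theta>_def dest: spec[of _ "_ - a"])+
 note e0 = conc_germ_sinusoid[of G0 p0 m0 a b, OF germ(1) S'(1)]
 note e1 = conc_germ_sinusoid[of G1 p1 m1 a b, OF germ(2) S'(2)]
 define J where "J s = sector_angle \<theta> (G0 a + s * (G1 a - G0 a)) (G0 b + s * (G1 b - G0 b))" for s
 have b: "G0 b = G0 a * cos \<theta> + p0 a * sin \<theta>" "G1 b = G1 a * cos \<theta> + p1 a * sin \<theta>"
  using f0[of \<theta>] f1[of \<theta>] th by (auto simp: \<theta>_def)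
 have mb: "m0 b = p0 a * cos \<theta> - G0 a * sin \<theta>" "m1 b = p1 a * cos \<theta> - G1 a * sin \<theta>"
  using e0(2)[of b] e1(2)[of b] ab by (auto simp: \<theta>_def)
 have int: "((\<lambda>t. angle_density (G t) (p t)) has_integral sector_angle \<theta> (G a) (G b)) {a..b}"
  if n: "(G a)\<^sup>2 + (p a)\<^sup>2 < 1" and g: "\<And>s. s \<in> {a..b} ==> G s = G a * cos (s - a) + p a * sin (s - a)"
   and pp: "\<And>s. s \<in> {a..<b} ==> p s = p a * cos (s - a) - G a * sin (s - a)" for G p
 proof -
  have "((\<lambda>s. angle_density (G a * cos s + p a * sin s) (p a * cos s - G a * sin s)) has_integral
    sector_angle \<theta> (G a) (G b)) (cbox 0 \<theta>)"
   using sector_angle_integral[OF _ _ n, of \<theta>] th g[of b] ab by (auto simp: \<theta>_def)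
  from has_integral_affinity'[OF this, of 1 "-a"]
  have "((\<lambda>s. angle_density (G a * cos (s - a) + p a * sin (s - a)) (p a * cos (s - a) - G a * sin (s - a))) has_integral
    sector_angle \<theta> (G a) (G b)) {a..b}" by (simp add: \<theta>_def)
  \<comment> \<open>The right slope at \<open>b\<close> belongs to the next cell, so the integrand
    is known only away from \<open>b\<close>.\<close>
  thus ?thesis by (rule has_integral_spike_finite[where S = "{b}", rotated 2])
    (auto intro!: arg_cong2[where f = angle_density] g pp)
 qed
 have J01: "J 0 = sector_angle \<theta> (G0 a) (G0 b)" "J 1 = sector_angle \<theta> (G1 a) (G1 b)" by (simp_all add: J_def)
 have J0: "((\<lambda>t. angle_density (G0 t) (p0 t)) has_integral J 0) {a..b}" unfolding J01 by (rule int[OF n0 S'(1) e0(1)])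
 have J1: "((\<lambda>t. angle_density (G1 t) (p1 t)) has_integral J 1) {a..b}" unfolding J01 by (rule int[OF n1 S'(2) e1(1)])
 have smooth: "p0 t = m0 t \<and> p1 t = m1 t" if "t \<in> {a<..<b}" for t
  using e0(1)[of t] e0(2)[of t] e1(1)[of t] e1(2)[of t] that by auto
 have D: "(J has_real_derivative ((G1 a - G0 a) * slope_interp G0 p0 G1 p1 a s - (G1 b - G0 b) * slope_interp G0 m0 G1 m1 b s)) (at s)"
  if s: "s \<in> {0..1}" for s
 proof -
  have "((\<lambda>s. sector_angle \<theta> (G0 a + s * (G1 a - G0 a)) (G0 b + s * (G1 b - G0 b))) has_real_derivative
    (G1 a - G0 a) * angle_slope (G0 a + s * (G1 a - G0 a)) (p0 a + s * (p1 a - p0 a)) -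
    (G1 b - G0 b) * angle_slope (G0 b + s * (G1 b - G0 b)) ((p0 a + s * (p1 a - p0 a)) * cos \<theta> - (G0 a + s * (G1 a - G0 a)) * sin \<theta>)) (at s)"
  proof (rule sector_angle_deriv[OF th])
   show "(G0 a + s * (G1 a - G0 a))\<^sup>2 + (p0 a + s * (p1 a - p0 a))\<^sup>2 < 1" using convex_disc[OF n0 n1] s by auto
   show "G0 b + s * (G1 b - G0 b) = (G0 a + s * (G1 a - G0 a)) * cos \<theta> + (p0 a + s * (p1 a - p0 a)) * sin \<theta>"
    by (simp add: b algebra_simps)
  qed (auto intro!: derivative_eq_intros)
  moreover have "(p0 a + s * (p1 a - p0 a)) * cos \<theta> - (G0 a + s * (G1 a - G0 a)) * sin \<theta> = m0 b + s * (m1 b - m0 b)"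
   by (simp add: mb algebra_simps)
  ultimately show ?thesis by (simp add: slope_interp_def J_def[abs_def])
 qed
 show ?thesis unfolding interp_angle_def using J0 J1 D smooth by (intro exI[of _ J] conjI ballI) auto
qed

text \<open>A concave kink of either profile lowers the interpolated slope, and the momentum is
  increasing in the slope. At \<open>s = 0\<close> or \<open>s = 1\<close> one of the profiles has
  weight zero and its kink would go unseen; hence the strict bounds on \<open>s\<close> in the
  equality case.\<close>

lemma slope_interp_mono:
 assumes "conc_germ G0 p0 m0 t" "conc_germ G1 p1 m1 t" "0 \<le> s" "s \<le> 1"
 shows "slope_interp G0 p0 G1 p1 t s \<le> slope_interp G0 m0 G1 m1 t s"
  and "0 < s ==> s < 1 ==> slope_interp G0 p0 G1 p1 t s = slope_interp G0 m0 G1 m1 t s ==> p0 t = m0 t \<and> p1 t = m1 t"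
proof -
 have g: "p0 t \<le> m0 t" "(G0 t)\<^sup>2 + (p0 t)\<^sup>2 < 1" "(G0 t)\<^sup>2 + (m0 t)\<^sup>2 < 1"
  "p1 t \<le> m1 t" "(G1 t)\<^sup>2 + (p1 t)\<^sup>2 < 1" "(G1 t)\<^sup>2 + (m1 t)\<^sup>2 < 1"
  using assms unfolding conc_germ_def by blast+
 define P where "P = p0 t + s * (p1 t - p0 t)"
 define M where "M = m0 t + s * (m1 t - m0 t)"
 have MP: "M - P = (1 - s) * (m0 t - p0 t) + s * (m1 t - p1 t)" by (simp add: M_def P_def algebra_simps)
 have t: "(1 - s) * (m0 t - p0 t) \<ge> 0" "s * (m1 t - p1 t) \<ge> 0" using g assms(3,4) by auto
 hence PM: "P \<le> M" using MP by linarith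
 have n: "(G0 t + s * (G1 t - G0 t))\<^sup>2 + P\<^sup>2 < 1" "(G0 t + s * (G1 t - G0 t))\<^sup>2 + M\<^sup>2 < 1"
  unfolding P_def M_def using convex_disc g assms by blast+
 show "slope_interp G0 p0 G1 p1 t s \<le> slope_interp G0 m0 G1 m1 t s" unfolding slope_interp_def P_def[symmetric] M_def[symmetric]
  using angle_slope_strict_mono[OF n] PM by (cases "P = M") (auto simp: less_le)
 assume s: "0 < s" "s < 1" and e: "slope_interp G0 p0 G1 p1 t s = slope_interp G0 m0 G1 m1 t s"
 have "P = M" using angle_slope_strict_mono[OF n] PM e unfolding slope_interp_def P_def[symmetric] M_def[symmetric] by fastforce
 hence "(1 - s) * (m0 t - p0 t) = 0" "s * (m1 t - p1 t) = 0" using MP t by linarith+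
 thus "p0 t = m0 t \<and> p1 t = m1 t" using s by auto
qed

text \<open>At the junction the two endpoint terms combine to the nonnegative increment times the
  jump of the momentum, which is at most 0 at a concave kink. Equality in the sum forces equality in
  both halves and at the junction.\<close>

lemma interp_angle_trans:
 assumes germ: "conc_germ G0 p0 m0 b" "conc_germ G1 p1 m1 b" and le: "G0 b \<le> G1 b"
  and ab: "a < b" "b < c"
  and 1: "interp_angle G0 p0 m0 G1 p1 m1 a b" and 2: "interp_angle G0 p0 m0 G1 p1 m1 b c"
 shows "interp_angle G0 p0 m0 G1 p1 m1 a c"
proof -
 obtain J where J: "((\<lambda>t. angle_density (G0 t) (p0 t)) has_integral J 0) {a..b}"
   "((\<lambda>t. angle_density (G1 t) (p1 t)) has_integral J 1) {a..b}"
   "\<And>s. s\<in>{0..1} ==> \<exists>D. (J has_real_derivative D) (at s) \<and>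
    D \<le> (G1 a - G0 a) * slope_interp G0 p0 G1 p1 a s - (G1 b - G0 b) * slope_interp G0 m0 G1 m1 b s \<and>
    (0 < s --> s < 1 -->
     D = (G1 a - G0 a) * slope_interp G0 p0 G1 p1 a s - (G1 b - G0 b) * slope_interp G0 m0 G1 m1 b s -->
      (\<forall>t\<in>{a<..<b}. G1 t = G0 t \<or> (p0 t = m0 t \<and> p1 t = m1 t)))" using 1 unfolding interp_angle_def by blast
 obtain K where K: "((\<lambda>t. angle_density (G0 t) (p0 t)) has_integral K 0) {b..c}"
   "((\<lambda>t. angle_density (G1 t) (p1 t)) has_integral K 1) {b..c}"
   "\<And>s. s\<in>{0..1} ==> \<exists>D. (K has_real_derivative D) (at s) \<and>
    D \<le> (G1 b - G0 b) * slope_interp G0 p0 G1 p1 b s - (G1 c - G0 c) * slope_interp G0 m0 G1 m1 c s \<and>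
    (0 < s --> s < 1 -->
     D = (G1 b - G0 b) * slope_interp G0 p0 G1 p1 b s - (G1 c - G0 c) * slope_interp G0 m0 G1 m1 c s -->
      (\<forall>t\<in>{b<..<c}. G1 t = G0 t \<or> (p0 t = m0 t \<and> p1 t = m1 t)))" using 2 unfolding interp_angle_def by blast
 show ?thesis unfolding interp_angle_def
 proof (intro exI[of _ "\<lambda>s. J s + K s"] conjI ballI)
  show "((\<lambda>t. angle_density (G0 t) (p0 t)) has_integral J 0 + K 0) {a..c}" using has_integral_combine[OF _ _ J(1) K(1)] ab by simp
  show "((\<lambda>t. angle_density (G1 t) (p1 t)) has_integral J 1 + K 1) {a..c}" using has_integral_combine[OF _ _ J(2) K(2)] ab by simp
  fix s :: real assume s: "s \<in> {0..1}"
  obtain D where D: "(J has_real_derivative D) (at s)"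
    "D \<le> (G1 a - G0 a) * slope_interp G0 p0 G1 p1 a s - (G1 b - G0 b) * slope_interp G0 m0 G1 m1 b s"
    "0 < s --> s < 1 -->
     D = (G1 a - G0 a) * slope_interp G0 p0 G1 p1 a s - (G1 b - G0 b) * slope_interp G0 m0 G1 m1 b s -->
      (\<forall>t\<in>{a<..<b}. G1 t = G0 t \<or> (p0 t = m0 t \<and> p1 t = m1 t))" using J(3)[OF s] by blast
  obtain E where E: "(K has_real_derivative E) (at s)"
    "E \<le> (G1 b - G0 b) * slope_interp G0 p0 G1 p1 b s - (G1 c - G0 c) * slope_interp G0 m0 G1 m1 c s"
    "0 < s --> s < 1 -->
     E = (G1 b - G0 b) * slope_interp G0 p0 G1 p1 b s - (G1 c - G0 c) * slope_interp G0 m0 G1 m1 c s -->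
      (\<forall>t\<in>{b<..<c}. G1 t = G0 t \<or> (p0 t = m0 t \<and> p1 t = m1 t))" using K(3)[OF s] by blast
  note mono = slope_interp_mono[OF germ, of s]
  have m: "(G1 b - G0 b) * slope_interp G0 p0 G1 p1 b s \<le> (G1 b - G0 b) * slope_interp G0 m0 G1 m1 b s"
   using mono(1) le s by (intro mult_left_mono) auto
  show "\<exists>D. ((\<lambda>s. J s + K s) has_real_derivative D) (at s) \<and>
    D \<le> (G1 a - G0 a) * slope_interp G0 p0 G1 p1 a s - (G1 c - G0 c) * slope_interp G0 m0 G1 m1 c s \<and>
    (0 < s --> s < 1 -->
     D = (G1 a - G0 a) * slope_interp G0 p0 G1 p1 a s - (G1 c - G0 c) * slope_interp G0 m0 G1 m1 c s -->
      (\<forall>t\<in>{a<..<c}. G1 t = G0 t \<or> (p0 t = m0 t \<and> p1 t = m1 t)))"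
  proof (intro exI[of _ "D + E"] conjI impI)
   show "((\<lambda>s. J s + K s) has_real_derivative D + E) (at s)" using D(1) E(1) by (rule DERIV_add)
   show "D + E \<le> (G1 a - G0 a) * slope_interp G0 p0 G1 p1 a s - (G1 c - G0 c) * slope_interp G0 m0 G1 m1 c s"
    using D(2) E(2) m by linarith
   assume s': "0 < s" "s < 1" and
    e: "D + E = (G1 a - G0 a) * slope_interp G0 p0 G1 p1 a s - (G1 c - G0 c) * slope_interp G0 m0 G1 m1 c s"
   have ed: "D = (G1 a - G0 a) * slope_interp G0 p0 G1 p1 a s - (G1 b - G0 b) * slope_interp G0 m0 G1 m1 b s"
    "E = (G1 b - G0 b) * slope_interp G0 p0 G1 p1 b s - (G1 c - G0 c) * slope_interp G0 m0 G1 m1 c s"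
    "(G1 b - G0 b) * slope_interp G0 p0 G1 p1 b s = (G1 b - G0 b) * slope_interp G0 m0 G1 m1 b s" using D(2) E(2) m e by linarith+
   have "G1 b = G0 b \<or> (p0 b = m0 b \<and> p1 b = m1 b)" using ed(3) mono(2) s' by auto
   thus "\<forall>t\<in>{a<..<c}. G1 t = G0 t \<or> (p0 t = m0 t \<and> p1 t = m1 t)"
    using D(3) E(3) ed s' by (metis greaterThanLessThan_iff linorder_neqE_linordered_idom)
  qed
 qed
qed

text \<open>The kinks are not listed anywhere; bisection passes from the germs at single points to
  the whole interval.\<close>

lemma interp_angle_exists:
 assumes ab: "a < b"
  and germ: "\<And>t. conc_germ G0 p0 m0 t" "\<And>t. conc_germ G1 p1 m1 t" and le: "\<And>t. G0 t \<le> G1 t"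
 shows "interp_angle G0 p0 m0 G1 p1 m1 a b"
proof -
 have "a < b --> interp_angle G0 p0 m0 G1 p1 m1 a b"
 proof (rule Bolzano[of a b "\<lambda>a b. a < b --> interp_angle G0 p0 m0 G1 p1 m1 a b"])
  show "a \<le> b" using ab by simp
  show "[|u < v --> interp_angle G0 p0 m0 G1 p1 m1 u v; v < w --> interp_angle G0 p0 m0 G1 p1 m1 v w; u \<le> v; v \<le> w|]
    ==> u < w --> interp_angle G0 p0 m0 G1 p1 m1 u w" for u v w
   using interp_angle_trans[OF germ(1) germ(2) le, of u v w] by (metis less_eq_real_def)
  fix x
  obtain \<eta>0 where e0: "\<eta>0 > 0" "\<And>s. s\<in>{x..x+\<eta>0} ==> G0 s = G0 x * cos (s - x) + p0 x * sin (s - x)"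
    "\<And>s. s\<in>{x-\<eta>0..x} ==> G0 s = G0 x * cos (s - x) + m0 x * sin (s - x)"
   using germ(1)[of x] unfolding conc_germ_def by blast
  obtain \<eta>1 where e1: "\<eta>1 > 0" "\<And>s. s\<in>{x..x+\<eta>1} ==> G1 s = G1 x * cos (s - x) + p1 x * sin (s - x)"
    "\<And>s. s\<in>{x-\<eta>1..x} ==> G1 s = G1 x * cos (s - x) + m1 x * sin (s - x)"
   using germ(2)[of x] unfolding conc_germ_def by blast
  show "\<exists>d>0. \<forall>a b. a \<le> x \<and> x \<le> b \<and> b - a < d --> a < b --> interp_angle G0 p0 m0 G1 p1 m1 a b"
  \<comment> \<open>The bound 1 keeps the two cells meeting at \<open>x\<close> shorter than
    \<open>pi\<close>.\<close>
  proof (intro exI[of _ "min (min \<eta>0 \<eta>1) 1"] conjI allI impI)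
   show "0 < min (min \<eta>0 \<eta>1) 1" using e0(1) e1(1) by simp
   fix a b assume h: "a \<le> x \<and> x \<le> b \<and> b - a < min (min \<eta>0 \<eta>1) 1" "a < b"
   have 1: "interp_angle G0 p0 m0 G1 p1 m1 a x" if "a < x" by (rule interp_angle_cell[OF that _ germ e0(3) e1(3)]) (use h pi_gt3 in auto)
   have 2: "interp_angle G0 p0 m0 G1 p1 m1 x b" if "x < b" by (rule interp_angle_cell[OF that _ germ e0(2) e1(2)]) (use h pi_gt3 in auto)
   show "interp_angle G0 p0 m0 G1 p1 m1 a b"
   proof -
    consider "a = x" | "x = b" | "a < x" "x < b" using h by linarith
    thus ?thesis
    proof cases
     case 3 thus ?thesis using interp_angle_trans[OF germ(1) germ(2) le 3 1 2] by blast
    qed (use 1 2 h in blast)+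
   qed
  qed
 qed
 thus ?thesis using ab by simp
qed

text \<open>The mean value theorem for \<open>J\<close> on one period: equal cone angles force the increment to vanish
 at every kink.\<close>
lemma cone_angle_rigid_kinks:
 assumes \<alpha>: "\<alpha> > 0"
  and germ: "\<And>t. conc_germ G0 p0 m0 t" "\<And>t. conc_germ G1 p1 m1 t" and le: "\<And>t. G0 t \<le> G1 t"
  and per: "\<And>t. G0 (t + \<alpha>) = G0 t" "\<And>t. G1 (t + \<alpha>) = G1 t"
   "\<And>t. p0 (t + \<alpha>) = p0 t" "\<And>t. p1 (t + \<alpha>) = p1 t" "\<And>t. m0 (t + \<alpha>) = m0 t" "\<And>t. m1 (t + \<alpha>) = m1 t"
  and eq: "integral {u..u+\<alpha>} (\<lambda>t. angle_density (G0 t) (p0 t)) = integral {u..u+\<alpha>} (\<lambda>t. angle_density (G1 t) (p1 t))"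
  and t: "t \<in> {u..<u+\<alpha>}"
 shows "G1 t = G0 t \<or> (p0 t = m0 t \<and> p1 t = m1 t)"
proof -
 have "interp_angle G0 p0 m0 G1 p1 m1 u (u+\<alpha>)" using \<alpha> by (intro interp_angle_exists germ le) auto
 then obtain J where J: "((\<lambda>t. angle_density (G0 t) (p0 t)) has_integral J 0) {u..u+\<alpha>}"
   "((\<lambda>t. angle_density (G1 t) (p1 t)) has_integral J 1) {u..u+\<alpha>}"
   "\<And>s. s\<in>{0..1} ==> \<exists>D. (J has_real_derivative D) (at s) \<and>
    D \<le> (G1 u - G0 u) * slope_interp G0 p0 G1 p1 u s - (G1 (u+\<alpha>) - G0 (u+\<alpha>)) * slope_interp G0 m0 G1 m1 (u+\<alpha>) s \<and>
    (0 < s --> s < 1 -->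
     D = (G1 u - G0 u) * slope_interp G0 p0 G1 p1 u s - (G1 (u+\<alpha>) - G0 (u+\<alpha>)) * slope_interp G0 m0 G1 m1 (u+\<alpha>) s -->
      (\<forall>t\<in>{u<..<u+\<alpha>}. G1 t = G0 t \<or> (p0 t = m0 t \<and> p1 t = m1 t)))" unfolding interp_angle_def by blast
 have "J 0 = J 1" using J(1,2) eq by (simp add: integral_unique)
 obtain D where D: "\<And>s. s \<in> {0..1} ==> (J has_real_derivative D s) (at s)" using J(3) by metis
 obtain s where s: "0 < s" "s < 1" "J 1 - J 0 = (1 - 0) * D s" using MVT2[of 0 1 J D] D by auto
 obtain E where E: "(J has_real_derivative E) (at s)"
    "E \<le> (G1 u - G0 u) * slope_interp G0 p0 G1 p1 u s - (G1 (u+\<alpha>) - G0 (u+\<alpha>)) * slope_interp G0 m0 G1 m1 (u+\<alpha>) s"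
    "E = (G1 u - G0 u) * slope_interp G0 p0 G1 p1 u s - (G1 (u+\<alpha>) - G0 (u+\<alpha>)) * slope_interp G0 m0 G1 m1 (u+\<alpha>) s -->
      (\<forall>t\<in>{u<..<u+\<alpha>}. G1 t = G0 t \<or> (p0 t = m0 t \<and> p1 t = m1 t))" using J(3)[of s] s by auto
 have "E = 0" using DERIV_unique[OF E(1) D[of s]] s \<open>J 0 = J 1\<close> by auto
 \<comment> \<open>By periodicity the two endpoint terms sit at the same point of the circle, so
   together they form one more kink term, at \<open>u\<close>.\<close>
 have per': "slope_interp G0 m0 G1 m1 (u+\<alpha>) s = slope_interp G0 m0 G1 m1 u s" by (simp add: slope_interp_def per)
 note mono = slope_interp_mono[OF germ(1)[of u] germ(2)[of u], of s]
 have m: "(G1 u - G0 u) * slope_interp G0 p0 G1 p1 u s \<le> (G1 u - G0 u) * slope_interp G0 m0 G1 m1 u s"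
  using mono(1) le[of u] s by (intro mult_left_mono) auto
 have e: "(G1 u - G0 u) * slope_interp G0 p0 G1 p1 u s = (G1 u - G0 u) * slope_interp G0 m0 G1 m1 u s"
  using E(2)[unfolded per per'] \<open>E = 0\<close> m by linarith
 have 1: "\<forall>t\<in>{u<..<u+\<alpha>}. G1 t = G0 t \<or> (p0 t = m0 t \<and> p1 t = m1 t)"
  using E(3)[unfolded per per'] \<open>E = 0\<close> e by linarith
 have 2: "G1 u = G0 u \<or> (p0 u = m0 u \<and> p1 u = m1 u)"
 proof (cases "G1 u = G0 u")
  case False
  hence "slope_interp G0 p0 G1 p1 u s = slope_interp G0 m0 G1 m1 u s" using e by simp
  thus ?thesis using mono(2)[OF _ _ s(1,2)] s by linarith
 qed simp
 have "t = u \<or> t \<in> {u<..<u+\<alpha>}" using t by auto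
 thus ?thesis using 1 2 by blast
qed

lemma sinusoid_coeffs:
 "x * cos (s - t) + p * sin (s - t) = (x * cos t - p * sin t) * cos s + (x * sin t + p * cos t) * sin (s::real)"
 unfolding cos_diff sin_diff by (simp add: algebra_simps)

lemma conc_germ_isCont:
 assumes "conc_germ G dp dm t" shows "isCont G t"
proof -
 obtain \<eta> where \<eta>: "\<eta> > 0" "\<And>s. s\<in>{t..t+\<eta>} ==> G s = G t * cos (s - t) + dp t * sin (s - t)"
  "\<And>s. s\<in>{t-\<eta>..t} ==> G s = G t * cos (s - t) + dm t * sin (s - t)" using assms unfolding conc_germ_def by blast
 have "((\<lambda>s. G t * cos (s - t) + dp t * sin (s - t)) \<longlongrightarrow> G t * cos (t - t) + dp t * sin (t - t)) (at_right t)"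
  by (intro tendsto_intros)
 moreover have "eventually (\<lambda>s. G t * cos (s - t) + dp t * sin (s - t) = G s) (at_right t)"
  unfolding eventually_at_right_field by (rule exI[of _ "t + \<eta>"]) (use \<eta>(1) in \<open>auto intro!: \<eta>(2)[symmetric]\<close>)
 ultimately have 1: "(G \<longlongrightarrow> G t) (at_right t)" by (simp add: filterlim_cong[OF refl refl] tendsto_cong)
 have "((\<lambda>s. G t * cos (s - t) + dm t * sin (s - t)) \<longlongrightarrow> G t * cos (t - t) + dm t * sin (t - t)) (at_left t)"
  by (intro tendsto_intros)
 moreover have "eventually (\<lambda>s. G t * cos (s - t) + dm t * sin (s - t) = G s) (at_left t)"
  unfolding eventually_at_left_field by (rule exI[of _ "t - \<eta>"]) (use \<eta>(1) in \<open>auto intro!: \<eta>(3)[symmetric]\<close>)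
 ultimately have 2: "(G \<longlongrightarrow> G t) (at_left t)" by (simp add: tendsto_cong)
 show ?thesis unfolding isCont_def using 1 2 by (simp add: filterlim_at_split)
qed

lemma conc_germ_smooth_interval:
 assumes germ: "\<And>t. conc_germ G dp dm t" and smooth: "\<And>t. t \<in> {a<..<b} ==> dp t = dm t"
  and c: "c \<in> {a<..<b}" and t: "t \<in> {a<..<b}"
 shows "G t = G c * cos (t - c) + dp c * sin (t - c)"
proof -
 \<comment> \<open>The coefficients of \<open>cos\<close> and \<open>sin\<close>, based at 0, of the
   sinusoid with value \<open>G t\<close> and slope \<open>dp t\<close> at \<open>t\<close>. They
   are locally constant where there is no kink, hence constant on an interval.\<close>
 define f where "f t = (G t * cos t - dp t * sin t, G t * sin t + dp t * cos t)" for t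
 have fl: "f u = f w" if "w \<in> {a<..<b}" "G u = G w * cos (u - w) + dp w * sin (u - w)"
  "dp u = dp w * cos (u - w) - G w * sin (u - w)" for u w
 proof -
  have "G w = G u * cos (w - u) + dp u * sin (w - u)" "dp w = dp u * cos (w - u) - G u * sin (w - u)"
   unfolding that(2,3) cos_diff sin_diff using sin_cos_squared_add[of u] sin_cos_squared_add[of w] by algebra+
  have "G u * cos u - dp u * sin u = G w * cos w - dp w * sin w"
   unfolding that(2,3) cos_diff sin_diff using sin_cos_squared_add[of u] by algebra
  moreover have "G u * sin u + dp u * cos u = G w * sin w + dp w * cos w"
   unfolding that(2,3) cos_diff sin_diff using sin_cos_squared_add[of u] by algebra
  ultimately show ?thesis by (simp add: f_def)
 qed
 have "f c = f t"
 proof (rule connected_local_const[of "{a<..<b}"])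
  show "\<forall>w\<in>{a<..<b}. eventually (\<lambda>u. f w = f u) (at w within {a<..<b})"
  proof
   fix w assume w: "w \<in> {a<..<b}"
   obtain \<eta> where \<eta>: "\<eta> > 0" "\<And>s. s\<in>{w..w+\<eta>} ==> G s = G w * cos (s - w) + dp w * sin (s - w)"
    "\<And>s. s\<in>{w-\<eta>..w} ==> G s = G w * cos (s - w) + dm w * sin (s - w)" using germ[of w] unfolding conc_germ_def by blast
   have "f w = f u" if u: "dist u w < \<eta>" for u
   proof (cases "w \<le> u")
    case True
    have "dp u = dp w * cos (u - w) - G w * sin (u - w)"
     by (rule conc_germ_sinusoid(1)[OF germ \<eta>(2)]) (use True u in \<open>auto simp: dist_real_def\<close>)
    moreover have "G u = G w * cos (u - w) + dp w * sin (u - w)"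
     by (rule \<eta>(2)) (use True u in \<open>auto simp: dist_real_def\<close>)
    ultimately show ?thesis using fl[OF w, of u] by simp
   next
    case False
    have "dp u = dm w * cos (u - w) - G w * sin (u - w)"
     by (rule conc_germ_sinusoid(1)[OF germ \<eta>(3)]) (use False u in \<open>auto simp: dist_real_def\<close>)
    moreover have "G u = G w * cos (u - w) + dm w * sin (u - w)"
     by (rule \<eta>(3)) (use False u in \<open>auto simp: dist_real_def\<close>)
    ultimately show ?thesis using fl[OF w, of u] smooth[OF w] by simp
   qed
   thus "eventually (\<lambda>u. f w = f u) (at w within {a<..<b})" unfolding eventually_at using \<eta>(1) by blast
  qed
 qed (use c t in auto)
 hence e: "G c * cos c - dp c * sin c = G t * cos t - dp t * sin t" "G c * sin c + dp c * cos c = G t * sin t + dp t * cos t"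
  by (auto simp: f_def)
 have "G t = (G t * cos t - dp t * sin t) * cos t + (G t * sin t + dp t * cos t) * sin t" using sin_cos_squared_add[of t] by algebra
 thus ?thesis unfolding e[symmetric] using sinusoid_coeffs[of "G c" t c "dp c"] by simp
qed

text \<open>
 Where \<open>G1 > G0\<close>, neither function has a kink, so the increment is a positive sinusoid there; hence
 the components of \<open>{G1 > G0}\<close> have length \<open>pi\<close> and \<open>G0\<close> takes opposite values at the two ends.
\<close>
lemma cone_angle_rigid:
 assumes \<alpha>: "\<alpha> > 0"
  and germ: "\<And>t. conc_germ G0 p0 m0 t" "\<And>t. conc_germ G1 p1 m1 t" and le: "\<And>t. G0 t \<le> G1 t"
  and per: "\<And>t. G0 (t + \<alpha>) = G0 t" "\<And>t. G1 (t + \<alpha>) = G1 t"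
   "\<And>t. p0 (t + \<alpha>) = p0 t" "\<And>t. p1 (t + \<alpha>) = p1 t" "\<And>t. m0 (t + \<alpha>) = m0 t" "\<And>t. m1 (t + \<alpha>) = m1 t"
  and eq: "\<And>u. integral {u..u+\<alpha>} (\<lambda>t. angle_density (G0 t) (p0 t)) = integral {u..u+\<alpha>} (\<lambda>t. angle_density (G1 t) (p1 t))"
 shows "(\<forall>t. G1 t = G0 t) \<or> (\<exists>t. G0 t \<ge> 0 \<and> G1 t = G0 t \<and> (\<forall>\<eta>>0. \<exists>t'. \<bar>t' - t\<bar> < \<eta> \<and> G0 t' < G1 t'))"
proof (rule disj_imp[THEN iffD2], rule impI)
 assume "\<not> (\<forall>t. G1 t = G0 t)"
 then obtain c where c: "G0 c < G1 c" using le by (metis order_le_imp_less_or_eq)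
 have smooth: "p0 t = m0 t \<and> p1 t = m1 t" if "G0 t < G1 t" for t
  using cone_angle_rigid_kinks[OF \<alpha> germ le per eq, where u = t] that \<alpha> by (metis atLeastLessThan_iff le_add_same_cancel1 less_add_same_cancel1 less_irrefl order_refl)
 have cont: "isCont (\<lambda>t. G1 t - G0 t) t" for t
  using conc_germ_isCont[OF germ(1)] conc_germ_isCont[OF germ(2)] by (intro continuous_intros) auto
 hence contS: "continuous_on S (\<lambda>t. G1 t - G0 t)" for S by (simp add: continuous_at_imp_continuous_on)
 define D where "D t = (G1 c - G0 c) * cos (t - c) + (p1 c - p0 c) * sin (t - c)" for t
 have Dpi: "D (t + pi) = - D t" for t
 proof -
  have "t + pi - c = (t - c) + pi" by simp
  thus ?thesis by (simp only: D_def cos_periodic_pi sin_periodic_pi)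
 qed
 have on: "G0 t = G0 c * cos (t - c) + p0 c * sin (t - c) \<and> G1 t - G0 t = D t"
  if "c \<in> {a<..<b}" "t \<in> {a<..<b}" "\<And>t. t \<in> {a<..<b} ==> G0 t < G1 t" for a b t
 proof -
  have "G0 t = G0 c * cos (t - c) + p0 c * sin (t - c)"
   by (rule conc_germ_smooth_interval[OF germ(1) _ that(1,2)]) (use smooth that(3) in blast)
  moreover have "G1 t = G1 c * cos (t - c) + p1 c * sin (t - c)"
   by (rule conc_germ_smooth_interval[OF germ(2) _ that(1,2)]) (use smooth that(3) in blast)
  ultimately show ?thesis by (simp add: D_def algebra_simps)
 qed
 have cl: "closed ({t. G1 t - G0 t = 0})" using contS[of UNIV] by (intro closed_Collect_eq) auto
 \<comment> \<open>If the increment stayed positive all the way to \<open>c + pi\<close>, it would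
   coincide with the sinusoid \<open>D\<close> up to there, but \<open>D (c + pi) = - D c\<close> is
   negative. The same holds to the left of \<open>c\<close>.\<close>
 have ex: "\<exists>b>c. b \<le> c + pi \<and> G1 b = G0 b" "\<exists>a<c. a \<ge> c - pi \<and> G1 a = G0 a"
 proof -
  have near: "\<exists>e>0. \<forall>t. \<bar>t - c\<bar> < e --> G0 t < G1 t"
  proof -
   have "eventually (\<lambda>t. G1 t - G0 t > 0) (at c)" using order_tendstoD(1)[OF cont[of c, unfolded isCont_def], of 0] c by simp
   then obtain d where "d > 0" "\<And>t. t \<noteq> c ==> dist t c < d ==> G1 t - G0 t > 0" unfolding eventually_at by blast
   thus ?thesis using c by (intro exI[of _ d]) (force simp: dist_real_def)
  qed
  then obtain e where e: "e > 0" "\<And>t. \<bar>t - c\<bar> < e ==> G0 t < G1 t" by blast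
  show "\<exists>b>c. b \<le> c + pi \<and> G1 b = G0 b"
  proof (rule ccontr)
   assume "\<not> ?thesis"
   hence n: "G0 t < G1 t" if "c < t" "t \<le> c + pi" for t using le[of t] that by (metis order_le_imp_less_or_eq)
   have l: "G0 t < G1 t" if "t \<in> {c-e<..<c+pi}" for t using n[of t] e(2)[of t] that e(1) c by (cases t c rule: linorder_cases) auto
   have l1: "((\<lambda>t. G1 t - G0 t) \<longlongrightarrow> G1 (c + pi) - G0 (c + pi)) (at_left (c + pi))"
    using cont[of "c + pi"] unfolding isCont_def by (simp add: filterlim_at_split)
   have l2: "(D \<longlongrightarrow> D (c + pi)) (at_left (c + pi))" unfolding D_def by (intro tendsto_intros)
   have "eventually (\<lambda>t. D t = G1 t - G0 t) (at_left (c + pi))" unfolding eventually_at_left_field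
   proof (rule exI[of _ c], intro conjI allI impI)
    fix t assume "c < t" "t < c + pi"
    thus "D t = G1 t - G0 t" by (intro conjunct2[OF on[of "c - e" "c + pi"], symmetric] l) (use e(1) in auto)
   qed (use pi_gt_zero in auto)
   from tendsto_unique[OF _ l1 Lim_transform_eventually[OF l2 this]]
   have "G1 (c + pi) - G0 (c + pi) = D (c + pi)" by simp
   moreover have "D (c + pi) < 0" using c by (simp add: D_def)
   ultimately show False using le[of "c+pi"] by simp
  qed
  show "\<exists>a<c. a \<ge> c - pi \<and> G1 a = G0 a"
  proof (rule ccontr)
   assume "\<not> ?thesis"
   hence n: "G0 t < G1 t" if "t < c" "c - pi \<le> t" for t using le[of t] that by (metis order_le_imp_less_or_eq)
   have l: "G0 t < G1 t" if "t \<in> {c-pi<..<c+e}" for t using n[of t] e(2)[of t] that e(1) c by (cases t c rule: linorder_cases) auto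
   have l1: "((\<lambda>t. G1 t - G0 t) \<longlongrightarrow> G1 (c - pi) - G0 (c - pi)) (at_right (c - pi))"
    using cont[of "c - pi"] unfolding isCont_def by (simp add: filterlim_at_split)
   have l2: "(D \<longlongrightarrow> D (c - pi)) (at_right (c - pi))" unfolding D_def by (intro tendsto_intros)
   have "eventually (\<lambda>t. D t = G1 t - G0 t) (at_right (c - pi))" unfolding eventually_at_right_field
   proof (rule exI[of _ c], intro conjI allI impI)
    fix t assume "c - pi < t" "t < c"
    thus "D t = G1 t - G0 t" by (intro conjunct2[OF on[of "c - pi" "c + e"], symmetric] l) (use e(1) in auto)
   qed (use pi_gt_zero in auto)
   from tendsto_unique[OF _ l1 Lim_transform_eventually[OF l2 this]]
   have "G1 (c - pi) - G0 (c - pi) = D (c - pi)" by simp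
   moreover have "D (c - pi) < 0" using c by (simp add: D_def)
   ultimately show False using le[of "c-pi"] by simp
  qed
 qed
 define Zb where "Zb = {t. G1 t - G0 t = 0} \<inter> {c..}"
 define Za where "Za = {t. G1 t - G0 t = 0} \<inter> {..c}"
 define b where "b = Inf Zb"
 define a where "a = Sup Za"
 have bZ: "b \<in> Zb" unfolding b_def
  by (rule closed_contains_Inf) (use ex(1) cl in \<open>auto simp: Zb_def bdd_below_def intro!: closed_Int\<close>)
 have aZ: "a \<in> Za" unfolding a_def
  by (rule closed_contains_Sup) (use ex(2) cl in \<open>auto simp: Za_def bdd_above_def intro!: closed_Int\<close>)
 have bmin: "b \<le> t" if "t \<in> Zb" for t unfolding b_def using that by (intro cInf_lower) (auto simp: Zb_def)
 have amax: "t \<le> a" if "t \<in> Za" for t unfolding a_def using that by (intro cSup_upper) (auto simp: Za_def)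
 have acb: "a < c" "c < b" using aZ bZ c by (auto simp: Za_def Zb_def less_le)
 have pos: "G0 t < G1 t" if "t \<in> {a<..<b}" for t
 proof (rule ccontr)
  assume "\<not> ?thesis"
  hence "G1 t - G0 t = 0" using le[of t] by simp
  thus False using bmin[of t] amax[of t] that by (cases "t \<le> c") (auto simp: Za_def Zb_def)
 qed
 have ends: "G0 t = G0 c * cos (t - c) + p0 c * sin (t - c) \<and> G1 t - G0 t = D t" if t: "t \<in> {a..b}" for t
 proof -
  define h where "h t = (G0 t - (G0 c * cos (t - c) + p0 c * sin (t - c)), G1 t - G0 t - D t)" for t
  have cl: "closure {a<..<b} = {a..b}" using acb by (simp add: closure_greaterThanLessThan)
  have "continuous_on (closure {a<..<b}) h" unfolding h_def D_def using conc_germ_isCont[OF germ(1)] conc_germ_isCont[OF germ(2)]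
   by (intro continuous_intros continuous_at_imp_continuous_on) auto
  moreover have "h u = (0, 0)" if u: "u \<in> {a<..<b}" for u
  proof -
   have "c \<in> {a<..<b}" using acb by simp
   from on[OF this u pos] show ?thesis unfolding h_def by simp
  qed
  moreover have "t \<in> closure {a<..<b}" using t unfolding cl .
  ultimately have "h t = (0, 0)" by (rule continuous_constant_on_closure)
  thus ?thesis by (simp add: h_def)
 qed
 have Dab: "D a = 0" "D b = 0" using conjunct2[OF ends[of a]] conjunct2[OF ends[of b]] aZ bZ acb by (simp_all add: Za_def Zb_def)
 have Dpos: "D t > 0" if "t \<in> {a<..<b}" for t
 proof -
  have "c \<in> {a<..<b}" using acb by simp
  from on[OF this that pos] pos[OF that] show ?thesis by linarith
 qed
 have "b = a + pi"
 proof (rule ccontr)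
  assume "b \<noteq> a + pi"
  then consider "b > a + pi" | "b < a + pi" by linarith
  thus False
  proof cases
   case 1 thus ?thesis using Dpos[of "a + pi"] Dpi[of a] Dab pi_gt_zero by auto
  next
   case 2
   \<comment> \<open>A sinusoid with two zeros less than \<open>pi\<close> apart vanishes
     identically.\<close>
   define A B where "A = (G1 c - G0 c) * cos (a - c) + (p1 c - p0 c) * sin (a - c)"
    and "B = (p1 c - p0 c) * cos (a - c) - (G1 c - G0 c) * sin (a - c)"
   have Dt: "D t = A * cos (t - a) + B * sin (t - a)" for t unfolding D_def A_def B_def by (rule sinusoid_recenter)
   have "A = 0" using Dab(1) unfolding Dt by simp
   hence "B * sin (b - a) = 0" using Dab(2) unfolding Dt by simp
   moreover have "sin (b - a) > 0" using 2 acb by (intro sin_gt_zero) auto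
   ultimately have "D c = 0" unfolding Dt using \<open>A = 0\<close> by simp
   thus False using Dpos[of c] acb by auto
  qed
 qed
 have "G0 b = - G0 a"
 proof -
  have "b - c = (a - c) + pi" using \<open>b = a + pi\<close> by simp
  moreover have "G0 b = G0 c * cos (b - c) + p0 c * sin (b - c)" "G0 a = G0 c * cos (a - c) + p0 c * sin (a - c)"
   by (rule conjunct1[OF ends], use acb in simp)+
  ultimately show ?thesis by (auto simp only: cos_periodic_pi sin_periodic_pi)
 qed
 then consider "G0 a \<ge> 0" | "G0 b \<ge> 0" by linarith
 thus "\<exists>t. G0 t \<ge> 0 \<and> G1 t = G0 t \<and> (\<forall>\<eta>>0. \<exists>t'. \<bar>t' - t\<bar> < \<eta> \<and> G0 t' < G1 t')"
 proof cases
  case 1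
  have "\<exists>t'. \<bar>t' - a\<bar> < \<eta> \<and> G0 t' < G1 t'" if "\<eta> > 0" for \<eta>
   using pos[of "a + min (\<eta>/2) ((b-a)/2)"] that acb by (intro exI[of _ "a + min (\<eta>/2) ((b-a)/2)"]) (auto simp: min_def field_simps)
  thus ?thesis using 1 aZ by (intro exI[of _ a]) (auto simp: Za_def)
 next
  case 2
  have "\<exists>t'. \<bar>t' - b\<bar> < \<eta> \<and> G0 t' < G1 t'" if "\<eta> > 0" for \<eta>
   using pos[of "b - min (\<eta>/2) ((b-a)/2)"] that acb by (intro exI[of _ "b - min (\<eta>/2) ((b-a)/2)"]) (auto simp: min_def field_simps)
  thus ?thesis using 2 bZ by (intro exI[of _ b]) (auto simp: Zb_def)
 qed
qed

section \<open>Profiles assembled from arcs\<close>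

lemma periodic_int:
 fixes f :: "real \<Rightarrow> 'b"
 assumes "\<And>t. f (t + \<alpha>) = f t"
 shows "f (t + of_int n * \<alpha>) = f t"
proof (induction n rule: int_induct[where k=0])
 case (step1 i) thus ?case using assms[of "t + of_int i * \<alpha>"] by (simp add: algebra_simps)
next
 case (step2 i) thus ?case using assms[of "t + of_int (i - 1) * \<alpha>"] by (simp add: algebra_simps)
qed simp

lemma shift_into:
 fixes \<alpha> :: real
 assumes "\<alpha> > 0" shows "\<exists>n::int. t + of_int n * \<alpha> \<in> {u..<u + \<alpha>}"
proof -
 define q where "q = (t - u) / \<alpha>"
 have t: "t = u + q * \<alpha>" using assms by (simp add: q_def)
 have f: "of_int \<lfloor>q\<rfloor> \<le> q" "q < of_int \<lfloor>q\<rfloor> + 1" by linarith+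
 have "of_int \<lfloor>q\<rfloor> * \<alpha> \<le> q * \<alpha>" "q * \<alpha> < (of_int \<lfloor>q\<rfloor> + 1) * \<alpha>"
  using f assms by (auto intro: mult_right_mono mult_strict_right_mono)
 thus ?thesis by (intro exI[of _ "- \<lfloor>q\<rfloor>"]) (simp add: t algebra_simps)
qed

lemma has_integral_shift_real:
 fixes f :: "real \<Rightarrow> real"
 assumes "(f has_integral W) {a..b}"
 shows "((\<lambda>t. f (t + c)) has_integral W) {a - c..b - c}" using has_integral_affinity'[of f W a b 1 c] assms by simp

text \<open>The sets \<open>{l k..l k + \<beta> k}\<close> tile the circle of length \<open>\<alpha>\<close>.\<close>
locale arc_tiling =
 fixes \<alpha> :: real and K :: "'k set" and l \<beta> :: "'k \<Rightarrow> real"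
 assumes \<alpha>: "\<alpha> > 0" and fin: "finite K" and \<beta>: "\<And>k. k \<in> K ==> \<beta> k > 0"
  and cover: "\<And>t. \<exists>k\<in>K. \<exists>n::int. t + of_int n * \<alpha> \<in> {l k..l k + \<beta> k}"
  and disj: "\<And>k k' t n. [|k \<in> K; k' \<in> K; t \<in> {l k<..<l k + \<beta> k}; t + of_int n * \<alpha> \<in> {l k'..l k' + \<beta> k'}|]
    ==> k = k' \<and> n = 0"
begin

text \<open>An arc longer than the circle would overlap its own translate by one period.\<close>

lemma \<beta>_le: assumes "k \<in> K" shows "\<beta> k \<le> \<alpha>"
proof (rule ccontr)
 assume "\<not> ?thesis"
 hence "l k + (\<beta> k - \<alpha>) / 2 \<in> {l k<..<l k + \<beta> k}" "l k + (\<beta> k - \<alpha>) / 2 + of_int 1 * \<alpha> \<in> {l k..l k + \<beta> k}"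
  using \<alpha> by (auto simp: field_simps)
 thus False using disj[OF assms assms] by fastforce
qed

lemma tile_integral:
 fixes f :: "real \<Rightarrow> real"
 assumes per: "\<And>t. f (t + \<alpha>) = f t" and W: "\<And>k. k \<in> K ==> (f has_integral W k) {l k..l k + \<beta> k}"
 shows "(f has_integral sum W K) {u..u+\<alpha>}"
proof -
 have "\<exists>m::int. l k + of_int m * \<alpha> \<in> {u..<u + \<alpha>}" for k using shift_into[OF \<alpha>] by blast
 then obtain m :: "'k \<Rightarrow> int" where m: "\<And>k. l k + of_int (m k) * \<alpha> \<in> {u..<u + \<alpha>}" by metis
 define l' where "l' k = l k + of_int (m k) * \<alpha>" for k
 have l': "l' k \<in> {u..<u+\<alpha>}" for k using m by (simp add: l'_def)
 have fW: "(f has_integral W k) {l' k..l' k + \<beta> k}" if "k \<in> K" for k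
 proof -
  have "((\<lambda>t. f (t + - of_int (m k) * \<alpha>)) has_integral W k) {l k - - of_int (m k) * \<alpha>..l k + \<beta> k - - of_int (m k) * \<alpha>}"
   by (rule has_integral_shift_real[OF W[OF that]])
  moreover have "f (t + - of_int (m k) * \<alpha>) = f t" for t using periodic_int[of f \<alpha> t "- m k", OF per] by simp
  ultimately show ?thesis by (simp add: l'_def algebra_simps)
 qed
 \<comment> \<open>Each arc has been moved so that it starts in the period. Index
   \<open>False\<close> is the part before \<open>u + \<alpha>\<close>, index \<open>True\<close>
   the part beyond it, moved back by one period; without overhang the latter is empty or the single
   point \<open>u\<close>.\<close>
 define T where "T = (\<lambda>(k, i). if i then {u..l' k + \<beta> k - \<alpha>} else {l' k..min (l' k + \<beta> k) (u + \<alpha>)})"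
 define V where "V = (\<lambda>p. integral (T p) f)"
 have VT: "(f has_integral V (k, False)) (T (k, False)) \<and> (f has_integral V (k, True)) (T (k, True))
   \<and> V (k, False) + V (k, True) = W k" if k: "k \<in> K" for k
 proof (cases "l' k + \<beta> k \<le> u + \<alpha>")
  case True
  have 1: "T (k, False) = {l' k..l' k + \<beta> k}" using True by (simp add: T_def)
  have "negligible (T (k, True))" by (rule negligible_subset[of "{u}"]) (use True in \<open>auto simp: T_def\<close>)
  hence "(f has_integral 0) (T (k, True))" by (rule has_integral_negligible) auto
  thus ?thesis using fW[OF k] by (simp add: V_def 1 integral_unique)
 next
  case False
  have 1: "T (k, False) = {l' k..u + \<alpha>}" "T (k, True) = {u..l' k + \<beta> k - \<alpha>}" using False by (auto simp: T_def)
  have int: "f integrable_on {l' k..l' k + \<beta> k}" using fW[OF k] by blast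
  have ia: "f integrable_on {l' k..u + \<alpha>}" "f integrable_on {u + \<alpha>..l' k + \<beta> k}"
   using False l'[of k] by (auto intro: integrable_on_subinterval[OF int])
  have 2: "integral {l' k..u + \<alpha>} f + integral {u + \<alpha>..l' k + \<beta> k} f = W k"
   using Henstock_Kurzweil_Integration.integral_combine[OF _ _ int, of "u + \<alpha>"] False l'[of k] integral_unique[OF fW[OF k]] by auto
  have "((\<lambda>t. f (t + \<alpha>)) has_integral integral {u + \<alpha>..l' k + \<beta> k} f) {u + \<alpha> - \<alpha>..l' k + \<beta> k - \<alpha>}"
   by (rule has_integral_shift_real) (use ia(2) in \<open>simp add: has_integral_integral\<close>)
  hence 3: "(f has_integral integral {u + \<alpha>..l' k + \<beta> k} f) (T (k, True))" by (simp add: per 1)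
  thus ?thesis using 2 ia(1) by (simp add: V_def 1 integral_unique has_integral_integral[symmetric])
 qed
 \<comment> \<open>Off the finitely many end points of pieces the tiling property gives
   disjointness, so all discrepancies are confined to \<open>E\<close>.\<close>
 define E where "E = (\<Union>k\<in>K. {l' k, l' k - \<alpha>, l' k + \<beta> k, l' k + \<beta> k - \<alpha>}) \<union> {u + \<alpha>}"
 have finE: "finite E" using fin by (auto simp: E_def)
 have arc: "t \<in> T (k, i) ==> k \<in> K ==> t + (if i then \<alpha> else 0) \<in> {l' k..l' k + \<beta> k}" for t k i
  using l'[of k] by (auto simp: T_def split: if_splits)
 have uniq: "(k, i) = (k', i')"
  if t: "t \<notin> E" "t \<in> T (k, i)" "t \<in> T (k', i')" "k \<in> K" "k' \<in> K" for t k i k' i'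
 proof -
  define s where "s = t + (if i then \<alpha> else 0) - of_int (m k) * \<alpha>"
  define n :: int where "n = m k - m k' + (if i' then 1 else 0) - (if i then 1 else 0)"
  have "t + (if i then \<alpha> else 0) \<noteq> l' k" "t + (if i then \<alpha> else 0) \<noteq> l' k + \<beta> k"
   using t(1,4) by (auto simp: E_def)
  hence "s \<in> {l k<..<l k + \<beta> k}" using arc[OF t(2,4)] unfolding s_def l'_def by force
  moreover have "s + of_int n * \<alpha> = t + (if i' then \<alpha> else 0) - of_int (m k') * \<alpha>"
   by (simp add: s_def n_def algebra_simps)
  hence "s + of_int n * \<alpha> \<in> {l k'..l k' + \<beta> k'}" using arc[OF t(3,5)] unfolding l'_def by auto
  ultimately have "k = k' \<and> n = 0" using disj t(4,5) by blast
  thus ?thesis by (auto simp: n_def split: if_splits)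
 qed
 have I1: "(f has_integral sum V (K \<times> UNIV)) (\<Union>p\<in>K \<times> UNIV. T p)"
 proof (rule has_integral_UN)
  show "finite (K \<times> (UNIV :: bool set))" using fin by simp
  show "(f has_integral V p) (T p)" if "p \<in> K \<times> UNIV" for p using VT that by (cases p; cases "snd p") auto
  show "pairwise (\<lambda>p p'. negligible (T p \<inter> T p')) (K \<times> UNIV)"
  proof (rule pairwiseI)
   fix p p' assume p: "p \<in> K \<times> (UNIV :: bool set)" "p' \<in> K \<times> (UNIV :: bool set)" "p \<noteq> p'"
   obtain k i k' i' where pp: "p = (k, i)" "p' = (k', i')" by (metis surj_pair)
   have "T p \<inter> T p' \<subseteq> E" using uniq[of _ k i k' i'] p unfolding pp by blast
   thus "negligible (T p \<inter> T p')" using negligible_subset negligible_finite[OF finE] by blast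
  qed
 qed
 have "sum V (K \<times> UNIV) = sum W K"
 proof -
  have "sum V (K \<times> UNIV) = (\<Sum>k\<in>K. \<Sum>i\<in>UNIV. V (k, i))" by (simp add: sum.cartesian_product)
  also have "\<dots> = sum W K" by (rule sum.cong) (use VT in \<open>auto simp: UNIV_bool add.commute\<close>)
  finally show ?thesis .
 qed
 moreover have "{u..u+\<alpha>} \<subseteq> (\<Union>p\<in>K \<times> UNIV. T p) \<union> E"
 proof
  fix t assume t: "t \<in> {u..u+\<alpha>}"
  show "t \<in> (\<Union>p\<in>K \<times> UNIV. T p) \<union> E"
  proof (cases "t = u + \<alpha>")
   case False
   obtain k n where k: "k \<in> K" "t + of_int n * \<alpha> \<in> {l k..l k + \<beta> k}" using cover by blast
   define j where "j = n + m k"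
   have tj: "t + of_int j * \<alpha> \<in> {l' k..l' k + \<beta> k}" using k(2) by (auto simp: j_def l'_def algebra_simps)
   have b: "u \<le> t + of_int j * \<alpha>" "t + of_int j * \<alpha> < u + 2 * \<alpha>" using tj l'[of k] \<beta>_le[OF k(1)] by auto
   have "of_int j * \<alpha> > - 1 * \<alpha>" "of_int j * \<alpha> < 2 * \<alpha>"
   proof -
    have "u \<le> t" "t < u + \<alpha>" using t False by auto
    thus "of_int j * \<alpha> > - 1 * \<alpha>" "of_int j * \<alpha> < 2 * \<alpha>" using b by linarith+
   qed
   hence "of_int j > (-1::real)" "of_int j < (2::real)" using \<alpha> by (metis mult_less_cancel_right_pos)+
   hence "j = 0 \<or> j = 1" by linarith
   thus ?thesis
   proof
    assume "j = 0"
    hence "t \<in> T (k, False)" using tj t by (auto simp: T_def)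
    thus ?thesis using k(1) by blast
   next
    assume "j = 1"
    hence "t \<in> T (k, True)" using tj t by (auto simp: T_def)
    thus ?thesis using k(1) by blast
   qed
  qed (simp add: E_def)
 qed
 moreover have "(\<Union>p\<in>K \<times> UNIV. T p) \<subseteq> {u..u+\<alpha>}"
 proof
  fix t assume "t \<in> (\<Union>p\<in>K \<times> UNIV. T p)"
  then obtain k i where k: "k \<in> K" "t \<in> T (k, i)" by auto
  thus "t \<in> {u..u+\<alpha>}" using l'[of k] \<beta>_le[OF k(1)] by (cases i) (auto simp: T_def)
 qed
 ultimately have "(f has_integral sum W K) (\<Union>p\<in>K \<times> UNIV. T p)" "{u..u+\<alpha>} - (\<Union>p\<in>K \<times> UNIV. T p) \<subseteq> E"
  "(\<Union>p\<in>K \<times> UNIV. T p) - {u..u+\<alpha>} \<subseteq> E" using I1 by auto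
 moreover have "(f has_integral w) S" if "(f has_integral w) U" "S - U \<subseteq> E" "U - S \<subseteq> E" for U S w
  using that by (subst has_integral_spike_set_eq[of _ U])
   (auto intro!: negligible_subset[OF negligible_finite[OF finE]])
 ultimately show ?thesis by blast
qed

text \<open>Integrate the constant 1 over one period. This is how the corner angles at a point come
  to add up to the angle of the metric.\<close>

lemma sum_\<beta>: "sum \<beta> K = \<alpha>"
proof -
 have "((\<lambda>t. 1) has_integral sum \<beta> K) {0..0+\<alpha>}"
  using has_integral_const_real[of "1::real"] \<beta> by (intro tile_integral) (metis (no_types, lifting) add_diff_cancel_left' content_real less_add_same_cancel1 less_imp_le mult.right_neutral real_scaleR_def)+
 moreover have "((\<lambda>t. 1) has_integral \<alpha>) {0..0+\<alpha>}" using has_integral_const_real[of "1::real" 0 \<alpha>] \<alpha> by simp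
 ultimately show ?thesis by (rule has_integral_unique)
qed

end

section \<open>One-sided germs and the assembly of arcs into a profile\<close>

definition rgerm :: "(real \<Rightarrow> real) \<Rightarrow> real \<Rightarrow> real \<Rightarrow> bool" where
 "rgerm G t p \<longleftrightarrow> (\<exists>\<eta>>0. \<forall>s\<in>{0..\<eta>}. G (t + s) = G t * cos s + p * sin s)"

definition lgerm :: "(real \<Rightarrow> real) \<Rightarrow> real \<Rightarrow> real \<Rightarrow> bool" where
 "lgerm G t m \<longleftrightarrow> (\<exists>\<eta>>0. \<forall>s\<in>{0..\<eta>}. G (t - s) = G t * cos s - m * sin s)"

lemma rgerm_unique: "rgerm G t p ==> rgerm G t q ==> p = q"
proof -
 assume "rgerm G t p" "rgerm G t q"
 then obtain e d where e: "e > 0" "\<forall>s\<in>{0..e}. G (t + s) = G t * cos s + p * sin s"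
   and d: "d > 0" "\<forall>s\<in>{0..d}. G (t + s) = G t * cos s + q * sin s" unfolding rgerm_def by blast
 show "p = q"
 proof (rule sinusoid_germ_eq[of "min e d" "G t"])
  fix s assume "0 \<le> s" "s \<le> min e d"
  hence "s \<in> {0..e}" "s \<in> {0..d}" by auto
  thus "G t * cos s + p * sin s = G t * cos s + q * sin s" using e(2) d(2) by metis
 qed (use e d in simp)
qed

lemma lgerm_rgerm: "lgerm G t m \<longleftrightarrow> rgerm (\<lambda>s. G (- s)) (- t) (- m)" by (simp add: lgerm_def rgerm_def)

lemma lgerm_unique: "lgerm G t p ==> lgerm G t q ==> p = q" using rgerm_unique unfolding lgerm_rgerm by fastforce

lemma conc_germI:
 assumes r: "rgerm G t (dp t)" and l: "lgerm G t (dm t)"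
  and "dp t \<le> dm t" "(G t)\<^sup>2 + (dp t)\<^sup>2 < 1" "(G t)\<^sup>2 + (dm t)\<^sup>2 < 1"
 shows "conc_germ G dp dm t"
proof -
 obtain e where e: "e > 0" "\<And>s. s\<in>{0..e} ==> G (t + s) = G t * cos s + dp t * sin s" using r unfolding rgerm_def by blast
 obtain d where d: "d > 0" "\<And>s. s\<in>{0..d} ==> G (t - s) = G t * cos s - dm t * sin s" using l unfolding lgerm_def by blast
 have 1: "G s = G t * cos (s - t) + dp t * sin (s - t)" if "s \<in> {t..t + min e d}" for s
 proof -
  have "s - t \<in> {0..e}" using that by auto
  from e(2)[OF this] show ?thesis by simp
 qed
 have 2: "G s = G t * cos (s - t) + dm t * sin (s - t)" if "s \<in> {t - min e d..t}" for s
 proof -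
  have "G (t - (t - s)) = G t * cos (t - s) - dm t * sin (t - s)" by (rule d(2)) (use that in auto)
  moreover have "cos (t - s) = cos (s - t)" "sin (t - s) = - sin (s - t)"
   by (metis cos_minus minus_diff_eq, metis sin_minus minus_diff_eq)
  ultimately show ?thesis by simp
 qed
 have "min e d > 0" using e(1) d(1) by simp
 thus ?thesis unfolding conc_germ_def by (intro conjI exI[of _ "min e d"] ballI 1 2 assms(3-5))
qed

lemma rgerm_sinusoid:
 assumes G: "\<And>s. s \<in> {a..b} ==> G s = A * cos (s - a) + B * sin (s - (a::real))" and t: "t \<in> {a..<b}"
 shows "rgerm G t (B * cos (t - a) - A * sin (t - a))" unfolding rgerm_def
proof (intro exI[of _ "b - t"] conjI ballI)
 fix s assume s: "s \<in> {0..b - t}"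
 show "G (t + s) = G t * cos s + (B * cos (t - a) - A * sin (t - a)) * sin s"
  using G[of "t + s"] G[of t] s t sinusoid_recenter[of A "t + s" a B t] by simp
qed (use t in simp)

lemma lgerm_sinusoid:
 assumes G: "\<And>s. s \<in> {a..b} ==> G s = A * cos (s - a) + B * sin (s - (a::real))" and t: "t \<in> {a<..b}"
 shows "lgerm G t (B * cos (t - a) - A * sin (t - a))" unfolding lgerm_def
proof (intro exI[of _ "t - a"] conjI ballI)
 fix s assume s: "s \<in> {0..t - a}"
 show "G (t - s) = G t * cos s - (B * cos (t - a) - A * sin (t - a)) * sin s"
  using G[of "t - s"] G[of t] s t sinusoid_recenter[of A "t - s" a B t] by simp
qed (use t in simp)

text \<open>\<open>A k\<close> and \<open>B k\<close> are the value and slope at the left end of an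
  arc. The hypotheses \<open>right\<close> and \<open>left\<close> provide the neighbouring arc and
  say that the kink between the two is concave; the bounds on the slopes survive because rotation
  preserves the sum of squares.\<close>

lemma (in arc_tiling) arcs_conc_germ:
 fixes G :: "real \<Rightarrow> real"
 assumes per: "\<And>t. G (t + \<alpha>) = G t"
  and G: "\<And>k t. k \<in> K ==> t \<in> {l k..l k + \<beta> k} ==> G t = A k * cos (t - l k) + B k * sin (t - l k)"
  and AB: "\<And>k. k \<in> K ==> (A k)\<^sup>2 + (B k)\<^sup>2 < 1"
  and right: "\<And>k. k \<in> K ==> \<exists>k'\<in>K. \<exists>n::int. l k' = l k + \<beta> k + of_int n * \<alpha> \<and> B k' \<le> B k * cos (\<beta> k) - A k * sin (\<beta> k)"
  and left: "\<And>k. k \<in> K ==> \<exists>k'\<in>K. \<exists>n::int. l k = l k' + \<beta> k' + of_int n * \<alpha> \<and> B k \<le> B k' * cos (\<beta> k') - A k' * sin (\<beta> k')"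
 obtains dp dm where "\<And>t. conc_germ G dp dm t" "\<And>t. dp (t + \<alpha>) = dp t" "\<And>t. dm (t + \<alpha>) = dm t"
  "\<And>t. rgerm G t (dp t)"
proof -
 \<comment> \<open>Slopes are read off from the germs and not from the arcs: the germ predicates are
   periodic and have unique solutions, so the chosen slopes are periodic and independent of the arc
   that represents a point.\<close>
 define dp where "dp t = (SOME p. rgerm G t p)" for t
 define dm where "dm t = (SOME p. lgerm G t p)" for t
 have sh: "rgerm G (t + \<alpha>) = rgerm G t" "lgerm G (t + \<alpha>) = lgerm G t" for t
 proof -
  have "t + \<alpha> + s = (t + s) + \<alpha>" "t + \<alpha> - s = (t - s) + \<alpha>" for s by auto
  thus "rgerm G (t + \<alpha>) = rgerm G t" "lgerm G (t + \<alpha>) = lgerm G t"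
   unfolding rgerm_def[abs_def] lgerm_def[abs_def] by (simp_all only: per)
 qed
 have shn: "rgerm G (t + of_int n * \<alpha>) = rgerm G t" "lgerm G (t + of_int n * \<alpha>) = lgerm G t" for t n
  using periodic_int[of "rgerm G", OF sh(1)] periodic_int[of "lgerm G", OF sh(2)] by auto
 have Gn: "G (t + of_int n * \<alpha>) = G t" for t n using periodic_int[of G, OF per] .
 have R: "rgerm G t (B k * cos (t - l k) - A k * sin (t - l k))" if "k \<in> K" "t \<in> {l k..<l k + \<beta> k}" for k t
  by (rule rgerm_sinusoid[OF G[OF that(1)] that(2)])
 have L: "lgerm G t (B k * cos (t - l k) - A k * sin (t - l k))" if "k \<in> K" "t \<in> {l k<..l k + \<beta> k}" for k t
  by (rule lgerm_sinusoid[OF G[OF that(1)] that(2)])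
 have N: "(G t)\<^sup>2 + (B k * cos (t - l k) - A k * sin (t - l k))\<^sup>2 < 1" if "k \<in> K" "t \<in> {l k..l k + \<beta> k}" for k t
  unfolding G[OF that] rot_norm by (rule AB[OF that(1)])
 have junction: "\<exists>p m. rgerm G t p \<and> lgerm G t m \<and> p \<le> m \<and> (G t)\<^sup>2 + p\<^sup>2 < 1 \<and> (G t)\<^sup>2 + m\<^sup>2 < 1"
  if k: "k \<in> K" "k' \<in> K" "l k' = l k + \<beta> k + of_int n * \<alpha>" "B k' \<le> B k * cos (\<beta> k) - A k * sin (\<beta> k)"
   and t: "t = l k + \<beta> k" for k k' n t
 proof -
  have tk: "t + of_int n * \<alpha> = l k'" by (simp add: t k(3))
  have "rgerm G (l k') (B k')" using R[OF k(2), of "l k'"] \<beta>[OF k(2)] by simp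
  hence 1: "rgerm G t (B k')" unfolding tk[symmetric] shn .
  have 2: "lgerm G t (B k * cos (\<beta> k) - A k * sin (\<beta> k))" using L[OF k(1), of t] \<beta>[OF k(1)] by (simp add: t)
  have "(G (l k'))\<^sup>2 + (B k')\<^sup>2 < 1" using N[OF k(2), of "l k'"] \<beta>[OF k(2)] by simp
  hence 3: "(G t)\<^sup>2 + (B k')\<^sup>2 < 1" unfolding tk[symmetric] Gn .
  have 4: "(G t)\<^sup>2 + (B k * cos (\<beta> k) - A k * sin (\<beta> k))\<^sup>2 < 1" using N[OF k(1), of t] \<beta>[OF k(1)] by (simp add: t)
  show ?thesis using 1 2 3 4 k(4) by blast
 qed
 have ex: "\<exists>p m. rgerm G t p \<and> lgerm G t m \<and> p \<le> m \<and> (G t)\<^sup>2 + p\<^sup>2 < 1 \<and> (G t)\<^sup>2 + m\<^sup>2 < 1" for t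
 proof -
  obtain k n where k: "k \<in> K" "t + of_int n * \<alpha> \<in> {l k..l k + \<beta> k}" using cover by blast
  define s where "s = t + of_int n * \<alpha>"
  have "\<exists>p m. rgerm G s p \<and> lgerm G s m \<and> p \<le> m \<and> (G s)\<^sup>2 + p\<^sup>2 < 1 \<and> (G s)\<^sup>2 + m\<^sup>2 < 1"
  proof -
   consider "s = l k" | "s = l k + \<beta> k" | "s \<in> {l k<..<l k + \<beta> k}" using k(2) unfolding s_def by fastforce
   thus ?thesis
   proof cases
    case 1
    obtain k' j where k': "k' \<in> K" "l k = l k' + \<beta> k' + of_int j * \<alpha>" "B k \<le> B k' * cos (\<beta> k') - A k' * sin (\<beta> k')"
     using left[OF k(1)] by blast
    have "\<exists>p m. rgerm G (l k' + \<beta> k') p \<and> lgerm G (l k' + \<beta> k') m \<and> p \<le> m \<and> (G (l k' + \<beta> k'))\<^sup>2 + p\<^sup>2 < 1 \<and> (G (l k' + \<beta> k'))\<^sup>2 + m\<^sup>2 < 1"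
     by (rule junction[OF k'(1) k(1) k'(2,3) refl])
    thus ?thesis unfolding 1 k'(2) shn Gn .
   next
    case 2
    obtain k' j where "k' \<in> K" "l k' = l k + \<beta> k + of_int j * \<alpha>" "B k' \<le> B k * cos (\<beta> k) - A k * sin (\<beta> k)"
     using right[OF k(1)] by blast
    thus ?thesis using junction[OF k(1)] 2 by blast
   next
    case 3
    show ?thesis using R[OF k(1), of s] L[OF k(1), of s] N[OF k(1), of s] 3 by force
   qed
  qed
  thus ?thesis unfolding s_def shn Gn .
 qed
 have dpm: "rgerm G t (dp t) \<and> lgerm G t (dm t)" for t unfolding dp_def dm_def using ex[of t] by (metis someI)
 have cg: "conc_germ G dp dm t" for t using ex[of t] dpm[of t] rgerm_unique lgerm_unique by (intro conc_germI) metis+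
 have "dp (t + \<alpha>) = dp t" "dm (t + \<alpha>) = dm t" for t unfolding dp_def dm_def sh by simp_all
 with cg dpm show ?thesis using that by blast
qed

section \<open>Polar charts and corners\<close>

definition cosine_law :: "real \<Rightarrow> real \<Rightarrow> real \<Rightarrow> real" where
 "cosine_law r r' t = arcosh (cosh r * cosh r' - sinh r * sinh r' * cos t)"

lemma cosine_law_arg_ge1:
 assumes "0 \<le> r" "0 \<le> (r'::real)"
 shows "1 \<le> cosh r * cosh r' - sinh r * sinh r' * cos t"
proof -
 have "sinh r * sinh r' * cos t \<le> sinh r * sinh r' * 1" using assms by (intro mult_left_mono) auto
 moreover have "1 \<le> cosh (r - r')" by (rule cosh_real_ge_1)
 ultimately show ?thesis by (simp add: cosh_diff)
qed

lemma cosine_law_le_iff: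
 assumes "0 < r" "0 < r'"
 shows "cosine_law r r' s \<le> cosine_law r r' t \<longleftrightarrow> cos t \<le> cos s"
proof -
 have "cosine_law r r' s \<le> cosine_law r r' t \<longleftrightarrow>
   cosh r * cosh r' - sinh r * sinh r' * cos s \<le> cosh r * cosh r' - sinh r * sinh r' * cos t"
  unfolding cosine_law_def linorder_not_less[symmetric] using assms by (subst arcosh_less_iff_real) (auto intro!: cosine_law_arg_ge1)
 also have "\<dots> \<longleftrightarrow> sinh r * sinh r' * cos t \<le> sinh r * sinh r' * cos s" by linarith
 also have "\<dots> \<longleftrightarrow> cos t \<le> cos s" using assms by (intro mult_le_cancel_left_pos) simp
 finally show ?thesis .
qed

lemma cosine_law_0: "0 \<le> r ==> cosine_law 0 r t = r" by (simp add: cosine_law_def arcosh_cosh_real)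

lemma cos_le_abs_iff:
 assumes "\<bar>s\<bar> \<le> pi" "\<bar>t\<bar> \<le> pi"
 shows "cos t \<le> cos s \<longleftrightarrow> \<bar>s\<bar> \<le> \<bar>t\<bar>"
 using cos_mono_le_eq[of "\<bar>t\<bar>" "\<bar>s\<bar>"] assms by simp

text \<open>Directions are real numbers modulo \<open>\<alpha>\<close>. The condition on
  \<open>t - t'\<close> selects the shorter way round the circle, and
  \<open>\<alpha> \<le> 2 * pi\<close> keeps this angle within \<open>pi\<close>, where its cosine
  determines it.\<close>

locale polar_chart =
 fixes T :: "'t set" and g :: "'t \<Rightarrow> 't \<Rightarrow> real" and z :: 't and \<alpha> eps :: real
  and R :: "real \<Rightarrow> real \<Rightarrow> 't"
 assumes eps: "eps > 0" and \<alpha>: "0 < \<alpha>" "\<alpha> \<le> 2 * pi"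
  and R_T: "\<And>r t. 0 \<le> r ==> r < eps ==> R r t \<in> T"
  and R_per: "\<And>r t. 0 \<le> r ==> r < eps ==> R r (t + \<alpha>) = R r t"
  and R_0: "\<And>t. R 0 t = z"
  and R_dist: "\<And>r r' t t'. [|0 \<le> r; r < eps; 0 \<le> r'; r' < eps; \<bar>t - t'\<bar> \<le> \<alpha> / 2|]
    ==> g (R r t) (R r' t') = cosine_law r r' (t - t')"
  and R_onto: "\<And>w. [|w \<in> T; g z w < eps|] ==> \<exists>t. w = R (g z w) t"
begin

lemma R_int: "0 \<le> r ==> r < eps ==> R r (t + of_int n * \<alpha>) = R r t" by (rule periodic_int[of "R r"]) (rule R_per)

lemma R_near: assumes "0 \<le> r" "r < eps"
 shows "\<exists>n::int. R r (t + of_int n * \<alpha>) = R r t \<and> \<bar>t + of_int n * \<alpha> - t0\<bar> \<le> \<alpha> / 2"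
proof -
 obtain n :: int where "t + of_int n * \<alpha> \<in> {t0 - \<alpha>/2..<t0 - \<alpha>/2 + \<alpha>}" using shift_into[OF \<alpha>(1)] by blast
 hence "\<bar>t + of_int n * \<alpha> - t0\<bar> \<le> \<alpha> / 2" unfolding atLeastLessThan_iff abs_le_iff by linarith
 thus ?thesis using R_int[OF assms] by blast
qed

lemma R_radius: "0 \<le> r ==> r < eps ==> g z (R r t) = r" using R_dist[of 0 r t t] R_0 eps \<alpha> by (simp add: cosine_law_0)

lemma R_inj:
 assumes r: "0 < r" "r < eps" and eq: "R r t = R r t'"
 shows "\<exists>n::int. t' = t + of_int n * \<alpha>"
proof -
 obtain n :: int where n: "R r (t + of_int n * \<alpha>) = R r t" "\<bar>t + of_int n * \<alpha> - t'\<bar> \<le> \<alpha> / 2"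
  using R_near[of r t t'] r by auto
 have "cosine_law r r (t + of_int n * \<alpha> - t') = g (R r t) (R r t)" using R_dist[of r r "t + of_int n * \<alpha>" t'] n r eq by simp
 also have "\<dots> = cosine_law r r 0" using R_dist[of r r t t] r \<alpha> by simp
 finally have "cos (0::real) \<le> cos (t + of_int n * \<alpha> - t')" using cosine_law_le_iff r by (metis order_refl)
 hence "\<bar>t + of_int n * \<alpha> - t'\<bar> \<le> \<bar>0\<bar>" by (subst (asm) cos_le_abs_iff) (use n(2) \<alpha> in auto)
 thus ?thesis by (intro exI[of _ n]) simp
qed

text \<open>For fixed positive radii the distance increases with the angle in the range up to
  \<open>pi\<close>. This is how angles are read off from distances.\<close>

lemma R_dist_cos:
 assumes "0 < r" "r < eps" "0 < r'" "r' < eps" "\<bar>t - t'\<bar> \<le> \<alpha> / 2" "\<bar>s\<bar> \<le> pi"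
 shows "g (R r t) (R r' t') \<le> cosine_law r r' s ==> \<bar>t - t'\<bar> \<le> \<bar>s\<bar>"
  and "g (R r t) (R r' t') = cosine_law r r' s ==> \<bar>t - t'\<bar> = \<bar>s\<bar>"
proof -
 have d: "g (R r t) (R r' t') = cosine_law r r' (t - t')" using R_dist assms by simp
 have p: "\<bar>t - t'\<bar> \<le> pi" using assms(5) \<alpha> by simp
 show 1: "g (R r t) (R r' t') \<le> cosine_law r r' s ==> \<bar>t - t'\<bar> \<le> \<bar>s\<bar>"
  unfolding d cosine_law_le_iff[OF assms(1,3)] cos_le_abs_iff[OF p assms(6)] .
 assume e: "g (R r t) (R r' t') = cosine_law r r' s"
 hence "cosine_law r r' s \<le> cosine_law r r' (t - t')" using d by simp
 hence "\<bar>s\<bar> \<le> \<bar>t - t'\<bar>" unfolding cosine_law_le_iff[OF assms(1,3)] cos_le_abs_iff[OF assms(6) p] .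
 thus "\<bar>t - t'\<bar> = \<bar>s\<bar>" using 1 e by simp
qed

end

definition corner_end :: "real \<Rightarrow> bool \<Rightarrow> real" where
 "corner_end \<beta> b = (if b then \<beta> else 0)"

text \<open>Derivative of the profile at an end of a corner, taken in the direction that points into
  the corner. Where two corners meet, the kink is concave exactly when their two slopes add up to at
  most 0.\<close>

definition corner_slope :: "real \<Rightarrow> real \<Rightarrow> real \<Rightarrow> bool \<Rightarrow> real" where
 "corner_slope \<beta> x p b = (if b then x * sin \<beta> - p * cos \<beta> else p)"

text \<open>
 \<open>S k r \<psi>\<close> is the point at distance \<open>r\<close> from \<open>z\<close> in direction \<open>\<psi>\<close> of the \<open>k\<close>-th corner at \<open>z\<close>.
 The angles of the corners are not assumed to add up to \<open>\<alpha>\<close>.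
\<close>
locale fan = polar_chart T g z \<alpha> eps R
 for T :: "'t set" and g :: "'t \<Rightarrow> 't \<Rightarrow> real" and z :: 't and \<alpha> eps :: real
  and R :: "real \<Rightarrow> real \<Rightarrow> 't" +
 fixes K :: "'k set" and \<beta> X P W :: "'k \<Rightarrow> real" and S :: "'k \<Rightarrow> real \<Rightarrow> real \<Rightarrow> 't" and F :: "'t \<Rightarrow> real"
 assumes fin: "finite K"
  and \<beta>: "\<And>k. k \<in> K ==> 0 < \<beta> k \<and> \<beta> k \<le> pi"
  and S_T: "\<And>k r \<psi>. [|k \<in> K; 0 \<le> r; r < eps; \<psi> \<in> {0..\<beta> k}|] ==> S k r \<psi> \<in> T \<and> g z (S k r \<psi>) = r"
  and S_le: "\<And>k r r' \<psi> \<psi>'. [|k \<in> K; 0 \<le> r; r < eps; 0 \<le> r'; r' < eps; \<psi> \<in> {0..\<beta> k}; \<psi>' \<in> {0..\<beta> k}|]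
    ==> g (S k r \<psi>) (S k r' \<psi>') \<le> cosine_law r r' (\<psi> - \<psi>')"
  and S_loc: "\<And>k r \<psi>. [|k \<in> K; 0 < r; r < eps; \<psi> \<in> {0<..<\<beta> k}|] ==>
    \<exists>\<rho>>0. \<forall>\<psi>'\<in>{0<..<\<beta> k}. \<forall>\<psi>''\<in>{0<..<\<beta> k}. \<bar>\<psi>' - \<psi>\<bar> < \<rho> --> \<bar>\<psi>'' - \<psi>\<bar> < \<rho> -->
     g (S k r \<psi>') (S k r \<psi>'') = cosine_law r r (\<psi>' - \<psi>'')"
  and S_inj: "\<And>k k' r \<psi> \<psi>'. [|k \<in> K; k' \<in> K; 0 < r; r < eps; \<psi> \<in> {0<..<\<beta> k}; \<psi>' \<in> {0..\<beta> k'}; S k r \<psi> = S k' r \<psi>'|]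
    ==> k = k' \<and> \<psi> = \<psi>'"
  and S_cover: "\<And>w. [|w \<in> T; 0 < g z w; g z w < eps|] ==> \<exists>k\<in>K. \<exists>\<psi>\<in>{0..\<beta> k}. w = S k (g z w) \<psi>"
  and S_F: "\<And>k r \<psi>. [|k \<in> K; 0 \<le> r; r < eps; \<psi> \<in> {0..\<beta> k}|] ==>
    F (S k r \<psi>) = F z * (cosh r + (X k * cos \<psi> + P k * sin \<psi>) * sinh r)"
  and F_pos: "F z > 0"
  and XP: "\<And>k. k \<in> K ==> (X k)\<^sup>2 + (P k)\<^sup>2 < 1"
  and pair: "\<And>k b. k \<in> K ==> \<exists>k'\<in>K. \<exists>b' r. (k', b') \<noteq> (k, b) \<and> 0 < r \<and> r < eps \<and>
    S k r (corner_end (\<beta> k) b) = S k' r (corner_end (\<beta> k') b') \<and>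
    corner_slope (\<beta> k) (X k) (P k) b + corner_slope (\<beta> k') (X k') (P k') b' \<le> 0"
  and W: "\<And>k. k \<in> K ==> ((\<lambda>\<psi>. angle_density (X k * cos \<psi> + P k * sin \<psi>) (P k * cos \<psi> - X k * sin \<psi>))
    has_integral W k) {0..\<beta> k}"
begin

lemma S_rep:
 assumes "k \<in> K" "0 \<le> r" "r < eps" "\<psi> \<in> {0..\<beta> k}"
 shows "\<exists>t. S k r \<psi> = R r t \<and> \<bar>t - t0\<bar> \<le> \<alpha> / 2"
proof -
 obtain t where "S k r \<psi> = R r t" using S_T[OF assms] R_onto[of "S k r \<psi>"] assms by metis
 thus ?thesis using R_near[OF assms(2,3), of t t0] by metis
qed

text \<open>A segment inside one cell bounds the distance from above; a priori a detour through
  other cells could be shorter, so only an inequality of angles results.\<close>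

lemma S_lip:
 assumes k: "k \<in> K" and r: "0 < r" "r < eps" "0 < r'" "r' < eps" and p: "\<psi> \<in> {0..\<beta> k}" "\<psi>' \<in> {0..\<beta> k}"
  and e: "S k r \<psi> = R r t" "S k r' \<psi>' = R r' t'" and t: "\<bar>t - t'\<bar> \<le> \<alpha> / 2"
 shows "\<bar>t - t'\<bar> \<le> \<bar>\<psi> - \<psi>'\<bar>"
proof (rule R_dist_cos(1)[OF r t])
 show "\<bar>\<psi> - \<psi>'\<bar> \<le> pi" using p \<beta>[OF k] by auto
 show "g (R r t) (R r' t') \<le> cosine_law r r' (\<psi> - \<psi>')" using S_le[OF k _ r(2) _ r(4) p] r unfolding e by simp
qed

text \<open>The Lipschitz bound with equal directions leaves no room for the angle to change. So a
  direction found on one circle serves for all radii.\<close>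

lemma S_ray:
 assumes k: "k \<in> K" and r: "0 < r" "r < eps" "0 \<le> r'" "r' < eps" and p: "\<psi> \<in> {0..\<beta> k}"
  and e: "S k r \<psi> = R r t"
 shows "S k r' \<psi> = R r' t"
proof (cases "r' = 0")
 case True
 obtain t' where "S k r' \<psi> = R r' t'" using S_rep[OF k r(3,4) p] by blast
 thus ?thesis using True R_0 by simp
next
 case False
 obtain t' where t': "S k r' \<psi> = R r' t'" "\<bar>t' - t\<bar> \<le> \<alpha> / 2" using S_rep[OF k r(3,4) p] by blast
 have "\<bar>t' - t\<bar> \<le> \<bar>\<psi> - \<psi>\<bar>" by (rule S_lip[OF k _ r(4) r(1,2) p p t'(1) e t'(2)]) (use r False in simp)
 thus ?thesis using t' by simp
qed

lemma abs_isometry: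
 fixes d d1 x h :: real
 assumes "\<bar>d\<bar> = \<bar>x\<bar>" "\<bar>d1\<bar> = h" "\<bar>d - d1\<bar> = \<bar>x - h\<bar>" "h > 0"
 shows "d = sgn d1 * x" using assms by (auto simp: sgn_if abs_if split: if_splits)

text \<open>Strictly inside a corner the distances on a small arc are exact, so the arc goes
  isometrically into the circle of directions: it is a translation, possibly with a
  reflection.\<close>

lemma S_local:
 assumes k: "k \<in> K" and r: "0 < r" "r < eps" and p: "\<psi>0 \<in> {0<..<\<beta> k}"
 shows "\<exists>u \<sigma> d. \<sigma> \<in> {1, -1} \<and> d > 0 \<and> (\<forall>\<psi>\<in>{0<..<\<beta> k}. \<bar>\<psi> - \<psi>0\<bar> < d --> S k r \<psi> = R r (u + \<sigma> * \<psi>))"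
proof -
 obtain \<rho> where \<rho>: "\<rho> > 0" "\<And>\<psi>' \<psi>''. [|\<psi>'\<in>{0<..<\<beta> k}; \<psi>''\<in>{0<..<\<beta> k}; \<bar>\<psi>' - \<psi>0\<bar> < \<rho>; \<bar>\<psi>'' - \<psi>0\<bar> < \<rho>|] ==>
     g (S k r \<psi>') (S k r \<psi>'') = cosine_law r r (\<psi>' - \<psi>'')" using S_loc[OF k r p] by blast
 have in_cl: "\<psi> \<in> {0<..<\<beta> k} ==> \<psi> \<in> {0..\<beta> k}" for \<psi> by auto
 have bpi: "\<psi>' \<in> {0<..<\<beta> k} ==> \<psi>'' \<in> {0<..<\<beta> k} ==> \<bar>\<psi>' - \<psi>''\<bar> \<le> pi" for \<psi>' \<psi>'' using \<beta>[OF k] by auto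
 obtain q where q: "S k r \<psi>0 = R r q" using S_rep[OF k _ r(2) in_cl[OF p]] r by auto
 have "\<exists>t. S k r \<psi> = R r (q + t) \<and> \<bar>t\<bar> \<le> \<alpha> / 2" if p': "\<psi> \<in> {0<..<\<beta> k}" for \<psi>
 proof -
  obtain t where "S k r \<psi> = R r t" "\<bar>t - q\<bar> \<le> \<alpha> / 2" using S_rep[OF k _ r(2) in_cl[OF p']] r by auto
  thus ?thesis by (intro exI[of _ "t - q"]) simp
 qed
 then obtain D where D: "\<And>\<psi>. \<psi> \<in> {0<..<\<beta> k} ==> S k r \<psi> = R r (q + D \<psi>) \<and> \<bar>D \<psi>\<bar> \<le> \<alpha> / 2" by metis
 \<comment> \<open>The bound by \<open>\<alpha> / 8\<close> keeps the difference of any two offsets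
   below \<open>\<alpha> / 2\<close>, where the chart gives the distance; the other bounds stay
   inside the corner and where \<open>\<rho>\<close> applies.\<close>
 define d where "d = min (min \<rho> (\<alpha>/8)) (min \<psi>0 (\<beta> k - \<psi>0))"
 have d: "d > 0" "d \<le> \<rho>" "d \<le> \<alpha> / 8" "d \<le> \<psi>0" "d \<le> \<beta> k - \<psi>0"
  using \<rho>(1) \<alpha>(1) p unfolding d_def greaterThanLessThan_iff by linarith+
 have D1: "\<bar>D \<psi>\<bar> = \<bar>\<psi> - \<psi>0\<bar>" if "\<psi> \<in> {0<..<\<beta> k}" "\<bar>\<psi> - \<psi>0\<bar> < d" for \<psi>
 proof -
  have "\<bar>q + D \<psi> - q\<bar> = \<bar>\<psi> - \<psi>0\<bar>"
  proof (rule R_dist_cos(2)[OF r r])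
   show "\<bar>q + D \<psi> - q\<bar> \<le> \<alpha> / 2" using D[OF that(1)] by simp
   show "\<bar>\<psi> - \<psi>0\<bar> \<le> pi" using bpi that p by blast
   show "g (R r (q + D \<psi>)) (R r q) = cosine_law r r (\<psi> - \<psi>0)"
    using \<rho>(2)[OF that(1) p] that(2) d D[OF that(1)] q \<rho>(1) by simp
  qed
  thus ?thesis by simp
 qed
 have D2: "\<bar>D \<psi> - D \<psi>'\<bar> = \<bar>\<psi> - \<psi>'\<bar>"
  if "\<psi> \<in> {0<..<\<beta> k}" "\<bar>\<psi> - \<psi>0\<bar> < d" "\<psi>' \<in> {0<..<\<beta> k}" "\<bar>\<psi>' - \<psi>0\<bar> < d" for \<psi> \<psi>'
 proof -
  have "\<bar>(q + D \<psi>) - (q + D \<psi>')\<bar> = \<bar>\<psi> - \<psi>'\<bar>"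
  proof (rule R_dist_cos(2)[OF r r])
   show "\<bar>(q + D \<psi>) - (q + D \<psi>')\<bar> \<le> \<alpha> / 2" using D1[OF that(1,2)] D1[OF that(3,4)] that d by linarith
   show "\<bar>\<psi> - \<psi>'\<bar> \<le> pi" using bpi that by blast
   show "g (R r (q + D \<psi>)) (R r (q + D \<psi>')) = cosine_law r r (\<psi> - \<psi>')"
    using \<rho>(2)[OF that(1,3)] that d D[OF that(1)] D[OF that(3)] by simp
  qed
  thus ?thesis by simp
 qed
 define \<psi>1 where "\<psi>1 = \<psi>0 + d / 2"
 have p1: "\<psi>1 \<in> {0<..<\<beta> k}" "\<bar>\<psi>1 - \<psi>0\<bar> < d" "\<bar>\<psi>1 - \<psi>0\<bar> = d / 2" using d p by (auto simp: \<psi>1_def)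
 define \<sigma> where "\<sigma> = sgn (D \<psi>1)"
 have "\<bar>D \<psi>1\<bar> = d / 2" using D1[OF p1(1,2)] p1(3) by simp
 hence \<sigma>: "\<sigma> \<in> {1, -1}" using d(1) by (auto simp: \<sigma>_def sgn_if)
 have "S k r \<psi> = R r ((q - \<sigma> * \<psi>0) + \<sigma> * \<psi>)" if "\<psi> \<in> {0<..<\<beta> k}" "\<bar>\<psi> - \<psi>0\<bar> < d" for \<psi>
 proof -
  have "D \<psi> = \<sigma> * (\<psi> - \<psi>0)" unfolding \<sigma>_def
  proof (rule abs_isometry)
   show "\<bar>D \<psi>\<bar> = \<bar>\<psi> - \<psi>0\<bar>" by (rule D1[OF that])
   show "\<bar>D \<psi>1\<bar> = d / 2" by fact
   show "\<bar>D \<psi> - D \<psi>1\<bar> = \<bar>\<psi> - \<psi>0 - d / 2\<bar>" using D2[OF that p1(1,2)] by (simp add: \<psi>1_def)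
  qed (use d in simp)
  hence "q + D \<psi> = (q - \<sigma> * \<psi>0) + \<sigma> * \<psi>" by (simp add: algebra_simps)
  with D[OF that(1)] show ?thesis by metis
 qed
 thus ?thesis using \<sigma> d(1) by blast
qed

text \<open>Comparison at two nearby points: a different sign would have to be compensated by a jump
  of a whole period, for which a step of at most \<open>\<alpha> / 4\<close> is too short.\<close>

lemma line_unique:
 assumes r: "0 < r" "r < eps" and ab: "a < b" and s: "\<sigma> \<in> {1, -1}" "\<sigma>' \<in> {1, -1}"
  and e: "\<And>\<psi>. \<psi> \<in> {a<..<b} ==> R r (u + \<sigma> * \<psi>) = R r (u' + \<sigma>' * \<psi>)"
 shows "\<sigma> = \<sigma>' \<and> (\<exists>n::int. u' = u + of_int n * \<alpha>)"
proof -
 define \<psi> h where "\<psi> = (a + b) / 2" and "h = min ((b - a) / 4) (\<alpha> / 4)"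
 have h: "h > 0" "h \<le> \<alpha> / 4" "\<psi> \<in> {a<..<b}" "\<psi> + h \<in> {a<..<b}"
  using ab \<alpha> by (auto simp: h_def \<psi>_def min_def field_simps)
 obtain n :: int where n: "u' + \<sigma>' * \<psi> = u + \<sigma> * \<psi> + of_int n * \<alpha>" using R_inj[OF r e[OF h(3)]] by blast
 obtain m :: int where m: "u' + \<sigma>' * (\<psi> + h) = u + \<sigma> * (\<psi> + h) + of_int m * \<alpha>" using R_inj[OF r e[OF h(4)]] by blast
 have "(\<sigma>' - \<sigma>) * h = of_int (m - n) * \<alpha>" using n m by (simp add: algebra_simps)
 moreover have "\<bar>(\<sigma>' - \<sigma>) * h\<bar> \<le> 2 * h" using s h(1) by (auto simp: abs_mult)
 ultimately have "\<bar>of_int (m - n) * \<alpha>\<bar> \<le> 2 * h" by simp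
 hence "\<bar>of_int (m - n)\<bar> * \<alpha> \<le> 2 * h" using \<alpha>(1) by (simp add: abs_mult)
 hence "\<bar>of_int (m - n)\<bar> * \<alpha> < 1 * \<alpha>" using h(1,2) \<alpha>(1) by linarith
 hence "\<bar>of_int (m - n) :: real\<bar> < 1" using \<alpha>(1) by (metis mult_less_cancel_right_pos)
 hence "m = n" by linarith
 hence "\<sigma> = \<sigma>'" using \<open>(\<sigma>' - \<sigma>) * h = _\<close> h(1) by simp
 thus ?thesis using n by (intro conjI exI[of _ n]) auto
qed

lemma S_interval:
 assumes k: "k \<in> K" and r: "0 < r" "r < eps" and ab: "0 < a" "a \<le> b" "b < \<beta> k"
 shows "\<exists>u \<sigma>. \<sigma> \<in> {1, -1} \<and> (\<forall>\<psi>\<in>{a..b}. S k r \<psi> = R r (u + \<sigma> * \<psi>))"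
proof -
 define Q where "Q a b \<longleftrightarrow> (0 < a --> b < \<beta> k --> (\<exists>u \<sigma>. \<sigma> \<in> {1, -1} \<and> (\<forall>\<psi>\<in>{a..b}. S k r \<psi> = R r (u + \<sigma> * \<psi>))))" for a b
 have "Q a b"
 proof (rule Bolzano[OF ab(2)])
  fix a b c assume 1: "Q a b" and 2: "Q b c" and ord: "a \<le> b" "b \<le> c"
  show "Q a c" unfolding Q_def
  proof (intro impI)
   assume ac: "0 < a" "c < \<beta> k"
   obtain u \<sigma> where u: "\<sigma> \<in> {1, -1}" "\<And>\<psi>. \<psi>\<in>{a..b} ==> S k r \<psi> = R r (u + \<sigma> * \<psi>)"
    using 1 ac ord unfolding Q_def by force
   obtain v \<tau> where v: "\<tau> \<in> {1, -1}" "\<And>\<psi>. \<psi>\<in>{b..c} ==> S k r \<psi> = R r (v + \<tau> * \<psi>)"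
    using 2 ac ord unfolding Q_def by force
   \<comment> \<open>The two halves share only the point \<open>b\<close>, which does not determine
     a sign. Both are therefore compared with a parametrisation around \<open>b\<close>.\<close>
   have "b \<in> {0<..<\<beta> k}" using ac ord by auto
   then obtain w \<rho> d where w: "\<rho> \<in> {1, -1}" "d > 0"
    "\<And>\<psi>. \<psi>\<in>{0<..<\<beta> k} ==> \<bar>\<psi> - b\<bar> < d ==> S k r \<psi> = R r (w + \<rho> * \<psi>)"
    using S_local[OF k r] by metis
   have wu: "S k r \<psi> = R r (w + \<rho> * \<psi>)" if "\<psi> \<in> {a..b}" for \<psi>
   proof (cases "a = b")
    case True thus ?thesis using that w(3)[of \<psi>] ac ord w(2) by auto
   next
    case False
    have "\<rho> = \<sigma> \<and> (\<exists>n::int. u = w + of_int n * \<alpha>)"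
    proof (rule line_unique[OF r _ w(1) u(1), of "max a (b - d)" b])
     show "max a (b - d) < b" using False ord w(2) by auto
     fix \<psi> assume p: "\<psi> \<in> {max a (b - d)<..<b}"
     have "S k r \<psi> = R r (w + \<rho> * \<psi>)" by (rule w(3)) (use p ac ord in auto)
     moreover have "S k r \<psi> = R r (u + \<sigma> * \<psi>)" by (rule u(2)) (use p in auto)
     ultimately show "R r (w + \<rho> * \<psi>) = R r (u + \<sigma> * \<psi>)" by simp
    qed
    then obtain n :: int where n: "\<rho> = \<sigma>" "u = w + of_int n * \<alpha>" by blast
    have "u + \<sigma> * \<psi> = (w + \<rho> * \<psi>) + of_int n * \<alpha>" by (simp add: n)
    thus ?thesis using u(2)[OF that] R_int[of r "w + \<rho> * \<psi>" n] r by simp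
   qed
   have wv: "S k r \<psi> = R r (w + \<rho> * \<psi>)" if "\<psi> \<in> {b..c}" for \<psi>
   proof (cases "b = c")
    case True thus ?thesis using that w(3)[of \<psi>] ac ord w(2) by auto
   next
    case False
    have "\<rho> = \<tau> \<and> (\<exists>n::int. v = w + of_int n * \<alpha>)"
    proof (rule line_unique[OF r _ w(1) v(1), of b "min c (b + d)"])
     show "b < min c (b + d)" using False ord w(2) by auto
     fix \<psi> assume p: "\<psi> \<in> {b<..<min c (b + d)}"
     have "S k r \<psi> = R r (w + \<rho> * \<psi>)" by (rule w(3)) (use p ac ord in auto)
     moreover have "S k r \<psi> = R r (v + \<tau> * \<psi>)" by (rule v(2)) (use p in auto)
     ultimately show "R r (w + \<rho> * \<psi>) = R r (v + \<tau> * \<psi>)" by simp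
    qed
    then obtain n :: int where n: "\<rho> = \<tau>" "v = w + of_int n * \<alpha>" by blast
    have "v + \<tau> * \<psi> = (w + \<rho> * \<psi>) + of_int n * \<alpha>" by (simp add: n)
    thus ?thesis using v(2)[OF that] R_int[of r "w + \<rho> * \<psi>" n] r by simp
   qed
   show "\<exists>u \<sigma>. \<sigma> \<in> {1, -1} \<and> (\<forall>\<psi>\<in>{a..c}. S k r \<psi> = R r (u + \<sigma> * \<psi>))"
   proof (intro exI conjI ballI)
    fix \<psi> assume "\<psi> \<in> {a..c}"
    thus "S k r \<psi> = R r (w + \<rho> * \<psi>)" using wu[of \<psi>] wv[of \<psi>] by (cases "\<psi> \<le> b") auto
   qed (rule w(1))
  qed
 next
  fix x assume x: "a \<le> x" "x \<le> b"
  have xb: "x \<in> {0<..<\<beta> k}" using x ab by auto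
  obtain u \<sigma> d where u: "\<sigma> \<in> {1, -1}" "d > 0" "\<And>\<psi>. \<psi>\<in>{0<..<\<beta> k} ==> \<bar>\<psi> - x\<bar> < d ==> S k r \<psi> = R r (u + \<sigma> * \<psi>)"
   using S_local[OF k r xb] by metis
  show "\<exists>d>0. \<forall>a b. a \<le> x \<and> x \<le> b \<and> b - a < d --> Q a b"
  proof (intro exI[of _ d] conjI allI impI u(2))
   fix a' b' assume h: "a' \<le> x \<and> x \<le> b' \<and> b' - a' < d"
   show "Q a' b'" unfolding Q_def by (intro impI exI[of _ u] exI[of _ \<sigma>] conjI ballI u(1) u(3)) (use h in auto)
  qed
 qed
 thus ?thesis using ab by (simp add: Q_def)
qed

text \<open>The middle third fixes \<open>u\<close> and \<open>\<sigma>\<close>; larger compact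
  intervals must agree with it, the two ends follow from the Lipschitz bound, and
  \<open>S_ray\<close> carries the result from one radius to all.\<close>

lemma S_arc:
 assumes k: "k \<in> K"
 shows "\<exists>u \<sigma>. \<sigma> \<in> {1, -1} \<and> (\<forall>r \<psi>. 0 \<le> r --> r < eps --> \<psi> \<in> {0..\<beta> k} --> S k r \<psi> = R r (u + \<sigma> * \<psi>))"
proof -
 define r where "r = eps / 2"
 have r: "0 < r" "r < eps" using eps by (auto simp: r_def)
 have bk: "\<beta> k > 0" using \<beta>[OF k] by simp
 obtain u \<sigma> where u: "\<sigma> \<in> {1, -1}" "\<And>\<psi>. \<psi>\<in>{\<beta> k/3..2*\<beta> k/3} ==> S k r \<psi> = R r (u + \<sigma> * \<psi>)"
 proof -
  have "\<exists>u \<sigma>. \<sigma> \<in> {1, -1} \<and> (\<forall>\<psi>\<in>{\<beta> k/3..2*\<beta> k/3}. S k r \<psi> = R r (u + \<sigma> * \<psi>))"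
   by (rule S_interval[OF k r]) (use bk in auto)
  thus ?thesis using that by blast
 qed
 have int: "S k r \<psi> = R r (u + \<sigma> * \<psi>)" if p: "\<psi> \<in> {0<..<\<beta> k}" for \<psi>
 proof -
  obtain v \<tau> where v: "\<tau> \<in> {1, -1}" "\<And>\<psi>'. \<psi>'\<in>{min \<psi> (\<beta> k/3)..max \<psi> (2*\<beta> k/3)} ==> S k r \<psi>' = R r (v + \<tau> * \<psi>')"
  proof -
   have "\<exists>v \<tau>. \<tau> \<in> {1, -1} \<and> (\<forall>\<psi>'\<in>{min \<psi> (\<beta> k/3)..max \<psi> (2*\<beta> k/3)}. S k r \<psi>' = R r (v + \<tau> * \<psi>'))"
    by (rule S_interval[OF k r]) (use bk p in auto)
   thus ?thesis using that by blast
  qed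
  have "\<sigma> = \<tau> \<and> (\<exists>n::int. v = u + of_int n * \<alpha>)"
  proof (rule line_unique[OF r _ u(1) v(1), of "\<beta> k/3" "2*\<beta> k/3"])
   show "\<beta> k/3 < 2*\<beta> k/3" using bk by simp
   fix \<psi>' assume p': "\<psi>' \<in> {\<beta> k/3<..<2*\<beta> k/3}"
   have "S k r \<psi>' = R r (u + \<sigma> * \<psi>')" by (rule u(2)) (use p' in auto)
   moreover have "S k r \<psi>' = R r (v + \<tau> * \<psi>')" by (rule v(2)) (use p' in auto)
   ultimately show "R r (u + \<sigma> * \<psi>') = R r (v + \<tau> * \<psi>')" by simp
  qed
  then obtain n :: int where n: "\<sigma> = \<tau>" "v = u + of_int n * \<alpha>" by blast
  have "v + \<tau> * \<psi> = (u + \<sigma> * \<psi>) + of_int n * \<alpha>" by (simp add: n)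
  thus ?thesis using v(2)[of \<psi>] R_int[of r "u + \<sigma> * \<psi>" n] r by simp
 qed
 \<comment> \<open>At an end only the Lipschitz bound is available. If the end had another
   direction, the nearby interior point at angle \<open>h\<close> would be too far from it.\<close>
 have ends: "S k r e = R r (u + \<sigma> * e)" if e: "e = 0 \<or> e = \<beta> k" for e
 proof -
  have ecl: "e \<in> {0..\<beta> k}" using e bk by auto
  obtain t where t: "S k r e = R r t" "\<bar>t - (u + \<sigma> * e)\<bar> \<le> \<alpha> / 2" using S_rep[OF k _ r(2) ecl] r by auto
  have "t = u + \<sigma> * e"
  proof (rule ccontr)
   assume ne: "\<not> ?thesis"
   define \<delta> where "\<delta> = \<bar>t - (u + \<sigma> * e)\<bar>"
   define h where "h = min (\<beta> k / 2) (min (\<delta> / 4) (\<alpha> / 8))"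
   have "\<delta> > 0" using ne by (simp add: \<delta>_def)
   hence h: "h > 0" "h \<le> \<beta> k / 2" "h \<le> \<delta> / 4" "h \<le> \<alpha> / 8" using bk \<alpha>(1) unfolding h_def by linarith+
   define \<psi> where "\<psi> = (if e = 0 then h else \<beta> k - h)"
   have p: "\<psi> \<in> {0<..<\<beta> k}" "\<bar>e - \<psi>\<bar> = h" using h bk e by (auto simp: \<psi>_def)
   have s: "\<bar>(u + \<sigma> * \<psi>) - (u + \<sigma> * e)\<bar> = h" using u(1) p(2) by auto
   obtain n :: int where n: "R r (t + of_int n * \<alpha>) = R r t" "\<bar>t + of_int n * \<alpha> - (u + \<sigma> * \<psi>)\<bar> \<le> \<alpha> / 2"
    using R_near[of r t "u + \<sigma> * \<psi>"] r by auto
   have "\<bar>t + of_int n * \<alpha> - (u + \<sigma> * \<psi>)\<bar> \<le> \<bar>e - \<psi>\<bar>"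
    by (rule S_lip[OF k r r ecl _ _ int[OF p(1)] n(2)]) (use p t n in auto)
   hence c: "\<bar>t + of_int n * \<alpha> - (u + \<sigma> * e)\<bar> \<le> 2 * h" using s p(2) by linarith
   hence "\<bar>of_int n * \<alpha>\<bar> < 1 * \<alpha>" using t(2) h(4) \<alpha> by linarith
   hence "\<bar>of_int n :: real\<bar> < 1" using \<alpha>(1) by (simp add: abs_mult)
   hence "n = 0" by linarith
   thus False using c h(1,3) by (simp add: \<delta>_def)
  qed
  thus ?thesis using t by simp
 qed
 have all: "S k r \<psi> = R r (u + \<sigma> * \<psi>)" if "\<psi> \<in> {0..\<beta> k}" for \<psi>
  using int[of \<psi>] ends[of \<psi>] that by (cases "\<psi> = 0 \<or> \<psi> = \<beta> k") auto
 show ?thesis using u(1) S_ray[OF k r _ _ _ all] by (intro exI[of _ u] exI[of _ \<sigma>] conjI allI impI) auto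
qed

text \<open>The images of the corners are arcs of the circle of directions. That corners cover and
  do not overlap makes these arcs a tiling, which yields the profile, its integral and the angle sum
  at once.\<close>

lemma fan_profile:
 obtains G dp dm where
  "\<And>t. conc_germ G dp dm t" "\<And>t. G (t + \<alpha>) = G t" "\<And>t. dp (t + \<alpha>) = dp t" "\<And>t. dm (t + \<alpha>) = dm t"
  "\<And>r t. 0 \<le> r ==> r < eps ==> F (R r t) = F z * (cosh r + G t * sinh r)"
  "\<And>u. ((\<lambda>t. angle_density (G t) (dp t)) has_integral sum W K) {u..u+\<alpha>}"
  "sum \<beta> K = \<alpha>"
proof -
 define r0 where "r0 = eps / 2"
 have r0: "0 < r0" "r0 < eps" using eps by (auto simp: r0_def)
 have "\<forall>k\<in>K. \<exists>us. snd us \<in> {1, -1} \<and> (\<forall>r \<psi>. 0 \<le> r --> r < eps --> \<psi> \<in> {0..\<beta> k} --> S k r \<psi> = R r (fst us + snd us * \<psi>))"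
  using S_arc by (metis fst_conv snd_conv)
 from bchoice[OF this] obtain us where us:
  "\<forall>k\<in>K. snd (us k) \<in> {1, -1} \<and> (\<forall>r \<psi>. 0 \<le> r --> r < eps --> \<psi> \<in> {0..\<beta> k} --> S k r \<psi> = R r (fst (us k) + snd (us k) * \<psi>))"
  by blast
 define u \<sigma> where "u k = fst (us k)" and "\<sigma> k = snd (us k)" for k
 have \<sigma>: "\<sigma> k = 1 \<or> \<sigma> k = -1" if "k \<in> K" for k using us that by (auto simp: \<sigma>_def)
 have SR: "S k r \<psi> = R r (u k + \<sigma> k * \<psi>)" if "k \<in> K" "0 \<le> r" "r < eps" "\<psi> \<in> {0..\<beta> k}" for k r \<psi>
  using us that by (auto simp: u_def \<sigma>_def)
 \<comment> \<open>A corner with \<open>\<sigma> k = -1\<close> is traversed backwards.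
   \<open>l\<close>, \<open>A\<close> and \<open>B\<close> describe its arc and its profile from the
   left end in the orientation of the chart.\<close>
 define l where "l k = (if \<sigma> k = 1 then u k else u k - \<beta> k)" for k
 define A where "A k = (if \<sigma> k = 1 then X k else X k * cos (\<beta> k) + P k * sin (\<beta> k))" for k
 define B where "B k = (if \<sigma> k = 1 then P k else X k * sin (\<beta> k) - P k * cos (\<beta> k))" for k
 have arc: "\<sigma> k * (t - u k) \<in> {0..\<beta> k} \<and> u k + \<sigma> k * (\<sigma> k * (t - u k)) = t" if "k \<in> K" "t \<in> {l k..l k + \<beta> k}" for k t
  using \<sigma>[OF that(1)] that(2) by (auto simp: l_def)
 have arco: "\<sigma> k * (t - u k) \<in> {0<..<\<beta> k}" if "k \<in> K" "t \<in> {l k<..<l k + \<beta> k}" for k t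
  using \<sigma>[OF that(1)] that(2) by (auto simp: l_def)
 have RS: "R r t = S k r (\<sigma> k * (t - u k))" if "k \<in> K" "t \<in> {l k..l k + \<beta> k}" "0 \<le> r" "r < eps" for k r t
  using SR[OF that(1,3,4), of "\<sigma> k * (t - u k)"] arc[OF that(1,2)] by simp
 have prof: "X k * cos (\<sigma> k * (t - u k)) + P k * sin (\<sigma> k * (t - u k)) = A k * cos (t - l k) + B k * sin (t - l k)"
  if "k \<in> K" for k t
 proof (cases "\<sigma> k = 1")
  case False
  hence s: "\<sigma> k = -1" using \<sigma>[OF that] by simp
  define w where "w = t - l k"
  have e: "\<sigma> k * (t - u k) = \<beta> k - w" using s by (simp add: l_def w_def)
  show ?thesis unfolding e w_def[symmetric] cos_diff sin_diff using s by (simp add: A_def B_def algebra_simps)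
 qed (simp add: A_def B_def l_def)
 have AB: "(A k)\<^sup>2 + (B k)\<^sup>2 < 1" if "k \<in> K" for k
 proof -
  have "(A k)\<^sup>2 + (B k)\<^sup>2 = (X k)\<^sup>2 + (P k)\<^sup>2"
   using rot_norm[of "X k" "\<beta> k" "P k"] by (simp add: A_def B_def power2_commute)
  thus ?thesis using XP[OF that] by simp
 qed
 have tiling: "arc_tiling \<alpha> K l \<beta>"
 proof
  fix t
  have "g z (R r0 t) = r0" "R r0 t \<in> T" using R_radius[of r0 t] R_T[of r0 t] r0 by auto
  then obtain k \<psi> where k: "k \<in> K" "\<psi> \<in> {0..\<beta> k}" "R r0 t = S k r0 \<psi>" using S_cover[of "R r0 t"] r0 by auto
  hence "R r0 t = R r0 (u k + \<sigma> k * \<psi>)" using SR[OF k(1) _ r0(2) k(2)] r0 by simp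
  then obtain n :: int where "u k + \<sigma> k * \<psi> = t + of_int n * \<alpha>" using R_inj[OF r0] by blast
  moreover have "u k + \<sigma> k * \<psi> \<in> {l k..l k + \<beta> k}" using \<sigma>[OF k(1)] k(2) by (auto simp: l_def)
  ultimately show "\<exists>k\<in>K. \<exists>n::int. t + of_int n * \<alpha> \<in> {l k..l k + \<beta> k}" using k(1) by metis
 next
  fix k k' t and n :: int
  assume h: "k \<in> K" "k' \<in> K" "t \<in> {l k<..<l k + \<beta> k}" "t + of_int n * \<alpha> \<in> {l k'..l k' + \<beta> k'}"
  have tc: "t \<in> {l k..l k + \<beta> k}" using h(3) by auto
  have "S k r0 (\<sigma> k * (t - u k)) = S k' r0 (\<sigma> k' * (t + of_int n * \<alpha> - u k'))"
   using RS[OF h(1) tc, of r0] RS[OF h(2,4), of r0] R_int[of r0 t n] r0 by simp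
  hence e: "k = k' \<and> \<sigma> k * (t - u k) = \<sigma> k' * (t + of_int n * \<alpha> - u k')"
   by (intro S_inj[OF h(1,2) r0 arco[OF h(1,3)]]) (use arc[OF h(2,4)] in auto)
  hence "t = t + of_int n * \<alpha>" using \<sigma>[OF h(1)] by auto
  thus "k = k' \<and> n = 0" using e \<alpha> by simp
 qed (use \<alpha> fin \<beta> in auto)
 interpret arc_tiling \<alpha> K l \<beta> by (rule tiling)
 \<comment> \<open>The expansion of \<open>F\<close> solved for the profile at the single radius
   \<open>r0\<close>; the arcs then show that it is the same for every radius.\<close>
 define G where "G t = (F (R r0 t) / F z - cosh r0) / sinh r0" for t
 have perG: "G (t + \<alpha>) = G t" for t using R_per[of r0 t] r0 by (simp add: G_def)
 have Garc: "G t = A k * cos (t - l k) + B k * sin (t - l k)" if "k \<in> K" "t \<in> {l k..l k + \<beta> k}" for k t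
 proof -
  have "F (R r0 t) = F z * (cosh r0 + (A k * cos (t - l k) + B k * sin (t - l k)) * sinh r0)"
   using RS[OF that, of r0] S_F[OF that(1) _ r0(2), of "\<sigma> k * (t - u k)"] arc[OF that] r0 prof[OF that(1)] by simp
  moreover have "sinh r0 \<noteq> 0" using r0 by simp
  ultimately show ?thesis using F_pos by (simp add: G_def)
 qed
 define pos where "pos k b = u k + \<sigma> k * corner_end (\<beta> k) b" for k b
 define isR where "isR k b \<longleftrightarrow> ((\<sigma> k = 1) = b)" for k and b :: bool
 have pos: "pos k b = (if isR k b then l k + \<beta> k else l k)" if "k \<in> K" for k b
  using \<sigma>[OF that] by (auto simp: pos_def isR_def l_def corner_end_def)
 have slope: "corner_slope (\<beta> k) (X k) (P k) b = (if isR k b then - (B k * cos (\<beta> k) - A k * sin (\<beta> k)) else B k)"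
  if "k \<in> K" for k b
 proof -
  have "(X k * sin (\<beta> k) - P k * cos (\<beta> k)) * cos (\<beta> k) - (X k * cos (\<beta> k) + P k * sin (\<beta> k)) * sin (\<beta> k) = - P k"
   using sin_cos_squared_add[of "\<beta> k"] by algebra
  thus ?thesis using \<sigma>[OF that] by (auto simp: corner_slope_def isR_def A_def B_def)
 qed
 have partner: "\<exists>k'\<in>K. \<exists>b'. \<exists>n::int. isR k' b' = (\<not> isR k b) \<and> pos k' b' = pos k b + of_int n * \<alpha> \<and>
   corner_slope (\<beta> k) (X k) (P k) b + corner_slope (\<beta> k') (X k') (P k') b' \<le> 0" if k: "k \<in> K" for k b
 proof -
  obtain k' b' r where k': "k' \<in> K" "(k', b') \<noteq> (k, b)" "0 < r" "r < eps"
   "S k r (corner_end (\<beta> k) b) = S k' r (corner_end (\<beta> k') b')"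
   "corner_slope (\<beta> k) (X k) (P k) b + corner_slope (\<beta> k') (X k') (P k') b' \<le> 0" using pair[OF k] by blast
  have ce: "corner_end (\<beta> j) c \<in> {0..\<beta> j}" if "j \<in> K" for j c using \<beta>[OF that] by (auto simp: corner_end_def)
  have "R r (pos k b) = R r (pos k' b')"
   using k'(5) SR[OF k _ k'(4) ce[OF k]] SR[OF k'(1) _ k'(4) ce[OF k'(1)]] k'(3) by (simp add: pos_def)
  then obtain n :: int where n: "pos k' b' = pos k b + of_int n * \<alpha>" using R_inj[OF k'(3,4)] by blast
  \<comment> \<open>Two ends that meet lie on opposite sides: if both were right ends, or both left
    ends, the two arcs would overlap next to their common end.\<close>
  have "isR k' b' = (\<not> isR k b)"
  proof (rule ccontr)
   assume "\<not> ?thesis"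
   hence same: "isR k' b' = isR k b" by simp
   define h where "h = min (\<beta> k) (\<beta> k') / 2"
   have bb: "\<beta> k > 0" "\<beta> k' > 0" using \<beta> k k'(1) by auto
   have h: "0 < h" "h < \<beta> k" "h < \<beta> k'" using bb unfolding h_def by linarith+
   define t where "t = (if isR k b then pos k b - h else pos k b + h)"
   have "t \<in> {l k<..<l k + \<beta> k}" using h pos[OF k, of b] by (auto simp: t_def)
   moreover have "t + of_int n * \<alpha> = (if isR k' b' then pos k' b' - h else pos k' b' + h)" using n same by (auto simp: t_def)
   hence "t + of_int n * \<alpha> \<in> {l k'..l k' + \<beta> k'}" using h pos[OF k'(1), of b'] by auto
   ultimately have "k = k'" using disj[OF k k'(1)] by blast
   hence "b = b'" using same by (auto simp: isR_def)
   thus False using \<open>k = k'\<close> k'(2) by simp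
  qed
  thus ?thesis using n k'(1,6) by blast
 qed
 have right: "\<exists>k'\<in>K. \<exists>n::int. l k' = l k + \<beta> k + of_int n * \<alpha> \<and> B k' \<le> B k * cos (\<beta> k) - A k * sin (\<beta> k)"
  if k: "k \<in> K" for k
 proof -
  define b where "b = (\<sigma> k = 1)"
  have b: "isR k b" by (simp add: b_def isR_def)
  obtain k' b' n where k': "k' \<in> K" "isR k' b' = (\<not> isR k b)" "pos k' b' = pos k b + of_int n * \<alpha>"
   "corner_slope (\<beta> k) (X k) (P k) b + corner_slope (\<beta> k') (X k') (P k') b' \<le> 0" using partner[OF k, of b] by blast
  thus ?thesis using pos[OF k, of b] pos[OF k'(1), of b'] slope[OF k, of b] slope[OF k'(1), of b'] b
   by (intro bexI[OF _ k'(1)] exI[of _ n]) auto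
 qed
 have left: "\<exists>k'\<in>K. \<exists>n::int. l k = l k' + \<beta> k' + of_int n * \<alpha> \<and> B k \<le> B k' * cos (\<beta> k') - A k' * sin (\<beta> k')"
  if k: "k \<in> K" for k
 proof -
  define b where "b = (\<sigma> k \<noteq> 1)"
  have b: "\<not> isR k b" by (simp add: b_def isR_def)
  obtain k' b' n where k': "k' \<in> K" "isR k' b' = (\<not> isR k b)" "pos k' b' = pos k b + of_int n * \<alpha>"
   "corner_slope (\<beta> k) (X k) (P k) b + corner_slope (\<beta> k') (X k') (P k') b' \<le> 0" using partner[OF k, of b] by blast
  thus ?thesis using pos[OF k, of b] pos[OF k'(1), of b'] slope[OF k, of b] slope[OF k'(1), of b'] b
   by (intro bexI[OF _ k'(1)] exI[of _ "-n"]) auto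
 qed
 obtain dp dm where d: "\<And>t. conc_germ G dp dm t" "\<And>t. dp (t + \<alpha>) = dp t" "\<And>t. dm (t + \<alpha>) = dm t" "\<And>t. rgerm G t (dp t)"
  using arcs_conc_germ[of G A B, OF perG Garc AB right left] by metis
 have FR: "F (R r t) = F z * (cosh r + G t * sinh r)" if r: "0 \<le> r" "r < eps" for r t
 proof -
  obtain k and n :: int where k: "k \<in> K" "t + of_int n * \<alpha> \<in> {l k..l k + \<beta> k}" using cover by blast
  have "F (R r (t + of_int n * \<alpha>)) = F z * (cosh r + G (t + of_int n * \<alpha>) * sinh r)"
   unfolding Garc[OF k] prof[OF k(1), symmetric] RS[OF k r] by (rule S_F[OF k(1) r]) (use arc[OF k] in blast)
  moreover have "G (t + of_int n * \<alpha>) = G t" by (rule periodic_int[of G, OF perG])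
  ultimately show ?thesis using R_int[OF r] by simp
 qed
 have dens: "((\<lambda>t. angle_density (G t) (dp t)) has_integral W k) {l k..l k + \<beta> k}" if k: "k \<in> K" for k
 proof -
  have "((\<lambda>s. angle_density (A k * cos s + B k * sin s) (B k * cos s - A k * sin s)) has_integral W k) {0..\<beta> k}"
  proof (cases "\<sigma> k = 1")
   case True thus ?thesis using W[OF k] by (simp add: A_def B_def)
  next
   case False
   define f where "f \<psi> = angle_density (X k * cos \<psi> + P k * sin \<psi>) (P k * cos \<psi> - X k * sin \<psi>)" for \<psi>
   have "(f has_integral W k) {0..\<beta> k}" unfolding f_def by (rule W[OF k])
   hence "((\<lambda>x. f (- x)) has_integral W k) {-\<beta> k..-0}" by (rule has_integral_reflect_real[THEN iffD2])
   from has_integral_shift_real[OF this, of "- \<beta> k"]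
   have "((\<lambda>t. f (\<beta> k - t)) has_integral W k) {0..\<beta> k}" by simp
   moreover have "f (\<beta> k - s) = angle_density (A k * cos s + B k * sin s) (B k * cos s - A k * sin s)" for s
   proof -
    have "X k * cos (\<beta> k - s) + P k * sin (\<beta> k - s) = A k * cos s + B k * sin s"
     using False by (simp add: A_def B_def cos_diff sin_diff algebra_simps)
    moreover have "P k * cos (\<beta> k - s) - X k * sin (\<beta> k - s) = - (B k * cos s - A k * sin s)"
     using False by (simp add: A_def B_def cos_diff sin_diff algebra_simps)
    ultimately show ?thesis by (simp only: f_def angle_density_def power2_minus)
   qed
   ultimately show ?thesis by simp
  qed
  from has_integral_shift_real[OF this, of "- l k"]
  have "((\<lambda>t. angle_density (A k * cos (t - l k) + B k * sin (t - l k)) (B k * cos (t - l k) - A k * sin (t - l k))) has_integral W k) {l k..l k + \<beta> k}"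
   by (simp add: add.commute)
  thus ?thesis
  proof (rule has_integral_spike_finite[where S = "{l k + \<beta> k}", rotated 2])
   fix t assume t: "t \<in> {l k..l k + \<beta> k} - {l k + \<beta> k}"
   hence t': "t \<in> {l k..<l k + \<beta> k}" "t \<in> {l k..l k + \<beta> k}" by auto
   have "dp t = B k * cos (t - l k) - A k * sin (t - l k)" by (rule rgerm_unique[OF d(4) rgerm_sinusoid[OF Garc[OF k] t'(1)]])
   thus "angle_density (G t) (dp t) = angle_density (A k * cos (t - l k) + B k * sin (t - l k)) (B k * cos (t - l k) - A k * sin (t - l k))"
    by (simp only: Garc[OF k t'(2)])
  qed simp
 qed
 have "((\<lambda>t. angle_density (G t) (dp t)) has_integral sum W K) {v..v+\<alpha>}" for v
  by (rule tile_integral[OF _ dens]) (simp_all only: perG d(2))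
 thus ?thesis using that[OF d(1) perG d(2,3) FR _ sum_\<beta>] by blast
qed

end

text \<open>Half a great circle that misses the poles subtends the angle \<open>pi\<close>. It is
  cut into two quarters because \<open>sector_angle_integral\<close> stops short of
  \<open>pi\<close>; the two quarters have supplementary angles.\<close>

lemma half_disc_angle:
 assumes N: "x\<^sup>2 + p\<^sup>2 < (1::real)"
 shows "((\<lambda>s. angle_density (x * cos s + p * sin s) (p * cos s - x * sin s)) has_integral pi) {0..pi}"
proof -
 let ?f = "\<lambda>s. angle_density (x * cos s + p * sin s) (p * cos s - x * sin s)"
 have 1: "(?f has_integral sector_angle (pi/2) x p) {0..pi/2}" using sector_angle_integral[of "pi/2" x p] N by simp
 have "((\<lambda>s. angle_density (p * cos s + (-x) * sin s) (- x * cos s - p * sin s)) has_integral sector_angle (pi/2) p (-x)) {0..pi/2}"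
  using sector_angle_integral[of "pi/2" p "-x"] N by (simp add: add.commute)
 from has_integral_shift_real[OF this, of "-(pi/2)"]
 have 2: "(?f has_integral sector_angle (pi/2) p (-x)) {pi/2..pi}" by (simp add: cos_diff sin_diff algebra_simps)
 have ne: "x\<^sup>2 < 1" "p\<^sup>2 < 1" using N by (smt (verit) zero_le_power2)+
 define W where "W = (cos (pi/2) - x * p) / (sqrt (1 - x\<^sup>2) * sqrt (1 - p\<^sup>2))"
 have W: "-1 \<le> W" "W \<le> 1" using sector_cos_sqrt(2,3)[OF N, of p "pi/2"] pi_gt_zero by (auto simp: W_def)
 have "sector_angle (pi/2) x p = arccos W" by (simp add: sector_angle_def W_def)
 moreover have "sector_angle (pi/2) p (-x) = arccos (- W)" by (simp add: sector_angle_def W_def mult.commute)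
 ultimately have "sector_angle (pi/2) x p + sector_angle (pi/2) p (-x) = pi" using W by (simp add: arccos_minus)
 thus ?thesis using has_integral_combine[OF _ _ 1 2] by simp
qed

section \<open>The hyperboloid model\<close>

declare mem_ball [simp del] mem_ball_0 [simp del]

lemma lorentz_eq: "lorentz u w = fst u \<bullet> fst w - snd u * snd w" by (simp add: lorentz_def case_prod_beta)

lemma lorentz_simps [simp]:
 "lorentz (u + v) w = lorentz u w + lorentz v w" "lorentz u (v + w) = lorentz u v + lorentz u w"
 "lorentz (u - v) w = lorentz u w - lorentz v w" "lorentz u (v - w) = lorentz u v - lorentz u w"
 "lorentz (c *\<^sub>R u) w = c * lorentz u w" "lorentz u (c *\<^sub>R w) = c * lorentz u w"
 "lorentz (- u) w = - lorentz u w" "lorentz u (- w) = - lorentz u w"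
 "lorentz 0 w = 0" "lorentz u 0 = 0" by (simp_all add: lorentz_eq algebra_simps)

lemma lorentz_commute: "lorentz u w = lorentz w u" by (simp add: lorentz_eq inner_commute mult.commute)

definition on_hyperboloid :: "'a::euclidean_space \<times> real \<Rightarrow> bool" where
 "on_hyperboloid w \<longleftrightarrow> lorentz w w = -1 \<and> snd w > 0"

definition lift :: "'a::euclidean_space \<Rightarrow> 'a \<times> real" where
 "lift x = (1 / sqrt (1 - x \<bullet> x)) *\<^sub>R (x, 1)"

definition klein :: "'a::euclidean_space \<times> real \<Rightarrow> 'a" where
 "klein w = fst w /\<^sub>R snd w"

lemma ball_inner: "x \<in> ball 0 1 \<longleftrightarrow> x \<bullet> x < 1" by (simp add: mem_ball_0 norm_lt_square)

lemma lift_hyperboloid: assumes "x \<in> hyp_space" shows "on_hyperboloid (lift x)"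
proof -
 have p: "1 - x \<bullet> x > 0" using assms unfolding ball_inner by simp
 define c where "c = 1 / sqrt (1 - x \<bullet> x)"
 have "lorentz (lift x) (lift x) = c\<^sup>2 * (x \<bullet> x - 1)"
  unfolding lift_def c_def[symmetric] by (simp add: lorentz_eq power2_eq_square algebra_simps)
 also have "\<dots> = (1 / sqrt (1 - x \<bullet> x))\<^sup>2 * (x \<bullet> x - 1)" by (simp only: c_def)
 also have "\<dots> = -1" using p by (simp add: power_divide field_simps)
 finally show ?thesis using p by (simp add: on_hyperboloid_def lift_def)
qed

lemma lift_point: "x \<in> hyp_space ==> \<exists>c>0. lift x = c *\<^sub>R (x, 1)"
 unfolding lift_def by (intro exI[of _ "1 / sqrt (1 - x \<bullet> x)"]) (simp add: ball_inner)

lemma klein_lift: "x \<in> hyp_space ==> klein (lift x) = x" by (simp only: ball_inner) (simp add: klein_def lift_def)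

lemma klein_hyperboloid:
 assumes "on_hyperboloid w" shows "klein w \<in> hyp_space" "lift (klein w) = w"
proof -
 have w: "fst w \<bullet> fst w = (snd w)\<^sup>2 - 1" "snd w > 0"
  using assms by (auto simp: on_hyperboloid_def lorentz_eq power2_eq_square)
 have k: "klein w \<bullet> klein w = ((snd w)\<^sup>2 - 1) / (snd w)\<^sup>2"
  using w by (simp add: klein_def power2_eq_square divide_simps)
 have e: "1 - klein w \<bullet> klein w = 1 / (snd w)\<^sup>2" using w unfolding k by (simp add: field_simps)
 hence "1 - klein w \<bullet> klein w > 0" using w by simp
 thus "klein w \<in> hyp_space" by (simp only: ball_inner)
 have "1 / sqrt (1 - klein w \<bullet> klein w) = snd w" unfolding e using w by (simp add: real_sqrt_divide)
 thus "lift (klein w) = w" using w by (simp add: lift_def klein_def prod_eq_iff)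
qed

lemma hyp_dist_lift:
 assumes "x \<in> hyp_space" "y \<in> hyp_space"
 shows "hyp_dist x y = arcosh (- lorentz (lift x) (lift y))"
proof -
 have "- lorentz (lift x) (lift y) = (1 - x \<bullet> y) / sqrt ((1 - x \<bullet> x) * (1 - y \<bullet> y))"
  by (simp add: lift_def lorentz_eq real_sqrt_mult diff_divide_distrib)
 thus ?thesis by (simp add: hyp_dist_def)
qed

text \<open>The form has a single negative direction, which \<open>h\<close> uses up. In coordinates
  this is the Cauchy-Schwarz inequality for the spatial parts.\<close>

lemma timelike_orthogonal:
 assumes h: "lorentz h h < 0" and w: "lorentz h w = 0"
 shows "lorentz w w \<ge> 0" and "lorentz w w = 0 ==> w = 0"
proof -
 obtain m b n c where hw: "h = (m, b)" "w = (n, c)" by (metis surj_pair)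
 have 1: "m \<bullet> m < b\<^sup>2" and 2: "m \<bullet> n = b * c" using h w by (auto simp: hw lorentz_eq power2_eq_square)
 have b0: "b\<^sup>2 > 0" using 1 by (smt (verit) inner_ge_zero)
 have "(b * c)\<^sup>2 \<le> (m \<bullet> m) * (n \<bullet> n)" unfolding 2[symmetric] by (rule Cauchy_Schwarz_ineq)
 hence 3: "b\<^sup>2 * c\<^sup>2 \<le> (m \<bullet> m) * (n \<bullet> n)" by (simp add: power_mult_distrib)
 also have "\<dots> \<le> b\<^sup>2 * (n \<bullet> n)" using 1 by (intro mult_right_mono) auto
 finally have "c\<^sup>2 \<le> n \<bullet> n" using b0 by simp
 thus "lorentz w w \<ge> 0" by (simp add: hw lorentz_eq power2_eq_square)
 assume "lorentz w w = 0"
 hence e: "c\<^sup>2 = n \<bullet> n" by (simp add: hw lorentz_eq power2_eq_square)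
 have "n \<bullet> n = 0"
 proof (rule ccontr)
  assume "n \<bullet> n \<noteq> 0"
  hence "(m \<bullet> m) * (n \<bullet> n) < b\<^sup>2 * (n \<bullet> n)" using 1 by (intro mult_strict_right_mono) auto
  thus False using 3 e by simp
 qed
 thus "w = 0" using e by (simp add: hw prod_eq_iff zero_prod_def)
qed

lemma lorentz_Cauchy_Schwarz:
 assumes h: "lorentz h h < 0" and u: "lorentz h u = 0" "lorentz h w = 0"
 shows "(lorentz u w)\<^sup>2 \<le> lorentz u u * lorentz w w"
proof (cases "lorentz w w = 0")
 case True
 hence "w = 0" using timelike_orthogonal(2)[OF h u(2)] by simp
 thus ?thesis by simp
next
 case False
 hence p: "lorentz w w > 0" using timelike_orthogonal(1)[OF h u(2)] by simp
 define v where "v = lorentz w w *\<^sub>R u - lorentz u w *\<^sub>R w"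
 have "lorentz h v = 0" using u by (simp add: v_def)
 hence "0 \<le> lorentz v v" by (rule timelike_orthogonal(1)[OF h])
 also have "lorentz v v = lorentz w w * (lorentz u u * lorentz w w - (lorentz u w)\<^sup>2)"
  by (simp add: v_def lorentz_commute[of w u] algebra_simps power2_eq_square)
 finally show ?thesis using p by (simp add: zero_le_mult_iff)
qed

lemma hyperboloid_neg:
 assumes "on_hyperboloid h" "on_hyperboloid w" shows "lorentz h w < 0"
proof -
 have n: "norm (fst v) < snd v" if "on_hyperboloid v" for v :: "'a \<times> real"
  using that by (intro power2_less_imp_less[of "norm (fst v)"])
   (simp_all add: on_hyperboloid_def lorentz_eq dot_square_norm power2_eq_square[of "snd v"])
 have "fst h \<bullet> fst w \<le> norm (fst h) * norm (fst w)" by (rule norm_cauchy_schwarz)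
 also have "\<dots> < snd h * snd w" using n[OF assms(1)] n[OF assms(2)] by (intro mult_strict_mono') auto
 finally show ?thesis by (simp add: lorentz_eq)
qed

text \<open>Removing from \<open>w\<close> its component along \<open>h\<close> leaves a vector
  orthogonal to a timelike one, whose square \<open>c\<^sup>2 - 1\<close> cannot be
  negative.\<close>

lemma hyperboloid_ge1:
 assumes "on_hyperboloid h" "on_hyperboloid w"
 shows "1 \<le> - lorentz h w" and "- lorentz h w = 1 ==> h = w"
proof -
 define c where "c = - lorentz h w"
 define v where "v = w - c *\<^sub>R h"
 have hh: "lorentz h h = -1" "lorentz w w = -1" using assms by (auto simp: on_hyperboloid_def)
 have o: "lorentz h v = 0" by (simp add: v_def c_def hh)
 have n: "lorentz v v = c\<^sup>2 - 1" by (simp add: v_def c_def hh lorentz_commute[of w h] power2_eq_square algebra_simps)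
 have "0 \<le> lorentz v v" using timelike_orthogonal(1)[OF _ o] hh by simp
 hence "1 \<le> c\<^sup>2" by (simp add: n)
 moreover have "c > 0" using hyperboloid_neg[OF assms] by (simp add: c_def)
 ultimately show "1 \<le> - lorentz h w" unfolding c_def[symmetric] by (smt (verit) one_le_power power2_eq_square mult_le_one mult_less_cancel_left_pos)
 assume "- lorentz h w = 1"
 hence "lorentz v v = 0" "c = 1" using n by (auto simp: c_def)
 thus "h = w" using timelike_orthogonal(2)[OF _ o] hh by (simp add: v_def)
qed

section \<open>Polar coordinates: the exponential map of the hyperboloid\<close>

definition polar :: "'a::euclidean_space \<times> real \<Rightarrow> 'a \<times> real \<Rightarrow> real \<Rightarrow> 'a \<times> real" where
 "polar h u r = cosh r *\<^sub>R h + sinh r *\<^sub>R u"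

definition unit_tangent :: "'a::euclidean_space \<times> real \<Rightarrow> 'a \<times> real \<Rightarrow> bool" where
 "unit_tangent h u \<longleftrightarrow> lorentz h u = 0 \<and> lorentz u u = 1"

lemma lorentz_polar:
 assumes "on_hyperboloid h" "unit_tangent h u" "unit_tangent h u'"
 shows "lorentz (polar h u r) (polar h u' r') = - (cosh r * cosh r' - sinh r * sinh r' * lorentz u u')"
 using assms by (simp add: polar_def on_hyperboloid_def unit_tangent_def lorentz_commute[of u h] algebra_simps)

lemma lorentz_polar_base:
 assumes "on_hyperboloid h" "unit_tangent h u" shows "lorentz h (polar h u r) = - cosh r"
 using assms by (simp add: polar_def on_hyperboloid_def unit_tangent_def)

text \<open>The quadratic equation leaves two sheets. A vector on the lower sheet would have
  nonnegative product with \<open>h\<close>, while the product here is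
  \<open>- cosh r\<close>.\<close>

lemma polar_hyperboloid:
 assumes h: "on_hyperboloid h" and u: "unit_tangent h u" shows "on_hyperboloid (polar h u r)"
proof -
 define w where "w = polar h u r"
 have l: "lorentz w w = -1" using lorentz_polar[OF h u u, of r r] u
  by (simp add: w_def unit_tangent_def cosh_square_eq flip: power2_eq_square)
 have hw: "lorentz h w < 0" using lorentz_polar_base[OF h u] by (simp add: w_def)
 have nn: "norm (fst v) < \<bar>snd v\<bar>" if "lorentz v v = -1" for v :: "'a \<times> real"
  using that by (intro power2_less_imp_less[of "norm (fst v)"])
   (simp_all add: lorentz_eq dot_square_norm power2_eq_square[of "snd v"])
 have "snd w > 0"
 proof (rule ccontr)
  assume "\<not> snd w > 0"
  hence "norm (fst w) < - snd w" "norm (fst h) < snd h" using nn[of w] nn[of h] l h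
   by (auto simp: on_hyperboloid_def abs_if split: if_splits)
  hence "norm (fst h) * norm (fst w) \<le> snd h * (- snd w)"
  proof (intro mult_mono)
   show "0 \<le> snd h" using norm_ge_zero[of "fst h"] \<open>norm (fst h) < snd h\<close> by linarith
  qed auto
  moreover have "- (fst h \<bullet> fst w) \<le> norm (fst h) * norm (fst w)" using norm_cauchy_schwarz[of "fst h" "- fst w"] by simp
  ultimately have "lorentz h w \<ge> 0" by (simp add: lorentz_eq)
  thus False using hw by simp
 qed
 thus ?thesis using l by (simp add: on_hyperboloid_def w_def)
qed

lemma polar_exists:
 assumes h: "on_hyperboloid h" and w: "on_hyperboloid w" and ne: "h \<noteq> w"
 defines "r \<equiv> arcosh (- lorentz h w)"
 defines "u \<equiv> (1 / sinh r) *\<^sub>R (w - cosh r *\<^sub>R h)"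
 shows "r > 0" "unit_tangent h u" "w = polar h u r"
proof -
 have g: "1 < - lorentz h w" using hyperboloid_ge1[OF h w] ne by (metis less_eq_real_def)
 show r: "r > 0" using g by (simp add: r_def)
 have c: "cosh r = - lorentz h w" using g by (simp add: r_def)
 have s: "(sinh r)\<^sup>2 = (cosh r)\<^sup>2 - 1" by (simp add: cosh_square_eq)
 have hh: "lorentz h h = -1" "lorentz w w = -1" using h w by (auto simp: on_hyperboloid_def)
 show "w = polar h u r" using r by (simp add: polar_def u_def)
 define v where "v = w - cosh r *\<^sub>R h"
 have "lorentz v v = (sinh r)\<^sup>2" unfolding s c v_def by (simp add: hh lorentz_commute[of w h] power2_eq_square algebra_simps)
 moreover have "u = (1 / sinh r) *\<^sub>R v" by (simp add: u_def v_def)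
 ultimately have "lorentz u u = 1" using r by (simp add: power2_eq_square)
 moreover have "lorentz h u = 0" using c by (simp add: u_def hh)
 ultimately show "unit_tangent h u" by (simp add: unit_tangent_def)
qed

lemma unit_tangent_le1:
 assumes "on_hyperboloid h" "unit_tangent h u" "unit_tangent h u'"
 shows "\<bar>lorentz u u'\<bar> \<le> 1"
proof -
 have "(lorentz u u')\<^sup>2 \<le> 1" using lorentz_Cauchy_Schwarz[of h u u'] assms by (simp add: on_hyperboloid_def unit_tangent_def)
 thus ?thesis by (simp add: abs_square_le_1)
qed

lemma hyp_dist_commute: "hyp_dist x y = hyp_dist y x" by (simp add: hyp_dist_def inner_commute mult.commute)

lemma hyp_dist_self: "x \<in> hyp_space ==> hyp_dist x x = 0" using lift_hyperboloid[of x] by (simp add: hyp_dist_lift on_hyperboloid_def)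

lemma cosh_hyp_dist:
 assumes "x \<in> hyp_space" "y \<in> hyp_space" shows "cosh (hyp_dist x y) = - lorentz (lift x) (lift y)"
 using hyperboloid_ge1[OF lift_hyperboloid[OF assms(1)] lift_hyperboloid[OF assms(2)]] by (simp add: hyp_dist_lift assms)

lemma hyp_dist_nonneg: assumes "x \<in> hyp_space" "y \<in> hyp_space" shows "hyp_dist x y \<ge> 0"
 using hyperboloid_ge1[OF lift_hyperboloid[OF assms(1)] lift_hyperboloid[OF assms(2)]] by (simp add: hyp_dist_lift assms)

lemma hyp_dist_0: assumes "x \<in> hyp_space" "y \<in> hyp_space" "hyp_dist x y = 0" shows "x = y"
proof -
 have "lift x = lift y"
  using hyperboloid_ge1(2)[OF lift_hyperboloid[OF assms(1)] lift_hyperboloid[OF assms(2)]] cosh_hyp_dist[OF assms(1,2)] assms(3) by simp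
 thus ?thesis using klein_lift assms by metis
qed

lemma hyp_polar_exists:
 assumes "x \<in> hyp_space" "y \<in> hyp_space" "x \<noteq> y"
 obtains u where "unit_tangent (lift x) u" "lift y = polar (lift x) u (hyp_dist x y)" "hyp_dist x y > 0"
  "u = (1 / sinh (hyp_dist x y)) *\<^sub>R (lift y - cosh (hyp_dist x y) *\<^sub>R lift x)"
proof -
 have "lift x \<noteq> lift y" using klein_lift assms by metis
 from polar_exists[OF lift_hyperboloid[OF assms(1)] lift_hyperboloid[OF assms(2)] this]
 show ?thesis using that hyp_dist_lift[OF assms(1,2)] by metis
qed

lemma hyp_dist_polar:
 assumes h: "on_hyperboloid h" and u: "unit_tangent h u" "unit_tangent h u'"
 shows "hyp_dist (klein (polar h u r)) (klein (polar h u' r')) =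
   arcosh (cosh r * cosh r' - sinh r * sinh r' * lorentz u u')"
 using klein_hyperboloid[OF polar_hyperboloid[OF h u(1)]] klein_hyperboloid[OF polar_hyperboloid[OF h u(2)]] lorentz_polar[OF h u]
 by (simp add: hyp_dist_lift)

text \<open>Law of cosines for the hinge at \<open>y\<close>; the cosine of its angle is at least
  -1, the value for opposite directions.\<close>

lemma hyp_dist_triangle:
 assumes x: "x \<in> hyp_space" "y \<in> hyp_space" "z \<in> hyp_space"
 shows "hyp_dist x z \<le> hyp_dist x y + hyp_dist y z"
proof (cases "y = x \<or> y = z")
 case True thus ?thesis using hyp_dist_self[OF x(1)] hyp_dist_self[OF x(3)] by auto
next
 case False
 obtain u where u: "unit_tangent (lift y) u" "lift x = polar (lift y) u (hyp_dist y x)" "hyp_dist y x > 0"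
  using hyp_polar_exists[OF x(2,1)] False by metis
 obtain u' where u': "unit_tangent (lift y) u'" "lift z = polar (lift y) u' (hyp_dist y z)" "hyp_dist y z > 0"
  using hyp_polar_exists[OF x(2,3)] False by metis
 note h = lift_hyperboloid[OF x(2)]
 have "cosh (hyp_dist x z) = cosh (hyp_dist y x) * cosh (hyp_dist y z) - sinh (hyp_dist y x) * sinh (hyp_dist y z) * lorentz u u'"
  unfolding cosh_hyp_dist[OF x(1,3)] u(2) u'(2) lorentz_polar[OF h u(1) u'(1)] by simp
 also have "\<dots> \<le> cosh (hyp_dist y x) * cosh (hyp_dist y z) + sinh (hyp_dist y x) * sinh (hyp_dist y z) * 1"
 proof -
  have "sinh (hyp_dist y x) * sinh (hyp_dist y z) * (- lorentz u u') \<le> sinh (hyp_dist y x) * sinh (hyp_dist y z) * 1"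
   using unit_tangent_le1[OF h u(1) u'(1)] u(3) u'(3) by (intro mult_left_mono) auto
  thus ?thesis by simp
 qed
 also have "\<dots> = cosh (hyp_dist y x + hyp_dist y z)" by (simp add: cosh_add)
 finally show ?thesis using hyp_dist_nonneg[OF x(1,3)] u(3) u'(3) by (simp add: cosh_real_nonneg_le_iff hyp_dist_commute[of y x])
qed

text \<open>In the Klein model segments are geodesics. The lift of \<open>m\<close> is a positive
  combination of the lifts of the ends, so the components orthogonal to it must cancel; this forces
  the unit tangents from \<open>m\<close> to the two ends to be opposite.\<close>

lemma hyp_dist_segment:
 assumes x: "x \<in> hyp_space" "y \<in> hyp_space" and m: "m \<in> closed_segment x y"
 shows "m \<in> hyp_space" "hyp_dist x m + hyp_dist m y = hyp_dist x y"
proof -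
 show mb: "m \<in> hyp_space" using m x by (metis convex_ball convex_contains_segment subsetD)
 show "hyp_dist x m + hyp_dist m y = hyp_dist x y"
 proof (cases "m = x \<or> m = y")
  case True thus ?thesis using hyp_dist_self[OF x(1)] hyp_dist_self[OF x(2)] by auto
 next
  case False
  obtain t where t: "0 \<le> t" "t \<le> 1" "m = (1 - t) *\<^sub>R x + t *\<^sub>R y" using m by (auto simp: in_segment)
  have t01: "0 < t" "t < 1" using t False by (auto simp: less_le)
  obtain cx cy cm where c: "cx > 0" "lift x = cx *\<^sub>R (x, 1)" "cy > 0" "lift y = cy *\<^sub>R (y, 1)" "cm > 0" "lift m = cm *\<^sub>R (m, 1)"
   using lift_point x mb by metis
  define a b where "a = cm * (1 - t) / cx" and "b = cm * t / cy"
  have ab: "a > 0" "b > 0" using c t01 by (auto simp: a_def b_def)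
  have lm: "lift m = a *\<^sub>R lift x + b *\<^sub>R lift y"
  proof -
   have m1: "(m, 1::real) = (1 - t) *\<^sub>R (x, 1) + t *\<^sub>R (y, 1)" by (simp add: t(3))
   have "lift m = (cm * (1 - t)) *\<^sub>R (x, 1) + (cm * t) *\<^sub>R (y, 1)"
    unfolding c(6) m1 by (simp only: scaleR_add_right scaleR_scaleR)
   thus ?thesis using c(1,3) unfolding c(2,4) a_def b_def by simp
  qed
  note h = lift_hyperboloid[OF mb]
  obtain u where u: "unit_tangent (lift m) u" "lift x = polar (lift m) u (hyp_dist m x)" "hyp_dist m x > 0"
   using hyp_polar_exists[OF mb x(1)] False by metis
  obtain u' where u': "unit_tangent (lift m) u'" "lift y = polar (lift m) u' (hyp_dist m y)" "hyp_dist m y > 0"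
   using hyp_polar_exists[OF mb x(2)] False by metis
  define p q where "p = a * sinh (hyp_dist m x)" and "q = b * sinh (hyp_dist m y)"
  have pq: "p > 0" "q > 0" using ab u(3) u'(3) by (auto simp: p_def q_def)
  have e: "lift m = (a * cosh (hyp_dist m x) + b * cosh (hyp_dist m y)) *\<^sub>R lift m + p *\<^sub>R u + q *\<^sub>R u'"
   using lm unfolding u(2) u'(2) polar_def p_def q_def by (simp add: algebra_simps)
  have o: "lorentz (lift m) u = 0" "lorentz (lift m) u' = 0" "lorentz u u = 1" "lorentz u' u' = 1" "lorentz u (lift m) = 0" "lorentz u' (lift m) = 0"
   using u(1) u'(1) by (auto simp: unit_tangent_def lorentz_commute[of _ "lift m"])
  define l where "l = lorentz u u'"
  have "lorentz (lift m) u = lorentz ((a * cosh (hyp_dist m x) + b * cosh (hyp_dist m y)) *\<^sub>R lift m + p *\<^sub>R u + q *\<^sub>R u') u"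
   using e by simp
  hence 1: "p + q * l = 0" using o by (simp add: l_def lorentz_commute[of u' u])
  have "lorentz (lift m) u' = lorentz ((a * cosh (hyp_dist m x) + b * cosh (hyp_dist m y)) *\<^sub>R lift m + p *\<^sub>R u + q *\<^sub>R u') u'"
   using e by simp
  hence 2: "p * l + q = 0" using o by (simp add: l_def)
  have "p * (1 - l\<^sup>2) = 0" using 1 2 by algebra
  hence "l\<^sup>2 = 1" using pq by simp
  moreover have "l < 0" using 1 pq by (smt (verit) mult_nonneg_nonneg)
  ultimately have l: "l = -1" by (metis power2_eq_1_iff less_irrefl not_one_less_zero)
  have "cosh (hyp_dist x y) = cosh (hyp_dist m x) * cosh (hyp_dist m y) - sinh (hyp_dist m x) * sinh (hyp_dist m y) * l"
   unfolding cosh_hyp_dist[OF x] u(2) u'(2) lorentz_polar[OF h u(1) u'(1)] l_def by simp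
  also have "\<dots> = cosh (hyp_dist m x + hyp_dist m y)" by (simp add: l cosh_add)
  finally have "hyp_dist x y = hyp_dist m x + hyp_dist m y" using hyp_dist_nonneg[OF x] u(3) u'(3) by (simp add: cosh_real_eq_iff)
  thus ?thesis by (simp add: hyp_dist_commute[of m x])
 qed
qed

text \<open>Turns Euclidean neighbourhoods, in which polytopes are described, into hyperbolic
  radii.\<close>

lemma dist_le_sinh_hyp_dist:
 assumes x: "x \<in> hyp_space" "y \<in> hyp_space" shows "dist x y \<le> sinh (hyp_dist x y)"
proof -
 define a b c where "a = x \<bullet> x" and "b = y \<bullet> y" and "c = x \<bullet> y"
 have ab: "a < 1" "b < 1" "a \<ge> 0" "b \<ge> 0" using x by (simp_all only: ball_inner) (auto simp: a_def b_def)
 have "cosh (hyp_dist x y) = (1 - c) / sqrt ((1 - a) * (1 - b))"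
  using cosh_hyp_dist[OF x] by (simp add: lift_def lorentz_eq real_sqrt_mult a_def b_def c_def diff_divide_distrib)
 hence "(cosh (hyp_dist x y))\<^sup>2 = (1 - c)\<^sup>2 / ((1 - a) * (1 - b))" using ab by (simp add: power_divide)
 hence s: "(sinh (hyp_dist x y))\<^sup>2 = (1 - c)\<^sup>2 / ((1 - a) * (1 - b)) - 1" by (simp add: sinh_square_eq)
 have d: "(dist x y)\<^sup>2 = a + b - 2 * c" by (simp add: dist_norm power2_norm_eq_inner a_def b_def c_def inner_commute algebra_simps)
 have cs: "0 \<le> (c - a)\<^sup>2" by simp
 have nn: "a + b - 2 * c \<ge> 0" using d by (metis zero_le_power2)
 have "(a + b - 2 * c) * ((1 - a) * (1 - b)) \<le> (a + b - 2 * c) * (1 - a)"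
  using nn ab by (intro mult_left_mono) (auto simp: mult_le_cancel_left1)
 also have "\<dots> \<le> (1 - c)\<^sup>2 - (1 - a) * (1 - b)" using cs by (simp add: power2_eq_square algebra_simps)
 finally have "a + b - 2 * c \<le> ((1 - c)\<^sup>2 - (1 - a) * (1 - b)) / ((1 - a) * (1 - b))" using ab by (subst pos_le_divide_eq) auto
 hence "a + b - 2 * c \<le> (sinh (hyp_dist x y))\<^sup>2" unfolding s using ab by (simp add: diff_divide_distrib)
 hence "(dist x y)\<^sup>2 \<le> (sinh (hyp_dist x y))\<^sup>2" by (simp add: d)
 moreover have "sinh (hyp_dist x y) \<ge> 0" using hyp_dist_nonneg[OF x] by simp
 ultimately show ?thesis by (rule power2_le_imp_le)
qed

lemma continuous_on_hyp_dist:
 assumes "x \<in> hyp_space" shows "continuous_on hyp_space (hyp_dist x)"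
proof -
 have "continuous_on hyp_space (\<lambda>y. arcosh ((1 - x \<bullet> y) / sqrt ((1 - x \<bullet> x) * (1 - y \<bullet> y))))"
 proof (rule continuous_on_compose2[OF continuous_on_arcosh[OF order.refl]])
  have b: "1 - x \<bullet> x > 0" "y \<in> hyp_space ==> 1 - y \<bullet> y > 0" for y :: 'a using assms unfolding ball_inner by auto
  show "continuous_on hyp_space (\<lambda>y. (1 - x \<bullet> y) / sqrt ((1 - x \<bullet> x) * (1 - y \<bullet> y)))"
   by (intro continuous_intros) (use b in fastforce)
  show "(\<lambda>y. (1 - x \<bullet> y) / sqrt ((1 - x \<bullet> x) * (1 - y \<bullet> y))) ` hyp_space \<subseteq> {1..}"
  proof clarify
   fix y :: 'a assume y: "y \<in> hyp_space"
   have "- lorentz (lift x) (lift y) = (1 - x \<bullet> y) / sqrt ((1 - x \<bullet> x) * (1 - y \<bullet> y))"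
    by (simp add: lift_def lorentz_eq real_sqrt_mult diff_divide_distrib)
   thus "1 \<le> (1 - x \<bullet> y) / sqrt ((1 - x \<bullet> x) * (1 - y \<bullet> y))"
    using hyperboloid_ge1(1)[OF lift_hyperboloid[OF assms] lift_hyperboloid[OF y]] by simp
  qed
 qed
 thus ?thesis by (simp add: hyp_dist_def[abs_def])
qed

lemma hyp_dist_compact_pos:
 assumes x: "x \<in> hyp_space" and S: "compact S" "S \<subseteq> hyp_space" "x \<notin> S"
 shows "\<exists>eps>0. \<forall>y\<in>S. eps \<le> hyp_dist x y"
proof (cases "S = {}")
 case False
 obtain y where y: "y \<in> S" "\<And>w. w \<in> S ==> hyp_dist x y \<le> hyp_dist x w"
  using continuous_attains_inf[OF S(1) False continuous_on_subset[OF continuous_on_hyp_dist[OF x] S(2)]] by blast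
 have "hyp_dist x y > 0" using hyp_dist_nonneg[OF x] hyp_dist_0[OF x] y(1) S by (metis less_eq_real_def subsetD)
 thus ?thesis using y by blast
qed (auto intro: exI[of _ 1])

section \<open>Convex polygons\<close>

lemma orthogonal_independent:
 fixes B :: "('a::euclidean_space \<times> real) set"
 assumes "finite B" and o: "\<And>u w. u \<in> B ==> w \<in> B ==> u \<noteq> w ==> lorentz u w = 0"
  and n: "\<And>u. u \<in> B ==> lorentz u u \<noteq> 0"
 shows "independent B"
proof (rule independent_if_scalars_zero[OF \<open>finite B\<close>])
 fix f :: "'a \<times> real \<Rightarrow> real" and x assume s: "(\<Sum>x\<in>B. f x *\<^sub>R x) = 0" and x: "x \<in> B"
 have lin: "lorentz (\<Sum>y\<in>C. f y *\<^sub>R y) x = (\<Sum>y\<in>C. f y * lorentz y x)" if "finite C" for C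
  using that by (induction C rule: finite_induct) auto
 have "0 = (\<Sum>y\<in>B. f y * lorentz y x)" using lin[OF \<open>finite B\<close>] s by simp
 also have "\<dots> = f x * lorentz x x + (\<Sum>y\<in>B - {x}. f y * lorentz y x)" by (rule sum.remove[OF \<open>finite B\<close> x])
 also have "(\<Sum>y\<in>B - {x}. f y * lorentz y x) = 0" by (intro sum.neutral) (use o x in auto)
 finally show "f x = 0" using n[OF x] by simp
qed

text \<open>Used as a substitute for bases: an orthogonal expansion is complete because a nonzero
  remainder would be one orthogonal vector too many.\<close>

lemma orthogonal_card:
 fixes B :: "('a::euclidean_space \<times> real) set"
 assumes "finite B" "\<And>u w. u \<in> B ==> w \<in> B ==> u \<noteq> w ==> lorentz u w = 0" "\<And>u. u \<in> B ==> lorentz u u \<noteq> 0"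
 shows "card B \<le> DIM('a) + 1" using independent_bound[OF orthogonal_independent[OF assms]] by simp

lemma orthogonal_exists:
 fixes B :: "('a::euclidean_space \<times> real) set"
 assumes "finite B" "card B < DIM('a) + 1"
 shows "\<exists>x. x \<noteq> 0 \<and> (\<forall>b\<in>B. lorentz b x = 0)"
proof -
 \<comment> \<open>Changing the sign of the last coordinate turns Lorentz orthogonality into
   Euclidean orthogonality.\<close>
 define S where "S = (\<lambda>b. (fst b, - snd b)) ` B"
 have "dim S \<le> card S" using assms(1) by (intro dim_le_card') (simp add: S_def)
 also have "\<dots> \<le> card B" unfolding S_def by (rule card_image_le[OF assms(1)])
 finally have "dim S < DIM('a \<times> real)" using assms(2) by simp
 then obtain x where x: "x \<noteq> 0" "\<And>y. y \<in> span S ==> orthogonal x y" using orthogonal_to_subspace_exists by blast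
 have "lorentz b x = 0" if "b \<in> B" for b
 proof -
  have "orthogonal x (fst b, - snd b)" using x(2) that span_base[of _ S] by (auto simp: S_def)
  thus ?thesis by (simp add: orthogonal_def lorentz_eq inner_prod_def inner_commute mult.commute)
 qed
 thus ?thesis using x(1) by blast
qed

lemma orthogonal_unit_exists:
 fixes B :: "('a::euclidean_space \<times> real) set"
 assumes "finite B" "card B < DIM('a) + 1" "h \<in> B" "lorentz h h < 0"
 shows "\<exists>x. lorentz x x = 1 \<and> (\<forall>b\<in>B. lorentz b x = 0)"
proof -
 obtain x where x: "x \<noteq> 0" "\<forall>b\<in>B. lorentz b x = 0" using orthogonal_exists[OF assms(1,2)] by blast
 have "lorentz x x > 0" using timelike_orthogonal[OF assms(4), of x] x assms(3) by (metis less_eq_real_def)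
 hence "lorentz ((1 / sqrt (lorentz x x)) *\<^sub>R x) ((1 / sqrt (lorentz x x)) *\<^sub>R x) = 1"
  by (simp add: real_sqrt_mult_self flip: power2_eq_square)
 thus ?thesis using x(2) by (intro exI[of _ "(1 / sqrt (lorentz x x)) *\<^sub>R x"]) simp
qed

section \<open>Frames, directions and rays in the ball\<close>

definition dir :: "'a::euclidean_space \<times> real \<Rightarrow> 'a \<times> real \<Rightarrow> real \<Rightarrow> 'a \<times> real" where
 "dir e1 e2 \<psi> = cos \<psi> *\<^sub>R e1 + sin \<psi> *\<^sub>R e2"

definition ray :: "'a::euclidean_space \<Rightarrow> 'a \<times> real \<Rightarrow> real \<Rightarrow> 'a" where
 "ray v u r = klein (polar (lift v) u r)"

definition tangent_frame :: "'a::euclidean_space \<Rightarrow> 'a \<times> real \<Rightarrow> 'a \<times> real \<Rightarrow> bool" where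
 "tangent_frame v e1 e2 \<longleftrightarrow> v \<in> hyp_space \<and> unit_tangent (lift v) e1 \<and> unit_tangent (lift v) e2 \<and> lorentz e1 e2 = 0"

lemma tangent_frame_neg: "tangent_frame v e1 e2 ==> tangent_frame v e1 (- e2)" by (simp add: tangent_frame_def unit_tangent_def)

lemma dir_unit_tangent: assumes "tangent_frame v e1 e2" shows "unit_tangent (lift v) (dir e1 e2 \<psi>)"
 using assms sin_cos_squared_add[of \<psi>]
 by (simp add: tangent_frame_def unit_tangent_def dir_def lorentz_commute[of e2 e1] power2_eq_square)

lemma lorentz_dir:
 assumes "tangent_frame v e1 e2" shows "lorentz (dir e1 e2 s) (dir e1 e2 t) = cos (s - t)"
 using assms by (simp add: tangent_frame_def unit_tangent_def dir_def lorentz_commute[of e2 e1] cos_diff)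

lemma lift_ray:
 assumes "v \<in> hyp_space" "unit_tangent (lift v) u"
 shows "lift (ray v u r) = polar (lift v) u r" "ray v u r \<in> hyp_space"
 using klein_hyperboloid[OF polar_hyperboloid[OF lift_hyperboloid[OF assms(1)] assms(2)]] by (simp_all add: ray_def)

lemma ray_0: "v \<in> hyp_space ==> ray v u 0 = v" by (simp add: ray_def polar_def klein_lift)

lemma hyp_dist_ray:
 assumes "v \<in> hyp_space" "unit_tangent (lift v) u" "0 \<le> r"
 shows "hyp_dist v (ray v u r) = r" using lorentz_polar_base[OF lift_hyperboloid[OF assms(1)] assms(2)] lift_ray[OF assms(1,2)] assms
 by (simp add: hyp_dist_lift arcosh_cosh_real)

lemma hyp_dist_rays:
 assumes "tangent_frame v e1 e2"
 shows "hyp_dist (ray v (dir e1 e2 s) r) (ray v (dir e1 e2 t) r') = cosine_law r r' (s - t)"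
proof -
 have v: "v \<in> hyp_space" using assms by (simp add: tangent_frame_def)
 show ?thesis unfolding ray_def cosine_law_def
  using hyp_dist_polar[OF lift_hyperboloid[OF v] dir_unit_tangent[OF assms, of s] dir_unit_tangent[OF assms, of t]]
  by (simp add: lorentz_dir[OF assms])
qed

lemma ray_inj:
 assumes v: "v \<in> hyp_space" and u: "unit_tangent (lift v) u" "unit_tangent (lift v) u'" and r: "0 < r"
  and e: "ray v u r = ray v u' r"
 shows "u = u'"
proof -
 have "polar (lift v) u r = polar (lift v) u' r" using lift_ray[OF v] u e by metis
 thus ?thesis using r by (simp add: polar_def)
qed

lemma dir_eq_imp:
 assumes "tangent_frame v e1 e2" and e: "dir e1 e2 s = dir e1 e2 t" shows "cos s = cos t" "sin s = sin t"
proof -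
 have o: "lorentz e1 e1 = 1" "lorentz e2 e2 = 1" "lorentz e1 e2 = 0" "lorentz e2 e1 = 0"
  using assms by (auto simp: tangent_frame_def unit_tangent_def lorentz_commute[of e2 e1])
 have "lorentz e1 (dir e1 e2 s) = lorentz e1 (dir e1 e2 t)" "lorentz e2 (dir e1 e2 s) = lorentz e2 (dir e1 e2 t)" using e by auto
 thus "cos s = cos t" "sin s = sin t" using o by (simp_all add: dir_def)
qed

text \<open>The lift is a positive multiple of \<open>(x, 1)\<close>. So affine conditions on points
  of the ball, such as half-planes and faces, can be tested on the hyperboloid.\<close>

lemma lorentz_scaled_point:
 assumes "x \<in> hyp_space"
 shows "lorentz m (lift x) = 0 \<longleftrightarrow> lorentz m (x, 1) = 0" "lorentz m (lift x) > 0 \<longleftrightarrow> lorentz m (x, 1) > 0"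
  "lorentz m (lift x) \<ge> 0 \<longleftrightarrow> lorentz m (x, 1) \<ge> 0"
proof -
 obtain c where c: "c > 0" "lift x = c *\<^sub>R (x, 1)" using lift_point[OF assms] by blast
 have "lorentz m (lift x) = c * lorentz m (x, 1)" unfolding c(2) by (rule lorentz_simps)
 thus "lorentz m (lift x) = 0 \<longleftrightarrow> lorentz m (x, 1) = 0" "lorentz m (lift x) > 0 \<longleftrightarrow> lorentz m (x, 1) > 0"
  "lorentz m (lift x) \<ge> 0 \<longleftrightarrow> lorentz m (x, 1) \<ge> 0"
  using c(1) by (auto simp: zero_less_mult_iff zero_le_mult_iff)
qed

lemma lorentz_point_affine:
 "lorentz m ((1 - t) *\<^sub>R x + t *\<^sub>R y, 1) = (1 - t) * lorentz m (x, 1) + t * lorentz m (y, 1)"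
 by (simp add: lorentz_eq inner_add_right algebra_simps)

text \<open>\<open>\<nu>\<close> is either of the two unit normals of the plane of \<open>A\<close>;
  its sign is left open here.\<close>

locale polygon =
 fixes A :: "(real^3) set" and \<nu> :: "(real^3) \<times> real"
 assumes poly: "convex_polygon A"
  and \<nu>: "lorentz \<nu> \<nu> = 1" "\<And>x. x \<in> affine hull A \<longleftrightarrow> lorentz \<nu> (x, 1) = 0"
begin

lemma A_facts: "polytope A" "aff_dim A = 2" "A \<subseteq> hyp_space" "polyhedron A" "convex A" "compact A" "closed A" "A \<noteq> {}"
 using poly by (auto simp: convex_polygon_def polytope_imp_polyhedron polytope_imp_convex polytope_imp_compact compact_imp_closed)

lemma A_hyp: "x \<in> A ==> x \<in> hyp_space" using A_facts(3) by blast

lemma \<nu>_A: "x \<in> A ==> lorentz \<nu> (lift x) = 0"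
 using \<nu>(2)[of x] hull_subset[of A affine] lorentz_scaled_point(1)[OF A_hyp] by blast

lemma edge_facet: "e edge_of A \<longleftrightarrow> e facet_of A" by (auto simp: edge_of_def facet_of_def A_facts(2))

lemma finite_edges: "finite {e. e edge_of A}" using finite_polytope_facets[OF A_facts(1)] by (simp add: edge_facet)

lemma edge_facts: assumes "e edge_of A" shows "e \<subseteq> A" "compact e" "e \<noteq> {}" "e face_of A" "aff_dim e = 1" "convex e" "e \<noteq> A"
 using assms A_facts face_of_imp_subset[of e A] face_of_imp_compact[OF A_facts(5,6)] face_of_imp_convex[of e A] by (auto simp: edge_of_def)

lemma boundary_edges: "A - rel_interior A = \<Union> {e. e edge_of A}"
 using rel_boundary_of_polyhedron[OF A_facts(4)] by (simp add: edge_facet)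

text \<open>Tangent to the plane of \<open>A\<close> and pointing into \<open>A\<close>, unlike
  \<open>outer_normal\<close>, which points out of the solid.\<close>

definition is_edge_normal :: "(real^3) set \<Rightarrow> (real^3) \<times> real \<Rightarrow> bool" where
 "is_edge_normal e m \<longleftrightarrow> lorentz m m = 1 \<and> lorentz \<nu> m = 0 \<and> (\<forall>x\<in>A. lorentz m (x, 1) \<ge> 0) \<and>
   e = {x \<in> A. lorentz m (x, 1) = 0}"

definition edge_normal :: "(real^3) set \<Rightarrow> (real^3) \<times> real" where
 "edge_normal e = (SOME m. is_edge_normal e m)"

lemma edge_normal: assumes e: "e edge_of A" shows "is_edge_normal e (edge_normal e)"
proof -
 obtain a b where ab: "a \<noteq> 0" "A \<subseteq> {x. a \<bullet> x \<le> b}" "e = A \<inter> {x. a \<bullet> x = b}"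
  using facet_of_polyhedron[OF A_facts(4)] e unfolding edge_facet by metis
 define m0 where "m0 = (- a, - b)"
 \<comment> \<open>\<open>\<nu>\<close> vanishes on \<open>A\<close>, so subtracting its component
   makes the form tangent to the plane without changing its values on \<open>A\<close>.\<close>
 define m1 where "m1 = m0 - lorentz m0 \<nu> *\<^sub>R \<nu>"
 have m0: "lorentz m0 (x, 1) = b - a \<bullet> x" for x by (simp add: m0_def lorentz_eq)
 have m1: "lorentz m1 (x, 1) = b - a \<bullet> x" if "x \<in> A" for x
  using \<nu>(2)[of x] hull_inc[OF that, of affine] by (simp add: m1_def m0)
 have "\<exists>x\<in>A. a \<bullet> x \<noteq> b" using ab(3) edge_facts(7)[OF e] by blast
 then obtain x where x: "x \<in> A" "a \<bullet> x \<noteq> b" by blast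
 have ne: "m1 \<noteq> 0" using m1[OF x(1)] x(2) by auto
 obtain v where v: "v \<in> e" using edge_facts(3)[OF e] by blast
 hence vA: "v \<in> A" "v \<in> hyp_space" using ab(3) A_hyp by auto
 have "lorentz m1 (v, 1) = 0" using m1[OF vA(1)] v ab(3) by simp
 hence "lorentz (lift v) m1 = 0" using lorentz_scaled_point(1)[OF vA(2)] by (simp add: lorentz_commute)
 hence p: "lorentz m1 m1 > 0"
  using timelike_orthogonal[of "lift v" m1] lift_hyperboloid[OF vA(2)] ne unfolding on_hyperboloid_def by (metis less_eq_real_def less_minus_one_simps(1))
 define c where "c = 1 / sqrt (lorentz m1 m1)"
 have c: "c > 0" "c * c * lorentz m1 m1 = 1" using p by (simp_all add: c_def)
 have "is_edge_normal e (c *\<^sub>R m1)" unfolding is_edge_normal_def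
 proof (intro conjI ballI)
  show "lorentz (c *\<^sub>R m1) (c *\<^sub>R m1) = 1" using c(2) by (simp add: mult.assoc)
  show "lorentz \<nu> (c *\<^sub>R m1) = 0" using \<nu>(1) by (simp add: m1_def lorentz_commute[of \<nu> m0])
  show "lorentz (c *\<^sub>R m1) (x, 1) \<ge> 0" if "x \<in> A" for x using m1[OF that] ab(2) that c(1) by auto
  show "e = {x \<in> A. lorentz (c *\<^sub>R m1) (x, 1) = 0}" using m1 ab(3) c(1) by auto
 qed
 thus ?thesis unfolding edge_normal_def by (rule someI)
qed

lemma edge_normal_facts:
 assumes e: "e edge_of A"
 shows "lorentz (edge_normal e) (edge_normal e) = 1" "lorentz \<nu> (edge_normal e) = 0"
  "x \<in> A ==> lorentz (edge_normal e) (lift x) \<ge> 0" "x \<in> A ==> lorentz (edge_normal e) (lift x) = 0 \<longleftrightarrow> x \<in> e"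
 using edge_normal[OF e] lorentz_scaled_point[OF A_hyp] unfolding is_edge_normal_def by auto

lemma two_points_edge:
 assumes "e edge_of A" "f edge_of A" "x \<in> e" "x \<in> f" "y \<in> e" "y \<in> f" "x \<noteq> y" shows "e = f"
proof -
 have d: "aff_dim (e \<inter> f) \<ge> 1"
 proof -
  have "aff_dim {x, y} = 1" using assms(7) by simp
  moreover have "aff_dim {x, y} \<le> aff_dim (e \<inter> f)" by (rule aff_dim_subset) (use assms in auto)
  ultimately show ?thesis by simp
 qed
 have fc: "(e \<inter> f) face_of A" using assms edge_facts(4) face_of_Int by blast
 have 1: "(e \<inter> f) face_of e" "(e \<inter> f) face_of f" using face_of_subset[OF fc] edge_facts(1) assms by blast+
 have "e \<inter> f = e" using face_of_aff_dim_lt[OF edge_facts(6)[OF assms(1)] 1(1)] d edge_facts(5)[OF assms(1)] by force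
 moreover have "e \<inter> f = f" using face_of_aff_dim_lt[OF edge_facts(6)[OF assms(2)] 1(2)] d edge_facts(5)[OF assms(2)] by force
 ultimately show ?thesis by simp
qed

lemma edge_other_point: assumes "e edge_of A" "v \<in> e" obtains b where "b \<in> e" "b \<noteq> v"
proof -
 have "e \<noteq> {v}" using edge_facts(5)[OF assms(1)] by auto
 thus ?thesis using assms that by blast
qed

text \<open>Near \<open>v\<close> only the edges through \<open>v\<close> matter. If a nearby point
  \<open>y\<close> of the plane were outside \<open>A\<close>, a segment to it from an interior
  point close to \<open>v\<close> would leave \<open>A\<close> through some edge near
  \<open>v\<close>, hence through an edge containing \<open>v\<close>, whose half-plane nevertheless
  contains \<open>y\<close>.\<close>

lemma local_halfspaces:
 assumes v: "v \<in> A"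
 shows "\<exists>\<delta>>0. (\<forall>y\<in>affine hull A. dist v y < \<delta> -->
    (\<forall>e. e edge_of A --> v \<in> e --> lorentz (edge_normal e) (y, 1) \<ge> 0) --> y \<in> A) \<and>
   (\<forall>y e. dist v y < \<delta> --> e edge_of A --> y \<in> e --> v \<in> e)"
proof -
 define C where "C = \<Union> {e. e edge_of A \<and> v \<notin> e}"
 have "closed C" unfolding C_def by (intro closed_Union) (use finite_edges edge_facts(2) compact_imp_closed in auto)
 moreover have "v \<notin> C" by (auto simp: C_def)
 ultimately obtain \<delta> where \<delta>: "\<delta> > 0" "ball v \<delta> \<inter> C = {}"
  by (metis ComplI disjoint_iff open_Compl open_contains_ball_eq subset_Compl_self_eq Compl_disjoint2 inf.orderE disjoint_eq_subset_Compl)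
 have far: "v \<in> e" if "y \<in> ball v \<delta>" "e edge_of A" "y \<in> e" for y e using \<delta>(2) that by (auto simp: C_def)
 have "y \<in> A" if y: "y \<in> affine hull A" "dist v y < \<delta>"
  and pos: "\<And>e. e edge_of A ==> v \<in> e ==> lorentz (edge_normal e) (y, 1) \<ge> 0" for y
 proof (rule ccontr)
  assume yA: "y \<notin> A"
  have "v \<in> closure (rel_interior A)" using v closure_subset[of A] convex_closure_rel_interior[OF A_facts(5)] by auto
  then obtain c where c: "c \<in> rel_interior A" "dist c v < \<delta>" using \<delta>(1) closure_approachable by blast
  have cA: "c \<in> A" using c(1) rel_interior_subset by blast
  have seg: "closed_segment c y \<subseteq> ball v \<delta>"
   by (rule closed_segment_subset) (use c y in \<open>auto simp: mem_ball dist_commute\<close>)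
  have "y \<noteq> c" using cA yA by blast
  obtain d where d: "0 < d" "c + d *\<^sub>R (y - c) \<in> rel_frontier A"
   "\<And>e. 0 \<le> e ==> e < d ==> c + e *\<^sub>R (y - c) \<in> rel_interior A"
   using ray_to_rel_frontier[of A c "y - c"] compact_imp_bounded[OF A_facts(6)] c(1) y(1) \<open>y \<noteq> c\<close> by auto
  have d1: "d \<le> 1"
  proof (rule ccontr)
   assume "\<not> d \<le> 1"
   hence "c + 1 *\<^sub>R (y - c) \<in> rel_interior A" using d(3)[of 1] by simp
   thus False using yA rel_interior_subset[of A] by auto
  qed
  define w where "w = c + d *\<^sub>R (y - c)"
  have w: "w \<in> closed_segment c y" "w \<in> rel_frontier A"
   using d(1,2) d1 by (auto simp: w_def in_segment algebra_simps intro!: exI[of _ d])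
  have "w \<in> A - rel_interior A" using w(2) A_facts(7) by (auto simp: rel_frontier_def)
  then obtain e where e: "e edge_of A" "w \<in> e" using boundary_edges by blast
  have ve: "v \<in> e" using far e w(1) seg by blast
  obtain t where t: "0 \<le> t" "t \<le> 1" "w = (1 - t) *\<^sub>R c + t *\<^sub>R y" using w(1) by (auto simp: in_segment)
  note en = edge_normal[OF e(1), unfolded is_edge_normal_def]
  have "c \<notin> e" using c(1) boundary_edges e(1) by blast
  hence "lorentz (edge_normal e) (c, 1) \<noteq> 0" using en cA by blast
  moreover have "lorentz (edge_normal e) (c, 1) \<ge> 0" using en cA by blast
  ultimately have lc: "lorentz (edge_normal e) (c, 1) > 0" by linarith
  have "lorentz (edge_normal e) (w, 1) = 0" using en e(2) by blast
  hence "(1 - t) * lorentz (edge_normal e) (c, 1) + t * lorentz (edge_normal e) (y, 1) = 0" unfolding t(3) lorentz_point_affine .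
  moreover have "t * lorentz (edge_normal e) (y, 1) \<ge> 0" using pos[OF e(1) ve] t(1) by simp
  moreover have "(1 - t) * lorentz (edge_normal e) (c, 1) \<ge> 0" using lc t(2) by simp
  ultimately have "(1 - t) * lorentz (edge_normal e) (c, 1) = 0" by linarith
  hence "t = 1" using lc by simp
  hence "w = y" using t(3) by simp
  thus False using yA e edge_facts(1) by blast
 qed
 thus ?thesis using \<delta>(1) far by (intro exI[of _ \<delta>]) (auto simp: mem_ball)
qed

definition plane_frame :: "real^3 \<Rightarrow> (real^3) \<times> real \<Rightarrow> (real^3) \<times> real \<Rightarrow> bool" where
 "plane_frame v e1 e2 \<longleftrightarrow> tangent_frame v e1 e2 \<and> lorentz \<nu> (lift v) = 0 \<and> lorentz \<nu> e1 = 0 \<and> lorentz \<nu> e2 = 0"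

text \<open>Dimension count: with a nonzero remainder there would be five mutually orthogonal
  vectors in a space of dimension four.\<close>

lemma frame_expand:
 assumes f: "plane_frame v e1 e2" and w: "lorentz \<nu> w = 0" "lorentz (lift v) w = 0"
 shows "w = lorentz e1 w *\<^sub>R e1 + lorentz e2 w *\<^sub>R e2"
proof (rule ccontr)
 assume ne: "\<not> ?thesis"
 define x where "x = w - (lorentz e1 w *\<^sub>R e1 + lorentz e2 w *\<^sub>R e2)"
 define h where "h = lift v"
 have o: "lorentz h h = -1" "lorentz e1 e1 = 1" "lorentz e2 e2 = 1" "lorentz h e1 = 0" "lorentz h e2 = 0" "lorentz e1 e2 = 0"
   "lorentz \<nu> h = 0" "lorentz \<nu> e1 = 0" "lorentz \<nu> e2 = 0"
  using f lift_hyperboloid[of v] by (auto simp: plane_frame_def tangent_frame_def unit_tangent_def on_hyperboloid_def h_def)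
 have o': "lorentz e1 h = 0" "lorentz e2 h = 0" "lorentz e2 e1 = 0" "lorentz h \<nu> = 0" "lorentz e1 \<nu> = 0" "lorentz e2 \<nu> = 0"
  using o by (simp_all add: lorentz_commute[of e1 h] lorentz_commute[of e2 h] lorentz_commute[of e2 e1] lorentz_commute[of _ \<nu>])
 have x: "x \<noteq> 0" "lorentz h x = 0" "lorentz e1 x = 0" "lorentz e2 x = 0" "lorentz \<nu> x = 0"
  using ne w o o' by (simp_all add: x_def h_def)
 have x': "lorentz x h = 0" "lorentz x e1 = 0" "lorentz x e2 = 0" "lorentz x \<nu> = 0" using x by (simp_all add: lorentz_commute[of x])
 have xx: "lorentz x x \<noteq> 0" using timelike_orthogonal(2)[of h x] o x by auto
 have d: "distinct [h, e1, e2, \<nu>, x]" using o o' x x' xx \<nu>(1) by auto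
 have "card {h, e1, e2, \<nu>, x} \<le> DIM(real^3) + 1" by (rule orthogonal_card) (use o o' x x' xx \<nu>(1) in auto)
 moreover have "card {h, e1, e2, \<nu>, x} = 5" using distinct_card[OF d] by simp
 ultimately show False by simp
qed

lemma frame_dir:
 assumes f: "plane_frame v e1 e2" and w: "lorentz \<nu> u = 0" "unit_tangent (lift v) u"
 shows "\<exists>\<psi>. 0 \<le> \<psi> \<and> \<psi> < 2 * pi \<and> u = dir e1 e2 \<psi>"
proof -
 have u: "u = lorentz e1 u *\<^sub>R e1 + lorentz e2 u *\<^sub>R e2" using frame_expand[OF f w(1)] w(2) by (simp add: unit_tangent_def)
 have o: "lorentz e1 e1 = 1" "lorentz e2 e2 = 1" "lorentz e1 e2 = 0" "lorentz e2 e1 = 0"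
  using f by (auto simp: plane_frame_def tangent_frame_def unit_tangent_def lorentz_commute[of e2 e1])
 have "lorentz u u = (lorentz e1 u)\<^sup>2 + (lorentz e2 u)\<^sup>2"
 proof -
  have "lorentz (a *\<^sub>R e1 + b *\<^sub>R e2) (a *\<^sub>R e1 + b *\<^sub>R e2) = a\<^sup>2 + b\<^sup>2" for a b
   using o by (simp add: power2_eq_square)
  thus ?thesis using u by metis
 qed
 hence "(lorentz e1 u)\<^sup>2 + (lorentz e2 u)\<^sup>2 = 1" using w(2) by (simp add: unit_tangent_def)
 then obtain t where "0 \<le> t" "t < 2 * pi" "lorentz e1 u = cos t" "lorentz e2 u = sin t" using sincos_total_2pi by metis
 thus ?thesis using u by (metis dir_def)
qed

lemma polar_coordinates:
 assumes f: "plane_frame v e1 e2" and v: "v \<in> A" and y: "y \<in> A" "y \<noteq> v"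
 shows "\<exists>\<psi>. 0 \<le> \<psi> \<and> \<psi> < 2 * pi \<and> y = ray v (dir e1 e2 \<psi>) (hyp_dist v y)"
proof -
 obtain u where u: "unit_tangent (lift v) u" "lift y = polar (lift v) u (hyp_dist v y)"
   "u = (1 / sinh (hyp_dist v y)) *\<^sub>R (lift y - cosh (hyp_dist v y) *\<^sub>R lift v)"
  using hyp_polar_exists[OF A_hyp[OF v] A_hyp[OF y(1)]] y(2) by metis
 have "lorentz \<nu> u = 0" unfolding u(3) using \<nu>_A v y by simp
 then obtain \<psi> where \<psi>: "0 \<le> \<psi>" "\<psi> < 2 * pi" "u = dir e1 e2 \<psi>" using frame_dir[OF f _ u(1)] by blast
 have "y = klein (lift y)" using klein_lift[OF A_hyp[OF y(1)]] by simp
 thus ?thesis using \<psi> u(2) by (auto simp: ray_def)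
qed

lemma ray_affine_hull:
 assumes f: "plane_frame v e1 e2" shows "ray v (dir e1 e2 \<psi>) r \<in> affine hull A"
proof -
 have t: "v \<in> hyp_space" "unit_tangent (lift v) (dir e1 e2 \<psi>)"
  using f dir_unit_tangent[of v e1 e2] by (auto simp: plane_frame_def tangent_frame_def)
 have "lorentz \<nu> (lift (ray v (dir e1 e2 \<psi>) r)) = 0"
  unfolding lift_ray(1)[OF t] using f by (simp add: polar_def dir_def plane_frame_def)
 thus ?thesis using \<nu>(2) lorentz_scaled_point(1)[OF lift_ray(2)[OF t]] by blast
qed

lemma edge_normal_ray:
 assumes f: "plane_frame v e1 e2" and e: "e edge_of A" "v \<in> e"
 shows "lorentz (edge_normal e) (lift (ray v (dir e1 e2 \<psi>) r)) = sinh r * lorentz (edge_normal e) (dir e1 e2 \<psi>)"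
proof -
 have t: "v \<in> hyp_space" "unit_tangent (lift v) (dir e1 e2 \<psi>)"
  using f dir_unit_tangent[of v e1 e2] by (auto simp: plane_frame_def tangent_frame_def)
 have "lorentz (edge_normal e) (lift v) = 0" using edge_normal_facts(4)[OF e(1)] e edge_facts(1) by blast
 thus ?thesis unfolding lift_ray(1)[OF t] by (simp add: polar_def)
qed

text \<open>A corner \<open>(e1, e2, \<beta>)\<close> is a sector of angle \<open>\<beta>\<close> spanned by the directions \<open>dir e1 e2 \<psi>\<close>.\<close>

definition end_normal :: "((real^3) \<times> real) \<times> ((real^3) \<times> real) \<times> real \<Rightarrow> bool \<Rightarrow> (real^3) \<times> real" where
 "end_normal k b = (if b then sin (snd (snd k)) *\<^sub>R fst k - cos (snd (snd k)) *\<^sub>R fst (snd k) else fst (snd k))"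

definition corner_ray :: "real^3 \<Rightarrow> ((real^3) \<times> real) \<times> ((real^3) \<times> real) \<times> real \<Rightarrow> real \<Rightarrow> real \<Rightarrow> real^3" where
 "corner_ray v k r \<psi> = ray v (dir (fst k) (fst (snd k)) \<psi>) r"

abbreviation corner_angle :: "((real^3) \<times> real) \<times> ((real^3) \<times> real) \<times> real \<Rightarrow> real" where
 "corner_angle k \<equiv> snd (snd k)"

text \<open>Sectors are limited to angle \<open>pi\<close>, so that on a sector
  \<open>cos \<psi>\<close> determines \<open>\<psi>\<close>. A vertex or an inner point of an edge
  has one sector; an inner point of the polygon needs two half discs.\<close>

definition corner_sectors :: "real^3 \<Rightarrow> (((real^3) \<times> real) \<times> ((real^3) \<times> real) \<times> real) set \<Rightarrow> real \<Rightarrow> bool" where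
 "corner_sectors v C eps \<longleftrightarrow> finite C \<and> 0 < eps \<and>
  (\<forall>k\<in>C. plane_frame v (fst k) (fst (snd k)) \<and> 0 < corner_angle k \<and> corner_angle k \<le> pi) \<and>
  (\<forall>k\<in>C. \<forall>r \<psi>. 0 \<le> r --> r < eps --> \<psi> \<in> {0..corner_angle k} --> corner_ray v k r \<psi> \<in> A) \<and>
  (\<forall>y\<in>A. 0 < hyp_dist v y --> hyp_dist v y < eps -->
    (\<exists>k\<in>C. \<exists>\<psi>\<in>{0..corner_angle k}. y = corner_ray v k (hyp_dist v y) \<psi>)) \<and>
  (\<forall>k\<in>C. \<forall>r \<psi> e. 0 < r --> r < eps --> \<psi> \<in> {0<..<corner_angle k} --> e edge_of A --> corner_ray v k r \<psi> \<notin> e) \<and>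
  (\<forall>k\<in>C. \<forall>k'\<in>C. \<forall>r \<psi> \<psi>'. 0 < r --> r < eps --> \<psi> \<in> {0<..<corner_angle k} --> \<psi>' \<in> {0..corner_angle k'} -->
    corner_ray v k r \<psi> = corner_ray v k' r \<psi>' --> k = k' \<and> \<psi> = \<psi>')"

text \<open>An end of a sector runs along an edge, or along the artificial cut between two half
  discs. The opposite end normals at a cut express that no kink can arise there.\<close>

definition corner_ends :: "real^3 \<Rightarrow> (((real^3) \<times> real) \<times> ((real^3) \<times> real) \<times> real) set \<Rightarrow> real \<Rightarrow> bool" where
 "corner_ends v C eps \<longleftrightarrow>
  (\<forall>k\<in>C. \<forall>b.
    (\<exists>e. e edge_of A \<and> v \<in> e \<and> end_normal k b = edge_normal e \<and>
     (\<forall>r. 0 \<le> r --> r < eps --> corner_ray v k r (corner_end (corner_angle k) b) \<in> e)) \<or>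
    (\<exists>k'\<in>C. \<exists>b'. (k', b') \<noteq> (k, b) \<and> end_normal k b = - end_normal k' b' \<and>
     (\<forall>r. corner_ray v k r (corner_end (corner_angle k) b) = corner_ray v k' r (corner_end (corner_angle k') b')))) \<and>
  (\<forall>e y. e edge_of A --> y \<in> e --> 0 < hyp_dist v y --> hyp_dist v y < eps --> v \<in> e \<and>
    (\<exists>k\<in>C. \<exists>b. y = corner_ray v k (hyp_dist v y) (corner_end (corner_angle k) b) \<and> end_normal k b = edge_normal e))"

definition corner_type :: "real^3 \<Rightarrow> (((real^3) \<times> real) \<times> ((real^3) \<times> real) \<times> real) set \<Rightarrow> bool" where
 "corner_type v C \<longleftrightarrow> (if v extreme_point_of A
   then \<exists>k e f. C = {k} \<and> corner_angle k < pi \<and> e edge_of A \<and> f edge_of A \<and> e \<noteq> f \<and> v \<in> e \<and> v \<in> f \<and>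
    end_normal k False = edge_normal e \<and> end_normal k True = edge_normal f \<and> (\<forall>g. g edge_of A --> v \<in> g --> g = e \<or> g = f)
   else (\<forall>k\<in>C. corner_angle k = pi))"

definition corner_system where
 "corner_system v C eps \<longleftrightarrow> corner_sectors v C eps \<and> corner_ends v C eps \<and> corner_type v C"

lemma corner_system_mono:
 assumes s: "corner_system v C eps" and eps': "0 < eps'" "eps' \<le> eps"
 shows "corner_system v C eps'"
proof -
 have lt: "r < eps" if "r < eps'" for r using that eps'(2) by linarith
 have "corner_sectors v C eps'" using s eps'(1) unfolding corner_system_def corner_sectors_def
  by (elim conjE, intro conjI) (assumption | blast intro: lt)+
 moreover have "corner_ends v C eps'" unfolding corner_ends_def
 proof (intro conjI ballI allI impI)
  have ce: "corner_ends v C eps" using s by (simp add: corner_system_def)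
  fix k b assume "k \<in> C"
  with ce consider e where "e edge_of A" "v \<in> e" "end_normal k b = edge_normal e"
    "\<And>r. 0 \<le> r ==> r < eps ==> corner_ray v k r (corner_end (corner_angle k) b) \<in> e"
   | "\<exists>k'\<in>C. \<exists>b'. (k', b') \<noteq> (k, b) \<and> end_normal k b = - end_normal k' b' \<and>
     (\<forall>r. corner_ray v k r (corner_end (corner_angle k) b) = corner_ray v k' r (corner_end (corner_angle k') b'))"
   unfolding corner_ends_def by meson
  thus "(\<exists>e. e edge_of A \<and> v \<in> e \<and> end_normal k b = edge_normal e \<and>
     (\<forall>r. 0 \<le> r --> r < eps' --> corner_ray v k r (corner_end (corner_angle k) b) \<in> e)) \<or>
    (\<exists>k'\<in>C. \<exists>b'. (k', b') \<noteq> (k, b) \<and> end_normal k b = - end_normal k' b' \<and>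
     (\<forall>r. corner_ray v k r (corner_end (corner_angle k) b) = corner_ray v k' r (corner_end (corner_angle k') b')))"
  proof cases
   case (1 e)
   thus ?thesis using lt by (intro disjI1 exI[of _ e]) simp
  qed (rule disjI2)
 next
  have ce: "corner_ends v C eps" using s by (simp add: corner_system_def)
  fix e y assume "e edge_of A" "y \<in> e" "0 < hyp_dist v y" "hyp_dist v y < eps'"
  thus "v \<in> e" "\<exists>k\<in>C. \<exists>b. y = corner_ray v k (hyp_dist v y) (corner_end (corner_angle k) b) \<and> end_normal k b = edge_normal e"
   using ce lt unfolding corner_ends_def by blast+
 qed
 ultimately show ?thesis using s by (simp add: corner_system_def)
qed

lemma sector_bounds:
 assumes "0 < \<beta>" "\<beta> \<le> pi" "0 \<le> \<psi>" "\<psi> < 2 * pi" "sin \<psi> \<ge> 0" "sin (\<beta> - \<psi>) \<ge> 0"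
 shows "\<psi> \<le> \<beta>"
proof (rule ccontr)
 assume "\<not> ?thesis"
 moreover have "\<psi> \<le> pi" using sin_lt_zero[of \<psi>] assms by linarith
 ultimately have "sin (\<psi> - \<beta>) > 0" using assms by (intro sin_gt_zero) auto
 moreover have "sin (\<beta> - \<psi>) = - sin (\<psi> - \<beta>)" by (metis minus_diff_eq sin_minus)
 ultimately show False using assms by simp
qed

lemma sinh_radius: assumes "\<delta> > 0" shows "\<exists>eps>0. \<forall>r<eps. sinh r < (\<delta>::real)"
proof (intro exI[of _ "arsinh \<delta>"] conjI allI impI)
 show "0 < arsinh \<delta>" using assms by simp
 show "sinh r < \<delta>" if "r < arsinh \<delta>" for r using that by (metis sinh_arsinh_real sinh_real_less_iff)
qed

lemma ray_near:
 assumes f: "plane_frame v e1 e2" and v: "v \<in> A" and r: "0 \<le> r"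
 shows "dist v (ray v (dir e1 e2 \<psi>) r) \<le> sinh r"
proof -
 have t: "v \<in> hyp_space" "unit_tangent (lift v) (dir e1 e2 \<psi>)"
  using f dir_unit_tangent[of v e1 e2] by (auto simp: plane_frame_def tangent_frame_def)
 show ?thesis using dist_le_sinh_hyp_dist[OF t(1) lift_ray(2)[OF t, of r]] hyp_dist_ray[OF t r] by simp
qed

lemma frame_lorentz:
 assumes "plane_frame v e1 e2"
 shows "lorentz e2 (dir e1 e2 \<psi>) = sin \<psi>"
  "lorentz (sin \<beta> *\<^sub>R e1 - cos \<beta> *\<^sub>R e2) (dir e1 e2 \<psi>) = sin (\<beta> - \<psi>)"
 using assms by (auto simp: plane_frame_def tangent_frame_def unit_tangent_def dir_def lorentz_commute[of e2 e1] sin_diff)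

lemma dir_inj_half:
 assumes "plane_frame v e1 e2" "dir e1 e2 \<psi> = dir e1 e2 \<psi>'" "\<psi> \<in> {0..pi}" "\<psi>' \<in> {0..pi}" shows "\<psi> = \<psi>'"
 using dir_eq_imp(1)[of v e1 e2 \<psi> \<psi>'] assms cos_inj_pi[of \<psi> \<psi>'] by (simp add: plane_frame_def)

lemma ray_inj_frame:
 assumes "plane_frame v e1 e2" "plane_frame v e1' e2'" "0 < r" "ray v (dir e1 e2 \<psi>) r = ray v (dir e1' e2' \<psi>') r"
 shows "dir e1 e2 \<psi> = dir e1' e2' \<psi>'"
 using assms by (intro ray_inj[OF _ dir_unit_tangent dir_unit_tangent]) (auto simp: plane_frame_def tangent_frame_def)

text \<open>In direction \<open>\<psi>\<close> the two edge forms are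
  \<open>sinh r * sin \<psi>\<close> and \<open>sinh r * sin (\<beta> - \<psi>)\<close>, so the two
  half-planes cut out \<open>0 \<le> \<psi> \<le> \<beta>\<close>. The case \<open>e = e'\<close>,
  \<open>\<beta> = pi\<close> is that of a point inside an edge.\<close>

lemma sector_corner:
 assumes v: "v \<in> A" and f: "plane_frame v e1 e2" and \<beta>: "0 < \<beta>" "\<beta> \<le> pi"
  and e: "e edge_of A" "v \<in> e" "edge_normal e = e2"
  and e': "e' edge_of A" "v \<in> e'" "edge_normal e' = sin \<beta> *\<^sub>R e1 - cos \<beta> *\<^sub>R e2"
  and only: "\<And>g. g edge_of A ==> v \<in> g ==> g = e \<or> g = e'"
 shows "\<exists>eps. corner_sectors v {(e1, e2, \<beta>)} eps \<and> corner_ends v {(e1, e2, \<beta>)} eps"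
proof -
 obtain \<delta> where \<delta>: "\<delta> > 0" "\<And>y. [|y \<in> affine hull A; dist v y < \<delta>; \<And>e. e edge_of A ==> v \<in> e ==> lorentz (edge_normal e) (y, 1) \<ge> 0|] ==> y \<in> A"
  "\<And>y e. dist v y < \<delta> ==> e edge_of A ==> y \<in> e ==> v \<in> e" using local_halfspaces[OF v] by metis
 obtain eps where eps: "eps > 0" "\<And>r. r < eps ==> sinh r < \<delta>" using sinh_radius[OF \<delta>(1)] by blast
 define E where "E r \<psi> = ray v (dir e1 e2 \<psi>) r" for r \<psi>
 have vh: "v \<in> hyp_space" using A_hyp v .
 have t: "unit_tangent (lift v) (dir e1 e2 \<psi>)" for \<psi> using f dir_unit_tangent[of v e1 e2] by (auto simp: plane_frame_def)
 have Eh: "E r \<psi> \<in> hyp_space" for r \<psi> unfolding E_def by (rule lift_ray(2)[OF vh t])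
 have near: "dist v (E r \<psi>) < \<delta>" if "0 \<le> r" "r < eps" for r \<psi>
  using ray_near[OF f v that(1), of \<psi>] eps(2)[OF that(2)] by (simp add: E_def)
 have le: "lorentz (edge_normal e) (lift (E r \<psi>)) = sinh r * sin \<psi>"
  "lorentz (edge_normal e') (lift (E r \<psi>)) = sinh r * sin (\<beta> - \<psi>)" for r \<psi>
  using edge_normal_ray[OF f e(1,2)] edge_normal_ray[OF f e'(1,2)] frame_lorentz[OF f] by (simp_all add: E_def e(3) e'(3))
 have c1: "E r \<psi> \<in> A" if r: "0 \<le> r" "r < eps" and p: "\<psi> \<in> {0..\<beta>}" for r \<psi>
 proof (rule \<delta>(2))
  show "E r \<psi> \<in> affine hull A" unfolding E_def by (rule ray_affine_hull[OF f])
  show "dist v (E r \<psi>) < \<delta>" by (rule near[OF r])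
  fix g assume g: "g edge_of A" "v \<in> g"
  have "sin \<psi> \<ge> 0" "sin (\<beta> - \<psi>) \<ge> 0" using p \<beta> by (auto intro!: sin_ge_zero)
  hence "lorentz (edge_normal g) (lift (E r \<psi>)) \<ge> 0" using only[OF g] le r by auto
  thus "lorentz (edge_normal g) (E r \<psi>, 1) \<ge> 0" using lorentz_scaled_point(3)[OF Eh] by blast
 qed
 have c2: "\<exists>\<psi>\<in>{0..\<beta>}. y = E (hyp_dist v y) \<psi>" if y: "y \<in> A" "0 < hyp_dist v y" for y
 proof -
  have "y \<noteq> v" using y hyp_dist_self[OF vh] by auto
  then obtain \<psi> where \<psi>: "0 \<le> \<psi>" "\<psi> < 2 * pi" "y = E (hyp_dist v y) \<psi>"
   using polar_coordinates[OF f v y(1)] by (auto simp: E_def)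
  have "0 \<le> sinh (hyp_dist v y) * sin \<psi>" "0 \<le> sinh (hyp_dist v y) * sin (\<beta> - \<psi>)"
   using edge_normal_facts(3)[OF e(1) y(1)] edge_normal_facts(3)[OF e'(1) y(1)] le \<psi>(3) by metis+
  hence "sin \<psi> \<ge> 0" "sin (\<beta> - \<psi>) \<ge> 0" using y(2) by (simp_all add: zero_le_mult_iff)
  thus ?thesis using sector_bounds[OF \<beta> \<psi>(1,2)] \<psi> by auto
 qed
 have c3: "E r \<psi> \<notin> g" if r: "0 < r" "r < eps" and p: "\<psi> \<in> {0<..<\<beta>}" and g: "g edge_of A" for r \<psi> g
 proof
  assume E: "E r \<psi> \<in> g"
  have vg: "v \<in> g" by (rule \<delta>(3)[OF near g E]) (use r in auto)
  have "lorentz (edge_normal g) (lift (E r \<psi>)) = 0" using edge_normal_facts(4)[OF g] E edge_facts(1)[OF g] by blast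
  moreover have "sin \<psi> > 0" "sin (\<beta> - \<psi>) > 0" using p \<beta> by (auto intro!: sin_gt_zero)
  ultimately show False using only[OF g vg] le r by auto
 qed
 have c5: "E r 0 \<in> e" "E r \<beta> \<in> e'" if r: "0 \<le> r" "r < eps" for r
 proof -
  have "E r 0 \<in> A" "E r \<beta> \<in> A" using c1[OF r] \<beta> by auto
  thus "E r 0 \<in> e" "E r \<beta> \<in> e'"
   using edge_normal_facts(4)[OF e(1), of "E r 0"] edge_normal_facts(4)[OF e'(1), of "E r \<beta>"] le(1)[of r 0] le(2)[of r \<beta>] by simp_all
 qed
 have c6: "v \<in> g \<and> (\<exists>b. y = E (hyp_dist v y) (corner_end \<beta> b) \<and> end_normal (e1, e2, \<beta>) b = edge_normal g)"
  if g: "g edge_of A" and y: "y \<in> g" "0 < hyp_dist v y" "hyp_dist v y < eps" for g y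
 proof -
  have yA: "y \<in> A" using y edge_facts(1)[OF g] by blast
  obtain \<psi> where \<psi>: "\<psi> \<in> {0..\<beta>}" "y = E (hyp_dist v y) \<psi>" using c2[OF yA y(2)] by blast
  have "dist v y < \<delta>" using near[of "hyp_dist v y" \<psi>] \<psi>(2) y by auto
  hence vg: "v \<in> g" using \<delta>(3) g y by blast
  have ends: "\<psi> = 0 \<or> \<psi> = \<beta>"
   using c3[OF y(2,3) _ g, of \<psi>] \<psi> y(1) by (cases "\<psi> = 0 \<or> \<psi> = \<beta>") auto
  have z: "lorentz (edge_normal g) (lift y) = 0" using edge_normal_facts(4)[OF g yA] y(1) by blast
  have s: "sinh (hyp_dist v y) \<noteq> 0" using y(2) by simp
  have "\<exists>b. \<psi> = corner_end \<beta> b \<and> end_normal (e1, e2, \<beta>) b = edge_normal g" using only[OF g vg]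
  proof
   assume ge: "g = e"
   have "sin \<psi> = 0" using z s le(1)[of "hyp_dist v y" \<psi>] \<psi>(2) ge by simp
   show ?thesis
   proof (cases "\<psi> = 0")
    case True thus ?thesis by (intro exI[of _ False]) (simp add: corner_end_def end_normal_def ge e(3))
   next
    case False
    hence "\<psi> = \<beta>" using ends by simp
    hence "\<beta> = pi" using \<open>sin \<psi> = 0\<close> sin_gt_zero[of \<beta>] \<beta> by force
    thus ?thesis using \<open>\<psi> = \<beta>\<close> by (intro exI[of _ True]) (simp add: corner_end_def end_normal_def ge e(3))
   qed
  next
   assume ge: "g = e'"
   have "sin (\<beta> - \<psi>) = 0" using z s le(2)[of "hyp_dist v y" \<psi>] \<psi>(2) ge by simp
   show ?thesis
   proof (cases "\<psi> = \<beta>")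
    case True thus ?thesis by (intro exI[of _ True]) (simp add: corner_end_def end_normal_def ge e'(3))
   next
    case False
    hence "\<psi> = 0" using ends by simp
    hence "\<beta> = pi" using \<open>sin (\<beta> - \<psi>) = 0\<close> sin_gt_zero[of \<beta>] \<beta> by force
    thus ?thesis using \<open>\<psi> = 0\<close> by (intro exI[of _ False]) (simp add: corner_end_def end_normal_def ge e'(3))
   qed
  qed
  thus ?thesis using vg \<psi>(2) by metis
 qed
 have c4: "\<psi> = \<psi>'" if "0 < r" "\<psi> \<in> {0<..<\<beta>}" "\<psi>' \<in> {0..\<beta>}" "E r \<psi> = E r \<psi>'" for r \<psi> \<psi>'
  using ray_inj_frame[OF f f that(1)] dir_inj_half[OF f, of \<psi> \<psi>'] that \<beta> by (auto simp: E_def)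
 have sec: "corner_sectors v {(e1, e2, \<beta>)} eps"
  unfolding corner_sectors_def corner_ray_def using eps(1) f \<beta> c1 c2 c3 c4 by (simp add: E_def)
 have "corner_ends v {(e1, e2, \<beta>)} eps" unfolding corner_ends_def
 proof (intro conjI ballI allI impI)
  fix k b assume k: "k \<in> {(e1, e2, \<beta>)}"
  have "\<exists>g. g edge_of A \<and> v \<in> g \<and> end_normal k b = edge_normal g \<and>
     (\<forall>r. 0 \<le> r --> r < eps --> corner_ray v k r (corner_end (corner_angle k) b) \<in> g)"
   using k c5 e e' by (cases b) (auto simp: end_normal_def corner_ray_def corner_end_def E_def)
  thus "(\<exists>e. e edge_of A \<and> v \<in> e \<and> end_normal k b = edge_normal e \<and>
     (\<forall>r. 0 \<le> r --> r < eps --> corner_ray v k r (corner_end (corner_angle k) b) \<in> e)) \<or>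
    (\<exists>k'\<in>{(e1, e2, \<beta>)}. \<exists>b'. (k', b') \<noteq> (k, b) \<and> end_normal k b = - end_normal k' b' \<and>
     (\<forall>r. corner_ray v k r (corner_end (corner_angle k) b) = corner_ray v k' r (corner_end (corner_angle k') b')))" by blast
 next
  fix g y assume "g edge_of A" "y \<in> g" "0 < hyp_dist v y" "hyp_dist v y < eps"
  from c6[OF this] show "v \<in> g" "\<exists>k\<in>{(e1, e2, \<beta>)}. \<exists>b. y = corner_ray v k (hyp_dist v y) (corner_end (corner_angle k) b) \<and> end_normal k b = edge_normal g"
   by (simp_all add: corner_ray_def E_def)
 qed
 with sec show ?thesis by blast
qed

lemma dir_neg: "dir e1 (- e2) \<psi> = dir e1 e2 (- \<psi>)" by (simp add: dir_def)

text \<open>The full disc is cut along the line in direction \<open>e1\<close>; reversing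
  \<open>e2\<close> parametrises the second half by the same angles.\<close>

lemma interior_corner:
 assumes v: "v \<in> A" and f: "plane_frame v e1 e2" and none: "\<And>g. g edge_of A ==> v \<notin> g"
 shows "\<exists>eps. corner_sectors v {(e1, e2, pi), (e1, - e2, pi)} eps \<and> corner_ends v {(e1, e2, pi), (e1, - e2, pi)} eps"
proof -
 obtain \<delta> where \<delta>: "\<delta> > 0" "\<And>y. [|y \<in> affine hull A; dist v y < \<delta>; \<And>e. e edge_of A ==> v \<in> e ==> lorentz (edge_normal e) (y, 1) \<ge> 0|] ==> y \<in> A"
  "\<And>y e. dist v y < \<delta> ==> e edge_of A ==> y \<in> e ==> v \<in> e" using local_halfspaces[OF v] by metis
 obtain eps where eps: "eps > 0" "\<And>r. r < eps ==> sinh r < \<delta>" using sinh_radius[OF \<delta>(1)] by blast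
 have vh: "v \<in> hyp_space" using A_hyp v .
 have f': "plane_frame v e1 (- e2)" using f tangent_frame_neg[of v e1 e2] by (simp add: plane_frame_def)
 define E where "E r \<psi> = ray v (dir e1 e2 \<psi>) r" for r \<psi>
 have EA: "E r \<psi> \<in> A \<and> (g edge_of A --> E r \<psi> \<notin> g)" if "0 \<le> r" "r < eps" for r \<psi> g
 proof -
  have "dist v (E r \<psi>) < \<delta>" using ray_near[OF f v that(1), of \<psi>] eps(2)[OF that(2)] by (simp add: E_def)
  moreover have "E r \<psi> \<in> affine hull A" unfolding E_def by (rule ray_affine_hull[OF f])
  ultimately show ?thesis using \<delta>(2,3) none by blast
 qed
 have e20: "e2 \<noteq> - e2"
 proof
  assume "e2 = - e2"
  hence "lorentz e2 e2 = lorentz e2 (- e2)" by simp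
  thus False using f by (simp add: plane_frame_def tangent_frame_def unit_tangent_def)
 qed
 have c2: "(\<exists>\<psi>\<in>{0..pi}. y = E (hyp_dist v y) \<psi>) \<or> (\<exists>\<psi>\<in>{0..pi}. y = E (hyp_dist v y) (- \<psi>))"
  if y: "y \<in> A" "0 < hyp_dist v y" for y
 proof -
  have "y \<noteq> v" using y hyp_dist_self[OF vh] by auto
  then obtain \<psi> where \<psi>: "0 \<le> \<psi>" "\<psi> < 2 * pi" "y = E (hyp_dist v y) \<psi>"
   using polar_coordinates[OF f v y(1)] by (auto simp: E_def)
  show ?thesis
  proof (cases "\<psi> \<le> pi")
   case False
   have "dir e1 e2 (- (2 * pi - \<psi>)) = dir e1 e2 \<psi>" by (simp add: dir_def cos_diff sin_diff)
   hence "y = E (hyp_dist v y) (- (2 * pi - \<psi>))" using \<psi>(3) by (simp add: E_def)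
   moreover have "2 * pi - \<psi> \<in> {0..pi}" using False \<psi> by auto
   ultimately show ?thesis by blast
  qed (use \<psi> in auto)
 qed
 have c4: "\<psi> = \<psi>'" if "0 < r" "\<psi> \<in> {0<..<pi}" "\<psi>' \<in> {0..pi}" "E r \<psi> = E r \<psi>'" for r \<psi> \<psi>'
  using ray_inj_frame[OF f f that(1)] dir_inj_half[OF f, of \<psi> \<psi>'] that by (auto simp: E_def)
 have c4': "\<psi> = \<psi>'" if "0 < r" "\<psi> \<in> {0<..<pi}" "\<psi>' \<in> {0..pi}" "E r (- \<psi>) = E r (- \<psi>')" for r \<psi> \<psi>'
  using ray_inj_frame[OF f' f' that(1), of \<psi> \<psi>'] dir_inj_half[OF f', of \<psi> \<psi>'] that by (auto simp: E_def dir_neg)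
 have c4'': False if "0 < r" "\<psi> \<in> {0<..<pi}" "\<psi>' \<in> {0..pi}" "E r \<psi> = E r (- \<psi>') \<or> E r (- \<psi>) = E r \<psi>'" for r \<psi> \<psi>'
 proof -
  have "dir e1 e2 \<psi> = dir e1 e2 (- \<psi>') \<or> dir e1 e2 (- \<psi>) = dir e1 e2 \<psi>'"
   using that(4) ray_inj_frame[OF f f that(1)] by (auto simp: E_def)
  hence "sin \<psi> = - sin \<psi>'"
   using dir_eq_imp(2)[of v e1 e2 \<psi> "- \<psi>'"] dir_eq_imp(2)[of v e1 e2 "- \<psi>" "\<psi>'"] f by (auto simp: plane_frame_def)
  moreover have "sin \<psi> > 0" "sin \<psi>' \<ge> 0" using that by (auto intro: sin_gt_zero sin_ge_zero)
  ultimately show False by simp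
 qed
 have cr: "corner_ray v (e1, e2, pi) r \<psi> = E r \<psi>" "corner_ray v (e1, - e2, pi) r \<psi> = E r (- \<psi>)" for r \<psi>
  by (simp_all add: corner_ray_def E_def dir_neg)
 have two: "k = (e1, e2, pi) \<or> k = (e1, - e2, pi)" if "k \<in> {(e1, e2, pi), (e1, - e2, pi)}" for k using that by blast
 have sec: "corner_sectors v {(e1, e2, pi), (e1, - e2, pi)} eps" unfolding corner_sectors_def
 proof (intro conjI ballI allI impI)
  fix k r \<psi> assume "k \<in> {(e1, e2, pi), (e1, - e2, pi)}" "0 \<le> r" "r < eps"
  thus "corner_ray v k r \<psi> \<in> A" using two[of k] EA cr by metis
 next
  fix y assume y: "y \<in> A" "0 < hyp_dist v y" "hyp_dist v y < eps"
  from c2[OF y(1,2)]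
  show "\<exists>k\<in>{(e1, e2, pi), (e1, - e2, pi)}. \<exists>\<psi>\<in>{0..corner_angle k}. y = corner_ray v k (hyp_dist v y) \<psi>"
  proof
   assume "\<exists>\<psi>\<in>{0..pi}. y = E (hyp_dist v y) \<psi>"
   thus ?thesis by (intro bexI[of _ "(e1, e2, pi)"]) (simp_all add: cr)
  next
   assume "\<exists>\<psi>\<in>{0..pi}. y = E (hyp_dist v y) (- \<psi>)"
   thus ?thesis by (intro bexI[of _ "(e1, - e2, pi)"]) (simp_all add: cr)
  qed
 next
  fix k r \<psi> e assume "k \<in> {(e1, e2, pi), (e1, - e2, pi)}" "0 < r" "r < eps" "e edge_of A"
  thus "corner_ray v k r \<psi> \<notin> e" using two[of k] EA cr by (metis less_imp_le)
 next
  fix k k' r \<psi> \<psi>'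
  assume h: "k \<in> {(e1, e2, pi), (e1, - e2, pi)}" "k' \<in> {(e1, e2, pi), (e1, - e2, pi)}" "0 < r" "r < eps"
   "\<psi> \<in> {0<..<corner_angle k}" "\<psi>' \<in> {0..corner_angle k'}" "corner_ray v k r \<psi> = corner_ray v k' r \<psi>'"
  have p: "\<psi> \<in> {0<..<pi}" "\<psi>' \<in> {0..pi}" using two[OF h(1)] two[OF h(2)] h(5,6) by auto
  consider "k = (e1, e2, pi)" "k' = (e1, e2, pi)" | "k = (e1, - e2, pi)" "k' = (e1, - e2, pi)"
   | "k = (e1, e2, pi)" "k' = (e1, - e2, pi)" | "k = (e1, - e2, pi)" "k' = (e1, e2, pi)" using two[OF h(1)] two[OF h(2)] by blast
  hence "k = k' \<and> \<psi> = \<psi>'"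
  proof cases
   case 1 thus ?thesis using c4[OF h(3) p] h(7) cr by simp
  next
   case 2 thus ?thesis using c4'[OF h(3) p] h(7) cr by simp
  next
   case 3 thus ?thesis using c4''[OF h(3) p] h(7) cr by simp
  next
   case 4 thus ?thesis using c4''[OF h(3) p] h(7) cr by simp
  qed
  thus "k = k'" "\<psi> = \<psi>'" by auto
 qed (use eps(1) f f' two in auto)
 have "corner_ends v {(e1, e2, pi), (e1, - e2, pi)} eps" unfolding corner_ends_def
 proof (intro conjI ballI allI impI)
  fix k b assume k: "k \<in> {(e1, e2, pi), (e1, - e2, pi)}"
  define k' where "k' = (if k = (e1, e2, pi) then (e1, - e2, pi) else (e1, e2, pi))"
  have "k' \<in> {(e1, e2, pi), (e1, - e2, pi)}" "(k', b) \<noteq> (k, b)" "end_normal k b = - end_normal k' b"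
   "\<And>r. corner_ray v k r (corner_end (corner_angle k) b) = corner_ray v k' r (corner_end (corner_angle k') b)"
   using k e20 by (auto simp: k'_def end_normal_def corner_ray_def corner_end_def dir_def)
  thus "(\<exists>e. e edge_of A \<and> v \<in> e \<and> end_normal k b = edge_normal e \<and>
     (\<forall>r. 0 \<le> r --> r < eps --> corner_ray v k r (corner_end (corner_angle k) b) \<in> e)) \<or>
    (\<exists>k'\<in>{(e1, e2, pi), (e1, - e2, pi)}. \<exists>b'. (k', b') \<noteq> (k, b) \<and> end_normal k b = - end_normal k' b' \<and>
     (\<forall>r. corner_ray v k r (corner_end (corner_angle k) b) = corner_ray v k' r (corner_end (corner_angle k') b')))" by blast
 next
  fix g y assume g: "g edge_of A" "y \<in> g" "0 < hyp_dist v y" "hyp_dist v y < eps"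
  have yA: "y \<in> A" using g edge_facts(1) by blast
  have False using c2[OF yA g(3)] EA[of "hyp_dist v y"] g by (metis less_imp_le)
  thus "v \<in> g" "\<exists>k\<in>{(e1, e2, pi), (e1, - e2, pi)}. \<exists>b. y = corner_ray v k (hyp_dist v y) (corner_end (corner_angle k) b) \<and> end_normal k b = edge_normal g"
   by auto
 qed
 with sec show ?thesis by blast
qed

lemma plane_frame_exists:
 assumes "v \<in> A" shows "\<exists>e1 e2. plane_frame v e1 e2"
proof -
 have h: "lorentz (lift v) (lift v) = -1" using lift_hyperboloid[OF A_hyp[OF assms]] by (simp add: on_hyperboloid_def)
 have \<nu>v: "lorentz \<nu> (lift v) = 0" using \<nu>_A assms .
 obtain e1 where e1: "lorentz e1 e1 = 1" "lorentz (lift v) e1 = 0" "lorentz \<nu> e1 = 0"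
  using orthogonal_unit_exists[of "{lift v, \<nu>}" "lift v"] h card_insert_le_m1[of 2 "{\<nu>}" "lift v"] by auto
 have "card {lift v, \<nu>, e1} < DIM(real^3) + 1" by (rule le_less_trans[OF card_insert_le_m1[of 3]]) (auto simp: card_insert_if)
 then obtain e2 where e2: "lorentz e2 e2 = 1" "lorentz (lift v) e2 = 0" "lorentz \<nu> e2 = 0" "lorentz e1 e2 = 0"
  using orthogonal_unit_exists[of "{lift v, \<nu>, e1}" "lift v"] h by auto
 show ?thesis using e1 e2 \<nu>v A_hyp[OF assms]
  by (intro exI[of _ e1] exI[of _ e2]) (simp add: plane_frame_def tangent_frame_def unit_tangent_def)
qed

lemma edge_frame:
 assumes e: "e edge_of A" "v \<in> e" and b: "b \<in> e" "b \<noteq> v"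
 shows "\<exists>e1. plane_frame v e1 (edge_normal e) \<and> b = ray v e1 (hyp_dist v b) \<and> hyp_dist v b > 0"
proof -
 have v: "v \<in> A" "v \<in> hyp_space" and bA: "b \<in> A" "b \<in> hyp_space" using e b edge_facts(1) A_hyp by blast+
 obtain u where u: "unit_tangent (lift v) u" "lift b = polar (lift v) u (hyp_dist v b)" "hyp_dist v b > 0"
   "u = (1 / sinh (hyp_dist v b)) *\<^sub>R (lift b - cosh (hyp_dist v b) *\<^sub>R lift v)"
  using hyp_polar_exists[OF v(2) bA(2)] b(2) by metis
 have "lorentz (edge_normal e) (lift v) = 0" "lorentz (edge_normal e) (lift b) = 0" using edge_normal_facts(4)[OF e(1)] v bA e b by blast+
 hence "lorentz (edge_normal e) u = 0" "lorentz (lift v) (edge_normal e) = 0" unfolding u(4) by (simp_all add: lorentz_commute)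
 moreover have "lorentz \<nu> u = 0" unfolding u(4) using \<nu>_A v bA by simp
 ultimately have "plane_frame v u (edge_normal e)" using u(1) v \<nu>_A[OF v(1)] edge_normal_facts(1,2)[OF e(1)]
  by (simp add: plane_frame_def tangent_frame_def unit_tangent_def lorentz_commute[of u "edge_normal e"])
 moreover have "b = ray v u (hyp_dist v b)" using klein_lift[OF bA(2)] u(2) by (simp add: ray_def)
 ultimately show ?thesis using u(3) by blast
qed

lemma extreme_on_edge: assumes "v extreme_point_of A" shows "\<exists>e. e edge_of A \<and> v \<in> e"
proof -
 have f: "{v} face_of A" using assms by (simp add: face_of_singleton)
 have "{v} \<noteq> A" using A_facts(2) by auto
 hence "{v} \<inter> rel_interior A = {}" using face_of_disjoint_rel_interior[OF f] by blast
 moreover have "v \<in> A" using assms extreme_point_of_def by blast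
 ultimately show ?thesis using boundary_edges by blast
qed

lemma two_edges_extreme:
 assumes "e edge_of A" "f edge_of A" "e \<noteq> f" "v \<in> e" "v \<in> f" shows "v extreme_point_of A"
proof -
 have "e \<inter> f = {v}" using two_points_edge[OF assms(1,2)] assms by blast
 moreover have "(e \<inter> f) face_of A" using assms edge_facts(4) face_of_Int by blast
 ultimately show ?thesis by (simp add: face_of_singleton)
qed

text \<open>In the frame of \<open>e\<close> the edge \<open>g\<close> leaves \<open>v\<close> in
  direction \<open>\<gamma>\<close>. A point of \<open>e\<close> lies strictly inside the half-plane
  of \<open>g\<close> and a point of \<open>g\<close> strictly inside that of \<open>e\<close>; this
  places \<open>\<gamma>\<close> strictly between 0 and \<open>pi\<close>.\<close>

lemma other_edge_normal:
 assumes e: "e edge_of A" "v \<in> e" and b: "b \<in> e" "b \<noteq> v" and f: "plane_frame v e1 (edge_normal e)" "b = ray v e1 (hyp_dist v b)" "hyp_dist v b > 0"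
  and g: "g edge_of A" "v \<in> g" "g \<noteq> e"
 shows "\<exists>\<gamma>. 0 < \<gamma> \<and> \<gamma> < pi \<and> edge_normal g = sin \<gamma> *\<^sub>R e1 - cos \<gamma> *\<^sub>R edge_normal e \<and>
   (\<exists>c\<in>g. c \<noteq> v \<and> c = ray v (dir e1 (edge_normal e) \<gamma>) (hyp_dist v c) \<and> hyp_dist v c > 0)"
proof -
 have v: "v \<in> A" "v \<in> hyp_space" and bA: "b \<in> A" using e b edge_facts(1) A_hyp by blast+
 have o: "lorentz e1 e1 = 1" "lorentz (edge_normal e) (edge_normal e) = 1" "lorentz e1 (edge_normal e) = 0" "lorentz (edge_normal e) e1 = 0"
  using f(1) by (auto simp: plane_frame_def tangent_frame_def unit_tangent_def lorentz_commute[of "edge_normal e" e1])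
 define m where "m = edge_normal g"
 have mv: "lorentz m (lift v) = 0" using edge_normal_facts(4)[OF g(1) v(1)] g(2) by (simp add: m_def)
 define a c where "a = lorentz e1 m" and "c = lorentz (edge_normal e) m"
 have m: "m = a *\<^sub>R e1 + c *\<^sub>R edge_normal e"
  unfolding a_def c_def by (rule frame_expand[OF f(1)]) (use edge_normal_facts(2)[OF g(1)] mv in \<open>simp_all add: m_def lorentz_commute\<close>)
 have "lorentz m m = a\<^sup>2 + c\<^sup>2" unfolding m using o by (simp add: power2_eq_square)
 hence ac: "a\<^sup>2 + c\<^sup>2 = 1" using edge_normal_facts(1)[OF g(1)] by (simp add: m_def)
 have "b \<notin> g" using two_points_edge[OF e(1) g(1) e(2) g(2) b(1)] b(2) g(3) by blast
 hence "lorentz m (lift b) > 0" using edge_normal_facts(3,4)[OF g(1) bA] by (simp add: m_def less_le)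
 moreover have "lift b = polar (lift v) e1 (hyp_dist v b)"
  using lift_ray(1)[OF v(2), of e1 "hyp_dist v b"] f(1,2) by (simp add: plane_frame_def tangent_frame_def)
 ultimately have "sinh (hyp_dist v b) * a > 0" using mv by (simp add: polar_def a_def lorentz_commute)
 hence a: "a > 0" using f(3) by (simp add: zero_less_mult_iff)
 define \<gamma> where "\<gamma> = arccos (- c)"
 have "c\<^sup>2 < 1" using ac a by (smt (verit) zero_less_power)
 hence c1: "-1 < c" "c < 1" by (auto simp: abs_square_less_1 abs_less_iff)
 have \<gamma>: "0 < \<gamma>" "\<gamma> < pi" "cos \<gamma> = - c" using arccos_lt_bounded[of "-c"] c1 by (auto simp: \<gamma>_def)
 have "sin \<gamma> = sqrt (1 - (- c)\<^sup>2)" using c1 by (simp add: \<gamma>_def sin_arccos)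
 also have "1 - (-c)\<^sup>2 = a\<^sup>2" using ac by simp
 finally have s: "sin \<gamma> = a" using a by simp
 have mg: "m = sin \<gamma> *\<^sub>R e1 - cos \<gamma> *\<^sub>R edge_normal e" using m s \<gamma>(3) by simp
 obtain d where d: "d \<in> g" "d \<noteq> v" using edge_other_point[OF g(1,2)] by blast
 have dA: "d \<in> A" using d edge_facts(1)[OF g(1)] by blast
 obtain \<psi> where \<psi>: "0 \<le> \<psi>" "\<psi> < 2 * pi" "d = ray v (dir e1 (edge_normal e) \<psi>) (hyp_dist v d)"
  using polar_coordinates[OF f(1) v(1) dA d(2)] by blast
 have dd: "hyp_dist v d > 0" using hyp_dist_nonneg[OF v(2) A_hyp[OF dA]] hyp_dist_0[OF v(2) A_hyp[OF dA]] d(2) by force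
 have "d \<notin> e" using two_points_edge[OF e(1) g(1) e(2) g(2)] d g(3) by blast
 hence "lorentz (edge_normal e) (lift d) > 0" using edge_normal_facts(3,4)[OF e(1) dA] by (simp add: less_le)
 hence "sinh (hyp_dist v d) * sin \<psi> > 0"
  using edge_normal_ray[OF f(1) e, of \<psi> "hyp_dist v d"] \<psi>(3) frame_lorentz(1)[OF f(1)] by simp
 hence sp: "sin \<psi> > 0" using dd by (simp add: zero_less_mult_iff)
 have "\<psi> \<noteq> 0" "\<psi> \<noteq> pi" using sp by auto
 moreover have "\<not> pi < \<psi>" using sin_lt_zero[of \<psi>] \<psi>(2) sp by linarith
 ultimately have ppi: "0 < \<psi>" "\<psi> < pi" using \<psi>(1) by linarith+
 have "lorentz (edge_normal g) (lift d) = 0" using edge_normal_facts(4)[OF g(1) dA] d(1) by blast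
 hence "sinh (hyp_dist v d) * lorentz m (dir e1 (edge_normal e) \<psi>) = 0"
  using edge_normal_ray[OF f(1) g(1,2), of \<psi> "hyp_dist v d"] \<psi>(3) by (simp add: m_def)
 hence "sin (\<gamma> - \<psi>) = 0" using dd frame_lorentz(2)[OF f(1), of \<gamma> \<psi>] by (simp add: mg)
 hence "sin (\<psi> - \<gamma>) = 0" by (metis minus_diff_eq neg_equal_0_iff_equal sin_minus)
 have "\<psi> = \<gamma>"
 proof (rule linorder_cases)
  assume "\<psi> < \<gamma>"
  thus ?thesis using sin_gt_zero[of "\<gamma> - \<psi>"] \<gamma> ppi \<open>sin (\<gamma> - \<psi>) = 0\<close> by linarith
 next
  assume "\<gamma> < \<psi>"
  thus ?thesis using sin_gt_zero[of "\<psi> - \<gamma>"] \<gamma> ppi \<open>sin (\<psi> - \<gamma>) = 0\<close> by linarith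
 qed
 thus ?thesis using \<gamma>(1,2) mg d \<psi>(3) dd by (auto simp: m_def)
qed

lemma corner_system_exists:
 assumes v: "v \<in> A" shows "\<exists>C eps. corner_system v C eps"
proof -
 have vh: "v \<in> hyp_space" using A_hyp v .
 consider (none) "\<And>g. g edge_of A ==> v \<notin> g"
  | (edge) e where "e edge_of A" "v \<in> e" "\<not> v extreme_point_of A"
  | (vertex) "v extreme_point_of A" by blast
 thus ?thesis
 proof cases
  case none
  obtain e1 e2 where f: "plane_frame v e1 e2" using plane_frame_exists[OF v] by blast
  have "\<not> v extreme_point_of A" using extreme_on_edge none by blast
  hence "corner_type v {(e1, e2, pi), (e1, - e2, pi)}" unfolding corner_type_def by simp
  thus ?thesis using interior_corner[OF v f none] unfolding corner_system_def by blast
 next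
  case edge
  obtain b where b: "b \<in> e" "b \<noteq> v" using edge_other_point[OF edge(1,2)] by blast
  obtain e1 where f: "plane_frame v e1 (edge_normal e)" using edge_frame[OF edge(1,2) b] by blast
  have "\<exists>eps. corner_sectors v {(e1, edge_normal e, pi)} eps \<and> corner_ends v {(e1, edge_normal e, pi)} eps"
   by (rule sector_corner[OF v f _ _ edge(1,2) refl edge(1,2)]) (use two_edges_extreme[OF edge(1)] edge in auto)
  moreover have "corner_type v {(e1, edge_normal e, pi)}" unfolding corner_type_def using edge(3) by simp
  ultimately show ?thesis unfolding corner_system_def by blast
 next
  case vertex
  obtain e where e: "e edge_of A" "v \<in> e" using extreme_on_edge[OF vertex] by blast
  obtain b where b: "b \<in> e" "b \<noteq> v" using edge_other_point[OF e] by blast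
  obtain e1 where f: "plane_frame v e1 (edge_normal e)" "b = ray v e1 (hyp_dist v b)" "hyp_dist v b > 0" using edge_frame[OF e b] by blast
  note on = other_edge_normal[OF e b f]
  \<comment> \<open>With only one edge through \<open>v\<close>, the polygon near \<open>v\<close>
    would be a half disc. It would contain the rays in the directions \<open>e1\<close> and
    \<open>- e1\<close>, and \<open>v\<close> would be inside a segment of \<open>A\<close>.\<close>
  have "\<exists>g. g edge_of A \<and> v \<in> g \<and> g \<noteq> e"
  proof (rule ccontr)
   assume "\<not> ?thesis"
   hence "\<exists>eps. corner_sectors v {(e1, edge_normal e, pi)} eps \<and> corner_ends v {(e1, edge_normal e, pi)} eps"
    by (intro sector_corner[OF v f(1) _ _ e refl e]) auto
   then obtain eps where eps: "corner_sectors v {(e1, edge_normal e, pi)} eps" by blast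
   define r where "r = eps / 2"
   have r: "0 < r" "r < eps" using eps by (auto simp: corner_sectors_def r_def)
   have yA: "ray v e1 r \<in> A" "ray v (- e1) r \<in> A"
   proof -
    have "corner_ray v (e1, edge_normal e, pi) r 0 \<in> A" "corner_ray v (e1, edge_normal e, pi) r pi \<in> A"
     using eps r unfolding corner_sectors_def by auto
    thus "ray v e1 r \<in> A" "ray v (- e1) r \<in> A" by (simp_all add: corner_ray_def dir_def)
   qed
   have ut: "unit_tangent (lift v) e1" "unit_tangent (lift v) (- e1)"
    using f(1) by (auto simp: plane_frame_def tangent_frame_def unit_tangent_def)
   obtain p q c where pq: "p > 0" "lift (ray v e1 r) = p *\<^sub>R (ray v e1 r, 1)" "q > 0" "lift (ray v (- e1) r) = q *\<^sub>R (ray v (- e1) r, 1)"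
    "c > 0" "lift v = c *\<^sub>R (v, 1)" using lift_point A_hyp yA vh by metis
   have "p *\<^sub>R (ray v e1 r, 1::real) + q *\<^sub>R (ray v (- e1) r, 1) = (2 * cosh r * c) *\<^sub>R (v, 1)"
    unfolding pq(2,4)[symmetric] lift_ray(1)[OF vh ut(1)] lift_ray(1)[OF vh ut(2)] by (simp add: polar_def pq(6) flip: scaleR_add_left)
   hence s: "p *\<^sub>R ray v e1 r + q *\<^sub>R ray v (- e1) r = (2 * cosh r * c) *\<^sub>R v" "p + q = 2 * cosh r * c" by auto
   have ne: "ray v e1 r \<noteq> ray v (- e1) r"
   proof
    assume "ray v e1 r = ray v (- e1) r"
    hence "e1 = - e1" by (rule ray_inj[OF vh ut r(1)])
    hence "lorentz e1 e1 = lorentz e1 (- e1)" by simp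
    thus False using ut(1) by (simp add: unit_tangent_def)
   qed
   have pq0: "p + q > 0" using pq by simp
   have "v = (p / (p + q)) *\<^sub>R ray v e1 r + (q / (p + q)) *\<^sub>R ray v (- e1) r"
   proof -
    have "(p + q) *\<^sub>R v = p *\<^sub>R ray v e1 r + q *\<^sub>R ray v (- e1) r" using s by simp
    hence "v = (1 / (p + q)) *\<^sub>R (p *\<^sub>R ray v e1 r + q *\<^sub>R ray v (- e1) r)" using pq0 by (metis divideR_right inverse_eq_divide less_irrefl)
    thus ?thesis by (simp add: scaleR_add_right)
   qed
   moreover have "p / (p + q) = 1 - q / (p + q)" using pq0 by (simp add: field_simps)
   ultimately have "v \<in> open_segment (ray v e1 r) (ray v (- e1) r)"
    unfolding in_segment using ne pq(1,3) pq0 by (intro conjI exI[of _ "q / (p + q)"]) auto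
   thus False using vertex yA by (auto simp: extreme_point_of_def)
  qed
  then obtain g where g: "g edge_of A" "v \<in> g" "g \<noteq> e" by blast
  obtain \<beta> c where \<beta>: "0 < \<beta>" "\<beta> < pi" "edge_normal g = sin \<beta> *\<^sub>R e1 - cos \<beta> *\<^sub>R edge_normal e"
   and c: "c \<in> g" "c \<noteq> v" "c = ray v (dir e1 (edge_normal e) \<beta>) (hyp_dist v c)" "hyp_dist v c > 0"
   using on[OF g] by blast
  \<comment> \<open>Of two further edges each would have to lie strictly inside the half-plane of
    the other, making both \<open>sin (\<gamma> - \<beta>)\<close> and its negative
    positive.\<close>
  have only: "k = e \<or> k = g" if k: "k edge_of A" "v \<in> k" for k
  proof (rule ccontr)
   assume n: "\<not> ?thesis"
   obtain \<gamma> d where \<gamma>: "0 < \<gamma>" "\<gamma> < pi" "edge_normal k = sin \<gamma> *\<^sub>R e1 - cos \<gamma> *\<^sub>R edge_normal e"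
    and d: "d \<in> k" "d \<noteq> v" "d = ray v (dir e1 (edge_normal e) \<gamma>) (hyp_dist v d)" "hyp_dist v d > 0"
    using on[OF k] n by blast
   have cA: "c \<in> A" "d \<in> A" using c(1) d(1) edge_facts(1) g(1) k(1) by blast+
   have "c \<notin> k" "d \<notin> g" using two_points_edge[OF g(1) k(1) g(2) k(2)] c d n by blast+
   hence "lorentz (edge_normal k) (lift c) > 0" "lorentz (edge_normal g) (lift d) > 0"
    using edge_normal_facts(3,4)[OF k(1) cA(1)] edge_normal_facts(3,4)[OF g(1) cA(2)] by (simp_all add: less_le)
   hence "sinh (hyp_dist v c) * sin (\<gamma> - \<beta>) > 0" "sinh (hyp_dist v d) * sin (\<beta> - \<gamma>) > 0"
    using edge_normal_ray[OF f(1) k, of \<beta> "hyp_dist v c"] edge_normal_ray[OF f(1) g(1,2), of \<gamma> "hyp_dist v d"]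
     c(3) d(3) frame_lorentz(2)[OF f(1)] \<gamma>(3) \<beta>(3) by simp_all
   hence "sin (\<gamma> - \<beta>) > 0" "sin (\<beta> - \<gamma>) > 0" using c(4) d(4) by (simp_all add: zero_less_mult_iff)
   moreover have "sin (\<beta> - \<gamma>) = - sin (\<gamma> - \<beta>)" by (metis minus_diff_eq sin_minus)
   ultimately show False by simp
  qed
  have "\<exists>eps. corner_sectors v {(e1, edge_normal e, \<beta>)} eps \<and> corner_ends v {(e1, edge_normal e, \<beta>)} eps"
   by (rule sector_corner[OF v f(1) \<beta>(1) _ e refl g(1,2) \<beta>(3)]) (use \<beta> only in auto)
  moreover have "corner_type v {(e1, edge_normal e, \<beta>)}" unfolding corner_type_def if_P[OF vertex]
  proof (rule exI[of _ "(e1, edge_normal e, \<beta>)"], rule exI[of _ e], rule exI[of _ g], intro conjI allI impI)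
   show "end_normal (e1, edge_normal e, \<beta>) False = edge_normal e" "end_normal (e1, edge_normal e, \<beta>) True = edge_normal g"
    using \<beta>(3) by (simp_all add: end_normal_def)
   show "e \<noteq> g" using g(3) by simp
   show "k = e \<or> k = g" if "k edge_of A" "v \<in> k" for k by (rule only[OF that])
   show "corner_angle (e1, edge_normal e, \<beta>) < pi" using \<beta>(2) by simp
  qed (rule refl e g(1,2))+
  ultimately show ?thesis unfolding corner_system_def by blast
 qed
qed

end

lemma polygon_exists:
 assumes "convex_polygon A" shows "\<exists>\<nu>. polygon A \<nu>"
proof -
 have A: "aff_dim A = 2" "A \<subseteq> hyp_space" using assms by (auto simp: convex_polygon_def)
 obtain n b where n: "n \<noteq> 0" "affine hull A = {x. n \<bullet> x = b}" using aff_dim_eq_hyperplane[of A] A(1) by auto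
 define m where "m = (n, b)"
 have m: "lorentz m (x, 1) = n \<bullet> x - b" for x by (simp add: m_def lorentz_eq)
 have "A \<noteq> {}" using A(1) by auto
 then obtain v where v: "v \<in> A" by blast
 hence vh: "v \<in> hyp_space" using A by blast
 have "lorentz m (v, 1) = 0" using n(2) hull_inc[OF v, of affine] by (simp add: m)
 hence "lorentz (lift v) m = 0" using lorentz_scaled_point(1)[OF vh] by (simp add: lorentz_commute)
 moreover have "m \<noteq> 0" using n(1) by (simp add: m_def zero_prod_def)
 ultimately have p: "lorentz m m > 0"
  using timelike_orthogonal[of "lift v" m] lift_hyperboloid[OF vh] unfolding on_hyperboloid_def by (metis less_eq_real_def less_minus_one_simps(1))
 define c where "c = 1 / sqrt (lorentz m m)"
 have c: "c > 0" "c * c * lorentz m m = 1" using p by (simp_all add: c_def)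
 have "polygon A (c *\<^sub>R m)" by unfold_locales (use assms c n(2) m in \<open>auto simp: mult.assoc\<close>)
 thus ?thesis by blast
qed

section \<open>Semi-ideal pyramids\<close>

text \<open>The definite description needs uniqueness: the facet spans its hyperplane, so a normal
  is determined up to a factor, the normalisation leaves a sign, and the strict point
  \<open>x0\<close> fixes it.\<close>

lemma outer_normal_eq:
 assumes u: "lorentz u u = 1" "\<And>x. x \<in> P ==> lorentz u (x, 1) \<le> 0" "Q = {x \<in> P. lorentz u (x, 1) = 0}"
  and strict: "x0 \<in> P" "lorentz u (x0, 1) < 0"
  and span: "\<And>w. (\<And>x. x \<in> Q ==> lorentz w (x, 1) = 0) ==> \<exists>c. w = c *\<^sub>R u"
 shows "outer_normal P Q = u" unfolding outer_normal_def
proof (rule the_equality)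
 have l: "lorentz w (x, 1) \<le> 0 \<longleftrightarrow> fst w \<bullet> x \<le> snd w" "lorentz w (x, 1) = 0 \<longleftrightarrow> fst w \<bullet> x = snd w" for w x
  by (auto simp: lorentz_eq)
 show "lorentz u u = 1 \<and> P \<subseteq> {x. fst u \<bullet> x \<le> snd u} \<and> Q = P \<inter> {x. fst u \<bullet> x = snd u}"
  using u by (auto simp: l)
 fix w assume w: "lorentz w w = 1 \<and> P \<subseteq> {x. fst w \<bullet> x \<le> snd w} \<and> Q = P \<inter> {x. fst w \<bullet> x = snd w}"
 hence "lorentz w (x, 1) = 0" if "x \<in> Q" for x using that by (auto simp: l)
 then obtain c where c: "w = c *\<^sub>R u" using span by blast
 have "c * c = 1" using w u(1) by (simp add: c)
 moreover have "lorentz w (x0, 1) \<le> 0" using w strict(1) by (auto simp: l)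
 hence "c \<ge> 0" using strict(2) by (simp add: c mult_le_0_iff)
 ultimately have "c = 1" by (metis mult_cancel_right1 mult_left_cancel power2_eq_1_iff power2_eq_square abs_of_nonneg abs_neg_one abs_minus_cancel abs_one)
 thus "w = u" using c by simp
qed

lemma pyramid_points:
 assumes "convex S" "S \<noteq> {}"
 shows "x \<in> pyramid S a \<longleftrightarrow> (\<exists>y\<in>S. \<exists>t. 0 \<le> t \<and> t \<le> 1 \<and> x = (1 - t) *\<^sub>R y + t *\<^sub>R a)"
proof -
 have "x \<in> pyramid S a \<longleftrightarrow> (\<exists>u v b. 0 \<le> u \<and> 0 \<le> v \<and> u + v = 1 \<and> b \<in> S \<and> x = u *\<^sub>R a + v *\<^sub>R b)"
  unfolding pyramid_def using assms by (simp add: convex_hull_insert hull_same[of convex S])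
 also have "\<dots> \<longleftrightarrow> (\<exists>y\<in>S. \<exists>t. 0 \<le> t \<and> t \<le> 1 \<and> x = (1 - t) *\<^sub>R y + t *\<^sub>R a)"
 proof
  assume "\<exists>u v b. 0 \<le> u \<and> 0 \<le> v \<and> u + v = 1 \<and> b \<in> S \<and> x = u *\<^sub>R a + v *\<^sub>R b"
  then obtain u v b where h: "0 \<le> u" "0 \<le> v" "u + v = 1" "b \<in> S" "x = u *\<^sub>R a + v *\<^sub>R b" by blast
  have "v = 1 - u" using h(3) by simp
  thus "\<exists>y\<in>S. \<exists>t. 0 \<le> t \<and> t \<le> 1 \<and> x = (1 - t) *\<^sub>R y + t *\<^sub>R a"
   using h by (intro bexI[of _ b] exI[of _ u]) (auto simp: add.commute)
 next
  assume "\<exists>y\<in>S. \<exists>t. 0 \<le> t \<and> t \<le> 1 \<and> x = (1 - t) *\<^sub>R y + t *\<^sub>R a"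
  then obtain y t where "y \<in> S" "0 \<le> t" "t \<le> 1" "x = (1 - t) *\<^sub>R y + t *\<^sub>R a" by blast
  thus "\<exists>u v b. 0 \<le> u \<and> 0 \<le> v \<and> u + v = 1 \<and> b \<in> S \<and> x = u *\<^sub>R a + v *\<^sub>R b"
   by (intro exI[of _ t] exI[of _ "1 - t"] exI[of _ y]) (auto simp: add.commute)
 qed
 finally show ?thesis .
qed

text \<open>The sign of \<open>\<nu>\<close> is chosen so that it is the outer normal of the base
  facet.\<close>

locale apexed_polygon = polygon +
 fixes a :: "real^3"
 assumes apex: "a \<in> sphere 0 1" and apex_side: "lorentz \<nu> (a, 1) < 0"
begin

definition L :: "(real^3) \<times> real" where "L = (a, 1)"

text \<open>The least value of \<open>horo\<close> on the plane of the base, as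
  \<open>frame_norm\<close> shows: it is the value where the gradient vanishes.\<close>

definition D :: real where "D = - lorentz \<nu> L"

lemma L_null: "lorentz L L = 0" using apex by (simp add: L_def lorentz_eq dot_square_norm)

lemma D_pos: "D > 0" using apex_side by (simp add: D_def L_def)

definition horo :: "real^3 \<Rightarrow> real" where "horo x = - lorentz (lift x) L"

lemma horo_pos: assumes "x \<in> hyp_space" shows "horo x > 0"
proof -
 obtain c where c: "c > 0" "lift x = c *\<^sub>R (x, 1)" using lift_point[OF assms] by blast
 have "x \<bullet> a \<le> norm x * norm a" by (rule norm_cauchy_schwarz)
 also have "\<dots> < 1" using assms apex by (simp add: mem_ball_0)
 finally show ?thesis using c by (simp add: horo_def L_def lorentz_eq)
qed

text \<open>Coordinates of the light-like vector \<open>L\<close> in the frame at \<open>v\<close>, normalised by \<open>horo v\<close>.\<close>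
definition hx :: "real^3 \<Rightarrow> (real^3) \<times> real \<Rightarrow> real" where "hx v e = - lorentz e L / horo v"

text \<open>Expand \<open>L\<close> along \<open>lift v\<close>, \<open>\<nu>\<close> and the frame;
  the identity says that \<open>L\<close> is light-like. Hence the gradient of \<open>horo\<close>
  along the base, divided by \<open>horo\<close>, has length less than 1.\<close>

lemma frame_norm:
 assumes f: "plane_frame v e1 e2"
 shows "(horo v)\<^sup>2 * (1 - (hx v e1)\<^sup>2 - (hx v e2)\<^sup>2) = D\<^sup>2" "(hx v e1)\<^sup>2 + (hx v e2)\<^sup>2 < 1"
proof -
 define h where "h = lift v"
 define F where "F = horo v"
 have vh: "v \<in> hyp_space" using f by (simp add: plane_frame_def tangent_frame_def)
 have F: "F > 0" using horo_pos[OF vh] by (simp add: F_def)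
 have o: "lorentz h h = -1" "lorentz e1 e1 = 1" "lorentz e2 e2 = 1" "lorentz h e1 = 0" "lorentz h e2 = 0" "lorentz e1 e2 = 0"
   "lorentz \<nu> h = 0" "lorentz \<nu> e1 = 0" "lorentz \<nu> e2 = 0"
  using f lift_hyperboloid[of v] by (auto simp: plane_frame_def tangent_frame_def unit_tangent_def on_hyperboloid_def h_def)
 have o': "lorentz e1 h = 0" "lorentz e2 h = 0" "lorentz e2 e1 = 0" "lorentz h \<nu> = 0" "lorentz e1 \<nu> = 0" "lorentz e2 \<nu> = 0"
  using o by (simp_all add: lorentz_commute[of e1 h] lorentz_commute[of e2 h] lorentz_commute[of e2 e1] lorentz_commute[of _ \<nu>])
 define w where "w = L + D *\<^sub>R \<nu> - F *\<^sub>R h"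
 have "lorentz \<nu> w = 0" "lorentz h w = 0" using o o' \<nu>(1) by (simp_all add: w_def D_def F_def horo_def h_def)
 hence "w = lorentz e1 w *\<^sub>R e1 + lorentz e2 w *\<^sub>R e2" unfolding h_def by (rule frame_expand[OF f])
 moreover have "lorentz e1 w = - (F * hx v e1)" "lorentz e2 w = - (F * hx v e2)"
  using o o' F by (simp_all add: w_def hx_def F_def[symmetric])
 ultimately have w: "w = (- (F * hx v e1)) *\<^sub>R e1 + (- (F * hx v e2)) *\<^sub>R e2" by simp
 have "L = F *\<^sub>R h + w - D *\<^sub>R \<nu>" by (simp add: w_def)
 hence "lorentz L L = - F\<^sup>2 + (F * hx v e1)\<^sup>2 + (F * hx v e2)\<^sup>2 + D\<^sup>2"
  unfolding w using o o' \<nu>(1) by (simp add: power2_eq_square)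
 hence e: "F\<^sup>2 * (1 - (hx v e1)\<^sup>2 - (hx v e2)\<^sup>2) = D\<^sup>2" using L_null by (simp add: power_mult_distrib algebra_simps)
 thus "(horo v)\<^sup>2 * (1 - (hx v e1)\<^sup>2 - (hx v e2)\<^sup>2) = D\<^sup>2" by (simp add: F_def)
 have "F\<^sup>2 * (1 - (hx v e1)\<^sup>2 - (hx v e2)\<^sup>2) > 0" unfolding e using D_pos by simp
 hence "1 - (hx v e1)\<^sup>2 - (hx v e2)\<^sup>2 > 0" using F by (simp add: zero_less_mult_iff)
 thus "(hx v e1)\<^sup>2 + (hx v e2)\<^sup>2 < 1" by simp
qed

lemma horo_ray:
 assumes f: "plane_frame v e1 e2"
 shows "horo (ray v (dir e1 e2 \<psi>) r) = horo v * (cosh r + (hx v e1 * cos \<psi> + hx v e2 * sin \<psi>) * sinh r)"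
proof -
 have t: "v \<in> hyp_space" "unit_tangent (lift v) (dir e1 e2 \<psi>)"
  using f dir_unit_tangent[of v e1 e2] by (auto simp: plane_frame_def tangent_frame_def)
 have F: "horo v > 0" by (rule horo_pos[OF t(1)])
 have "horo (ray v (dir e1 e2 \<psi>) r) = horo v * cosh r - sinh r * (cos \<psi> * lorentz e1 L + sin \<psi> * lorentz e2 L)"
  unfolding horo_def lift_ray(1)[OF t] by (simp add: polar_def dir_def algebra_simps)
 also have "lorentz e1 L = - (horo v * hx v e1)" using F by (simp add: hx_def)
 also have "lorentz e2 L = - (horo v * hx v e2)" using F by (simp add: hx_def)
 finally show ?thesis by (simp add: algebra_simps)
qed

definition edge_M :: "(real^3) set \<Rightarrow> real" where "edge_M e = lorentz (edge_normal e) L"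

text \<open>The least value of \<open>horo\<close> on the line carrying the edge. Its quotient with
  \<open>edge_M\<close> is the cosine of the base angle.\<close>

definition edge_K :: "(real^3) set \<Rightarrow> real" where "edge_K e = sqrt (D\<^sup>2 + (edge_M e)\<^sup>2)"

text \<open>The forms vanishing on the edge are spanned by \<open>edge_normal e\<close> and
  \<open>\<nu>\<close>; vanishing at the apex fixes their ratio, \<open>edge_K\<close> normalises,
  and the minus sign points out of the pyramid.\<close>

definition lateral_normal :: "(real^3) set \<Rightarrow> (real^3) \<times> real" where
 "lateral_normal e = - (1 / edge_K e) *\<^sub>R (D *\<^sub>R edge_normal e + edge_M e *\<^sub>R \<nu>)"

lemma edge_K: "edge_K e > 0" "(edge_K e)\<^sup>2 = D\<^sup>2 + (edge_M e)\<^sup>2" using D_pos by (auto simp: edge_K_def add_pos_nonneg)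

lemma pyramid_A: "x \<in> pyramid A a \<longleftrightarrow> (\<exists>y\<in>A. \<exists>t. 0 \<le> t \<and> t \<le> 1 \<and> x = (1 - t) *\<^sub>R y + t *\<^sub>R a)"
 by (rule pyramid_points) (use A_facts in auto)

lemma outer_normal_base: "outer_normal (pyramid A a) A = \<nu>"
proof (rule outer_normal_eq[where ?x0.0 = a])
 have A0: "lorentz \<nu> (y, 1) = 0" if "y \<in> A" for y using \<nu>(2) hull_inc[OF that, of affine] by blast
 show "lorentz \<nu> \<nu> = 1" by (rule \<nu>(1))
 have p: "lorentz \<nu> ((1 - t) *\<^sub>R y + t *\<^sub>R a, 1) = - t * D" if "y \<in> A" for t y
  unfolding lorentz_point_affine using A0[OF that] by (simp add: D_def L_def)
 show "lorentz \<nu> (x, 1) \<le> 0" if "x \<in> pyramid A a" for x using that p D_pos unfolding pyramid_A by auto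
 show "A = {x \<in> pyramid A a. lorentz \<nu> (x, 1) = 0}"
 proof (intro set_eqI iffI)
  fix x assume "x \<in> A"
  thus "x \<in> {x \<in> pyramid A a. lorentz \<nu> (x, 1) = 0}" using A0[of x] unfolding mem_Collect_eq pyramid_A
   by (intro conjI bexI[of _ x] exI[of _ 0]) auto
 next
  fix x assume "x \<in> {x \<in> pyramid A a. lorentz \<nu> (x, 1) = 0}"
  then obtain y t where "y \<in> A" "x = (1 - t) *\<^sub>R y + t *\<^sub>R a" "lorentz \<nu> (x, 1) = 0" unfolding mem_Collect_eq pyramid_A by blast
  hence "t = 0" using p[of y t] D_pos by simp
  thus "x \<in> A" using \<open>x = _\<close> \<open>y \<in> A\<close> by simp
 qed
 \<comment> \<open>A corner of \<open>A\<close> supplies two independent directions of the plane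
   along which a form vanishing on \<open>A\<close> must vanish.\<close>
 obtain y where ye: "y extreme_point_of A" using extreme_point_exists_convex[OF A_facts(6,5,8)] by blast
 hence y: "y \<in> A" by (simp add: extreme_point_of_def)
 show "a \<in> pyramid A a" unfolding pyramid_A using y by (intro bexI[of _ y] exI[of _ 1]) auto
 show "lorentz \<nu> (a, 1) < 0" by (rule apex_side)
 fix w assume w: "\<And>x. x \<in> A ==> lorentz w (x, 1) = 0"
 hence wl: "lorentz w (lift x) = 0" if "x \<in> A" for x using lorentz_scaled_point(1)[OF A_hyp[OF that]] that by blast
 obtain C eps where Cs: "corner_system y C eps" using corner_system_exists[OF y] by blast
 hence C: "corner_sectors y C eps" by (simp add: corner_system_def)
 obtain k where k: "k \<in> C" using Cs ye unfolding corner_system_def corner_type_def by auto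
 define e1 e2 \<beta> where "e1 = fst k" and "e2 = fst (snd k)" and "\<beta> = corner_angle k"
 have fr: "plane_frame y e1 e2" and \<beta>: "0 < \<beta>" "\<beta> \<le> pi" and eps: "eps > 0"
  using C k unfolding corner_sectors_def by (auto simp: e1_def e2_def \<beta>_def)
 have z: "lorentz w (dir e1 e2 \<psi>) = 0" if "\<psi> \<in> {0..\<beta>}" for \<psi>
 proof -
  have ut: "y \<in> hyp_space" "unit_tangent (lift y) (dir e1 e2 \<psi>)"
   using fr dir_unit_tangent[of y e1 e2] by (auto simp: plane_frame_def tangent_frame_def)
  have "corner_ray y k (eps/2) \<psi> \<in> A" using C k that eps unfolding corner_sectors_def by (simp add: \<beta>_def)
  from wl[OF this] have "lorentz w (polar (lift y) (dir e1 e2 \<psi>) (eps/2)) = 0"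
   unfolding corner_ray_def e1_def[symmetric] e2_def[symmetric] lift_ray(1)[OF ut] .
  hence "sinh (eps/2) * lorentz w (dir e1 e2 \<psi>) = 0" using wl[OF y] by (simp add: polar_def)
  thus ?thesis using eps by simp
 qed
 have we1: "lorentz w e1 = 0" using z[of 0] \<beta> by (simp add: dir_def)
 have "lorentz w (dir e1 e2 (\<beta>/2)) = 0" using z[of "\<beta>/2"] \<beta> by simp
 hence "sin (\<beta>/2) * lorentz w e2 = 0" using we1 by (simp add: dir_def)
 moreover have "sin (\<beta>/2) > 0" using \<beta> by (intro sin_gt_zero) auto
 ultimately have we2: "lorentz w e2 = 0" by simp
 define w' where "w' = w - lorentz w \<nu> *\<^sub>R \<nu>"
 have fe: "lorentz \<nu> e1 = 0" "lorentz \<nu> e2 = 0" "lorentz \<nu> (lift y) = 0" using fr by (auto simp: plane_frame_def)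
 have sym: "lorentz e1 w = 0" "lorentz e2 w = 0" "lorentz (lift y) w = 0" "lorentz e1 \<nu> = 0" "lorentz e2 \<nu> = 0" "lorentz (lift y) \<nu> = 0"
  using we1 we2 wl[OF y] fe by (simp_all add: lorentz_commute)
 have wexp: "w' = lorentz e1 w' *\<^sub>R e1 + lorentz e2 w' *\<^sub>R e2"
  by (rule frame_expand[OF fr]) (use \<nu>(1) sym in \<open>simp_all add: w'_def lorentz_commute[of w \<nu>]\<close>)
 have z0: "lorentz e1 w' = 0" "lorentz e2 w' = 0" using sym by (simp_all add: w'_def)
 have "w' = 0" using wexp unfolding z0 by simp
 thus "\<exists>c. w = c *\<^sub>R \<nu>" by (intro exI[of _ "lorentz w \<nu>"]) (simp add: w'_def)
qed

lemma lateral_normal_L: "lorentz (lateral_normal e) (a, 1) = 0"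
proof -
 have "D * edge_M e + edge_M e * lorentz \<nu> L = 0" by (simp add: D_def)
 thus ?thesis by (simp add: lateral_normal_def edge_M_def flip: L_def)
qed

text \<open>A form that vanishes on the lateral face vanishes at the apex, at a point of the edge
  and in the direction of the edge; only a line of such forms is left.\<close>

lemma outer_normal_lateral:
 assumes e: "e edge_of A"
 shows "outer_normal (pyramid A a) (pyramid e a) = lateral_normal e"
proof -
 have pe: "x \<in> pyramid e a \<longleftrightarrow> (\<exists>y\<in>e. \<exists>t. 0 \<le> t \<and> t \<le> 1 \<and> x = (1 - t) *\<^sub>R y + t *\<^sub>R a)" for x
  by (rule pyramid_points) (use edge_facts[OF e] in auto)
 have A0: "lorentz \<nu> (y, 1) = 0" if "y \<in> A" for y using \<nu>(2) hull_inc[OF that, of affine] by blast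
 have nA: "lorentz (lateral_normal e) (y, 1) = - (D / edge_K e) * lorentz (edge_normal e) (y, 1)" if "y \<in> A" for y
  using A0[OF that] by (simp add: lateral_normal_def)
 have p: "lorentz (lateral_normal e) ((1 - t) *\<^sub>R y + t *\<^sub>R a, 1) = - ((1 - t) * ((D / edge_K e) * lorentz (edge_normal e) (y, 1)))"
  if "y \<in> A" for t y unfolding lorentz_point_affine lateral_normal_L nA[OF that] by simp
 have pos: "lorentz (edge_normal e) (y, 1) \<ge> 0" "lorentz (edge_normal e) (y, 1) = 0 \<longleftrightarrow> y \<in> e" if "y \<in> A" for y
  using edge_normal[OF e] that unfolding is_edge_normal_def by auto
 have DK: "D / edge_K e > 0" using D_pos edge_K(1) by simp
 obtain v where v: "v \<in> e" using edge_facts(3)[OF e] by blast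
 obtain b where b: "b \<in> e" "b \<noteq> v" using edge_other_point[OF e v] by blast
 obtain e1 where f: "plane_frame v e1 (edge_normal e)" "b = ray v e1 (hyp_dist v b)" "hyp_dist v b > 0" using edge_frame[OF e v b] by blast
 have vb: "v \<in> A" "b \<in> A" using v b edge_facts(1)[OF e] by auto
 have fe: "lorentz \<nu> e1 = 0" "lorentz \<nu> (edge_normal e) = 0" "lorentz \<nu> (lift v) = 0" "lorentz e1 e1 = 1"
  "unit_tangent (lift v) e1" "v \<in> hyp_space" using f(1) by (auto simp: plane_frame_def tangent_frame_def unit_tangent_def)
 obtain x0 where x0: "x0 \<in> A" "x0 \<notin> e" using edge_facts(1,7)[OF e] by blast
 show ?thesis
 proof (rule outer_normal_eq[where ?x0.0 = x0])
  show "lorentz (lateral_normal e) (lateral_normal e) = 1"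
  proof -
   have "lorentz (lateral_normal e) (lateral_normal e) = (1 / edge_K e)\<^sup>2 * (D\<^sup>2 + (edge_M e)\<^sup>2)"
    using edge_normal_facts(1,2)[OF e] \<nu>(1)
    by (simp add: lateral_normal_def lorentz_commute[of "edge_normal e" \<nu>] power2_eq_square algebra_simps)
   thus ?thesis unfolding edge_K(2)[symmetric] using edge_K(1)[of e] by (simp add: power_divide)
  qed
  show "lorentz (lateral_normal e) (x, 1) \<le> 0" if "x \<in> pyramid A a" for x
  proof -
   obtain y t where y: "y \<in> A" "0 \<le> t" "t \<le> 1" "x = (1 - t) *\<^sub>R y + t *\<^sub>R a" using \<open>x \<in> pyramid A a\<close> unfolding pyramid_A by blast
   have "(1 - t) * ((D / edge_K e) * lorentz (edge_normal e) (y, 1)) \<ge> 0"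
    using y pos(1)[OF y(1)] DK by (intro mult_nonneg_nonneg) auto
   thus ?thesis unfolding y(4) p[OF y(1)] by simp
  qed
  show "pyramid e a = {x \<in> pyramid A a. lorentz (lateral_normal e) (x, 1) = 0}"
  proof (intro set_eqI iffI)
   fix x assume "x \<in> pyramid e a"
   then obtain y t where y: "y \<in> e" "0 \<le> t" "t \<le> 1" "x = (1 - t) *\<^sub>R y + t *\<^sub>R a" unfolding pe by blast
   have yA: "y \<in> A" using y(1) edge_facts(1)[OF e] by blast
   have "x \<in> pyramid A a" unfolding pyramid_A using y yA by blast
   moreover have "lorentz (lateral_normal e) (x, 1) = 0" unfolding y(4) p[OF yA] using pos(2)[OF yA] y(1) by simp
   ultimately show "x \<in> {x \<in> pyramid A a. lorentz (lateral_normal e) (x, 1) = 0}" by simp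
  next
   fix x assume "x \<in> {x \<in> pyramid A a. lorentz (lateral_normal e) (x, 1) = 0}"
   then obtain y t where y: "y \<in> A" "0 \<le> t" "t \<le> 1" "x = (1 - t) *\<^sub>R y + t *\<^sub>R a" "lorentz (lateral_normal e) (x, 1) = 0"
    unfolding mem_Collect_eq pyramid_A by blast
   have "(1 - t) * ((D / edge_K e) * lorentz (edge_normal e) (y, 1)) = 0" using y(5) unfolding y(4) p[OF y(1)] by simp
   hence "t = 1 \<or> y \<in> e" using pos(2)[OF y(1)] DK by auto
   thus "x \<in> pyramid e a"
   proof
    assume "t = 1"
    thus ?thesis unfolding pe using y v by (intro bexI[of _ v] exI[of _ 1]) auto
   next
    assume "y \<in> e" thus ?thesis unfolding pe using y by blast
   qed
  qed
  show "x0 \<in> pyramid A a" unfolding pyramid_A using x0 by (intro bexI[of _ x0] exI[of _ 0]) auto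
  have "lorentz (edge_normal e) (x0, 1) > 0" using pos[OF x0(1)] x0(2) by (simp add: less_le)
  hence "(D / edge_K e) * lorentz (edge_normal e) (x0, 1) > 0" using DK by (intro mult_pos_pos)
  moreover have "lorentz (lateral_normal e) (x0, 1) = - ((D / edge_K e) * lorentz (edge_normal e) (x0, 1))" using nA[OF x0(1)] by simp
  ultimately show "lorentz (lateral_normal e) (x0, 1) < 0" by linarith
  fix w assume w: "\<And>x. x \<in> pyramid e a ==> lorentz w (x, 1) = 0"
  have "a \<in> pyramid e a" "v \<in> pyramid e a" "b \<in> pyramid e a"
   unfolding pe using v b by (metis (no_types) diff_self scaleR_one scaleR_zero_left add_0 zero_le_one order_refl)
    (use v b in \<open>auto intro!: bexI exI[of _ 0]\<close>)
  hence w0: "lorentz w L = 0" "lorentz w (lift v) = 0" "lorentz w (lift b) = 0"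
   using w lorentz_scaled_point(1)[OF A_hyp] vb by (auto simp: L_def)
  have "lift b = polar (lift v) e1 (hyp_dist v b)" using lift_ray(1)[OF fe(6,5), of "hyp_dist v b"] f(2) by simp
  hence "sinh (hyp_dist v b) * lorentz w e1 = 0" using w0 by (simp add: polar_def)
  hence we1: "lorentz w e1 = 0" using f(3) by simp
  define w' where "w' = w - lorentz w \<nu> *\<^sub>R \<nu>"
  have sym: "lorentz e1 w = 0" "lorentz (lift v) w = 0" "lorentz e1 \<nu> = 0" "lorentz (lift v) \<nu> = 0"
   using we1 w0 fe by (simp_all add: lorentz_commute)
  define c where "c = lorentz (edge_normal e) w'"
  have wexp: "w' = lorentz e1 w' *\<^sub>R e1 + c *\<^sub>R edge_normal e" unfolding c_def
   by (rule frame_expand[OF f(1)]) (use \<nu>(1) sym in \<open>simp_all add: w'_def lorentz_commute[of w \<nu>]\<close>)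
  have z0: "lorentz e1 w' = 0" using sym by (simp add: w'_def)
  have "w' = c *\<^sub>R edge_normal e" using wexp unfolding z0 by simp
  moreover have "w = w' + lorentz w \<nu> *\<^sub>R \<nu>" by (simp add: w'_def)
  ultimately have w': "w = c *\<^sub>R edge_normal e + lorentz w \<nu> *\<^sub>R \<nu>" by simp
  have "lorentz w L = c * edge_M e - lorentz w \<nu> * D" by (subst w') (simp add: edge_M_def D_def)
  hence "lorentz w \<nu> = c * edge_M e / D" using w0(1) D_pos by (simp add: field_simps)
  hence "w = (c / D) *\<^sub>R (D *\<^sub>R edge_normal e + edge_M e *\<^sub>R \<nu>)" using w' D_pos by (simp add: algebra_simps)
  hence "w = (- c / D * edge_K e) *\<^sub>R lateral_normal e" using edge_K(1)[of e] by (simp add: lateral_normal_def)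
  thus "\<exists>c. w = c *\<^sub>R lateral_normal e" by blast
 qed
qed

lemma base_angle_eq:
 assumes e: "e edge_of A" shows "base_angle A a e = arccos (edge_M e / edge_K e)" "\<bar>edge_M e / edge_K e\<bar> \<le> 1"
proof -
 have "lorentz \<nu> (lateral_normal e) = - (edge_M e / edge_K e)"
  using edge_normal_facts(2)[OF e] \<nu>(1) by (simp add: lateral_normal_def)
 thus "base_angle A a e = arccos (edge_M e / edge_K e)"
  by (simp add: base_angle_def dihedral_angle_def outer_normal_base outer_normal_lateral[OF e])
 have "(edge_M e)\<^sup>2 \<le> (edge_K e)\<^sup>2" using edge_K(2)[of e] by simp
 hence "\<bar>edge_M e\<bar> \<le> edge_K e" using edge_K(1)[of e] by (metis abs_le_square_iff abs_of_pos)
 thus "\<bar>edge_M e / edge_K e\<bar> \<le> 1" using edge_K(1)[of e] by (simp add: abs_divide)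
qed

text \<open>\<open>edge_K\<close> only depends on the restriction of \<open>horo\<close> to the edge.\<close>
lemma edge_K_eq:
 assumes e: "e edge_of A" "x \<in> e" "y \<in> e" "x \<noteq> y"
 shows "(edge_K e)\<^sup>2 * (sinh (hyp_dist x y))\<^sup>2 = 2 * horo x * horo y * cosh (hyp_dist x y) - (horo x)\<^sup>2 - (horo y)\<^sup>2"
proof -
 obtain e1 where f: "plane_frame x e1 (edge_normal e)" "y = ray x e1 (hyp_dist x y)" using edge_frame[OF e(1,2,3)] e(4) by blast
 define d F where "d = hyp_dist x y" and "F = horo x"
 have Fp: "F > 0" unfolding F_def by (rule horo_pos) (use f(1) in \<open>simp add: plane_frame_def tangent_frame_def\<close>)
 have y: "horo y = F * (cosh d + hx x e1 * sinh d)" using horo_ray[OF f(1), of 0 d] f(2) by (simp add: dir_def F_def d_def)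
 have K: "(edge_K e)\<^sup>2 = F\<^sup>2 * (1 - (hx x e1)\<^sup>2)"
 proof -
  have "edge_M e = - F * hx x (edge_normal e)" using Fp by (simp add: edge_M_def hx_def F_def)
  hence "(edge_M e)\<^sup>2 = F\<^sup>2 * (hx x (edge_normal e))\<^sup>2" by (simp add: power_mult_distrib)
  thus ?thesis using frame_norm(1)[OF f(1)] unfolding edge_K(2) F_def by (simp add: algebra_simps)
 qed
 have c: "(cosh d)\<^sup>2 = (sinh d)\<^sup>2 + 1" by (simp add: cosh_square_eq)
 have "F\<^sup>2 * (1 - (hx x e1)\<^sup>2) * (sinh d)\<^sup>2 = 2 * F * (F * (cosh d + hx x e1 * sinh d)) * cosh d - F\<^sup>2 - (F * (cosh d + hx x e1 * sinh d))\<^sup>2"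
  using c by algebra
 thus ?thesis unfolding K y d_def[symmetric] F_def[symmetric] .
qed

text \<open>In the unit sphere at \<open>v\<close> the two lateral faces are great circles through
  the direction of the apex, so their angle is the spherical angle there, opposite to the side
  \<open>\<beta>\<close>. The cosines \<open>hx\<close> refer to the opposite direction, which does
  not change that angle.\<close>

lemma lateral_angle_eq:
 assumes v: "v extreme_point_of A"
  and k: "e edge_of A" "f edge_of A" "e \<noteq> f" "v \<in> e" "v \<in> f" "\<And>g. g edge_of A ==> v \<in> g ==> g = e \<or> g = f"
  and fr: "plane_frame v e1 e2" and n: "edge_normal e = e2" "edge_normal f = sin \<beta> *\<^sub>R e1 - cos \<beta> *\<^sub>R e2"
 shows "lateral_angle A a v = sector_angle \<beta> (hx v e1) (hx v e1 * cos \<beta> + hx v e2 * sin \<beta>)"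
proof -
 define F x p where "F = horo v" and "x = hx v e1" and "p = hx v e2"
 define y q where "y = x * cos \<beta> + p * sin \<beta>" and "q = p * cos \<beta> - x * sin \<beta>"
 have Fp: "F > 0" unfolding F_def by (rule horo_pos) (use fr in \<open>simp add: plane_frame_def tangent_frame_def\<close>)
 have D2: "D\<^sup>2 = F\<^sup>2 * (1 - x\<^sup>2 - p\<^sup>2)" and xp: "x\<^sup>2 + p\<^sup>2 < 1" using frame_norm[OF fr] by (simp_all add: F_def x_def p_def)
 have yq: "y\<^sup>2 + q\<^sup>2 = x\<^sup>2 + p\<^sup>2" unfolding y_def q_def by (rule rot_norm)
 have x1: "x\<^sup>2 < 1" "y\<^sup>2 < 1" using xp yq by (smt (verit) zero_le_power2)+
 have Me: "edge_M e = - (F * p)" using Fp by (simp add: edge_M_def n(1) p_def hx_def F_def)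
 have Mf: "edge_M f = F * q"
 proof -
  have "lorentz e1 L = - (F * x)" "lorentz e2 L = - (F * p)" using Fp by (simp_all add: x_def p_def hx_def F_def)
  thus ?thesis by (simp add: edge_M_def n(2) q_def algebra_simps)
 qed
 have Ke: "edge_K e = F * sqrt (1 - x\<^sup>2)"
 proof -
  have "D\<^sup>2 + (edge_M e)\<^sup>2 = F\<^sup>2 * (1 - x\<^sup>2)" unfolding D2 Me by (simp add: power_mult_distrib algebra_simps)
  thus ?thesis using Fp by (simp add: edge_K_def real_sqrt_mult)
 qed
 have Kf: "edge_K f = F * sqrt (1 - y\<^sup>2)"
 proof -
  have "1 - y\<^sup>2 = 1 - x\<^sup>2 - p\<^sup>2 + q\<^sup>2" using yq by simp
  hence "D\<^sup>2 + (edge_M f)\<^sup>2 = F\<^sup>2 * (1 - y\<^sup>2)" unfolding D2 Mf by (simp add: power_mult_distrib algebra_simps)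
  thus ?thesis using Fp by (simp add: edge_K_def real_sqrt_mult)
 qed
 have o: "lorentz e1 e1 = 1" "lorentz e2 e2 = 1" "lorentz e1 e2 = 0" "lorentz e2 e1 = 0" "lorentz \<nu> e1 = 0" "lorentz \<nu> e2 = 0"
   "lorentz e1 \<nu> = 0" "lorentz e2 \<nu> = 0"
  using fr by (auto simp: plane_frame_def tangent_frame_def unit_tangent_def lorentz_commute[of e2 e1] lorentz_commute[of _ \<nu>])
 have ln: "- lorentz (lateral_normal e) (lateral_normal f) = (cos \<beta> - x * y) / (sqrt (1 - x\<^sup>2) * sqrt (1 - y\<^sup>2))"
 proof -
  define E1 E2 where "E1 = D *\<^sub>R edge_normal e + edge_M e *\<^sub>R \<nu>" and "E2 = D *\<^sub>R edge_normal f + edge_M f *\<^sub>R \<nu>"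
  have E: "lorentz E1 E2 = - (D\<^sup>2 * cos \<beta> - edge_M e * edge_M f)"
   unfolding E1_def E2_def n using o \<nu>(1) by (simp add: power2_eq_square algebra_simps)
  have "lateral_normal e = (- (1 / edge_K e)) *\<^sub>R E1" "lateral_normal f = (- (1 / edge_K f)) *\<^sub>R E2"
   by (simp_all add: lateral_normal_def E1_def E2_def)
  hence "- lorentz (lateral_normal e) (lateral_normal f) = - lorentz E1 E2 / (edge_K e * edge_K f)"
   by (simp del: scaleR_minus_left add: lorentz_simps)
  also have "\<dots> = (D\<^sup>2 * cos \<beta> - edge_M e * edge_M f) / (edge_K e * edge_K f)" unfolding E by simp
  also have "D\<^sup>2 * cos \<beta> - edge_M e * edge_M f = F\<^sup>2 * (cos \<beta> - x * y)"
   unfolding D2 Me Mf y_def q_def by (simp add: power2_eq_square algebra_simps)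
  also have "edge_K e * edge_K f = F\<^sup>2 * (sqrt (1 - x\<^sup>2) * sqrt (1 - y\<^sup>2))" unfolding Ke Kf by (simp add: power2_eq_square)
  finally show ?thesis using Fp by simp
 qed
 have on: "outer_normal (pyramid A a) (pyramid e a) = lateral_normal e" "outer_normal (pyramid A a) (pyramid f a) = lateral_normal f"
  using outer_normal_lateral k by auto
 have de: "dihedral_angle (pyramid A a) (pyramid e a) (pyramid f a) = sector_angle \<beta> x y"
   "dihedral_angle (pyramid A a) (pyramid f a) (pyramid e a) = sector_angle \<beta> x y"
  unfolding dihedral_angle_def on sector_angle_def ln[symmetric] by (simp_all add: lorentz_commute)
 have "lateral_angle A a v = sector_angle \<beta> x y" unfolding lateral_angle_def
 proof (rule the_equality)
  show "\<exists>e f. e edge_of A \<and> f edge_of A \<and> e \<noteq> f \<and> v \<in> e \<and> v \<in> f \<and>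
   sector_angle \<beta> x y = dihedral_angle (pyramid A a) (pyramid e a) (pyramid f a)" using k de(1) by metis
  fix \<omega> assume "\<exists>e f. e edge_of A \<and> f edge_of A \<and> e \<noteq> f \<and> v \<in> e \<and> v \<in> f \<and>
   \<omega> = dihedral_angle (pyramid A a) (pyramid e a) (pyramid f a)"
  then obtain e' f' where "e' edge_of A" "f' edge_of A" "e' \<noteq> f'" "v \<in> e'" "v \<in> f'"
   "\<omega> = dihedral_angle (pyramid A a) (pyramid e' a) (pyramid f' a)" by blast
  thus "\<omega> = sector_angle \<beta> x y" using k(6)[of e'] k(6)[of f'] de by auto
 qed
 thus ?thesis by (simp add: x_def p_def y_def)
qed

end

lemma apexed_polygon_exists:
 assumes "semi_ideal_pyramid A a" shows "\<exists>\<nu>. apexed_polygon A \<nu> a"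
proof -
 have A: "convex_polygon A" "a \<in> sphere 0 1" "a \<notin> affine hull A" using assms by (auto simp: semi_ideal_pyramid_def)
 obtain \<nu> where p: "polygon A \<nu>" using polygon_exists[OF A(1)] by blast
 have n: "polygon A (- \<nu>)" using p by (simp add: polygon_def)
 have "lorentz \<nu> (a, 1) \<noteq> 0" using p A(3) by (simp add: polygon_def)
 hence "lorentz \<nu> (a, 1) < 0 \<or> lorentz (- \<nu>) (a, 1) < 0" by auto
 thus ?thesis using p n A(2) unfolding apexed_polygon_def apexed_polygon_axioms_def by blast
qed

section \<open>Vertical coordinates in a pyramid\<close>

definition horofn :: "real^3 \<Rightarrow> real^3 \<Rightarrow> real" where
 "horofn a x = - lorentz (lift x) (a, 1)"

text \<open>The point on the half-line from \<open>y\<close> to the apex where the horofunction has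
  dropped by the factor \<open>t\<close>. The coefficient of \<open>(a, 1)\<close> is forced by the
  equation of the hyperboloid.\<close>

definition vertical :: "real^3 \<Rightarrow> real^3 \<Rightarrow> real \<Rightarrow> real^3" where
 "vertical a y t = klein (t *\<^sub>R lift y + ((1 - t\<^sup>2) / (2 * t * horofn a y)) *\<^sub>R (a, 1))"

lemma horofn_pos: assumes "x \<in> hyp_space" "a \<in> sphere 0 1" shows "horofn a x > 0"
proof -
 obtain c where c: "c > 0" "lift x = c *\<^sub>R (x, 1)" using lift_point[OF assms(1)] by blast
 have "x \<bullet> a \<le> norm x * norm a" by (rule norm_cauchy_schwarz)
 also have "\<dots> < 1" using assms by (simp add: mem_ball_0)
 finally show ?thesis using c by (simp add: horofn_def lorentz_eq)
qed

lemma horofn_horoball: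
 assumes "x \<in> hyp_space" shows "x \<in> horoball a c \<longleftrightarrow> horofn a x < c"
proof -
 have "horofn a x = (1 - x \<bullet> a) / sqrt (1 - x \<bullet> x)" by (simp add: horofn_def lift_def lorentz_eq diff_divide_distrib)
 thus ?thesis using assms by (simp add: horoball_def)
qed

lemma apex_null: "a \<in> sphere 0 1 ==> lorentz (a, 1) (a, 1) = 0" by (simp add: lorentz_eq dot_square_norm)

lemma lift_vertical:
 assumes y: "y \<in> hyp_space" and a: "a \<in> sphere 0 1" and t: "0 < t" "t \<le> 1"
 shows "lift (vertical a y t) = t *\<^sub>R lift y + ((1 - t\<^sup>2) / (2 * t * horofn a y)) *\<^sub>R (a, 1)"
  and "vertical a y t \<in> hyp_space" and "horofn a (vertical a y t) = t * horofn a y"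
proof -
 define G where "G = (1 - t\<^sup>2) / (2 * t * horofn a y)"
 have h: "horofn a y > 0" by (rule horofn_pos[OF y a])
 have G: "G \<ge> 0" using h t by (auto simp: G_def power_le_one divide_nonneg_pos)
 have ya: "lorentz (lift y) (a, 1) = - horofn a y" "lorentz (a, 1) (lift y) = - horofn a y" by (simp_all add: horofn_def lorentz_commute)
 have yy: "lorentz (lift y) (lift y) = -1" "snd (lift y) > 0" using lift_hyperboloid[OF y] by (auto simp: on_hyperboloid_def)
 have "lorentz (t *\<^sub>R lift y + G *\<^sub>R (a, 1)) (t *\<^sub>R lift y + G *\<^sub>R (a, 1)) = - t\<^sup>2 - 2 * t * G * horofn a y"
  by (simp only: lorentz_simps ya yy apex_null[OF a]) (simp add: power2_eq_square algebra_simps)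
 also have "2 * t * G * horofn a y = 1 - t\<^sup>2" using h t by (simp add: G_def)
 finally have "on_hyperboloid (t *\<^sub>R lift y + G *\<^sub>R (a, 1))"
  unfolding on_hyperboloid_def using yy(2) t G by (simp add: add_pos_nonneg)
 from klein_hyperboloid[OF this]
 show l: "lift (vertical a y t) = t *\<^sub>R lift y + ((1 - t\<^sup>2) / (2 * t * horofn a y)) *\<^sub>R (a, 1)"
  and "vertical a y t \<in> hyp_space" by (simp_all add: vertical_def G_def)
 show "horofn a (vertical a y t) = t * horofn a y"
  unfolding horofn_def[of a "vertical a y t"] l by (simp add: ya apex_null[OF a] del: scaleR_Pair)
qed

lemma vertical_pyramid:
 assumes S: "convex S" "S \<subseteq> hyp_space" and y: "y \<in> S" and a: "a \<in> sphere 0 1" and t: "0 < t" "t \<le> 1"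
 shows "vertical a y t \<in> pyramid S a - {a}"
proof -
 have yh: "y \<in> hyp_space" using S y by blast
 define G where "G = (1 - t\<^sup>2) / (2 * t * horofn a y)"
 have h: "horofn a y > 0" by (rule horofn_pos[OF yh a])
 have G: "G \<ge> 0" using h t by (auto simp: G_def power_le_one divide_nonneg_pos)
 obtain c where c: "c > 0" "lift y = c *\<^sub>R (y, 1)" using lift_point[OF yh] by blast
 define d where "d = t * c + G"
 have d: "d > 0" using t c G by (simp add: d_def add_pos_nonneg)
 have "vertical a y t = ((t * c) *\<^sub>R y + G *\<^sub>R a) /\<^sub>R d" by (simp add: vertical_def c(2) klein_def d_def G_def)
 also have "\<dots> = (1 - G / d) *\<^sub>R y + (G / d) *\<^sub>R a"
 proof -
  have "1 - G / d = t * c / d" using d by (simp add: d_def field_simps)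
  thus ?thesis by (simp add: scaleR_add_right divide_inverse mult.commute)
 qed
 finally have e: "vertical a y t = (1 - G / d) *\<^sub>R y + (G / d) *\<^sub>R a" .
 have "0 \<le> G / d" "G / d \<le> 1" using G d t c by (auto simp: d_def)
 moreover have "S \<noteq> {}" using y by blast
 ultimately have "vertical a y t \<in> pyramid S a" unfolding pyramid_points[OF S(1) \<open>S \<noteq> {}\<close>] using e y by blast
 moreover have "vertical a y t \<noteq> a" using lift_vertical(2)[OF yh a t] a by (auto simp: mem_ball_0)
 ultimately show ?thesis by blast
qed

lemma pyramid_vertical:
 assumes S: "convex S" "S \<subseteq> hyp_space" "S \<noteq> {}" and a: "a \<in> sphere 0 1" and q: "q \<in> pyramid S a - {a}"
 shows "\<exists>y\<in>S. \<exists>t. 0 < t \<and> t \<le> 1 \<and> q = vertical a y t"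
proof -
 obtain y s where y: "y \<in> S" "0 \<le> s" "s \<le> 1" "q = (1 - s) *\<^sub>R y + s *\<^sub>R a" using q pyramid_points[OF S(1,3)] by blast
 have s1: "s < 1" using y q by (cases "s = 1") auto
 have yh: "y \<in> hyp_space" using S y by blast
 have "norm q \<le> (1 - s) * norm y + s * norm a" unfolding y(4) using y(2,3) by (intro norm_triangle_le) simp
 also have "\<dots> < (1 - s) * 1 + s * 1" using yh a s1 y(2) by (intro add_less_le_mono mult_strict_left_mono) (auto simp: mem_ball_0)
 finally have qh: "q \<in> hyp_space" by (simp add: mem_ball_0)
 obtain c where c: "c > 0" "lift y = c *\<^sub>R (y, 1)" using lift_point[OF yh] by blast
 obtain d where d: "d > 0" "lift q = d *\<^sub>R (q, 1)" using lift_point[OF qh] by blast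
 define t G where "t = d * (1 - s) / c" and "G = d * s"
 have t0: "t > 0" using d c s1 by (simp add: t_def)
 have G0: "G \<ge> 0" using d y by (simp add: G_def)
 have lq: "lift q = t *\<^sub>R lift y + G *\<^sub>R (a, 1)"
 proof -
  have "(q, 1::real) = (1 - s) *\<^sub>R (y, 1) + s *\<^sub>R (a, 1)" by (simp add: y(4))
  hence "lift q = (d * (1 - s)) *\<^sub>R (y, 1) + (d * s) *\<^sub>R (a, 1)" unfolding d(2) by (simp only: scaleR_add_right scaleR_scaleR)
  thus ?thesis using c by (simp add: t_def G_def)
 qed
 have h: "horofn a y > 0" by (rule horofn_pos[OF yh a])
 have ya: "lorentz (lift y) (a, 1) = - horofn a y" "lorentz (a, 1) (lift y) = - horofn a y" by (simp_all add: horofn_def lorentz_commute)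
 have yy: "lorentz (lift y) (lift y) = -1" "lorentz (lift q) (lift q) = -1"
  using lift_hyperboloid[OF yh] lift_hyperboloid[OF qh] by (auto simp: on_hyperboloid_def)
 have "-1 = - t\<^sup>2 - 2 * t * G * horofn a y" using yy(2) unfolding lq
  by (simp only: lorentz_simps ya yy(1) apex_null[OF a]) (simp add: power2_eq_square algebra_simps)
 hence e: "2 * t * G * horofn a y = 1 - t\<^sup>2" by simp
 have "2 * t * G * horofn a y \<ge> 0" using t0 G0 h by simp
 hence "t\<^sup>2 \<le> 1" using e by simp
 hence t1: "t \<le> 1" using t0 by (simp add: power_le_one_iff abs_square_le_1)
 have "G = (1 - t\<^sup>2) / (2 * t * horofn a y)" using e t0 h by (simp add: field_simps)
 hence "q = vertical a y t" using klein_lift[OF qh] lq by (simp add: vertical_def)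
 thus ?thesis using y(1) t0 t1 by blast
qed

lemma vertical_1: "y \<in> hyp_space ==> vertical a y 1 = y" by (simp add: vertical_def klein_lift flip: zero_prod_def)

lemma cosh_dist_vertical:
 assumes y: "y \<in> hyp_space" "p \<in> hyp_space" and a: "a \<in> sphere 0 1" and t: "0 < t" "t \<le> 1"
 shows "cosh (hyp_dist p (vertical a y t)) = t * cosh (hyp_dist p y) + ((1 - t\<^sup>2) / (2 * t * horofn a y)) * horofn a p"
 unfolding cosh_hyp_dist[OF y(2) lift_vertical(2)[OF y(1) a t]] lift_vertical(1)[OF y(1) a t] cosh_hyp_dist[OF y(2,1)]
 by (simp only: lorentz_simps) (simp add: horofn_def)

text \<open>Only the distance of the feet, the two depths and the ratio of the horofunctions enter.
  This is why proportional horofunctions lead to isometric cusps.\<close>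

lemma cosh_dist_verticals:
 assumes y: "y \<in> hyp_space" "y' \<in> hyp_space" and a: "a \<in> sphere 0 1" and t: "0 < t" "t \<le> 1" "0 < t'" "t' \<le> 1"
 shows "cosh (hyp_dist (vertical a y t) (vertical a y' t')) =
  t * t' * cosh (hyp_dist y y') + t' * ((1 - t\<^sup>2) / (2 * t * horofn a y)) * horofn a y' + t * ((1 - t'\<^sup>2) / (2 * t' * horofn a y')) * horofn a y"
proof -
 have "cosh (hyp_dist (vertical a y t) (vertical a y' t')) =
   t' * cosh (hyp_dist (vertical a y t) y') + ((1 - t'\<^sup>2) / (2 * t' * horofn a y')) * (t * horofn a y)"
  using cosh_dist_vertical[OF y(2) lift_vertical(2)[OF y(1) a t(1,2)] a t(3,4)] lift_vertical(3)[OF y(1) a t(1,2)] by simp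
 also have "cosh (hyp_dist (vertical a y t) y') = t * cosh (hyp_dist y y') + ((1 - t\<^sup>2) / (2 * t * horofn a y)) * horofn a y'"
  using cosh_dist_vertical[OF y(1) y(2) a t(1,2)] by (simp add: hyp_dist_commute)
 finally show ?thesis by (simp add: algebra_simps)
qed

text \<open>
 Along a ray to the apex, \<open>t cosh d(p, vertical a y t)\<close> tends to a multiple of \<open>horofn a p\<close>.  So an
 isometry of lateral faces multiplies the horofunction by a constant.
\<close>
lemma lateral_isometry_horofn:
 assumes e: "convex e" "compact e" "e \<subseteq> hyp_space" "e \<noteq> {}" and a: "a \<in> sphere 0 1"
  and e': "convex e'" "compact e'" "e' \<subseteq> hyp_space" "e' \<noteq> {}" and a': "a' \<in> sphere 0 1"
  and iso: "isometry_between (pyramid e a - {a}) hyp_dist (pyramid e' a' - {a'}) hyp_dist f"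
 shows "\<exists>\<kappa>>0. \<forall>p\<in>pyramid e a - {a}. horofn a' (f p) = \<kappa> * horofn a p"
proof -
 have fi: "f p \<in> pyramid e' a' - {a'}" if "p \<in> pyramid e a - {a}" for p
  using iso that unfolding isometry_between_def bij_betw_def by blast
 have fd: "hyp_dist (f p) (f q) = hyp_dist p q" if "p \<in> pyramid e a - {a}" "q \<in> pyramid e a - {a}" for p q
  using iso that unfolding isometry_between_def by blast
 have hyp: "p \<in> hyp_space" if "p \<in> pyramid e a - {a}" for p
  using pyramid_vertical[OF e(1,3,4) a that] lift_vertical(2)[OF _ a] e(3) by blast
 have hyp': "p \<in> hyp_space" if "p \<in> pyramid e' a' - {a'}" for p
  using pyramid_vertical[OF e'(1,3,4) a' that] lift_vertical(2)[OF _ a'] e'(3) by blast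
 obtain x0 where x0: "x0 \<in> e" using e(4) by blast
 have x0h: "x0 \<in> hyp_space" using x0 e(3) by blast
 have h0: "horofn a x0 > 0" by (rule horofn_pos[OF x0h a])
 define q where "q t = vertical a x0 t" for t
 have q: "q t \<in> pyramid e a - {a}" if "0 < t" "t \<le> 1" for t unfolding q_def by (rule vertical_pyramid[OF e(1,3) x0 a that])
 have "\<forall>t\<in>{0<..1}. \<exists>ys. fst ys \<in> e' \<and> 0 < snd ys \<and> snd ys \<le> 1 \<and> f (q t) = vertical a' (fst ys) (snd ys)"
  using pyramid_vertical[OF e'(1,3,4) a' fi[OF q]] by fastforce
 from bchoice[OF this] obtain ys where ys: "\<And>t. t \<in> {0<..1} ==> fst (ys t) \<in> e' \<and> 0 < snd (ys t) \<and> snd (ys t) \<le> 1 \<and> f (q t) = vertical a' (fst (ys t)) (snd (ys t))"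
  by blast
 \<comment> \<open>The apex coefficient of the image point. Neither its foot nor its depth is known,
   so \<open>\<Gamma>\<close> has to be eliminated in the end.\<close>
 define \<Gamma> where "\<Gamma> t = (1 - (snd (ys t))\<^sup>2) / (2 * snd (ys t) * horofn a' (fst (ys t)))" for t
 have lim: "((\<lambda>t. t * \<Gamma> t * horofn a' (f p)) \<longlongrightarrow> horofn a p / (2 * horofn a x0)) (at_right 0)"
  if p: "p \<in> pyramid e a - {a}" for p
 proof -
  have ph: "p \<in> hyp_space" "f p \<in> hyp_space" using hyp[OF p] hyp'[OF fi[OF p]] .
  have ev: "eventually (\<lambda>t. t \<in> {0<..1::real}) (at_right 0)" unfolding eventually_at_right_field by (intro exI[of _ 1]) auto
  have "((\<lambda>t. t * (t * cosh (hyp_dist p x0)) + ((1 - t\<^sup>2) / (2 * horofn a x0)) * horofn a p) \<longlongrightarrow>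
    0 * (0 * cosh (hyp_dist p x0)) + ((1 - 0\<^sup>2) / (2 * horofn a x0)) * horofn a p) (at_right 0)"
   using h0 by (intro tendsto_intros) auto
  moreover have "eventually (\<lambda>t. t * (t * cosh (hyp_dist p x0)) + ((1 - t\<^sup>2) / (2 * horofn a x0)) * horofn a p = t * cosh (hyp_dist (f p) (f (q t)))) (at_right 0)"
   using ev
  proof eventually_elim
   case (elim t)
   hence t: "0 < t" "t \<le> 1" by auto
   have "t * cosh (hyp_dist (f p) (f (q t))) = t * cosh (hyp_dist p (vertical a x0 t))" using fd[OF p q[OF t]] by (simp add: q_def)
   also have "\<dots> = t * (t * cosh (hyp_dist p x0)) + ((1 - t\<^sup>2) / (2 * horofn a x0)) * horofn a p"
   proof -
    have "t * ((1 - t\<^sup>2) / (2 * t * horofn a x0) * horofn a p) = (1 - t\<^sup>2) / (2 * horofn a x0) * horofn a p" using t by simp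
    thus ?thesis unfolding cosh_dist_vertical[OF x0h ph(1) a t] distrib_left by simp
   qed
   finally show ?case by simp
  qed
  ultimately have l1: "((\<lambda>t. t * cosh (hyp_dist (f p) (f (q t)))) \<longlongrightarrow> horofn a p / (2 * horofn a x0)) (at_right 0)"
   by (auto intro: Lim_transform_eventually)
  have "continuous_on e' (hyp_dist (f p))" by (rule continuous_on_subset[OF continuous_on_hyp_dist[OF ph(2)] e'(3)])
  hence "compact (hyp_dist (f p) ` e')" by (intro compact_continuous_image e'(2))
  then obtain B where B: "\<And>y. y \<in> e' ==> \<bar>hyp_dist (f p) y\<bar> \<le> B"
   using compact_imp_bounded bounded_real by (metis imageI)
  \<comment> \<open>Feet stay in the compact edge \<open>e'\<close> and depths are at most 1, so the
    contribution of the feet is bounded and the factor \<open>t\<close> kills it.\<close>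
  have l2: "((\<lambda>t. t * (snd (ys t) * cosh (hyp_dist (f p) (fst (ys t))))) \<longlongrightarrow> 0) (at_right 0)"
  proof (rule Lim_null_comparison)
   show "((\<lambda>t. t * cosh B) \<longlongrightarrow> 0) (at_right (0::real))" by (auto intro!: tendsto_eq_intros)
   show "eventually (\<lambda>t. norm (t * (snd (ys t) * cosh (hyp_dist (f p) (fst (ys t))))) \<le> t * cosh B) (at_right 0)" using ev
   proof eventually_elim
    case (elim t)
    note y = ys[OF elim]
    have "\<bar>hyp_dist (f p) (fst (ys t))\<bar> \<le> \<bar>B\<bar>" using B[of "fst (ys t)"] y by linarith
    hence "cosh \<bar>hyp_dist (f p) (fst (ys t))\<bar> \<le> cosh \<bar>B\<bar>" by (subst cosh_real_nonneg_le_iff) auto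
    hence "cosh (hyp_dist (f p) (fst (ys t))) \<le> cosh B" by (simp add: cosh_real_abs)
    hence "snd (ys t) * cosh (hyp_dist (f p) (fst (ys t))) \<le> 1 * cosh B" using y by (intro mult_mono) auto
    thus ?case using elim y by (simp add: abs_mult mult_left_mono)
   qed
  qed
  have "eventually (\<lambda>t. t * cosh (hyp_dist (f p) (f (q t))) - t * (snd (ys t) * cosh (hyp_dist (f p) (fst (ys t)))) = t * \<Gamma> t * horofn a' (f p)) (at_right 0)"
   using ev
  proof eventually_elim
   case (elim t)
   note y = ys[OF elim]
   have yh: "fst (ys t) \<in> hyp_space" using y e'(3) by blast
   have "cosh (hyp_dist (f p) (f (q t))) = snd (ys t) * cosh (hyp_dist (f p) (fst (ys t))) + \<Gamma> t * horofn a' (f p)"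
    using cosh_dist_vertical[OF yh ph(2) a', of "snd (ys t)"] y by (simp add: \<Gamma>_def)
   thus ?case by (simp add: algebra_simps)
  qed
  from Lim_transform_eventually[OF tendsto_diff[OF l1 l2] this] show ?thesis by simp
 qed
 \<comment> \<open>Comparing the limits for two points eliminates the unknown factor
   \<open>t * \<Gamma> t\<close>.\<close>
 have rat: "horofn a p * horofn a' (f p') = horofn a p' * horofn a' (f p)"
  if p: "p \<in> pyramid e a - {a}" "p' \<in> pyramid e a - {a}" for p p'
 proof -
  have 1: "((\<lambda>t. t * \<Gamma> t * horofn a' (f p) * horofn a' (f p')) \<longlongrightarrow> horofn a p / (2 * horofn a x0) * horofn a' (f p')) (at_right 0)"
   by (intro tendsto_mult_right lim p)
  have 2: "((\<lambda>t. t * \<Gamma> t * horofn a' (f p') * horofn a' (f p)) \<longlongrightarrow> horofn a p' / (2 * horofn a x0) * horofn a' (f p)) (at_right 0)"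
   by (intro tendsto_mult_right lim p)
  have 3: "(\<lambda>t. t * \<Gamma> t * horofn a' (f p') * horofn a' (f p)) = (\<lambda>t. t * \<Gamma> t * horofn a' (f p) * horofn a' (f p'))"
   by (simp add: mult_ac)
  have "horofn a p / (2 * horofn a x0) * horofn a' (f p') = horofn a p' / (2 * horofn a x0) * horofn a' (f p)"
   by (rule tendsto_unique[OF trivial_limit_at_right_real 1 2[unfolded 3]])
  thus ?thesis using h0 by (simp add: field_simps)
 qed
 have x0P: "x0 \<in> pyramid e a - {a}" using q[of 1] by (simp add: q_def vertical_1[OF x0h])
 have hf: "horofn a' (f x0) > 0" by (rule horofn_pos[OF hyp'[OF fi[OF x0P]] a'])
 show ?thesis
 proof (intro exI[of _ "horofn a' (f x0) / horofn a x0"] conjI ballI)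
  show "0 < horofn a' (f x0) / horofn a x0" using hf h0 by simp
  fix p assume p: "p \<in> pyramid e a - {a}"
  show "horofn a' (f p) = horofn a' (f x0) / horofn a x0 * horofn a p" using rat[OF p x0P] h0 by (simp add: field_simps)
 qed
qed

text \<open>The difference of the lifts is orthogonal to \<open>y1\<close>, \<open>y2\<close> and
  the apex. These span the plane of the lateral face, which contains both lifts, so the difference
  is null and orthogonal to a timelike vector, hence zero.\<close>

lemma vertical_unique:
 assumes e: "convex e" "e \<subseteq> hyp_space" "e \<noteq> {}" "aff_dim e = 1" and a: "a \<in> sphere 0 1"
  and p: "p \<in> pyramid e a - {a}" "q \<in> pyramid e a - {a}"
  and y: "y1 \<in> e" "y2 \<in> e" "y1 \<noteq> y2"
  and d: "hyp_dist p y1 = hyp_dist q y1" "hyp_dist p y2 = hyp_dist q y2" "horofn a p = horofn a q"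
 shows "p = q"
proof -
 obtain x s where x: "x \<in> e" "0 < s" "s \<le> 1" "p = vertical a x s" using pyramid_vertical[OF e(1-3) a p(1)] by blast
 obtain x' s' where x': "x' \<in> e" "0 < s'" "s' \<le> 1" "q = vertical a x' s'" using pyramid_vertical[OF e(1-3) a p(2)] by blast
 have h: "x \<in> hyp_space" "x' \<in> hyp_space" "y1 \<in> hyp_space" "y2 \<in> hyp_space" using x x' y e(2) by auto
 have ph: "p \<in> hyp_space" "q \<in> hyp_space" using lift_vertical(2)[OF _ a] x x' h by auto
 have comb: "\<exists>u w. lift z = u *\<^sub>R lift y1 + w *\<^sub>R lift y2" if z: "z \<in> e" for z
 proof -
  have "collinear {y1, y2, z}" using collinear_subset[of e "{y1, y2, z}"] e(4) y z by (simp add: collinear_aff_dim)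
  then obtain k where k: "z = (1 - k) *\<^sub>R y1 + k *\<^sub>R y2"
  proof -
   have "z \<in> affine hull {y1, y2}" using \<open>collinear {y1, y2, z}\<close> y(3) by (simp add: collinear_3_affine_hull)
   then obtain u w where "u + w = 1" "z = u *\<^sub>R y1 + w *\<^sub>R y2" by (auto simp: affine_hull_2)
   thus ?thesis using that[of w] by (metis add_diff_cancel_right')
  qed
  have zh: "z \<in> hyp_space" using z e(2) by blast
  obtain c where c: "c > 0" "lift z = c *\<^sub>R (z, 1)" using lift_point[OF zh] by blast
  obtain c1 where c1: "c1 > 0" "lift y1 = c1 *\<^sub>R (y1, 1)" using lift_point[OF h(3)] by blast
  obtain c2 where c2: "c2 > 0" "lift y2 = c2 *\<^sub>R (y2, 1)" using lift_point[OF h(4)] by blast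
  have "(z, 1::real) = (1 - k) *\<^sub>R (y1, 1) + k *\<^sub>R (y2, 1)" by (simp add: k)
  hence "lift z = (c * (1 - k)) *\<^sub>R (y1, 1) + (c * k) *\<^sub>R (y2, 1)" unfolding c(2) by (simp only: scaleR_add_right scaleR_scaleR)
  hence "lift z = (c * (1 - k) / c1) *\<^sub>R lift y1 + (c * k / c2) *\<^sub>R lift y2" using c1 c2 by simp
  thus ?thesis by blast
 qed
 define w where "w = lift p - lift q"
 have wy: "lorentz w (lift y1) = 0" "lorentz w (lift y2) = 0" "lorentz w (a, 1) = 0"
  using arg_cong[OF d(1), of cosh] arg_cong[OF d(2), of cosh] d(3)
  unfolding cosh_hyp_dist[OF ph(1) h(3)] cosh_hyp_dist[OF ph(2) h(3)] cosh_hyp_dist[OF ph(1) h(4)] cosh_hyp_dist[OF ph(2) h(4)]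
  by (simp_all add: w_def horofn_def)
 obtain u1 w1 u2 w2 where uw: "lift x = u1 *\<^sub>R lift y1 + w1 *\<^sub>R lift y2" "lift x' = u2 *\<^sub>R lift y1 + w2 *\<^sub>R lift y2"
  using comb x(1) x'(1) by metis
 have wx: "lorentz w (lift x) = 0" "lorentz w (lift x') = 0" unfolding uw using wy by simp_all
 have "lorentz w (lift p) = 0" "lorentz w (lift q) = 0"
  unfolding x(4) x'(4) lift_vertical(1)[OF h(1) a x(2,3)] lift_vertical(1)[OF h(2) a x'(2,3)] by (simp_all only: lorentz_simps wx wy(3))
 hence "lorentz w w = 0" by (subst (2) w_def) simp
 moreover have "lorentz (lift p) w = 0" "lorentz (lift p) (lift p) < 0"
  using \<open>lorentz w (lift p) = 0\<close> lift_hyperboloid[OF ph(1)] by (simp_all add: lorentz_commute on_hyperboloid_def)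
 ultimately have "w = 0" using timelike_orthogonal(2) by blast
 thus ?thesis using klein_lift ph by (metis eq_iff_diff_eq_0 w_def)
qed

section \<open>Cusps\<close>

lemma edge_convex_facts:
 assumes "polygon A \<nu>" "e edge_of A"
 shows "convex e" "compact e" "e \<subseteq> hyp_space" "e \<noteq> {}" "aff_dim e = 1" "e \<subseteq> A"
 using polygon.edge_facts[OF assms] polygon.A_facts(3)[OF assms(1)] by auto

locale cusp =
 fixes C :: "'i cuspidal_complex"
 assumes poly: "polyhedral_cusp C" and conv: "convex_cusp C"
begin

definition nu :: "'i \<Rightarrow> (real^3) \<times> real" where
 "nu i = (SOME \<nu>. apexed_polygon (base C i) \<nu> (apex C i))"

lemma cx: "cuspidal_complex C" and cpt: "compatible C" using poly by (auto simp: polyhedral_cusp_def)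

lemma fin_cells: "finite (cells C)" using cx by (simp add: cuspidal_complex_def)

lemma ap: assumes "i \<in> cells C" shows "apexed_polygon (base C i) (nu i) (apex C i)"
 using apexed_polygon_exists[of "base C i" "apex C i"] cx assms unfolding nu_def cuspidal_complex_def by (metis someI_ex)

lemma pg: "i \<in> cells C ==> polygon (base C i) (nu i)" using ap apexed_polygon.axioms(1) by blast

lemma apex_sphere: "i \<in> cells C ==> apex C i \<in> sphere 0 1" using apexed_polygon.apex[OF ap] .

lemma base_hyp: "i \<in> cells C ==> x \<in> base C i ==> x \<in> hyp_space" using polygon.A_hyp[OF pg] .

lemma sidesD: "s \<in> sides C ==> fst s \<in> cells C \<and> snd s edge_of base C (fst s)" by (auto simp: sides_def)

lemma mate: "s \<in> sides C ==> mate C s \<in> sides C" "s \<in> sides C ==> mate C s \<noteq> s" "s \<in> sides C ==> mate C (mate C s) = s"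
 using cx by (auto simp: cuspidal_complex_def)

lemma gl_iso: "s \<in> sides C ==> isometry_between (lateral_face C s) hyp_dist (lateral_face C (mate C s)) hyp_dist (gluing C s)"
 and gl_edge: "s \<in> sides C ==> gluing C s ` snd s = snd (mate C s)"
 and gl_inv: "s \<in> sides C ==> x \<in> lateral_face C s ==> gluing C (mate C s) (gluing C s x) = x"
 using cx unfolding cuspidal_complex_def by blast+

lemma gl_in: "s \<in> sides C ==> x \<in> lateral_face C s ==> gluing C s x \<in> lateral_face C (mate C s)"
 using gl_iso unfolding isometry_between_def bij_betw_def by blast

lemma gl_dist: "s \<in> sides C ==> x \<in> lateral_face C s ==> y \<in> lateral_face C s ==> hyp_dist (gluing C s x) (gluing C s y) = hyp_dist x y"
 using gl_iso unfolding isometry_between_def by blast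

lemma side_edge:
 assumes "s \<in> sides C"
 shows "convex (snd s)" "compact (snd s)" "snd s \<subseteq> hyp_space" "snd s \<noteq> {}" "aff_dim (snd s) = 1" "snd s \<subseteq> base C (fst s)"
  "lateral_face C s = pyramid (snd s) (apex C (fst s)) - {apex C (fst s)}" "apex C (fst s) \<in> sphere 0 1"
 using edge_convex_facts[OF pg, of "fst s" "snd s"] sidesD[OF assms] apex_sphere by (auto simp: lateral_face_def)

lemma lf_vertical: assumes "s \<in> sides C" "p \<in> lateral_face C s"
 shows "\<exists>y\<in>snd s. \<exists>t. 0 < t \<and> t \<le> 1 \<and> p = vertical (apex C (fst s)) y t"
 using pyramid_vertical[of "snd s" "apex C (fst s)" p] side_edge[OF assms(1)] assms(2) by simp

lemma vertical_lf: assumes "s \<in> sides C" "y \<in> snd s" "0 < t" "t \<le> 1" shows "vertical (apex C (fst s)) y t \<in> lateral_face C s"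
 using vertical_pyramid[of "snd s" y "apex C (fst s)" t] side_edge[OF assms(1)] assms by simp

lemma lf_hyp: assumes "s \<in> sides C" "p \<in> lateral_face C s" shows "p \<in> hyp_space"
 using lf_vertical[OF assms] lift_vertical(2)[OF _ side_edge(8)[OF assms(1)]] side_edge(3)[OF assms(1)] by blast

lemma edge_lf: assumes "s \<in> sides C" "y \<in> snd s" shows "y \<in> lateral_face C s"
 using vertical_lf[OF assms, of 1] vertical_1[of y] side_edge(3)[OF assms(1)] assms(2) by auto

lemma vertical_in_base:
 assumes i: "i \<in> cells C" and y: "y \<in> base C i" and t: "0 < t" "t \<le> 1" and b: "vertical (apex C i) y t \<in> base C i"
 shows "t = 1"
proof -
 interpret apexed_polygon "base C i" "nu i" "apex C i" by (rule ap[OF i])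
 have yh: "y \<in> hyp_space" by (rule A_hyp[OF y])
 have "lorentz (nu i) (lift (vertical (apex C i) y t)) = 0" by (rule \<nu>_A[OF b])
 hence "((1 - t\<^sup>2) / (2 * t * horofn (apex C i) y)) * lorentz (nu i) (apex C i, 1) = 0"
  unfolding lift_vertical(1)[OF yh apex t] using \<nu>_A[OF y] by (simp del: scaleR_Pair)
 moreover have "horofn (apex C i) y > 0" by (rule horofn_pos[OF yh apex])
 ultimately have "t\<^sup>2 = 1" using t apex_side by (simp del: power_eq_1_iff)
 thus "t = 1" using t by (simp add: power2_eq_1_iff)
qed

lemma base_lf: assumes s: "s \<in> sides C" and p: "p \<in> lateral_face C s" "p \<in> base C (fst s)" shows "p \<in> snd s"
proof -
 obtain y t where y: "y \<in> snd s" "0 < t" "t \<le> 1" "p = vertical (apex C (fst s)) y t" using lf_vertical[OF s p(1)] by blast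
 have "t = 1" using vertical_in_base[of "fst s" y t] sidesD[OF s] side_edge(6)[OF s] y p(2) by blast
 thus ?thesis using y side_edge(3)[OF s] vertical_1 by (metis subsetD)
qed

definition height :: "'i \<Rightarrow> real" where
 "height = (SOME c. (\<forall>i\<in>cells C. c i > 0 \<and> horoball (apex C i) (c i) \<inter> base C i = {}) \<and>
   (\<forall>s\<in>sides C. gluing C s ` (lateral_face C s - horoball (apex C (fst s)) (c (fst s))) =
    lateral_face C (mate C s) - horoball (apex C (fst (mate C s))) (c (fst (mate C s)))))"

lemma height: "i \<in> cells C ==> height i > 0" "i \<in> cells C ==> horoball (apex C i) (height i) \<inter> base C i = {}"
  "s \<in> sides C ==> gluing C s ` (lateral_face C s - horoball (apex C (fst s)) (height (fst s))) =
    lateral_face C (mate C s) - horoball (apex C (fst (mate C s))) (height (fst (mate C s)))"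
proof -
 obtain B where B: "\<forall>i \<in> cells C. (\<exists>c>0. B i = horoball (apex C i) c) \<and> B i \<inter> base C i = {}"
   "\<forall>s \<in> sides C. gluing C s ` (lateral_face C s - B (fst s)) = lateral_face C (mate C s) - B (fst (mate C s))"
  using cpt unfolding compatible_def by blast
 have "\<forall>i\<in>cells C. \<exists>c. c > 0 \<and> B i = horoball (apex C i) c" using B(1) by blast
 from bchoice[OF this] obtain c where c: "\<forall>i\<in>cells C. c i > 0 \<and> B i = horoball (apex C i) (c i)" by blast
 have "(\<forall>i\<in>cells C. c i > 0 \<and> horoball (apex C i) (c i) \<inter> base C i = {}) \<and>
   (\<forall>s\<in>sides C. gluing C s ` (lateral_face C s - horoball (apex C (fst s)) (c (fst s))) =
    lateral_face C (mate C s) - horoball (apex C (fst (mate C s))) (c (fst (mate C s))))"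
  using B c sidesD mate(1) by (metis (no_types, lifting))
 from someI[of "\<lambda>c. (\<forall>i\<in>cells C. c i > 0 \<and> horoball (apex C i) (c i) \<inter> base C i = {}) \<and>
   (\<forall>s\<in>sides C. gluing C s ` (lateral_face C s - horoball (apex C (fst s)) (c (fst s))) =
    lateral_face C (mate C s) - horoball (apex C (fst (mate C s))) (c (fst (mate C s))))", OF this, folded height_def]
 show "i \<in> cells C ==> height i > 0" "i \<in> cells C ==> horoball (apex C i) (height i) \<inter> base C i = {}"
  "s \<in> sides C ==> gluing C s ` (lateral_face C s - horoball (apex C (fst s)) (height (fst s))) =
    lateral_face C (mate C s) - horoball (apex C (fst (mate C s))) (height (fst (mate C s)))" by blast+
qed

text \<open>The horofunction scaled so that the truncating horosphere is the level set 1; the base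
  lies where \<open>N\<close> is at least 1.\<close>

definition N :: "'i \<times> (real^3) \<Rightarrow> real" where
 "N p = horofn (apex C (fst p)) (snd p) / height (fst p)"

lemma N_pos: "fst p \<in> cells C ==> snd p \<in> hyp_space ==> N p > 0" using horofn_pos[OF _ apex_sphere] height(1) by (simp add: N_def)

text \<open>A gluing multiplies the horofunction by a constant, and compatibility makes the sets
  where \<open>N\<close> is at least 1 correspond. Since \<open>N\<close> takes every value in
  \<open>(0, 1]\<close> on a lateral face, the constant \<open>\<kappa>\<close> for \<open>N\<close>
  must be 1.\<close>

lemma N_glue:
 assumes s: "s \<in> sides C" and p: "p \<in> lateral_face C s"
 shows "N (fst (mate C s), gluing C s p) = N (fst s, p)"
proof -
 note E = side_edge[OF s] and E' = side_edge[OF mate(1)[OF s]]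
 have ic: "fst s \<in> cells C" "fst (mate C s) \<in> cells C" using sidesD s mate(1) by blast+
 obtain \<kappa>0 where k0: "\<kappa>0 > 0" "\<And>p. p \<in> lateral_face C s ==> horofn (apex C (fst (mate C s))) (gluing C s p) = \<kappa>0 * horofn (apex C (fst s)) p"
  using lateral_isometry_horofn[OF E(1-4,8) E'(1-4,8), folded E(7) E'(7), OF gl_iso[OF s]] by blast
 define \<kappa> where "\<kappa> = \<kappa>0 * height (fst s) / height (fst (mate C s))"
 have k: "\<kappa> > 0" using k0(1) height(1) ic by (simp add: \<kappa>_def)
 have N': "N (fst (mate C s), gluing C s p) = \<kappa> * N (fst s, p)" if "p \<in> lateral_face C s" for p
  using k0(2)[OF that] height(1)[OF ic(1)] height(1)[OF ic(2)] by (simp add: N_def \<kappa>_def)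
 have out: "p \<notin> horoball (apex C (fst t)) (height (fst t)) \<longleftrightarrow> N (fst t, p) \<ge> 1" if "t \<in> sides C" "p \<in> lateral_face C t" for t p
  using horofn_horoball[OF lf_hyp[OF that]] height(1) sidesD[OF that(1)] by (auto simp: N_def not_less)
 have iff: "N (fst s, p) \<ge> 1 \<longleftrightarrow> \<kappa> * N (fst s, p) \<ge> 1" if p: "p \<in> lateral_face C s" for p
 proof
  assume "N (fst s, p) \<ge> 1"
  hence "gluing C s p \<in> lateral_face C (mate C s) - horoball (apex C (fst (mate C s))) (height (fst (mate C s)))"
   using height(3)[OF s] out[OF s p] p by blast
  hence "N (fst (mate C s), gluing C s p) \<ge> 1" using out[OF mate(1)[OF s]] by blast
  thus "\<kappa> * N (fst s, p) \<ge> 1" using N'[OF p] by simp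
 next
  assume "\<kappa> * N (fst s, p) \<ge> 1"
  hence "N (fst (mate C s), gluing C s p) \<ge> 1" using N'[OF p] by simp
  hence "gluing C s p \<in> lateral_face C (mate C s) - horoball (apex C (fst (mate C s))) (height (fst (mate C s)))"
   using out[OF mate(1)[OF s] gl_in[OF s p]] gl_in[OF s p] by blast
  then obtain p' where p': "p' \<in> lateral_face C s - horoball (apex C (fst s)) (height (fst s))" "gluing C s p' = gluing C s p"
   using height(3)[OF s] by (metis imageE)
  hence "p' = p" using gl_inv[OF s] p by (metis DiffD1)
  thus "N (fst s, p) \<ge> 1" using p' out[OF s p] by blast
 qed
 obtain x0 where x0: "x0 \<in> snd s" using E(4) by blast
 have x0h: "x0 \<in> hyp_space" "x0 \<in> lateral_face C s" using x0 E(3) edge_lf[OF s] by auto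
 have "x0 \<notin> horoball (apex C (fst s)) (height (fst s))" using height(2)[OF ic(1)] x0 E(6) by blast
 hence n0: "N (fst s, x0) \<ge> 1" using out[OF s x0h(2)] by simp
 have attain: "\<exists>p\<in>lateral_face C s. N (fst s, p) = r" if r: "0 < r" "r \<le> 1" for r
 proof -
  define t where "t = r / N (fst s, x0)"
  have t: "0 < t" "t \<le> 1" using r n0 by (auto simp: t_def divide_le_eq)
  have "N (fst s, vertical (apex C (fst s)) x0 t) = t * N (fst s, x0)" using lift_vertical(3)[OF x0h(1) E(8) t] by (simp add: N_def)
  also have "\<dots> = r" using n0 by (simp add: t_def)
  finally show ?thesis using vertical_lf[OF s x0 t] by blast
 qed
 have "\<kappa> \<ge> 1"
 proof -
  obtain q where "q \<in> lateral_face C s" "N (fst s, q) = 1" using attain[of 1] by auto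
  thus ?thesis using iff[of q] by simp
 qed
 moreover have "\<kappa> \<le> 1"
 proof (rule ccontr)
  assume "\<not> \<kappa> \<le> 1"
  hence "0 < 1 / \<kappa>" "1 / \<kappa> \<le> 1" by auto
  then obtain q where "q \<in> lateral_face C s" "N (fst s, q) = 1 / \<kappa>" using attain by blast
  thus False using iff[of q] \<open>\<not> \<kappa> \<le> 1\<close> by simp
 qed
 ultimately show ?thesis using N'[OF p] by simp
qed

section \<open>The gluing relation and its classes\<close>

definition gstep :: "(('i \<times> (real^3)) \<times> ('i \<times> (real^3))) set" where
 "gstep = {((fst s, x), (fst (mate C s), gluing C s x)) | s x. s \<in> sides C \<and> x \<in> lateral_face C s}"

lemma glued_gstep: "glued C = gstep\<^sup>*" by (simp add: glued_def gstep_def)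

lemma gstep_sym: assumes "(p, q) \<in> gstep" shows "(q, p) \<in> gstep"
proof -
 obtain s x where s: "s \<in> sides C" "x \<in> lateral_face C s" "p = (fst s, x)" "q = (fst (mate C s), gluing C s x)"
  using assms by (auto simp: gstep_def)
 have "((fst (mate C s), gluing C s x), (fst (mate C (mate C s)), gluing C (mate C s) (gluing C s x))) \<in> gstep"
  unfolding gstep_def using s(1,2) mate(1) gl_in by blast
 thus ?thesis using s mate(3) gl_inv by simp
qed

lemma glued_refl: "(p, p) \<in> glued C" by (simp add: glued_gstep)

lemma glued_sym: "(p, q) \<in> glued C ==> (q, p) \<in> glued C"
 unfolding glued_gstep using gstep_sym sym_rtrancl[of gstep] by (metis symD symI)

lemma glued_trans: "(p, q) \<in> glued C ==> (q, r) \<in> glued C ==> (p, r) \<in> glued C" by (simp add: glued_gstep)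

definition cls :: "'i \<times> (real^3) \<Rightarrow> ('i \<times> (real^3)) set" where "cls p = glued C `` {p}"

lemma cls_iff: "q \<in> cls p \<longleftrightarrow> (p, q) \<in> glued C" by (simp add: cls_def)

lemma cls_self: "p \<in> cls p" by (simp add: cls_iff glued_refl)

lemma cls_eq: "cls p = cls q \<longleftrightarrow> (p, q) \<in> glued C"
proof
 assume "cls p = cls q"
 thus "(p, q) \<in> glued C" using cls_self[of q] cls_iff by blast
next
 assume pq: "(p, q) \<in> glued C"
 show "cls p = cls q"
 proof (rule set_eqI)
  fix x show "x \<in> cls p \<longleftrightarrow> x \<in> cls q"
   unfolding cls_iff using glued_trans[OF pq, of x] glued_trans[OF glued_sym[OF pq], of x] by blast
 qed
qed

lemma N_glued: "(p, q) \<in> glued C ==> N q = N p" unfolding glued_gstep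
proof (induction rule: rtrancl_induct)
 case (step y z)
 then obtain s x where "s \<in> sides C" "x \<in> lateral_face C s" "y = (fst s, x)" "z = (fst (mate C s), gluing C s x)"
  by (auto simp: gstep_def)
 thus ?case using N_glue step(3) by simp
qed simp

lemma base_pointsD: "p \<in> base_points C \<longleftrightarrow> fst p \<in> cells C \<and> snd p \<in> base C (fst p)"
 by (cases p) (auto simp: base_points_def)

lemma pyramid_pointsD: "p \<in> pyramid_points C \<longleftrightarrow> fst p \<in> cells C \<and> snd p \<in> pyramid (base C (fst p)) (apex C (fst p)) - {apex C (fst p)}"
 by (cases p) (auto simp: pyramid_points_def)

lemma gstep_base:
 assumes "(p, q) \<in> gstep" "p \<in> base_points C"
 obtains s where "s \<in> sides C" "fst p = fst s" "snd p \<in> snd s" "q = (fst (mate C s), gluing C s (snd p))" "gluing C s (snd p) \<in> snd (mate C s)"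
  "q \<in> base_points C"
proof -
 obtain s x where s: "s \<in> sides C" "x \<in> lateral_face C s" "p = (fst s, x)" "q = (fst (mate C s), gluing C s x)"
  using assms(1) by (auto simp: gstep_def)
 have x: "x \<in> snd s" using base_lf[OF s(1,2)] assms(2) s(3) by (simp add: base_pointsD)
 have g: "gluing C s x \<in> snd (mate C s)" using gl_edge[OF s(1)] x by blast
 have "q \<in> base_points C" using g s(4) side_edge(6)[OF mate(1)[OF s(1)]] sidesD[OF mate(1)[OF s(1)]] by (auto simp: base_pointsD)
 thus ?thesis using that s x g by simp
qed

lemma gstep_edge:
 assumes "s \<in> sides C" "x \<in> snd s" shows "((fst s, x), (fst (mate C s), gluing C s x)) \<in> gstep"
 unfolding gstep_def using assms edge_lf by blast

lemma glued_base: "(p, q) \<in> glued C ==> p \<in> base_points C ==> q \<in> base_points C" unfolding glued_gstep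
proof (induction rule: rtrancl_induct)
 case (step y z)
 thus ?case using gstep_base by metis
qed simp

lemma cls_base: "p \<in> base_points C ==> cls p \<subseteq> base_points C" unfolding subset_iff cls_iff using glued_base by blast

section \<open>Chains and the distance of a gluing\<close>

definition is_chain where
 "is_chain S ch X Y \<longleftrightarrow> ch \<noteq> [] \<and> (\<forall>(p, q) \<in> set ch. p \<in> S \<and> q \<in> S \<and> fst p = fst q) \<and>
   successively (\<lambda>(_, q) (p', _). (q, p') \<in> glued C) ch \<and> fst (hd ch) \<in> X \<and> snd (last ch) \<in> Y"

definition chain_length :: "(('i \<times> (real^3)) \<times> ('i \<times> (real^3))) list \<Rightarrow> real" where
 "chain_length ch = (\<Sum>(p, q)\<leftarrow>ch. hyp_dist (snd p) (snd q))"

lemma gluing_dist_chain: "gluing_dist S (glued C) X Y = Inf {chain_length ch | ch. is_chain S ch X Y}"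
 by (simp add: gluing_dist_def is_chain_def chain_length_def)

lemma chain_length_nonneg:
 assumes "\<And>p. p \<in> S ==> snd p \<in> hyp_space" and "\<forall>(p, q) \<in> set ch. p \<in> S \<and> q \<in> S \<and> fst p = fst q"
 shows "chain_length ch \<ge> 0" unfolding chain_length_def using assms by (intro sum_list_nonneg) (auto intro!: hyp_dist_nonneg)

lemma gluing_dist_le:
 assumes S: "\<And>p. p \<in> S ==> snd p \<in> hyp_space" and ch: "is_chain S ch X Y"
 shows "gluing_dist S (glued C) X Y \<le> chain_length ch" unfolding gluing_dist_chain
proof (rule cInf_lower)
 show "bdd_below {chain_length ch | ch. is_chain S ch X Y}"
  using chain_length_nonneg[OF S] by (auto simp: bdd_below_def is_chain_def intro!: exI[of _ 0])
qed (use ch in blast)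

lemma gluing_dist_less:
 assumes "gluing_dist S (glued C) X Y < l" "is_chain S ch0 X Y"
 shows "\<exists>ch. is_chain S ch X Y \<and> chain_length ch < l"
proof -
 have "{chain_length ch | ch. is_chain S ch X Y} \<noteq> {}" using assms(2) by blast
 from cInf_lessD[OF this] show ?thesis using assms(1) unfolding gluing_dist_chain by blast
qed

lemma chain_singleton:
 "p \<in> S ==> q \<in> S ==> fst p = fst q ==> is_chain S [(p, q)] (cls p) (cls q)" by (simp add: is_chain_def cls_self)

lemma chain_append:
 assumes "is_chain S ch X (cls q)" "is_chain S ch' (cls q) Z"
 shows "is_chain S (ch @ ch') X Z \<and> chain_length (ch @ ch') = chain_length ch + chain_length ch'"
proof -
 have "(snd (last ch), fst (hd ch')) \<in> glued C" using assms glued_sym glued_trans unfolding is_chain_def cls_iff by blast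
 thus ?thesis using assms unfolding is_chain_def by (auto simp: successively_append_iff chain_length_def case_prod_beta)
qed

lemma gluing_dist_pair:
 assumes S: "\<And>p. p \<in> S ==> snd p \<in> hyp_space" and "p \<in> S" "q \<in> S" "fst p = fst q"
 shows "gluing_dist S (glued C) (cls p) (cls q) \<le> hyp_dist (snd p) (snd q)"
 using gluing_dist_le[OF S chain_singleton[OF assms(2-4)]] by (simp add: chain_length_def)

lemma base_points_hyp: "p \<in> base_points C ==> snd p \<in> hyp_space" using base_hyp by (auto simp: base_pointsD)

text \<open>\<open>star_bound Z eps\<close>: the star of radius \<open>eps\<close> around \<open>Z\<close> only crosses edges through points of \<open>Z\<close>.\<close>
definition star_bound :: "('i \<times> (real^3)) set \<Rightarrow> real \<Rightarrow> bool" where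
 "star_bound Z eps \<longleftrightarrow> Z \<subseteq> base_points C \<and> (\<forall>p q. p \<in> Z --> (p, q) \<in> gstep --> q \<in> Z) \<and>
   (\<forall>p\<in>Z. \<forall>e y. e edge_of base C (fst p) --> snd p \<notin> e --> y \<in> e --> eps \<le> hyp_dist (snd p) y)"

definition in_star :: "('i \<times> (real^3)) set \<Rightarrow> real \<Rightarrow> 'i \<times> (real^3) \<Rightarrow> bool" where
 "in_star Z l q \<longleftrightarrow> (\<exists>v. (fst q, v) \<in> Z \<and> hyp_dist v (snd q) \<le> l)"

text \<open>An edge met within the radius around \<open>v\<close> contains \<open>v\<close> itself,
  and the gluing is isometric on it. So the image point is as close to the image of
  \<open>v\<close>, which is again in \<open>Z\<close>.\<close>

lemma in_star_step:
 assumes Z: "star_bound Z eps" and l: "l < eps" and q: "q \<in> base_points C" "in_star Z l q" and st: "(q, q') \<in> gstep"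
 shows "in_star Z l q'"
proof -
 obtain v where v: "(fst q, v) \<in> Z" "hyp_dist v (snd q) \<le> l" using q(2) by (auto simp: in_star_def)
 obtain s where s: "s \<in> sides C" "fst q = fst s" "snd q \<in> snd s" "q' = (fst (mate C s), gluing C s (snd q))"
  using gstep_base[OF st q(1)] by blast
 have "v \<in> snd s"
 proof (rule ccontr)
  assume "v \<notin> snd s"
  hence "eps \<le> hyp_dist v (snd q)" using Z v(1) s sidesD[OF s(1)] unfolding star_bound_def by force
  thus False using v(2) l by simp
 qed
 hence "((fst s, v), (fst (mate C s), gluing C s v)) \<in> gstep" by (rule gstep_edge[OF s(1)])
 hence "(fst q', gluing C s v) \<in> Z" using Z v(1) s unfolding star_bound_def by (metis fst_conv)
 moreover have "hyp_dist (gluing C s v) (snd q') = hyp_dist v (snd q)"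
  using gl_dist[OF s(1) edge_lf[OF s(1) \<open>v \<in> snd s\<close>] edge_lf[OF s(1,3)]] s(4) by simp
 ultimately show ?thesis using v(2) by (auto simp: in_star_def)
qed

lemma in_star_glued:
 assumes Z: "star_bound Z eps" and l: "l < eps" and st: "(q, q') \<in> glued C" and q: "q \<in> base_points C" "in_star Z l q"
 shows "in_star Z l q'" using st unfolding glued_gstep
proof (induction rule: rtrancl_induct)
 case (step y z)
 have "y \<in> base_points C" using glued_base[of q y] step(1) q(1) by (simp add: glued_gstep)
 thus ?case using in_star_step[OF Z l _ step(3,2)] by simp
qed (rule q(2))

text \<open>A short chain cannot gain by crossing edges: its end has a point of \<open>Z\<close> in
  its own cell, no farther away than the length travelled.\<close>

lemma star_chain:
 assumes Z: "star_bound Z eps"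
 shows "ch \<noteq> [] ==> (\<forall>(p, q) \<in> set ch. p \<in> base_points C \<and> q \<in> base_points C \<and> fst p = fst q) ==>
   successively (\<lambda>(_, q) (p', _). (q, p') \<in> glued C) ch ==> in_star Z l (fst (hd ch)) ==> l + chain_length ch < eps ==>
   in_star Z (l + chain_length ch) (snd (last ch))"
proof (induction ch arbitrary: l)
 case (Cons pq ch)
 obtain p q where pq: "pq = (p, q)" by (cases pq)
 have b: "p \<in> base_points C" "q \<in> base_points C" "fst p = fst q" using Cons.prems(2) pq by auto
 have Zh: "\<And>x. x \<in> Z ==> snd x \<in> hyp_space" using Z base_points_hyp unfolding star_bound_def by blast
 obtain v where v: "(fst p, v) \<in> Z" "hyp_dist v (snd p) \<le> l" using Cons.prems(4) pq by (auto simp: in_star_def)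
 have "hyp_dist v (snd q) \<le> l + hyp_dist (snd p) (snd q)"
 proof -
  have "v \<in> hyp_space" using Zh[OF v(1)] by simp
  from hyp_dist_triangle[OF this base_points_hyp[OF b(1)] base_points_hyp[OF b(2)]] v(2) show ?thesis by linarith
 qed
 hence s1: "in_star Z (l + hyp_dist (snd p) (snd q)) q" using v(1) b(3) by (auto simp: in_star_def)
 have len: "chain_length (pq # ch) = hyp_dist (snd p) (snd q) + chain_length ch" by (simp add: chain_length_def pq)
 show ?case
 proof (cases "ch = []")
  case True thus ?thesis using s1 pq by (simp add: len) (simp add: chain_length_def)
 next
  case False
  have nn: "chain_length ch \<ge> 0" by (rule chain_length_nonneg[OF base_points_hyp]) (use Cons.prems(2) in auto)
  have "(q, fst (hd ch)) \<in> glued C" using Cons.prems(3) False pq by (cases ch) (auto simp: case_prod_beta)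
  moreover have "l + hyp_dist (snd p) (snd q) < eps" using Cons.prems(5) len nn by linarith
  ultimately have st: "in_star Z (l + hyp_dist (snd p) (snd q)) (fst (hd ch))" by (intro in_star_glued[OF Z _ _ b(2) s1])
  have su: "successively (\<lambda>(_, q) (p', _). (q, p') \<in> glued C) ch" using Cons.prems(3) by (cases ch) auto
  have bl: "l + hyp_dist (snd p) (snd q) + chain_length ch < eps" using Cons.prems(5) len by linarith
  have "\<forall>(p, q) \<in> set ch. p \<in> base_points C \<and> q \<in> base_points C \<and> fst p = fst q" using Cons.prems(2) by simp
  from Cons.IH[OF False this su st bl]
  have "in_star Z (l + hyp_dist (snd p) (snd q) + chain_length ch) (snd (last ch))" .
  thus ?thesis using False by (simp add: len add.assoc)
 qed
qed simp

end

lemma finite_uniform_bound: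
 fixes eps0 :: real
 assumes "finite Z" "eps0 > 0" "\<And>p. p \<in> Z ==> \<exists>\<delta>>0. \<forall>eps. 0 < eps --> eps \<le> \<delta> --> Q p eps"
 shows "\<exists>eps>0. eps \<le> eps0 \<and> (\<forall>p\<in>Z. Q p eps)"
proof -
 have "\<exists>\<delta>>0. \<delta> \<le> eps0 \<and> (\<forall>eps. 0 < eps --> eps \<le> \<delta> --> (\<forall>p\<in>Z. Q p eps))"
  using assms(1,3)
 proof (induction Z rule: finite_induct)
  case empty thus ?case using assms(2) by auto
 next
  case (insert p Z)
  obtain \<delta> where d: "\<delta> > 0" "\<delta> \<le> eps0" "\<And>eps p. 0 < eps ==> eps \<le> \<delta> ==> p \<in> Z ==> Q p eps" using insert by blast
  obtain \<delta>' where d': "\<delta>' > 0" "\<And>eps. 0 < eps ==> eps \<le> \<delta>' ==> Q p eps" using insert by blast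
  show ?case using d d' by (intro exI[of _ "min \<delta> \<delta>'"]) auto
 qed
 thus ?thesis by blast
qed

lemma cosine_law_small:
 assumes "\<delta> > 0" shows "\<exists>\<rho>>0. \<forall>t. \<bar>t\<bar> < \<rho> --> cosine_law r r t < \<delta>"
proof -
 have c: "cosine_law r r t = arcosh (1 + (sinh r)\<^sup>2 * (1 - cos t))" for t
  by (simp add: cosine_law_def cosh_square_eq algebra_simps flip: power2_eq_square)
 have ge: "1 \<le> 1 + (sinh r)\<^sup>2 * (1 - cos t)" for t by simp
 have "isCont (\<lambda>t. 1 + (sinh r)\<^sup>2 * (1 - cos t)) 0" by (intro continuous_intros)
 hence "((\<lambda>t. 1 + (sinh r)\<^sup>2 * (1 - cos t)) \<longlongrightarrow> 1) (at 0)" by (simp add: isCont_def)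
 moreover have "1 < cosh \<delta>" using assms cosh_real_nonneg_less_iff[of 0 \<delta>] by simp
 ultimately have "eventually (\<lambda>t. 1 + (sinh r)\<^sup>2 * (1 - cos t) < cosh \<delta>) (at 0)" by (rule order_tendstoD(2))
 then obtain \<rho> where \<rho>: "\<rho> > 0" "\<And>t. t \<noteq> 0 ==> dist t 0 < \<rho> ==> 1 + (sinh r)\<^sup>2 * (1 - cos t) < cosh \<delta>"
  unfolding eventually_at by auto
 have "cosine_law r r t < \<delta>" if "\<bar>t\<bar> < \<rho>" for t
 proof -
  have "1 + (sinh r)\<^sup>2 * (1 - cos t) < cosh \<delta>" using \<rho>(2)[of t] that \<open>1 < cosh \<delta>\<close> by (cases "t = 0") auto
  hence "arcosh (1 + (sinh r)\<^sup>2 * (1 - cos t)) < arcosh (cosh \<delta>)"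
   using ge[of t] \<open>1 < cosh \<delta>\<close> by (subst arcosh_less_iff_real) auto
  thus ?thesis using assms by (simp add: c arcosh_cosh_real)
 qed
 thus ?thesis using \<rho>(1) by blast
qed

section \<open>Vertices, finiteness of classes and admissible radii\<close>

context cusp
begin

text \<open>Being an end of an edge is a metric property: no two points of the edge on either side
  realise equality in the triangle inequality. An isometry of edges therefore preserves it.\<close>

lemma extreme_gstep:
 assumes st: "(p, q) \<in> gstep" and p: "p \<in> base_points C" and x: "snd p extreme_point_of base C (fst p)"
 shows "snd q extreme_point_of base C (fst q)"
proof -
 obtain s where s: "s \<in> sides C" "fst p = fst s" "snd p \<in> snd s" "q = (fst (mate C s), gluing C s (snd p))" "gluing C s (snd p) \<in> snd (mate C s)"
  using gstep_base[OF st p] by metis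
 define x where "x = snd p"
 note E = side_edge[OF s(1)] and E' = side_edge[OF mate(1)[OF s(1)]]
 have fc: "snd s face_of base C (fst s)" "snd (mate C s) face_of base C (fst (mate C s))"
  using sidesD[OF s(1)] sidesD[OF mate(1)[OF s(1)]] by (auto simp: edge_of_def)
 have xe: "x extreme_point_of snd s" using extreme_point_of_face[OF fc(1)] assms(3) s by (simp add: x_def)
 have "gluing C s x extreme_point_of snd (mate C s)" unfolding extreme_point_of_def
 proof (intro conjI ballI notI)
  show "gluing C s x \<in> snd (mate C s)" using s(5) by (simp add: x_def)
  fix y1 y2 assume y: "y1 \<in> snd (mate C s)" "y2 \<in> snd (mate C s)" "gluing C s x \<in> open_segment y1 y2"
  obtain x1 x2 where x12: "x1 \<in> snd s" "y1 = gluing C s x1" "x2 \<in> snd s" "y2 = gluing C s x2"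
   using y(1,2) gl_edge[OF s(1)] by blast
  have xs: "x \<in> snd s" using s(3) by (simp add: x_def)
  have gd: "hyp_dist (gluing C s u) (gluing C s w) = hyp_dist u w" if "u \<in> snd s" "w \<in> snd s" for u w
   using gl_dist[OF s(1) edge_lf[OF s(1) that(1)] edge_lf[OF s(1) that(2)]] .
  have h: "x \<in> hyp_space" "x1 \<in> hyp_space" "x2 \<in> hyp_space" "y1 \<in> hyp_space" "y2 \<in> hyp_space"
   using xs x12 y E(3) E'(3) by auto
  have "gluing C s x \<in> closed_segment y1 y2" using y(3) by (simp add: open_segment_def)
  from hyp_dist_segment(2)[OF h(4,5) this]
  have sum: "hyp_dist x1 x + hyp_dist x x2 = hyp_dist x1 x2" using gd x12 xs by simp
  have ne: "x1 \<noteq> x" "x2 \<noteq> x" using y(3) x12 by (auto simp: open_segment_def)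
  have pos: "hyp_dist x1 x > 0" "hyp_dist x x2 > 0" using hyp_dist_0 hyp_dist_nonneg h ne by (metis less_eq_real_def)+
  have "collinear {x1, x2, x}" using collinear_subset[of "snd s" "{x1, x2, x}"] E(5) x12 xs by (simp add: collinear_aff_dim)
  \<comment> \<open>One of three collinear points lies between the others. The sum of distances
    found above excludes all cases but the one in which \<open>x\<close> is between
    \<open>x1\<close> and \<open>x2\<close>.\<close>
  hence "between (x2, x) x1 \<or> between (x, x1) x2 \<or> between (x1, x2) x" by (simp add: collinear_between_cases)
  thus False
  proof (elim disjE)
   assume "between (x2, x) x1"
   from hyp_dist_segment(2)[OF h(3,1), of x1] this show False using sum pos
    by (simp add: between_mem_segment hyp_dist_commute[of x2 x1] hyp_dist_commute[of x2 x] hyp_dist_commute[of x x1])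
  next
   assume "between (x, x1) x2"
   from hyp_dist_segment(2)[OF h(1,2), of x2] this show False using sum pos
    by (simp add: between_mem_segment hyp_dist_commute[of x2 x1] hyp_dist_commute[of x x1])
  next
   assume "between (x1, x2) x"
   hence "x \<in> open_segment x1 x2" using ne by (simp add: between_mem_segment open_segment_def)
   thus False using xe x12 unfolding extreme_point_of_def by blast
  qed
 qed
 thus ?thesis using extreme_point_of_face[OF fc(2)] s(4) by (simp add: x_def)
qed

lemma extreme_glued:
 assumes "(p, q) \<in> glued C" "p \<in> base_points C" "snd p extreme_point_of base C (fst p)"
 shows "snd q extreme_point_of base C (fst q)" using assms(1) unfolding glued_gstep
proof (induction rule: rtrancl_induct)
 case (step y z)
 have "y \<in> base_points C" using glued_base[of p y] step(1) assms(2) by (simp add: glued_gstep)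
 thus ?case using extreme_gstep[OF step(2)] step(3) by blast
qed (rule assms(3))

lemma cls_interior:
 assumes p: "p \<in> base_points C" and F: "\<And>e. e edge_of base C (fst p) ==> snd p \<notin> e"
 shows "cls p = {p}"
proof -
 have "q = p" if "q \<in> cls p" for q
 proof -
  have "(p, q) \<in> gstep\<^sup>*" using that by (simp add: cls_iff glued_gstep)
  thus "q = p"
  proof (induction rule: rtrancl_induct)
   case (step y z)
   hence "(p, z) \<in> gstep" by simp
   then obtain s where "s \<in> sides C" "fst p = fst s" "snd p \<in> snd s" using gstep_base[OF _ p] by metis
   thus ?case using F[of "snd s"] sidesD[of s] by simp
  qed simp
 qed
 thus ?thesis using cls_self[of p] by blast
qed

text \<open>A class is a transitive closure, so finiteness needs the geometry: vertices are glued
  only to vertices, of which there are finitely many; a point inside an edge is glued only to its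
  partner; other points are alone.\<close>

lemma finite_cls:
 assumes p: "p \<in> base_points C" shows "finite (cls p)"
proof (cases "snd p extreme_point_of base C (fst p)")
 case True
 have "cls p \<subseteq> (SIGMA i : cells C. {v. v extreme_point_of base C i})"
  using extreme_glued[OF _ p True] cls_base[OF p] by (auto simp: cls_iff base_points_def)
 moreover have "finite (SIGMA i : cells C. {v. v extreme_point_of base C i})"
  using finite_polyhedron_extreme_points[OF polygon.A_facts(4)[OF pg]] fin_cells by (intro finite_SigmaI) auto
 ultimately show ?thesis by (rule finite_subset)
next
 case False
 have pi: "fst p \<in> cells C" using p by (simp add: base_pointsD)
 show ?thesis
 proof (cases "\<exists>e. e edge_of base C (fst p) \<and> snd p \<in> e")
  case F: False
  show ?thesis using cls_interior[OF p] F by auto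
 next
  case True
  then obtain e where e: "e edge_of base C (fst p)" "snd p \<in> e" by blast
  define s where "s = (fst p, e)"
  define p' where "p' = (fst (mate C s), gluing C s (snd p))"
  have s: "s \<in> sides C" using e pi by (simp add: s_def sides_def)
  have pp': "(p, p') \<in> gstep" using gstep_edge[OF s, of "snd p"] e(2) by (simp add: s_def p'_def)
  have p'e: "snd p' \<in> snd (mate C s)" using gl_edge[OF s] e(2) by (auto simp: p'_def s_def)
  have p'b: "p' \<in> base_points C" using gstep_base[OF pp' p] by blast
  have ne': "\<not> snd p' extreme_point_of base C (fst p')" using extreme_gstep[OF gstep_sym[OF pp'] p'b] False by blast
  have "cls p \<subseteq> {p, p'}"
  proof
   fix q assume "q \<in> cls p"
   hence "(p, q) \<in> gstep\<^sup>*" by (simp add: cls_iff glued_gstep)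
   thus "q \<in> {p, p'}"
   proof (induction rule: rtrancl_induct)
    case (step y z)
    hence "y = p \<or> y = p'" by blast
    thus ?case
    proof
     assume y: "y = p"
     obtain t where t: "t \<in> sides C" "fst p = fst t" "snd p \<in> snd t" "z = (fst (mate C t), gluing C t (snd p))"
      using gstep_base[OF step(2)[unfolded y] p] by metis
     have "snd t = e" using polygon.two_edges_extreme[OF pg[OF pi]] False e sidesD[OF t(1)] t by metis
     hence "t = s" using t(2) by (simp add: s_def prod_eq_iff)
     thus ?thesis using t(4) by (simp add: p'_def)
    next
     assume y: "y = p'"
     obtain t where t: "t \<in> sides C" "fst p' = fst t" "snd p' \<in> snd t" "z = (fst (mate C t), gluing C t (snd p'))"
      using gstep_base[OF step(2)[unfolded y] p'b] by metis
     have m: "fst p' \<in> cells C" "fst (mate C s) = fst p'" "snd (mate C s) edge_of base C (fst p')"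
      using sidesD[OF mate(1)[OF s]] by (simp_all add: p'_def)
     have "snd t = snd (mate C s)" using polygon.two_edges_extreme[OF pg[OF m(1)]] ne' p'e m(3) sidesD[OF t(1)] t by metis
     hence "t = mate C s" using t(2) m(2) by (simp add: prod_eq_iff)
     hence "z = p" using t(4) mate(3)[OF s] gl_inv[OF s edge_lf[OF s]] e(2) by (simp add: p'_def s_def)
     thus ?thesis by simp
    qed
   qed simp
  qed
  thus ?thesis using finite_subset by blast
 qed
qed

lemma cls_closed: "(q, r) \<in> gstep ==> q \<in> cls p ==> r \<in> cls p" by (simp add: cls_iff glued_gstep)

lemma far_edges:
 assumes i: "i \<in> cells C" and v: "v \<in> base C i"
 shows "\<exists>\<delta>>0. \<forall>e y. e edge_of base C i --> v \<notin> e --> y \<in> e --> \<delta> \<le> hyp_dist v y"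
proof -
 define S where "S = \<Union> {e. e edge_of base C i \<and> v \<notin> e}"
 have "compact S" unfolding S_def using polygon.finite_edges[OF pg[OF i]] polygon.edge_facts(2)[OF pg[OF i]] by (intro compact_Union) auto
 moreover have "S \<subseteq> hyp_space" using polygon.edge_facts(1)[OF pg[OF i]] base_hyp[OF i] by (auto simp: S_def)
 moreover have "v \<notin> S" by (auto simp: S_def)
 ultimately obtain \<delta> where "\<delta> > 0" "\<forall>y\<in>S. \<delta> \<le> hyp_dist v y"
  using hyp_dist_compact_pos[OF base_hyp[OF i v]] by blast
 thus ?thesis by (intro exI[of _ \<delta>]) (auto simp: S_def)
qed

definition corners :: "'i \<times> (real^3) \<Rightarrow> (((real^3) \<times> real) \<times> ((real^3) \<times> real) \<times> real) set \<Rightarrow> real \<Rightarrow> bool" where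
 "corners p = polygon.corner_system (base C (fst p)) (nu (fst p)) (snd p)"

text \<open>The factor 2 makes the stars of two representatives in the same cell disjoint, so a
  nearby point belongs to only one of them.\<close>

definition good_radius where
 "good_radius Z Cc eps \<longleftrightarrow> 0 < eps \<and> star_bound Z eps \<and> (\<forall>p\<in>Z. corners p (Cc p) eps) \<and>
   (\<forall>p\<in>Z. \<forall>q\<in>Z. fst p = fst q --> p \<noteq> q --> 2 * eps \<le> hyp_dist (snd p) (snd q))"

lemma good_radius_exists:
 assumes p: "p \<in> base_points C" and eps0: "eps0 > 0"
 shows "\<exists>Cc eps. eps \<le> eps0 \<and> good_radius (cls p) Cc eps"
proof -
 define Z where "Z = cls p"
 have Zb: "Z \<subseteq> base_points C" unfolding Z_def by (rule cls_base[OF p])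
 have fZ: "finite Z" unfolding Z_def by (rule finite_cls[OF p])
 have "\<forall>q\<in>Z. \<exists>Ce. corners q (fst Ce) (snd Ce)"
 proof
  fix q assume "q \<in> Z"
  hence q: "fst q \<in> cells C" "snd q \<in> base C (fst q)" using Zb by (auto simp: base_pointsD)
  obtain Cs eps where "corners q Cs eps" unfolding corners_def using polygon.corner_system_exists[OF pg[OF q(1)] q(2)] by blast
  thus "\<exists>Ce. corners q (fst Ce) (snd Ce)" by (intro exI[of _ "(Cs, eps)"]) simp
 qed
 from bchoice[OF this] obtain Ce where Ce: "\<forall>q\<in>Z. corners q (fst (Ce q)) (snd (Ce q))" by blast
 define Q where "Q q eps \<longleftrightarrow> corners q (fst (Ce q)) eps \<and>
   (\<forall>e y. e edge_of base C (fst q) --> snd q \<notin> e --> y \<in> e --> eps \<le> hyp_dist (snd q) y) \<and>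
   (\<forall>q'\<in>Z. fst q = fst q' --> q \<noteq> q' --> 2 * eps \<le> hyp_dist (snd q) (snd q'))" for q eps
 have "\<exists>eps>0. eps \<le> eps0 \<and> (\<forall>q\<in>Z. Q q eps)"
 proof (rule finite_uniform_bound[OF fZ eps0])
  fix q assume q: "q \<in> Z"
  hence qb: "fst q \<in> cells C" "snd q \<in> base C (fst q)" using Zb by (auto simp: base_pointsD)
  have c: "corners q (fst (Ce q)) (snd (Ce q))" using Ce q by blast
  have cp: "snd (Ce q) > 0" using c unfolding corners_def polygon.corner_system_def[OF pg[OF qb(1)]] polygon.corner_sectors_def[OF pg[OF qb(1)]] by blast
  obtain d1 where d1: "d1 > 0" "\<And>e y. e edge_of base C (fst q) ==> snd q \<notin> e ==> y \<in> e ==> d1 \<le> hyp_dist (snd q) y"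
   using far_edges[OF qb] by blast
  have "\<exists>eps>0. \<forall>y\<in>snd ` {q'\<in>Z. fst q = fst q' \<and> q \<noteq> q'}. eps \<le> hyp_dist (snd q) y"
  proof (rule hyp_dist_compact_pos[OF base_hyp[OF qb]])
   show "compact (snd ` {q'\<in>Z. fst q = fst q' \<and> q \<noteq> q'})" using fZ by (intro finite_imp_compact) auto
   show "snd ` {q'\<in>Z. fst q = fst q' \<and> q \<noteq> q'} \<subseteq> hyp_space" using Zb base_points_hyp by blast
   show "snd q \<notin> snd ` {q'\<in>Z. fst q = fst q' \<and> q \<noteq> q'}" by (auto simp: prod_eq_iff)
  qed
  then obtain d2 where d2: "d2 > 0" "\<And>q'. q' \<in> Z ==> fst q = fst q' ==> q \<noteq> q' ==> d2 \<le> hyp_dist (snd q) (snd q')" by blast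
  show "\<exists>\<delta>>0. \<forall>eps. 0 < eps --> eps \<le> \<delta> --> Q q eps"
  proof (intro exI[of _ "min (snd (Ce q)) (min d1 (d2 / 2))"] conjI allI impI)
   show "0 < min (snd (Ce q)) (min d1 (d2 / 2))" using cp d1 d2 by simp
   fix eps assume e: "0 < eps" "eps \<le> min (snd (Ce q)) (min d1 (d2 / 2))"
   have "corners q (fst (Ce q)) eps" unfolding corners_def
    by (rule polygon.corner_system_mono[OF pg[OF qb(1)] c[unfolded corners_def] e(1)]) (use e in simp)
   moreover have "eps \<le> hyp_dist (snd q) y" if "e edge_of base C (fst q)" "snd q \<notin> e" "y \<in> e" for e y
    using d1(2)[OF that] e(2) by simp
   moreover have "2 * eps \<le> hyp_dist (snd q) (snd q')" if "q' \<in> Z" "fst q = fst q'" "q \<noteq> q'" for q'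
    using d2(2)[OF that] e(2) by simp
   ultimately show "Q q eps" unfolding Q_def by blast
  qed
 qed
 then obtain eps where eps: "eps > 0" "eps \<le> eps0" "\<And>q. q \<in> Z ==> Q q eps" by blast
 have "good_radius Z (\<lambda>q. fst (Ce q)) eps" unfolding good_radius_def star_bound_def
 proof (intro conjI ballI allI impI)
  show "(q, r) \<in> gstep ==> r \<in> Z" if "q \<in> Z" for q r using cls_closed that by (simp add: Z_def)
 qed (use eps Zb in \<open>auto simp: Q_def\<close>)
 thus ?thesis using eps(2) unfolding Z_def by blast
qed

end

section \<open>The boundary metric\<close>

locale marked_cusp = cusp C for C :: "'i cuspidal_complex" +
 fixes g :: "complex \<times> complex \<Rightarrow> complex \<times> complex \<Rightarrow> real" and Sing :: "(complex \<times> complex) set"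
  and \<phi> :: "complex \<times> complex \<Rightarrow> ('i \<times> (real^3)) set"
 assumes met: "hyp_cone_metric_on_torus g Sing" and ident: "boundary_identification g Sing C \<phi>"
begin

lemma bij: "bij_betw \<phi> torus (cusp_boundary C)"
 and g_bd: "\<And>x y. x \<in> torus ==> y \<in> torus ==> g x y = boundary_dist C (\<phi> x) (\<phi> y)"
 using ident by (auto simp: boundary_identification_def isometry_between_def)

sublocale M: Metric_space torus g using met by (simp add: hyp_cone_metric_on_torus_def)

lemma boundary_cls: "cusp_boundary C = cls ` base_points C" by (auto simp: cusp_boundary_def quotient_def cls_def)

definition pt :: "'i \<times> (real^3) \<Rightarrow> complex \<times> complex" where
 "pt p = inv_into torus \<phi> (cls p)"

lemma pt: assumes "p \<in> base_points C" shows "pt p \<in> torus" "\<phi> (pt p) = cls p"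
proof -
 have "\<phi> ` torus = cls ` base_points C" using bij by (simp only: boundary_cls bij_betw_def)
 hence c: "cls p \<in> \<phi> ` torus" using assms by blast
 show "pt p \<in> torus" "\<phi> (pt p) = cls p" unfolding pt_def by (rule inv_into_into[OF c], rule f_inv_into_f[OF c])
qed

lemma pt_surj: assumes "w \<in> torus" shows "\<exists>p\<in>base_points C. w = pt p \<and> \<phi> w = cls p"
proof -
 have "\<phi> w \<in> cls ` base_points C" using bij_betwE[OF bij] assms unfolding boundary_cls by blast
 then obtain p where p: "p \<in> base_points C" "\<phi> w = cls p" by blast
 have "w = pt p" unfolding pt_def p(2)[symmetric] using assms bij by (simp add: bij_betw_def inv_into_f_f)
 thus ?thesis using p by blast
qed

lemma pt_rep: assumes "w \<in> torus" "p \<in> \<phi> w" shows "p \<in> base_points C" "pt p = w" "\<phi> w = cls p"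
proof -
 obtain q where q: "q \<in> base_points C" "w = pt q" "\<phi> w = cls q" using pt_surj[OF assms(1)] by blast
 have "(q, p) \<in> glued C" using assms(2) q(3) by (simp add: cls_iff)
 hence c: "cls q = cls p" by (simp only: cls_eq)
 show "p \<in> base_points C" by (rule glued_base[OF \<open>(q, p) \<in> glued C\<close> q(1)])
 show "pt p = w" unfolding q(2) pt_def c ..
 show "\<phi> w = cls p" unfolding q(3) by (rule c)
qed

lemma pt_eq:
 assumes "p \<in> base_points C" "q \<in> base_points C" shows "pt p = pt q \<longleftrightarrow> (p, q) \<in> glued C"
proof
 assume "pt p = pt q"
 hence "cls p = cls q" using pt(2)[OF assms(1)] pt(2)[OF assms(2)] by simp
 thus "(p, q) \<in> glued C" by (simp only: cls_eq)
next
 assume "(p, q) \<in> glued C"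
 hence "cls p = cls q" by (simp only: cls_eq)
 thus "pt p = pt q" by (simp only: pt_def)
qed

lemma g_pt: "p \<in> base_points C ==> q \<in> base_points C ==> g (pt p) (pt q) = gluing_dist (base_points C) (glued C) (cls p) (cls q)"
 using g_bd pt by (simp add: boundary_dist_def)

lemma g_pt_le: "p \<in> base_points C ==> q \<in> base_points C ==> fst p = fst q ==> g (pt p) (pt q) \<le> hyp_dist (snd p) (snd q)"
 using gluing_dist_pair[OF base_points_hyp] g_pt by simp

text \<open>Unconnected points would all be at the same distance \<open>Inf {}\<close>, which contradicts the connectedness of the torus.\<close>
lemma chain_exists:
 assumes p: "p \<in> base_points C" and q: "q \<in> base_points C"
 shows "\<exists>ch. is_chain (base_points C) ch (cls p) (cls q)"
proof (rule ccontr)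
 assume no: "\<not> ?thesis"
 define k0 :: real where "k0 = Inf {}"
 define con where "con a b \<longleftrightarrow> (\<exists>ch. is_chain (base_points C) ch (cls a) (cls b))" for a b
 have nk: "g (pt a) (pt b) = k0" if "a \<in> base_points C" "b \<in> base_points C" "\<not> con a b" for a b
 proof -
  have "{chain_length ch | ch. is_chain (base_points C) ch (cls a) (cls b)} = {}" using that(3) by (auto simp: con_def)
  thus ?thesis using g_pt[OF that(1,2)] by (simp add: gluing_dist_chain k0_def)
 qed
 have tr: "con a c" if "con a b" "con b c" for a b c using that chain_append unfolding con_def by blast
 have re: "con a a" if "a \<in> base_points C" for a using chain_singleton[OF that that refl] unfolding con_def by blast
 have npq: "\<not> con p q" using no by (simp add: con_def)
 have "pt p \<noteq> pt q" using npq re[OF p] pt_eq[OF p q] cls_eq by (metis con_def)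
 hence k0: "k0 > 0" using nk[OF p q npq] M.mdist_pos_less pt p q by metis
 define U where "U = {pt a | a. a \<in> base_points C \<and> con p a}"
 have cls_con: "con p b" if "con p a" "pt a = pt b" "a \<in> base_points C" "b \<in> base_points C" for a b
  using that pt_eq cls_eq by (metis con_def)
 have UT: "U \<subseteq> torus" using pt by (auto simp: U_def)
 have out: "w \<in> torus - U ==> \<exists>b\<in>base_points C. w = pt b \<and> \<not> con p b" for w using pt_surj[of w] by (auto simp: U_def)
 have sep: "g w w' = k0" if "w \<in> U" "w' \<in> torus - U" for w w'
 proof -
  obtain a where a: "a \<in> base_points C" "w = pt a" "con p a" using \<open>w \<in> U\<close> unfolding U_def by blast
  obtain b where b: "b \<in> base_points C" "w' = pt b" "\<not> con p b" using out[OF \<open>w' \<in> torus - U\<close>] by blast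
  show ?thesis using nk[OF a(1) b(1)] tr a b by blast
 qed
 have "openin M.mtopology U" unfolding M.openin_mtopology
 proof (intro conjI ballI allI impI UT)
  fix w assume w: "w \<in> U"
  have "M.mball w k0 \<subseteq> U" using sep[OF w] by (auto simp: M.in_mball) (metis DiffI less_irrefl)
  thus "\<exists>r>0. M.mball w r \<subseteq> U" using k0 by blast
 qed
 moreover have "openin M.mtopology (torus - U)" unfolding M.openin_mtopology
 proof (intro conjI ballI allI impI)
  fix w assume w: "w \<in> torus - U"
  have "M.mball w k0 \<subseteq> torus - U"
  proof
   fix w' assume "w' \<in> M.mball w k0"
   hence w': "w' \<in> torus" "g w w' < k0" by (auto simp: M.in_mball)
   have "g w' w < k0" using w' M.commute by simp
   thus "w' \<in> torus - U" using sep[OF _ w, of w'] w' by auto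
  qed
  thus "\<exists>r>0. M.mball w r \<subseteq> torus - U" using k0 by blast
 qed auto
 moreover have "M.mtopology = top_of_set torus" using met by (simp add: hyp_cone_metric_on_torus_def)
 ultimately have "openin (top_of_set torus) U" "openin (top_of_set torus) (torus - U)" by simp_all
 moreover have "connected (torus :: (complex \<times> complex) set)" unfolding torus_def by (intro connected_Times connected_sphere) auto
 moreover have "pt p \<in> U" unfolding U_def using re[OF p] p by blast
 moreover have "pt q \<in> torus - U"
 proof (rule DiffI[OF pt(1)[OF q]], rule notI)
  assume "pt q \<in> U"
  then obtain a where "a \<in> base_points C" "pt q = pt a" "con p a" unfolding U_def by blast
  thus False using npq cls_con[of a q] q by metis
 qed
 ultimately show False unfolding connected_openin by blast
qed

lemma near_in_star:
 assumes p: "p \<in> base_points C" and q: "q \<in> base_points C" and Z: "star_bound (cls p) eps"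
  and l: "g (pt p) (pt q) < l" "l \<le> eps"
 shows "\<exists>l'<l. in_star (cls p) l' q"
proof -
 obtain ch0 where "is_chain (base_points C) ch0 (cls p) (cls q)" using chain_exists[OF p q] by blast
 then obtain ch where ch: "is_chain (base_points C) ch (cls p) (cls q)" "chain_length ch < l"
  using gluing_dist_less[of "base_points C" "cls p" "cls q" l ch0] l(1) g_pt[OF p q] by auto
 have h: "fst (hd ch) \<in> cls p" using ch(1) by (simp add: is_chain_def)
 hence "fst (hd ch) \<in> base_points C" using cls_base[OF p] by blast
 hence "in_star (cls p) 0 (fst (hd ch))"
  using h hyp_dist_self[OF base_points_hyp] unfolding in_star_def by (intro exI[of _ "snd (fst (hd ch))"]) simp
 hence "in_star (cls p) (0 + chain_length ch) (snd (last ch))" using star_chain[OF Z, of ch 0] ch l(2) unfolding is_chain_def by simp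
 moreover have "snd (last ch) \<in> cls q" using ch(1) by (simp add: is_chain_def)
 hence "(snd (last ch), q) \<in> glued C" "snd (last ch) \<in> base_points C" using glued_sym cls_iff cls_base[OF q] by blast+
 ultimately have "in_star (cls p) (chain_length ch) q" using in_star_glued[OF Z, of "chain_length ch"] ch(2) l(2) by simp
 thus ?thesis using ch(2) by blast
qed

text \<open>One segment gives the upper bound. A shorter chain would end within that length of
  another representative in the same cell, but representatives are at least \<open>2 * eps\<close>
  apart.\<close>

lemma near_dist:
 assumes Z: "good_radius (cls p) Cc eps" and p: "p \<in> base_points C" and v: "v \<in> cls p" and q: "q \<in> base_points C" "fst q = fst v"
  and d: "hyp_dist (snd v) (snd q) < eps"
 shows "g (pt p) (pt q) = hyp_dist (snd v) (snd q)"
proof (rule antisym)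
 have vb: "v \<in> base_points C" using v cls_base[OF p] by blast
 have "pt v = pt p" using v pt_eq[OF vb p] glued_sym by (auto simp: cls_iff)
 thus "g (pt p) (pt q) \<le> hyp_dist (snd v) (snd q)" using g_pt_le[OF vb q(1)] q(2) by simp
 show "hyp_dist (snd v) (snd q) \<le> g (pt p) (pt q)"
 proof (rule ccontr)
  assume "\<not> ?thesis"
  hence "g (pt p) (pt q) < hyp_dist (snd v) (snd q)" by simp
  then obtain l where l: "l < hyp_dist (snd v) (snd q)" "in_star (cls p) l q"
   using near_in_star[OF p q(1)] Z d unfolding good_radius_def by (metis less_imp_le)
  then obtain x where x: "(fst q, x) \<in> cls p" "hyp_dist x (snd q) \<le> l" by (auto simp: in_star_def)
  have "x \<noteq> snd v" using x(2) l(1) by auto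
  hence "2 * eps \<le> hyp_dist x (snd v)" using Z x(1) v q(2) unfolding good_radius_def by (metis fst_conv snd_conv)
  moreover have "x \<in> hyp_space" using x(1) cls_base[OF p] base_points_hyp by force
  hence "hyp_dist x (snd v) \<le> hyp_dist x (snd q) + hyp_dist (snd q) (snd v)"
   by (rule hyp_dist_triangle[OF _ base_points_hyp[OF q(1)] base_points_hyp[OF vb]])
  ultimately show False using x(2) l(1) d by (simp add: hyp_dist_commute[of "snd q"])
 qed
qed

lemma near_rep:
 assumes Z: "good_radius (cls p) Cc eps" and p: "p \<in> base_points C" and q: "q \<in> base_points C" and d: "g (pt p) (pt q) < eps"
 shows "\<exists>v\<in>cls p. fst v = fst q \<and> hyp_dist (snd v) (snd q) = g (pt p) (pt q)"
proof -
 obtain l where l: "l < eps" "in_star (cls p) l q" using near_in_star[OF p q _ d order.refl] Z unfolding good_radius_def by blast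
 then obtain x where x: "(fst q, x) \<in> cls p" "hyp_dist x (snd q) \<le> l" by (auto simp: in_star_def)
 have "g (pt p) (pt q) = hyp_dist (snd (fst q, x)) (snd q)" by (rule near_dist[OF Z p x(1) q]) (use x l in auto)
 thus ?thesis using x(1) by (intro bexI[of _ "(fst q, x)"]) simp_all
qed

definition Fb :: "complex \<times> complex \<Rightarrow> real" where "Fb w = N (SOME p. p \<in> \<phi> w)"

lemma Fb: assumes "w \<in> torus" "p \<in> \<phi> w" shows "Fb w = N p"
proof -
 have s: "(SOME p. p \<in> \<phi> w) \<in> \<phi> w" using assms(2) by (rule someI)
 have "\<phi> w = cls p" using pt_rep(3)[OF assms] .
 hence "(p, SOME p. p \<in> \<phi> w) \<in> glued C" using s by (simp add: cls_iff)
 thus ?thesis using N_glued by (simp add: Fb_def)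
qed

lemma Fb_pt: "p \<in> base_points C ==> Fb (pt p) = N p" using Fb[OF pt(1)] pt(2) cls_self by metis

lemma Fb_pos: "w \<in> torus ==> Fb w > 0" using pt_surj[of w] Fb_pt N_pos base_points_hyp by (metis base_pointsD)

lemma Sing_torus: "Sing \<subseteq> torus" using met by (simp add: hyp_cone_metric_on_torus_def)

lemma vertex_iff:
 assumes w: "w \<in> torus" and p: "p \<in> \<phi> w"
 shows "snd p extreme_point_of base C (fst p) \<longleftrightarrow> w \<in> Sing"
proof -
 have im: "\<phi> ` Sing = boundary_vertices C" using ident by (simp add: boundary_identification_def)
 have pb: "p \<in> base_points C" "\<phi> w = cls p" using pt_rep[OF w p] by auto
 show ?thesis
 proof
  assume x: "snd p extreme_point_of base C (fst p)"
  have "p \<in> base_vertices C" using x pb by (cases p) (simp add: base_vertices_def base_pointsD)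
  hence "\<phi> w \<in> boundary_vertices C" unfolding pb(2) by (auto simp: boundary_vertices_def quotient_def cls_def)
  then obtain w' where "w' \<in> Sing" "\<phi> w = \<phi> w'" using im by (metis imageE)
  thus "w \<in> Sing" using bij w Sing_torus by (metis bij_betw_def inj_onD subsetD)
 next
  assume "w \<in> Sing"
  hence "\<phi> w \<in> boundary_vertices C" using im by blast
  then obtain q where q: "q \<in> base_vertices C" "\<phi> w = cls q" unfolding boundary_vertices_def quotient_def cls_def by blast
  have "q \<in> base_points C" "snd q extreme_point_of base C (fst q)"
   using q(1) by (auto simp: base_vertices_def base_pointsD extreme_point_of_def)
  moreover have "(q, p) \<in> glued C" using p q(2) by (simp add: cls_iff)
  ultimately show "snd p extreme_point_of base C (fst p)" using extreme_glued by blast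
 qed
qed

end

section \<open>The horofunction near a boundary point\<close>

context cusp
begin

definition slope_at :: "'i \<times> (real^3) \<Rightarrow> (real^3) \<times> real \<Rightarrow> real" where
 "slope_at q u = - lorentz u (apex C (fst q), 1) / horofn (apex C (fst q)) (snd q)"

lemma apexed_eqs:
 assumes "i \<in> cells C"
 shows "apexed_polygon.horo (apex C i) x = horofn (apex C i) x"
  "apexed_polygon.hx (apex C i) v u = slope_at (i, v) u"
  "apexed_polygon.edge_M (base C i) (nu i) (apex C i) e = lorentz (polygon.edge_normal (base C i) (nu i) e) (apex C i, 1)"
 by (simp_all add: apexed_polygon.horo_def[OF ap[OF assms]] apexed_polygon.L_def[OF ap[OF assms]] horofn_def
   apexed_polygon.hx_def[OF ap[OF assms]] apexed_polygon.edge_M_def[OF ap[OF assms]] slope_at_def)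

lemma N_corner:
 assumes q: "fst q \<in> cells C" and f: "polygon.plane_frame (nu (fst q)) (snd q) (fst k) (fst (snd k))"
 shows "N (fst q, polygon.corner_ray (snd q) k r \<psi>) = N q * (cosh r + (slope_at q (fst k) * cos \<psi> + slope_at q (fst (snd k)) * sin \<psi>) * sinh r)"
  "(slope_at q (fst k))\<^sup>2 + (slope_at q (fst (snd k)))\<^sup>2 < 1"
proof -
 note A = ap[OF q]
 show "(slope_at q (fst k))\<^sup>2 + (slope_at q (fst (snd k)))\<^sup>2 < 1"
  using apexed_polygon.frame_norm(2)[OF A f] by (simp add: apexed_eqs[OF q])
 show "N (fst q, polygon.corner_ray (snd q) k r \<psi>) = N q * (cosh r + (slope_at q (fst k) * cos \<psi> + slope_at q (fst (snd k)) * sin \<psi>) * sinh r)"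
  using apexed_polygon.horo_ray[OF A f, of \<psi> r] unfolding N_def polygon.corner_ray_def[OF pg[OF q]] by (simp add: apexed_eqs[OF q])
qed

lemma slope_end:
 assumes "fst q \<in> cells C"
 shows "corner_slope (snd (snd k)) (slope_at q (fst k)) (slope_at q (fst (snd k))) b = slope_at q (polygon.end_normal k b)"
 unfolding polygon.end_normal_def[OF pg[OF assms]] corner_slope_def
 by (simp add: slope_at_def diff_divide_distrib algebra_simps del: scaleR_Pair)

text \<open>Convexity at an edge bounds the sum of the slopes of \<^const>\<open>N\<close> across it.\<close>
lemma edge_slope:
 assumes s: "s \<in> sides C" and v: "v \<in> snd s" "y \<in> snd s" "y \<noteq> v"
 shows "slope_at (fst s, v) (polygon.edge_normal (base C (fst s)) (nu (fst s)) (snd s)) +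
  slope_at (fst (mate C s), gluing C s v) (polygon.edge_normal (base C (fst (mate C s))) (nu (fst (mate C s))) (snd (mate C s))) \<le> 0"
proof -
 define i j e f where "i = fst s" and "j = fst (mate C s)" and "e = snd s" and "f = snd (mate C s)"
 define w x where "w = gluing C s v" and "x = gluing C s y"
 have s': "mate C s \<in> sides C" using mate(1)[OF s] .
 have i: "i \<in> cells C" "e edge_of base C i" and j: "j \<in> cells C" "f edge_of base C j"
  using sidesD[OF s] sidesD[OF s'] by (simp_all add: i_def j_def e_def f_def)
 interpret I: apexed_polygon "base C i" "nu i" "apex C i" by (rule ap[OF i(1)])
 interpret J: apexed_polygon "base C j" "nu j" "apex C j" by (rule ap[OF j(1)])
 have ve: "v \<in> e" "y \<in> e" using v by (simp_all add: e_def)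
 have wf: "w \<in> f" "x \<in> f" using gl_edge[OF s] v by (auto simp: w_def x_def f_def)
 have vh: "v \<in> hyp_space" "y \<in> hyp_space" using side_edge(3)[OF s] v by auto
 have wh: "w \<in> hyp_space" "x \<in> hyp_space" using side_edge(3)[OF s'] wf unfolding f_def by auto
 define d where "d = hyp_dist v y"
 have d: "d > 0" unfolding d_def using hyp_dist_0[OF vh] hyp_dist_nonneg[OF vh] v(3) by force
 have dj: "hyp_dist w x = d" unfolding w_def x_def d_def by (rule gl_dist[OF s edge_lf[OF s v(1)] edge_lf[OF s v(2)]])
 have xw: "w \<noteq> x" using dj d hyp_dist_self[OF wh(1)] by auto
 define n m where "n = N (i, v)" and "m = N (i, y)"
 have nm: "N (j, w) = n" "N (j, x) = m" unfolding n_def m_def j_def i_def w_def x_def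
  using N_glue[OF s edge_lf[OF s v(1)]] N_glue[OF s edge_lf[OF s v(2)]] by simp_all
 have np: "n > 0" unfolding n_def using N_pos[of "(i, v)"] i vh by simp
 have hi: "height i > 0" and hj: "height j > 0" using height(1) i j by auto
 have ho: "I.horo v = n * height i" "I.horo y = m * height i" "J.horo w = n * height j" "J.horo x = m * height j"
  using nm hi hj by (simp_all add: apexed_eqs[OF i(1)] apexed_eqs[OF j(1)] n_def m_def N_def divide_eq_eq)
 \<comment> \<open>\<open>N\<close> agrees on the two copies of the edge, so by
   \<open>edge_K_eq\<close> the values \<open>edge_K\<close> on the two sides differ only by the
   factors \<open>height\<close>.\<close>
 define Q where "Q = 2 * n * m * cosh d - n\<^sup>2 - m\<^sup>2"
 have ki: "(I.edge_K e)\<^sup>2 * (sinh d)\<^sup>2 = (height i)\<^sup>2 * Q"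
  using I.edge_K_eq[OF i(2) ve] v(3) unfolding ho by (simp add: d_def Q_def power2_eq_square algebra_simps)
 have kj: "(J.edge_K f)\<^sup>2 * (sinh d)\<^sup>2 = (height j)\<^sup>2 * Q"
  using J.edge_K_eq[OF j(2) wf xw] unfolding ho dj by (simp add: Q_def power2_eq_square algebra_simps)
 have "(I.edge_K e * height j)\<^sup>2 * (sinh d)\<^sup>2 = (height j)\<^sup>2 * ((I.edge_K e)\<^sup>2 * (sinh d)\<^sup>2)" by (simp add: power_mult_distrib)
 also have "\<dots> = (height i)\<^sup>2 * ((J.edge_K f)\<^sup>2 * (sinh d)\<^sup>2)" unfolding ki kj by simp
 finally have "(I.edge_K e * height j)\<^sup>2 * (sinh d)\<^sup>2 = (J.edge_K f * height i)\<^sup>2 * (sinh d)\<^sup>2"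
  by (simp add: power_mult_distrib mult.commute)
 hence "(I.edge_K e * height j)\<^sup>2 = (J.edge_K f * height i)\<^sup>2" using d by simp
 hence KK: "I.edge_K e * height j = J.edge_K f * height i"
  using I.edge_K(1) J.edge_K(1) hi hj by (simp add: power2_eq_iff_nonneg less_imp_le)
 define a b where "a = I.edge_M e / I.edge_K e" and "b = J.edge_M f / J.edge_K f"
 have "side_angle C s + side_angle C (mate C s) \<le> pi" using conv s by (simp add: convex_cusp_def)
 \<comment> \<open>With \<open>a\<close> and \<open>b\<close> the cosines of the two base angles, an
   angle sum of at most \<open>pi\<close> means that \<open>a + b\<close> is nonnegative.\<close>
 hence "arccos a + arccos b \<le> pi"
  using I.base_angle_eq(1)[OF i(2)] J.base_angle_eq(1)[OF j(2)] by (simp add: side_angle_def a_def b_def i_def j_def e_def f_def)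
 moreover have ab: "\<bar>a\<bar> \<le> 1" "\<bar>b\<bar> \<le> 1" using I.base_angle_eq(2)[OF i(2)] J.base_angle_eq(2)[OF j(2)] by (simp_all add: a_def b_def)
 ultimately have "arccos a \<le> arccos (- b)" by (simp add: arccos_minus)
 hence "- b \<le> a" using arccos_le_mono[of a "- b"] ab by simp
 hence "0 \<le> (a + b) * (I.edge_K e * height j)" using I.edge_K(1)[of e] hj by simp
 also have "\<dots> = a * I.edge_K e * height j + b * (I.edge_K e * height j)" by (simp add: algebra_simps)
 also have "\<dots> = I.edge_M e * height j + J.edge_M f * height i"
  unfolding KK using I.edge_K(1)[of e] J.edge_K(1)[of f] by (simp add: a_def b_def)
 finally have "0 \<le> (I.edge_M e * height j + J.edge_M f * height i) / (n * height i * height j)" using np hi hj by simp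
 also have "\<dots> = I.edge_M e / I.horo v + J.edge_M f / J.horo w" unfolding ho using np hi hj by (simp add: field_simps)
 finally show ?thesis by (simp add: slope_at_def apexed_eqs[OF i(1)] apexed_eqs[OF j(1)] flip: i_def j_def e_def f_def w_def)
qed

lemma vertex_corner:
 assumes q: "fst q \<in> cells C" "snd q \<in> base C (fst q)" and x: "snd q extreme_point_of base C (fst q)" and c: "corners q Cq eps"
 shows "\<exists>k. Cq = {k} \<and> snd (snd k) < pi \<and> sector_angle (snd (snd k)) (slope_at q (fst k))
   (slope_at q (fst k) * cos (snd (snd k)) + slope_at q (fst (snd k)) * sin (snd (snd k))) = lateral_angle (base C (fst q)) (apex C (fst q)) (snd q)"
proof -
 interpret I: apexed_polygon "base C (fst q)" "nu (fst q)" "apex C (fst q)" by (rule ap[OF q(1)])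
 obtain k e f where k: "Cq = {k}" "snd (snd k) < pi" "e edge_of base C (fst q)" "f edge_of base C (fst q)" "e \<noteq> f" "snd q \<in> e" "snd q \<in> f"
    "I.end_normal k False = I.edge_normal e" "I.end_normal k True = I.edge_normal f"
    "\<And>g. g edge_of base C (fst q) ==> snd q \<in> g ==> g = e \<or> g = f"
  using c[unfolded corners_def I.corner_system_def I.corner_type_def] unfolding if_P[OF x] by metis
 have pf: "I.plane_frame (snd q) (fst k) (fst (snd k))"
  using c k(1) unfolding corners_def I.corner_system_def I.corner_sectors_def by blast
 have n: "I.edge_normal e = fst (snd k)" "I.edge_normal f = sin (snd (snd k)) *\<^sub>R fst k - cos (snd (snd k)) *\<^sub>R fst (snd k)"
  using k(8,9) by (simp_all add: I.end_normal_def)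
 from I.lateral_angle_eq[OF x k(3-7,10) pf n] show ?thesis using k(1,2) by (intro exI[of _ k]) (simp add: apexed_eqs[OF q(1)])
qed

end

context marked_cusp
begin

text \<open>Off the edges a class is a single point, and a chain shorter than
  \<open>\<delta>\<close> that starts there cannot reach another cell.\<close>

lemma interior_dist:
 assumes x: "x \<in> base_points C" and y: "y \<in> base_points C" "fst y = fst x"
  and far: "\<And>e w. e edge_of base C (fst x) ==> w \<in> e ==> \<delta> \<le> hyp_dist (snd x) w"
  and d: "hyp_dist (snd x) (snd y) < \<delta>"
 shows "g (pt x) (pt y) = hyp_dist (snd x) (snd y)"
proof (rule antisym)
 show "g (pt x) (pt y) \<le> hyp_dist (snd x) (snd y)" using g_pt_le[OF x y(1)] y(2) by simp
 have \<delta>: "\<delta> > 0" using d hyp_dist_nonneg[OF base_points_hyp[OF x] base_points_hyp[OF y(1)]] by linarith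
 have no: "snd x \<notin> e" if "e edge_of base C (fst x)" for e
  using far[OF that, of "snd x"] \<delta> hyp_dist_self[OF base_points_hyp[OF x]] by auto
 have cl: "cls x = {x}" by (rule cls_interior[OF x no])
 have sb: "star_bound (cls x) \<delta>" unfolding star_bound_def cl
 proof (intro conjI allI impI ballI)
  fix p q assume "p \<in> {x}" "(p, q) \<in> gstep"
  thus "q \<in> {x}" using cls_closed[of p q x] cl by simp
 qed (use x far in auto)
 show "hyp_dist (snd x) (snd y) \<le> g (pt x) (pt y)"
 proof (rule ccontr)
  assume "\<not> ?thesis"
  then obtain l where "l < hyp_dist (snd x) (snd y)" "in_star (cls x) l y"
   using near_in_star[OF x y(1) sb, of "hyp_dist (snd x) (snd y)"] d by auto
  thus False unfolding cl in_star_def using y(2) by (cases x) auto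
 qed
qed

text \<open>The fan at \<open>z\<close> consists of all corners at all representatives of
  \<open>z\<close>. A corner contributes its share of the particle angle at a vertex and
  \<open>pi\<close> elsewhere, so one statement covers singular and regular points.\<close>

lemma cusp_profile:
 assumes chart: "polar_chart torus g z \<alpha> eps0 R" and z: "z \<in> torus"
 obtains eps G dp dm where "0 < eps" "eps \<le> eps0"
  "\<And>t. conc_germ G dp dm t" "\<And>t. G (t + \<alpha>) = G t" "\<And>t. dp (t + \<alpha>) = dp t" "\<And>t. dm (t + \<alpha>) = dm t"
  "\<And>r t. 0 \<le> r ==> r < eps ==> Fb (R r t) = Fb z * (cosh r + G t * sinh r)"
  "\<And>u. ((\<lambda>t. angle_density (G t) (dp t)) has_integral (if z \<in> Sing then particle_angle C (\<phi> z) else \<alpha>)) {u..u+\<alpha>}"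
proof -
 interpret P0: polar_chart torus g z \<alpha> eps0 R by (rule chart)
 obtain p where p: "p \<in> base_points C" "z = pt p" "\<phi> z = cls p" using pt_surj[OF z] by blast
 obtain Cc eps where ele: "eps \<le> eps0" and gr: "good_radius (cls p) Cc eps" using good_radius_exists[OF p(1) P0.eps] by blast
 define Z where "Z = cls p"
 define K where "K = (SIGMA q : Z. Cc q)"
 have e0: "eps > 0" and sep: "\<And>q q'. q \<in> Z ==> q' \<in> Z ==> fst q = fst q' ==> q \<noteq> q' ==> 2 * eps \<le> hyp_dist (snd q) (snd q')"
  using gr unfolding good_radius_def Z_def by blast+
 have cs: "corners q (Cc q) eps" if "q \<in> Z" for q using gr that unfolding good_radius_def Z_def by blast
 have Zb: "q \<in> base_points C" "fst q \<in> cells C" "snd q \<in> base C (fst q)" "snd q \<in> hyp_space" if "q \<in> Z" for q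
  using cls_base[OF p(1)] that base_points_hyp by (auto simp: Z_def base_pointsD)
 have Zpt: "pt q = z" if "q \<in> Z" for q
  using that unfolding p(2) Z_def cls_iff using pt_eq[OF p(1) Zb(1)[unfolded Z_def]] by (simp add: cls_iff)
 have FbZ: "N q = Fb z" if "q \<in> Z" for q using Fb_pt[OF Zb(1)[OF that]] Zpt[OF that] by simp
 have secs: "finite (Cc q)" "k \<in> Cc q ==> polygon.plane_frame (nu (fst q)) (snd q) (fst k) (fst (snd k))"
    "k \<in> Cc q ==> 0 < snd (snd k) \<and> snd (snd k) \<le> pi"
    "k \<in> Cc q ==> 0 \<le> r ==> r < eps ==> \<psi> \<in> {0..snd (snd k)} ==> polygon.corner_ray (snd q) k r \<psi> \<in> base C (fst q)"
    "y \<in> base C (fst q) ==> 0 < hyp_dist (snd q) y ==> hyp_dist (snd q) y < eps ==>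
     \<exists>k\<in>Cc q. \<exists>\<psi>\<in>{0..snd (snd k)}. y = polygon.corner_ray (snd q) k (hyp_dist (snd q) y) \<psi>"
    "k \<in> Cc q ==> 0 < r ==> r < eps ==> \<psi> \<in> {0<..<snd (snd k)} ==> e edge_of base C (fst q) ==> polygon.corner_ray (snd q) k r \<psi> \<notin> e"
    "k \<in> Cc q ==> k' \<in> Cc q ==> 0 < r ==> r < eps ==> \<psi> \<in> {0<..<snd (snd k)} ==> \<psi>' \<in> {0..snd (snd k')} ==>
     polygon.corner_ray (snd q) k r \<psi> = polygon.corner_ray (snd q) k' r \<psi>' ==> k = k' \<and> \<psi> = \<psi>'"
  if q: "q \<in> Z" for q k k' r \<psi> \<psi>' y e
 proof -
  interpret I: polygon "base C (fst q)" "nu (fst q)" by (rule pg[OF Zb(2)[OF q]])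
  have "I.corner_sectors (snd q) (Cc q) eps" using cs[OF q] by (simp add: corners_def I.corner_system_def)
  note c = this[unfolded I.corner_sectors_def]
  note c3 = c[THEN conjunct2, THEN conjunct2] and c4 = c[THEN conjunct2, THEN conjunct2, THEN conjunct2]
  note c6 = c4[THEN conjunct2, THEN conjunct2]
  show "finite (Cc q)" by (rule c[THEN conjunct1])
  show "polygon.plane_frame (nu (fst q)) (snd q) (fst k) (fst (snd k))" if "k \<in> Cc q" using c3[THEN conjunct1] that by blast
  show "0 < snd (snd k) \<and> snd (snd k) \<le> pi" if "k \<in> Cc q" using c3[THEN conjunct1] that by blast
  show "polygon.corner_ray (snd q) k r \<psi> \<in> base C (fst q)" if "k \<in> Cc q" "0 \<le> r" "r < eps" "\<psi> \<in> {0..snd (snd k)}"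
   using c4[THEN conjunct1, rule_format, OF that] .
  show "\<exists>k\<in>Cc q. \<exists>\<psi>\<in>{0..snd (snd k)}. y = polygon.corner_ray (snd q) k (hyp_dist (snd q) y) \<psi>"
   if "y \<in> base C (fst q)" "0 < hyp_dist (snd q) y" "hyp_dist (snd q) y < eps"
   using c4[THEN conjunct2, THEN conjunct1, rule_format, OF that] .
  show "polygon.corner_ray (snd q) k r \<psi> \<notin> e"
   if "k \<in> Cc q" "0 < r" "r < eps" "\<psi> \<in> {0<..<snd (snd k)}" "e edge_of base C (fst q)"
   using c6[THEN conjunct1, rule_format, OF that] .
  show "k = k' \<and> \<psi> = \<psi>'"
   if "k \<in> Cc q" "k' \<in> Cc q" "0 < r" "r < eps" "\<psi> \<in> {0<..<snd (snd k)}" "\<psi>' \<in> {0..snd (snd k')}"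
     "polygon.corner_ray (snd q) k r \<psi> = polygon.corner_ray (snd q) k' r \<psi>'" using c6[THEN conjunct2, rule_format, OF that] .
 qed
 have tf: "tangent_frame (snd q) (fst k) (fst (snd k))" if "q \<in> Z" "k \<in> Cc q" for q k
  using secs(2)[OF that] unfolding polygon.plane_frame_def[OF pg[OF Zb(2)[OF that(1)]]] by blast
 have rd: "hyp_dist (polygon.corner_ray (snd q) k r s) (polygon.corner_ray (snd q) k r' t) = cosine_law r r' (s - t)" if "q \<in> Z" "k \<in> Cc q" for q k r r' s t
  unfolding polygon.corner_ray_def[OF pg[OF Zb(2)[OF that(1)]]] by (rule hyp_dist_rays[OF tf[OF that]])
 have r0: "hyp_dist (snd q) (polygon.corner_ray (snd q) k r t) = r" if "q \<in> Z" "k \<in> Cc q" "0 \<le> r" for q k r t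
  unfolding polygon.corner_ray_def[OF pg[OF Zb(2)[OF that(1)]]]
  by (rule hyp_dist_ray[OF Zb(4)[OF that(1)] dir_unit_tangent[OF tf[OF that(1,2)]] that(3)])
 define S where "S \<kappa> r \<psi> = pt (fst (fst \<kappa>), polygon.corner_ray (snd (fst \<kappa>)) (snd \<kappa>) r \<psi>)" for \<kappa> r \<psi>
 define \<beta> where "\<beta> \<kappa> = snd (snd (snd \<kappa>))" for \<kappa> :: "('i \<times> (real^3)) \<times> ((real^3) \<times> real) \<times> ((real^3) \<times> real) \<times> real"
 define X where "X \<kappa> = slope_at (fst \<kappa>) (fst (snd \<kappa>))" for \<kappa> :: "('i \<times> (real^3)) \<times> ((real^3) \<times> real) \<times> ((real^3) \<times> real) \<times> real"
 define P where "P \<kappa> = slope_at (fst \<kappa>) (fst (snd (snd \<kappa>)))" for \<kappa> :: "('i \<times> (real^3)) \<times> ((real^3) \<times> real) \<times> ((real^3) \<times> real) \<times> real"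
 \<comment> \<open>Straight corners are treated apart because \<open>sector_angle_integral\<close>
   stops short of \<open>pi\<close>.\<close>
 define W where "W \<kappa> = (if \<beta> \<kappa> = pi then pi else sector_angle (\<beta> \<kappa>) (X \<kappa>) (X \<kappa> * cos (\<beta> \<kappa>) + P \<kappa> * sin (\<beta> \<kappa>)))" for \<kappa>
 have Sb: "(fst q, polygon.corner_ray (snd q) k r \<psi>) \<in> base_points C" if "q \<in> Z" "k \<in> Cc q" "0 \<le> r" "r < eps" "\<psi> \<in> {0..snd (snd k)}" for q k r \<psi>
  using secs(4)[OF that] Zb(2)[OF that(1)] by (simp add: base_pointsD)
 interpret polar_chart torus g z \<alpha> eps R
  by unfold_locales (use e0 ele P0.\<alpha> P0.R_T P0.R_per P0.R_0 P0.R_dist P0.R_onto in auto)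
 interpret fan torus g z \<alpha> eps R K \<beta> X P W S Fb
 proof unfold_locales
  show "finite K" unfolding K_def using secs(1) finite_cls[OF p(1)] by (intro finite_SigmaI) (auto simp: Z_def)
  show "Fb z > 0" by (rule Fb_pos[OF z])
 next
  fix \<kappa> assume "\<kappa> \<in> K"
  then obtain q k where k: "\<kappa> = (q, k)" "q \<in> Z" "k \<in> Cc q" by (auto simp: K_def)
  show b: "0 < \<beta> \<kappa> \<and> \<beta> \<kappa> \<le> pi" using secs(3)[OF k(2,3)] by (simp add: \<beta>_def k(1))
  show xp: "(X \<kappa>)\<^sup>2 + (P \<kappa>)\<^sup>2 < 1" using N_corner(2)[OF Zb(2)[OF k(2)] secs(2)[OF k(2,3)]] by (simp add: X_def P_def k(1))
  show "((\<lambda>\<psi>. angle_density (X \<kappa> * cos \<psi> + P \<kappa> * sin \<psi>) (P \<kappa> * cos \<psi> - X \<kappa> * sin \<psi>)) has_integral W \<kappa>) {0..\<beta> \<kappa>}"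
  proof (cases "\<beta> \<kappa> = pi")
   case True thus ?thesis using half_disc_angle[OF xp] by (simp add: W_def)
  next
   case False thus ?thesis using sector_angle_integral[OF _ _ xp, of "\<beta> \<kappa>"] b by (simp add: W_def)
  qed
 next
  fix \<kappa> r \<psi> assume "\<kappa> \<in> K" and h: "0 \<le> r" "r < eps" "\<psi> \<in> {0..\<beta> \<kappa>}"
  then obtain q k where k: "\<kappa> = (q, k)" "q \<in> Z" "k \<in> Cc q" by (auto simp: K_def)
  have b: "(fst q, polygon.corner_ray (snd q) k r \<psi>) \<in> base_points C" using Sb[OF k(2,3) h(1,2)] h(3) by (simp add: \<beta>_def k(1))
  have S: "S \<kappa> r \<psi> = pt (fst q, polygon.corner_ray (snd q) k r \<psi>)" by (simp add: S_def k(1))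
  show "S \<kappa> r \<psi> \<in> torus \<and> g z (S \<kappa> r \<psi>) = r"
   unfolding S using pt(1)[OF b] near_dist[OF gr p(1) k(2)[unfolded Z_def] b] r0[OF k(2,3) h(1)] h(2) by (simp add: p(2))
  show "Fb (S \<kappa> r \<psi>) = Fb z * (cosh r + (X \<kappa> * cos \<psi> + P \<kappa> * sin \<psi>) * sinh r)"
   unfolding S Fb_pt[OF b] N_corner(1)[OF Zb(2)[OF k(2)] secs(2)[OF k(2,3)]] FbZ[OF k(2)] by (simp add: X_def P_def k(1))
 next
  fix \<kappa> r r' \<psi> \<psi>' assume "\<kappa> \<in> K" and h: "0 \<le> r" "r < eps" "0 \<le> r'" "r' < eps" "\<psi> \<in> {0..\<beta> \<kappa>}" "\<psi>' \<in> {0..\<beta> \<kappa>}"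
  then obtain q k where k: "\<kappa> = (q, k)" "q \<in> Z" "k \<in> Cc q" by (auto simp: K_def)
  have b: "(fst q, polygon.corner_ray (snd q) k r \<psi>) \<in> base_points C" "(fst q, polygon.corner_ray (snd q) k r' \<psi>') \<in> base_points C"
   using Sb[OF k(2,3) h(1,2)] Sb[OF k(2,3) h(3,4)] h(5,6) by (simp_all add: \<beta>_def k(1))
  show "g (S \<kappa> r \<psi>) (S \<kappa> r' \<psi>') \<le> cosine_law r r' (\<psi> - \<psi>')"
   using g_pt_le[OF b] rd[OF k(2,3)] by (simp add: S_def k(1))
 next
  fix \<kappa> r \<psi> assume "\<kappa> \<in> K" and h: "0 < r" "r < eps" "\<psi> \<in> {0<..<\<beta> \<kappa>}"
  then obtain q k where k: "\<kappa> = (q, k)" "q \<in> Z" "k \<in> Cc q" by (auto simp: K_def)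
  define y where "y = polygon.corner_ray (snd q) k"
  have r: "0 \<le> r" using h(1) by simp
  have in_cl: "t \<in> {0<..<\<beta> \<kappa>} ==> t \<in> {0..snd (snd k)}" for t by (simp add: \<beta>_def k(1))
  have yb: "(fst q, y r t) \<in> base_points C" if "t \<in> {0<..<\<beta> \<kappa>}" for t unfolding y_def by (rule Sb[OF k(2,3) r h(2) in_cl[OF that]])
  have yh: "y r t \<in> hyp_space" if "t \<in> {0<..<\<beta> \<kappa>}" for t using base_points_hyp[OF yb[OF that]] by simp
  have no: "y r \<psi> \<notin> e" if "e edge_of base C (fst q)" for e
   unfolding y_def by (rule secs(6)[OF k(2,3) h(1,2) _ that]) (use h(3) in \<open>simp add: \<beta>_def k(1)\<close>)
  have "y r \<psi> \<in> base C (fst q)" using yb[OF h(3)] by (simp add: base_pointsD)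
  from far_edges[OF Zb(2)[OF k(2)] this] obtain \<delta> where \<delta>: "\<delta> > 0"
   "\<And>e w. e edge_of base C (fst q) ==> w \<in> e ==> \<delta> \<le> hyp_dist (y r \<psi>) w" using no by metis
  \<comment> \<open>The quarter leaves both points at least \<open>\<delta> / 2\<close> away from
    every edge and less than \<open>\<delta> / 2\<close> from each other, as
    \<open>interior_dist\<close> requires.\<close>
  obtain \<rho> where \<rho>: "\<rho> > 0" "\<And>t. \<bar>t\<bar> < \<rho> ==> cosine_law r r t < \<delta> / 4" using cosine_law_small[of "\<delta> / 4" r] \<delta>(1) by auto
  have "g (S \<kappa> r \<psi>') (S \<kappa> r \<psi>'') = cosine_law r r (\<psi>' - \<psi>'')"
   if t: "\<psi>' \<in> {0<..<\<beta> \<kappa>}" "\<psi>'' \<in> {0<..<\<beta> \<kappa>}" "\<bar>\<psi>' - \<psi>\<bar> < \<rho>" "\<bar>\<psi>'' - \<psi>\<bar> < \<rho>" for \<psi>' \<psi>''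
  proof -
   have d1: "hyp_dist (y r \<psi>) (y r \<psi>') < \<delta> / 4" "hyp_dist (y r \<psi>) (y r \<psi>'') < \<delta> / 4"
    unfolding y_def rd[OF k(2,3)] using \<rho>(2)[of "\<psi> - \<psi>'"] \<rho>(2)[of "\<psi> - \<psi>''"] t by (simp_all add: abs_minus_commute)
   have "\<delta> / 2 \<le> hyp_dist (y r \<psi>') w" if e: "e edge_of base C (fst q)" "w \<in> e" for e w
   proof -
    have "w \<in> hyp_space" using polygon.edge_facts(1)[OF pg[OF Zb(2)[OF k(2)]] e(1)] e(2) base_hyp[OF Zb(2)[OF k(2)]] by blast
    from hyp_dist_triangle[OF yh[OF h(3)] yh[OF t(1)] this] \<delta>(2)[OF e] d1(1) \<delta>(1) show ?thesis by linarith
   qed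
   moreover have "hyp_dist (y r \<psi>') (y r \<psi>'') < \<delta> / 2"
    using hyp_dist_triangle[OF yh[OF t(1)] yh[OF h(3)] yh[OF t(2)]] d1 hyp_dist_commute[of "y r \<psi>'" "y r \<psi>"] by linarith
   ultimately have "g (pt (fst q, y r \<psi>')) (pt (fst q, y r \<psi>'')) = hyp_dist (y r \<psi>') (y r \<psi>'')"
    using interior_dist[OF yb[OF t(1)] yb[OF t(2)], of "\<delta> / 2"] by simp
   thus ?thesis unfolding y_def rd[OF k(2,3)] by (simp add: S_def k(1))
  qed
  thus "\<exists>\<rho>>0. \<forall>\<psi>'\<in>{0<..<\<beta> \<kappa>}. \<forall>\<psi>''\<in>{0<..<\<beta> \<kappa>}. \<bar>\<psi>' - \<psi>\<bar> < \<rho> --> \<bar>\<psi>'' - \<psi>\<bar> < \<rho> -->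
     g (S \<kappa> r \<psi>') (S \<kappa> r \<psi>'') = cosine_law r r (\<psi>' - \<psi>'')" using \<rho>(1) by blast
 next
  fix \<kappa> \<kappa>' r \<psi> \<psi>' assume "\<kappa> \<in> K" "\<kappa>' \<in> K" and h: "0 < r" "r < eps" "\<psi> \<in> {0<..<\<beta> \<kappa>}" "\<psi>' \<in> {0..\<beta> \<kappa>'}" "S \<kappa> r \<psi> = S \<kappa>' r \<psi>'"
  then obtain q k q' k' where k: "\<kappa> = (q, k)" "q \<in> Z" "k \<in> Cc q" and k': "\<kappa>' = (q', k')" "q' \<in> Z" "k' \<in> Cc q'" by (auto simp: K_def)
  define x x' where "x = (fst q, polygon.corner_ray (snd q) k r \<psi>)" and "x' = (fst q', polygon.corner_ray (snd q') k' r \<psi>')"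
  have p1: "\<psi> \<in> {0..snd (snd k)}" "\<psi> \<in> {0<..<snd (snd k)}" "\<psi>' \<in> {0..snd (snd k')}" using h(3,4) by (simp_all add: \<beta>_def k k')
  have xb: "x \<in> base_points C" "x' \<in> base_points C" unfolding x_def x'_def using Sb[OF k(2,3) _ h(2) p1(1)] Sb[OF k'(2,3) _ h(2) p1(3)] h(1) by simp_all
  have "snd x \<notin> e" if "e edge_of base C (fst x)" for e unfolding x_def snd_conv by (rule secs(6)[OF k(2,3) h(1,2) p1(2)]) (use that in \<open>simp add: x_def\<close>)
  hence "cls x = {x}" by (rule cls_interior[OF xb(1)])
  moreover have "pt x = pt x'" using h(5) by (simp add: S_def k k' x_def x'_def)
  hence "x' \<in> cls x" using pt_eq[OF xb] by (simp add: cls_iff)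
  ultimately have xx: "x' = x" by blast
  have fq: "fst q = fst q'" and cr: "polygon.corner_ray (snd q') k' r \<psi>' = polygon.corner_ray (snd q) k r \<psi>" using xx by (simp_all add: x_def x'_def)
  \<comment> \<open>The common point is at distance \<open>r < eps\<close> from both
    representatives, but distinct ones in a cell are at least \<open>2 * eps\<close> apart.\<close>
  have qq: "q = q'"
  proof (rule ccontr)
   assume "q \<noteq> q'"
   hence "2 * eps \<le> hyp_dist (snd q) (snd q')" by (rule sep[OF k(2) k'(2) fq])
   also have "\<dots> \<le> hyp_dist (snd q) (snd x) + hyp_dist (snd x) (snd q')"
    by (rule hyp_dist_triangle[OF Zb(4)[OF k(2)] base_points_hyp[OF xb(1)] Zb(4)[OF k'(2)]])
   also have "\<dots> = r + r"
    using r0[OF k(2,3), of r \<psi>] r0[OF k'(2,3), of r \<psi>'] h(1) unfolding cr by (simp add: x_def hyp_dist_commute[of _ "snd q'"])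
   finally show False using h(2) by simp
  qed
  have "k = k' \<and> \<psi> = \<psi>'" using secs(7)[OF k(2,3) _ h(1,2) p1(2,3)] k'(3) cr qq by simp
  thus "\<kappa> = \<kappa>' \<and> \<psi> = \<psi>'" using qq by (simp add: k k')
 next
  fix w assume w: "w \<in> torus" "0 < g z w" "g z w < eps"
  obtain x where x: "x \<in> base_points C" "w = pt x" using pt_surj[OF w(1)] by blast
  obtain q where q: "q \<in> Z" "fst q = fst x" "hyp_dist (snd q) (snd x) = g z w"
   using near_rep[OF gr p(1) x(1)] w(3) unfolding p(2) x(2) Z_def by blast
  obtain k \<psi> where k: "k \<in> Cc q" "\<psi> \<in> {0..snd (snd k)}" "snd x = polygon.corner_ray (snd q) k (g z w) \<psi>"
   using secs(5)[OF q(1), of "snd x"] x(1) w(2,3) q(2) unfolding q(3) base_pointsD by metis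
  have xe: "x = (fst q, polygon.corner_ray (snd q) k (g z w) \<psi>)" using q(2) k(3) by (simp add: prod_eq_iff)
  show "\<exists>k\<in>K. \<exists>\<psi>\<in>{0..\<beta> k}. w = S k (g z w) \<psi>"
  proof (intro bexI[of _ "(q, k)"] bexI[of _ \<psi>])
   have "w = pt (fst q, polygon.corner_ray (snd q) k (g z w) \<psi>)" using x(2) unfolding xe .
   thus "w = S (q, k) (g z w) \<psi>" unfolding S_def fst_conv snd_conv .
  qed (use q(1) k in \<open>simp_all add: K_def \<beta>_def\<close>)
 next
  \<comment> \<open>Every end of a corner has a partner: across a glued edge, where convexity bounds
    the sum of the slopes, or across the cut between two half discs, where the slopes
    cancel.\<close>
  fix \<kappa> and b :: bool assume "\<kappa> \<in> K"
  then obtain q k where k: "\<kappa> = (q, k)" "q \<in> Z" "k \<in> Cc q" by (auto simp: K_def)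
  interpret I: polygon "base C (fst q)" "nu (fst q)" by (rule pg[OF Zb(2)[OF k(2)]])
  have ends: "I.corner_ends (snd q) (Cc q) eps" using cs[OF k(2)] by (simp add: corners_def I.corner_system_def)
  have sl: "corner_slope (\<beta> (q, k)) (X (q, k)) (P (q, k)) b = slope_at q (I.end_normal k b)" if "q \<in> Z" for q k b
   using slope_end[OF Zb(2)[OF that]] by (simp add: \<beta>_def X_def P_def)
  define r where "r = eps / 2"
  have r: "0 < r" "r < eps" "0 \<le> r" using e0 by (simp_all add: r_def)
  define y where "y = polygon.corner_ray (snd q) k r (corner_end (snd (snd k)) b)"
  consider (edge) e where "e edge_of base C (fst q)" "snd q \<in> e" "I.end_normal k b = I.edge_normal e" "y \<in> e"
   | (fake) k' b' where "k' \<in> Cc q" "(k', b') \<noteq> (k, b)" "I.end_normal k b = - I.end_normal k' b'"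
     "y = polygon.corner_ray (snd q) k' r (corner_end (snd (snd k')) b')"
   using ends[unfolded I.corner_ends_def, THEN conjunct1, rule_format, OF k(3), of b] r unfolding y_def by metis
  thus "\<exists>k'\<in>K. \<exists>b' r. (k', b') \<noteq> (\<kappa>, b) \<and> 0 < r \<and> r < eps \<and>
    S \<kappa> r (corner_end (\<beta> \<kappa>) b) = S k' r (corner_end (\<beta> k') b') \<and>
    corner_slope (\<beta> \<kappa>) (X \<kappa>) (P \<kappa>) b + corner_slope (\<beta> k') (X k') (P k') b' \<le> 0"
  proof cases
   case fake
   have "slope_at q (I.end_normal k b) + slope_at q (I.end_normal k' b') \<le> 0" unfolding fake(3) by (simp add: slope_at_def)
   thus ?thesis using fake(1,2) r(1,2) fake(4) k sl[OF k(2)]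
    by (intro bexI[of _ "(q, k')"] exI[of _ b'] exI[of _ r]) (simp_all add: K_def S_def \<beta>_def y_def)
  next
   case edge
   define s where "s = (fst q, e)"
   have s: "s \<in> sides C" using edge(1) Zb(2)[OF k(2)] by (simp add: s_def sides_def)
   define j f where "j = fst (mate C s)" and "f = snd (mate C s)"
   define q' where "q' = (j, gluing C s (snd q))"
   have ve: "snd q \<in> snd s" "y \<in> snd s" using edge by (simp_all add: s_def)
   have "(q, q') \<in> gstep" using gstep_edge[OF s ve(1)] by (simp add: s_def q'_def j_def)
   hence q': "q' \<in> Z" using cls_closed[of q q' p] k(2) by (simp add: Z_def)
   interpret J: polygon "base C j" "nu j" using pg[OF Zb(2)[OF q']] by (simp add: q'_def)
   have fe: "f edge_of base C j" using sidesD[OF mate(1)[OF s]] by (simp add: f_def j_def)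
   have yf: "gluing C s y \<in> f" using gl_edge[OF s] ve(2) unfolding f_def by blast
   have dy: "hyp_dist (snd q) y = r" unfolding y_def by (rule r0[OF k(2,3) r(3)])
   have dy': "hyp_dist (snd q') (gluing C s y) = r" using gl_dist[OF s edge_lf[OF s ve(1)] edge_lf[OF s ve(2)]] dy by (simp add: q'_def)
   have ce': "J.corner_ends (snd q') (Cc q') eps" using cs[OF q'] by (simp add: corners_def J.corner_system_def q'_def)
   have "0 < hyp_dist (snd q') (gluing C s y)" "hyp_dist (snd q') (gluing C s y) < eps" using dy' r by simp_all
   from ce'[unfolded J.corner_ends_def, THEN conjunct2, rule_format, OF fe yf this]
   obtain k' b' where k': "k' \<in> Cc q'" "gluing C s y = J.corner_ray (snd q') k' r (corner_end (snd (snd k')) b')" "J.end_normal k' b' = J.edge_normal f"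
    unfolding dy' by blast
   have ynv: "y \<noteq> snd q" using dy r(1) hyp_dist_self[OF Zb(4)[OF k(2)]] by auto
   have "slope_at q (I.edge_normal e) + slope_at q' (J.edge_normal f) \<le> 0"
    using edge_slope[OF s ve ynv] by (simp add: s_def q'_def j_def f_def)
   \<comment> \<open>An end that is its own partner would make the edge its own mate, because the
     end normal determines the edge.\<close>
   moreover have "((q', k'), b') \<noteq> (\<kappa>, b)"
   proof
    assume "((q', k'), b') = (\<kappa>, b)"
    hence eq: "q' = q" "k' = k" "b' = b" by (simp_all add: k(1))
    have ji: "j = fst q" using eq(1) by (metis q'_def fst_conv)
    have "I.edge_normal f = I.edge_normal e" using k'(3) edge(3) eq unfolding ji by simp
    moreover have fe': "f edge_of base C (fst q)" using fe unfolding ji .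
    ultimately have "I.is_edge_normal f (I.edge_normal e)" using I.edge_normal[OF fe'] by simp
    hence "f = e" using I.edge_normal[OF edge(1)] unfolding I.is_edge_normal_def by blast
    hence "mate C s = s" using ji by (simp add: s_def j_def f_def prod_eq_iff)
    thus False using mate(2)[OF s] by simp
   qed
   moreover have "S \<kappa> r (corner_end (\<beta> \<kappa>) b) = S (q', k') r (corner_end (\<beta> (q', k')) b')"
   proof -
    have "((fst q, y), (j, gluing C s y)) \<in> gstep" using gstep_edge[OF s ve(2)] by (simp add: s_def j_def)
    hence "((fst q, y), (j, gluing C s y)) \<in> glued C" by (simp add: glued_gstep)
    hence "cls (fst q, y) = cls (j, gluing C s y)" by (simp only: cls_eq)
    hence "pt (fst q, y) = pt (j, gluing C s y)" by (simp only: pt_def)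
    thus ?thesis using k'(2) by (simp add: S_def \<beta>_def k(1) y_def q'_def)
   qed
   ultimately show ?thesis using k'(1) q' r(1,2) sl[OF k(2), of k b] sl[OF q', of k' b'] edge(3) k'(3) unfolding k(1)
    by (intro bexI[of _ "(q', k')"] exI[of _ b'] exI[of _ r]) (simp_all add: K_def)
  qed
 qed
 obtain G dp dm where prof:
  "\<And>t. conc_germ G dp dm t" "\<And>t. G (t + \<alpha>) = G t" "\<And>t. dp (t + \<alpha>) = dp t" "\<And>t. dm (t + \<alpha>) = dm t"
  "\<And>r t. 0 \<le> r ==> r < eps ==> Fb (R r t) = Fb z * (cosh r + G t * sinh r)"
  "\<And>u. ((\<lambda>t. angle_density (G t) (dp t)) has_integral sum W K) {u..u+\<alpha>}"
  "sum \<beta> K = \<alpha>" by (rule fan_profile) blast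
 have ext: "snd q extreme_point_of base C (fst q) \<longleftrightarrow> z \<in> Sing" if "q \<in> Z" for q
  using vertex_iff[OF z] that p(3) by (simp add: Z_def)
 have "sum W K = (if z \<in> Sing then particle_angle C (\<phi> z) else \<alpha>)"
 proof (cases "z \<in> Sing")
  case True
  have "sum W K = (\<Sum>q\<in>Z. \<Sum>k\<in>Cc q. W (q, k))"
   unfolding K_def using finite_cls[OF p(1)] secs(1) by (subst sum.Sigma) (auto simp: Z_def)
  also have "\<dots> = (\<Sum>q\<in>Z. lateral_angle (base C (fst q)) (apex C (fst q)) (snd q))"
  proof (rule sum.cong[OF refl])
   fix q assume q: "q \<in> Z"
   from vertex_corner[OF Zb(2,3)[OF q] _ cs[OF q]] ext[OF q] True
   obtain k where k: "Cc q = {k}" "snd (snd k) < pi" "sector_angle (snd (snd k)) (slope_at q (fst k))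
    (slope_at q (fst k) * cos (snd (snd k)) + slope_at q (fst (snd k)) * sin (snd (snd k))) = lateral_angle (base C (fst q)) (apex C (fst q)) (snd q)" by blast
   thus "(\<Sum>k\<in>Cc q. W (q, k)) = lateral_angle (base C (fst q)) (apex C (fst q)) (snd q)" by (simp add: W_def \<beta>_def X_def P_def)
  qed
  also have "\<dots> = particle_angle C (\<phi> z)"
  proof -
   have "q \<in> base_vertices C" if "q \<in> Z" for q using ext[OF that] True Zb(2)[OF that] by (cases q) (simp add: base_vertices_def)
   hence "Z \<inter> base_vertices C = Z" by blast
   thus ?thesis by (simp add: particle_angle_def p(3) Z_def case_prod_beta)
  qed
  finally show ?thesis using True by simp
 next
  case False
  have "W \<kappa> = \<beta> \<kappa>" if "\<kappa> \<in> K" for \<kappa>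
  proof -
   obtain q k where k: "\<kappa> = (q, k)" "q \<in> Z" "k \<in> Cc q" using \<open>\<kappa> \<in> K\<close> unfolding K_def by blast
   interpret I: polygon "base C (fst q)" "nu (fst q)" by (rule pg[OF Zb(2)[OF k(2)]])
   have "I.corner_type (snd q) (Cc q)" using cs[OF k(2)] by (simp add: corners_def I.corner_system_def)
   hence "snd (snd k) = pi" using ext[OF k(2)] False k(3) by (simp add: I.corner_type_def)
   thus ?thesis by (simp add: W_def \<beta>_def k(1))
  qed
  hence "sum W K = sum \<beta> K" by (intro sum.cong) auto
  thus ?thesis using prof(7) False by simp
 qed
 thus thesis using that[OF e0 ele prof(1-5)] prof(6) by simp
qed

end

section \<open>The maximum principle\<close>

lemma polar_chart_of_isometry:
 assumes M: "Metric_space T g" and z: "z \<in> T"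
  and iso: "isometry_between (Metric_space.mball T g z eps) g Y dY f"
  and eps': "0 < eps'" "eps' \<le> eps" and \<alpha>: "0 < \<alpha>" "\<alpha> \<le> 2 * pi"
  and P: "\<And>r t. 0 \<le> r ==> r < eps' ==> P r t \<in> Y" "\<And>r t. P r (t + \<alpha>) = P r t" "\<And>t. P 0 t = f z"
  and dist: "\<And>r r' t t'. [|0 \<le> r; r < eps'; 0 \<le> r'; r' < eps'; \<bar>t - t'\<bar> \<le> \<alpha> / 2|] ==> dY (P r t) (P r' t') = cosine_law r r' (t - t')"
  and onto: "\<And>y. y \<in> Y ==> dY (f z) y < eps' ==> \<exists>t. y = P (dY (f z) y) t"
 shows "polar_chart T g z \<alpha> eps' (\<lambda>r t. inv_into (Metric_space.mball T g z eps) f (P r t))"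
proof -
 interpret Metric_space T g by (rule M)
 define B where "B = mball z eps"
 have bij: "bij_betw f B Y" and isoD: "\<And>x y. x \<in> B ==> y \<in> B ==> dY (f x) (f y) = g x y"
  using iso by (auto simp: isometry_between_def B_def)
 have zB: "z \<in> B" using z eps' by (simp add: B_def)
 define h where "h = inv_into B f"
 have h: "h y \<in> B" "f (h y) = y" if "y \<in> Y" for y
  using that bij unfolding h_def by (metis bij_betw_def inv_into_into) (metis that bij bij_betw_def f_inv_into_f h_def)
 have hf: "h (f x) = x" if "x \<in> B" for x using that bij by (simp add: h_def bij_betw_def inv_into_f_f)
 have "polar_chart T g z \<alpha> eps' (\<lambda>r t. h (P r t))"
 proof
  fix r t :: real assume "0 \<le> r" "r < eps'"
  thus "h (P r t) \<in> T" using h(1)[OF P(1)] by (simp add: B_def)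
 next
  show "h (P 0 t) = z" for t using hf[OF zB] P(3) by simp
  show "g (h (P r t)) (h (P r' t')) = cosine_law r r' (t - t')" if "0 \<le> r" "r < eps'" "0 \<le> r'" "r' < eps'" "\<bar>t - t'\<bar> \<le> \<alpha> / 2" for r r' t t'
   using isoD[OF h(1)[OF P(1)[OF that(1,2)]] h(1)[OF P(1)[OF that(3,4)]], of t t'] dist[OF that] h(2)[OF P(1)[OF that(1,2)]] h(2)[OF P(1)[OF that(3,4)]] by simp
 next
  fix w assume w: "w \<in> T" "g z w < eps'"
  hence wB: "w \<in> B" using z eps' by (simp add: B_def)
  have d: "dY (f z) (f w) = g z w" by (rule isoD[OF zB wB])
  have "f w \<in> Y" using bij wB by (auto simp: bij_betw_def)
  then obtain t where "f w = P (g z w) t" using onto[of "f w"] d w(2) by auto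
  thus "\<exists>t. w = h (P (g z w) t)" using hf[OF wB] by metis
 qed (use eps' \<alpha> P(2) in auto)
 thus ?thesis by (simp add: h_def B_def)
qed

lemma tangent_frame_exists:
 assumes y: "y \<in> (hyp_space :: (real^2) set)" shows "\<exists>e1 e2. tangent_frame y e1 e2"
proof -
 have h: "lorentz (lift y) (lift y) < 0" using lift_hyperboloid[OF y] by (simp add: on_hyperboloid_def)
 obtain e1 where e1: "lorentz e1 e1 = 1" "lorentz (lift y) e1 = 0" using orthogonal_unit_exists[of "{lift y}" "lift y"] h by auto
 have "card {lift y, e1} < DIM(real^2) + 1" using card_insert_le_m1[of 2 "{e1}" "lift y"] by simp
 then obtain e2 where e2: "lorentz e2 e2 = 1" "lorentz (lift y) e2 = 0" "lorentz e1 e2 = 0"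
  using orthogonal_unit_exists[of "{lift y, e1}" "lift y"] h by auto
 show ?thesis using e1 e2 y by (intro exI[of _ e1] exI[of _ e2]) (simp add: tangent_frame_def unit_tangent_def)
qed

lemma plane_dir:
 assumes f: "tangent_frame (y :: real^2) e1 e2" and u: "unit_tangent (lift y) u"
 shows "\<exists>\<psi>. u = dir e1 e2 \<psi>"
proof -
 define h where "h = lift y"
 have o: "lorentz h h = -1" "lorentz e1 e1 = 1" "lorentz e2 e2 = 1" "lorentz h e1 = 0" "lorentz h e2 = 0" "lorentz e1 e2 = 0"
  using f lift_hyperboloid[of y] by (auto simp: tangent_frame_def unit_tangent_def on_hyperboloid_def h_def)
 have o': "lorentz e1 h = 0" "lorentz e2 h = 0" "lorentz e2 e1 = 0"
  using o by (simp_all add: lorentz_commute[of e1 h] lorentz_commute[of e2 h] lorentz_commute[of e2 e1])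
 have hu: "lorentz h u = 0" "lorentz u u = 1" using u by (simp_all add: unit_tangent_def h_def)
 define x where "x = u - (lorentz e1 u *\<^sub>R e1 + lorentz e2 u *\<^sub>R e2)"
 have x: "lorentz h x = 0" "lorentz e1 x = 0" "lorentz e2 x = 0" using o o' hu by (simp_all add: x_def)
 have x': "lorentz x h = 0" "lorentz x e1 = 0" "lorentz x e2 = 0" using x by (simp_all add: lorentz_commute[of x])
 have "x = 0"
 proof (rule ccontr)
  assume "x \<noteq> 0"
  hence xx: "lorentz x x \<noteq> 0" using timelike_orthogonal(2)[of h x] o x by auto
  have d: "distinct [h, e1, e2, x]" using o o' x x' xx by auto
  have "card {h, e1, e2, x} \<le> DIM(real^2) + 1" by (rule orthogonal_card) (use o o' x x' xx in auto)
  moreover have "card {h, e1, e2, x} = 4" using distinct_card[OF d] by simp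
  ultimately show False by simp
 qed
 hence ue: "u = lorentz e1 u *\<^sub>R e1 + lorentz e2 u *\<^sub>R e2" by (simp add: x_def)
 have "lorentz (a *\<^sub>R e1 + b *\<^sub>R e2) (a *\<^sub>R e1 + b *\<^sub>R e2) = a\<^sup>2 + b\<^sup>2" for a b
  using o o' by (simp add: power2_eq_square)
 hence "(lorentz e1 u)\<^sup>2 + (lorentz e2 u)\<^sup>2 = 1" using ue hu(2) by metis
 then obtain t where "lorentz e1 u = cos t" "lorentz e2 u = sin t" using sincos_total_2pi by metis
 thus ?thesis using ue by (metis dir_def)
qed

lemma regular_chart:
 assumes M: "Metric_space T g" and z: "z \<in> T" and eps: "eps > 0" and y: "y \<in> (hyp_space :: (real^2) set)"
  and iso: "isometry_between (Metric_space.mball T g z eps) g {w \<in> hyp_space. hyp_dist y w < eps} hyp_dist f"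
 shows "\<exists>\<alpha> eps R. polar_chart T g z \<alpha> eps R"
proof -
 interpret Metric_space T g by (rule M)
 have "f z \<in> {w \<in> hyp_space. hyp_dist y w < eps}"
  using iso z eps unfolding isometry_between_def bij_betw_def by (metis centre_in_mball_iff image_eqI)
 hence fz: "f z \<in> hyp_space" "hyp_dist y (f z) < eps" by auto
 obtain e1 e2 where e: "tangent_frame (f z) e1 e2" using tangent_frame_exists[OF fz(1)] by blast
 define P where "P r t = ray (f z) (dir e1 e2 t) r" for r t
 note t = dir_unit_tangent[OF e]
 have Ph: "P r t \<in> hyp_space" for r t unfolding P_def by (rule lift_ray(2)[OF fz(1) t])
 \<comment> \<open>The isometry need not send \<open>z\<close> to the centre \<open>y\<close> of the
   model ball, so the radius is reduced by their distance.\<close>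
 define eps' where "eps' = eps - hyp_dist y (f z)"
 have "polar_chart T g z (2 * pi) eps' (\<lambda>r t. inv_into (mball z eps) f (P r t))"
 proof (rule polar_chart_of_isometry[OF M z iso])
  show "0 < eps'" "eps' \<le> eps" using fz hyp_dist_nonneg[OF y fz(1)] by (auto simp: eps'_def)
  show "P r t \<in> {w \<in> hyp_space. hyp_dist y w < eps}" if "0 \<le> r" "r < eps'" for r t
   using hyp_dist_triangle[OF y fz(1) Ph, of r t] hyp_dist_ray[OF fz(1) t that(1), of t] that(2) Ph by (simp add: P_def eps'_def)
  show "P r (t + 2 * pi) = P r t" for r t by (simp add: P_def dir_def)
  show "P 0 t = f z" for t by (simp add: P_def ray_0[OF fz(1)])
  show "hyp_dist (P r t) (P r' t') = cosine_law r r' (t - t')" for r r' t t' unfolding P_def by (rule hyp_dist_rays[OF e])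
  fix w assume w: "w \<in> {w \<in> hyp_space. hyp_dist y w < eps}" "hyp_dist (f z) w < eps'"
  show "\<exists>t. w = P (hyp_dist (f z) w) t"
  proof (cases "w = f z")
   case True thus ?thesis using ray_0[OF fz(1)] hyp_dist_self[OF fz(1)] by (simp add: P_def)
  next
   case False
   have wh: "w \<in> hyp_space" using w by simp
   obtain u where u: "unit_tangent (lift (f z)) u" "lift w = polar (lift (f z)) u (hyp_dist (f z) w)"
    using hyp_polar_exists[OF fz(1) wh] False by metis
   obtain \<psi> where "u = dir e1 e2 \<psi>" using plane_dir[OF e u(1)] by blast
   moreover have "w = ray (f z) u (hyp_dist (f z) w)" using klein_lift[OF wh] u(2) by (simp add: ray_def)
   ultimately show ?thesis unfolding P_def by blast
  qed
 qed auto
 thus ?thesis by blast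
qed

lemma cone_chart:
 assumes M: "Metric_space T g" and z: "z \<in> T" and eps: "eps > 0" and \<alpha>: "0 < \<alpha>" "\<alpha> < 2 * pi"
  and iso: "isometry_between (Metric_space.mball T g z eps) g {p \<in> hyp_cone \<alpha>. fst p < eps} (hyp_cone_dist \<alpha>) f" and fz: "f z = (0, 0)"
 shows "\<exists>\<alpha> eps R. polar_chart T g z \<alpha> eps R"
proof -
 interpret Metric_space T g by (rule M)
 \<comment> \<open>\<open>\<tau>\<close> reduces an angle modulo \<open>\<alpha>\<close> to the
   range used by \<open>hyp_cone\<close>.\<close>
 define n where "n t = \<lfloor>t / \<alpha>\<rfloor>" for t
 define \<tau> where "\<tau> t = t - of_int (n t) * \<alpha>" for t
 have \<tau>: "0 \<le> \<tau> t" "\<tau> t < \<alpha>" for t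
 proof -
  have "of_int (n t) \<le> t / \<alpha>" "t / \<alpha> < of_int (n t) + 1" by (simp_all add: n_def)
  thus "0 \<le> \<tau> t" "\<tau> t < \<alpha>" using \<alpha>(1) by (simp_all add: \<tau>_def field_simps)
 qed
 have \<tau>id: "\<tau> t = t" if "0 \<le> t" "t < \<alpha>" for t
 proof -
  have "n t = 0" unfolding n_def using that \<alpha>(1) by (intro floor_eq2[of 0, simplified]) auto
  thus ?thesis by (simp add: \<tau>_def)
 qed
 have \<tau>per: "\<tau> (t + \<alpha>) = \<tau> t" for t
 proof -
  have "(t + \<alpha>) / \<alpha> = t / \<alpha> + 1" using \<alpha>(1) by (simp add: field_simps)
  hence "n (t + \<alpha>) = n t + 1" unfolding n_def by simp
  thus ?thesis by (simp add: \<tau>_def algebra_simps)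
 qed
 \<comment> \<open>The minimum is the distance on a circle of length \<open>\<alpha>\<close>; it
   equals the difference of unreduced angles as long as this is at most \<open>\<alpha> / 2\<close>.
   The reduction then shifts the difference by at most one period.\<close>
 have \<tau>cos: "cos (min \<bar>\<tau> t - \<tau> t'\<bar> (\<alpha> - \<bar>\<tau> t - \<tau> t'\<bar>)) = cos (t - t')" if "\<bar>t - t'\<bar> \<le> \<alpha> / 2" for t t'
 proof -
  define d m where "d = \<tau> t - \<tau> t'" and "m = n t - n t'"
  have tt: "t - t' = d + of_int m * \<alpha>" by (simp add: d_def m_def \<tau>_def algebra_simps)
  have d: "\<bar>d\<bar> < \<alpha>" using \<tau>[of t] \<tau>[of t'] by (simp add: d_def abs_less_iff)
  have "\<bar>of_int m * \<alpha>\<bar> < 2 * \<alpha>" using that d \<alpha>(1) unfolding tt by linarith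
  hence "\<bar>of_int m\<bar> * \<alpha> < 2 * \<alpha>" using \<alpha>(1) by (simp add: abs_mult)
  hence "\<bar>of_int m :: real\<bar> < 2" using \<alpha>(1) by (metis mult_less_cancel_right_pos)
  hence "m = 0 \<or> m = 1 \<or> m = -1" by linarith
  thus ?thesis
  proof (elim disjE)
   assume "m = 0"
   hence "t - t' = d" "min \<bar>d\<bar> (\<alpha> - \<bar>d\<bar>) = \<bar>d\<bar>" using that tt by auto
   thus ?thesis by (simp add: d_def)
  next
   assume "m = 1"
   hence e: "t - t' = d + \<alpha>" using tt by simp
   hence "min \<bar>d\<bar> (\<alpha> - \<bar>d\<bar>) = d + \<alpha>" using that \<alpha>(1) by (simp add: min_def abs_if split: if_splits)
   thus ?thesis unfolding e d_def by (simp only:)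
  next
   assume "m = -1"
   hence e: "t - t' = - (\<alpha> - d)" using tt by simp
   hence "min \<bar>d\<bar> (\<alpha> - \<bar>d\<bar>) = \<alpha> - d" using that \<alpha>(1) by (simp add: min_def abs_if split: if_splits)
   thus ?thesis unfolding e cos_minus by (simp add: d_def)
  qed
 qed
 define P where "P r t = (if r = 0 then (0, 0) else (r, \<tau> t))" for r t :: real
 have "polar_chart T g z \<alpha> eps (\<lambda>r t. inv_into (mball z eps) f (P r t))"
 proof (rule polar_chart_of_isometry[OF M z iso eps])
  show "P r t \<in> {p \<in> hyp_cone \<alpha>. fst p < eps}" if "0 \<le> r" "r < eps" for r t
   using that \<tau>[of t] eps by (auto simp: P_def hyp_cone_def)
  show "P r (t + \<alpha>) = P r t" for r t by (simp add: P_def \<tau>per)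
  show "P 0 t = f z" for t by (simp add: P_def fz)
  show "hyp_cone_dist \<alpha> (P r t) (P r' t') = cosine_law r r' (t - t')" if "\<bar>t - t'\<bar> \<le> \<alpha> / 2" for r r' t t'
   using \<tau>cos[OF that] by (simp add: P_def hyp_cone_dist_def cosine_law_def)
  fix w assume w: "w \<in> {p \<in> hyp_cone \<alpha>. fst p < eps}"
  then obtain s \<eta> where s: "w = (s, \<eta>)" "0 < s \<and> 0 \<le> \<eta> \<and> \<eta> < \<alpha> \<or> s = 0 \<and> \<eta> = 0" by (auto simp: hyp_cone_def)
  have "hyp_cone_dist \<alpha> (f z) w = s" using s by (auto simp: hyp_cone_dist_def fz arcosh_cosh_real)
  thus "\<exists>t. w = P (hyp_cone_dist \<alpha> (f z) w) t" using s \<tau>id by (intro exI[of _ \<eta>]) (auto simp: P_def)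
 qed (use \<alpha> in auto)
 thus ?thesis by blast
qed

lemma chart_exists:
 assumes met: "hyp_cone_metric_on_torus g Sing" and z: "z \<in> torus"
 shows "\<exists>\<alpha> eps R. polar_chart torus g z \<alpha> eps R"
proof (cases "z \<in> Sing")
 case True
 then obtain eps \<alpha> f where "eps > 0" "0 < \<alpha>" "\<alpha> < 2 * pi"
  "isometry_between (Metric_space.mball torus g z eps) g {p \<in> hyp_cone \<alpha>. fst p < eps} (hyp_cone_dist \<alpha>) f" "f z = (0, 0)"
  using met unfolding hyp_cone_metric_on_torus_def by blast
 thus ?thesis using cone_chart[OF _ z] met unfolding hyp_cone_metric_on_torus_def by blast
next
 case False
 then obtain eps y f where "eps > 0" "y \<in> (hyp_space :: (real^2) set)"
  "isometry_between (Metric_space.mball torus g z eps) g {w \<in> hyp_space. hyp_dist y w < eps} hyp_dist f"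
  using met z unfolding hyp_cone_metric_on_torus_def by blast
 thus ?thesis using regular_chart[OF _ z] met unfolding hyp_cone_metric_on_torus_def by blast
qed

context marked_cusp
begin

lemma top: "M.mtopology = top_of_set torus" using met by (simp add: hyp_cone_metric_on_torus_def)

text \<open>The profile is bounded by 1 in absolute value, so near \<open>z\<close> the change of
  \<open>Fb\<close> is at most \<open>Fb z * (cosh r - 1 + sinh r)\<close>, uniformly in the
  direction.\<close>

lemma Fb_continuous: "continuous_on torus Fb"
proof -
 have "openin (top_of_set torus) {w \<in> torus. f w \<in> U}"
  if U: "open U" and loc: "\<And>z. z \<in> torus ==> \<exists>eps>0. \<forall>w\<in>torus. g z w < eps --> (\<exists>G. \<bar>G\<bar> < 1 \<and> f w = f z * (cosh (g z w) + G * sinh (g z w)))"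
  for f :: "complex \<times> complex \<Rightarrow> real" and U unfolding top[symmetric] M.openin_mtopology
 proof (intro conjI allI impI)
  fix z assume z: "z \<in> {w \<in> torus. f w \<in> U}"
  then obtain e where e: "e > 0" "\<And>y. \<bar>y - f z\<bar> < e ==> y \<in> U" using U unfolding open_dist dist_real_def by auto
  obtain eps where eps: "eps > 0" "\<And>w. w \<in> torus ==> g z w < eps ==> \<exists>G. \<bar>G\<bar> < 1 \<and> f w = f z * (cosh (g z w) + G * sinh (g z w))"
   using loc z by blast
  have "isCont (\<lambda>r::real. \<bar>f z\<bar> * ((cosh r - 1) + sinh r)) 0" by (intro continuous_intros)
  hence "((\<lambda>r::real. \<bar>f z\<bar> * ((cosh r - 1) + sinh r)) \<longlongrightarrow> 0) (at 0)" by (simp add: isCont_def)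
  hence "eventually (\<lambda>r::real. \<bar>f z\<bar> * ((cosh r - 1) + sinh r) < e) (at 0)" using e(1) by (rule order_tendstoD(2))
  then obtain d where d: "d > 0" "\<And>r. r \<noteq> 0 ==> \<bar>r\<bar> < d ==> \<bar>f z\<bar> * ((cosh r - 1) + sinh r) < e"
   unfolding eventually_at dist_real_def by auto
  have "M.mball z (min eps d) \<subseteq> {w \<in> torus. f w \<in> U}"
  proof
   fix w assume w: "w \<in> M.mball z (min eps d)"
   define r where "r = g z w"
   have r: "w \<in> torus" "r < eps" "r < d" "r \<ge> 0" using w M.nonneg by (auto simp: r_def M.in_mball)
   obtain G where G: "\<bar>G\<bar> < 1" "f w = f z * (cosh r + G * sinh r)" using eps(2)[OF r(1)] r(2) by (auto simp: r_def)
   have "\<bar>f w - f z\<bar> = \<bar>f z\<bar> * \<bar>(cosh r - 1) + G * sinh r\<bar>"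
    unfolding G(2) abs_mult[symmetric] by (simp add: algebra_simps)
   also have "\<dots> \<le> \<bar>f z\<bar> * ((cosh r - 1) + sinh r)"
   proof (rule mult_left_mono)
    have "\<bar>G\<bar> * sinh r \<le> 1 * sinh r" using G(1) r(4) by (intro mult_right_mono) auto
    hence "\<bar>G * sinh r\<bar> \<le> sinh r" using r(4) by (simp add: abs_mult)
    thus "\<bar>cosh r - 1 + G * sinh r\<bar> \<le> (cosh r - 1) + sinh r" using cosh_real_ge_1[of r] by linarith
   qed simp
   also have "\<dots> < e" using d(2)[of r] r e(1) by (cases "r = 0") auto
   finally show "w \<in> {w \<in> torus. f w \<in> U}" using e(2) r(1) by simp
  qed
  thus "\<exists>r>0. M.mball z r \<subseteq> {w \<in> torus. f w \<in> U}" using eps(1) d(1) by (intro exI[of _ "min eps d"]) simp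
 qed auto
 hence cont: "continuous_on torus f"
  if "\<And>z. z \<in> torus ==> \<exists>eps>0. \<forall>w\<in>torus. g z w < eps --> (\<exists>G. \<bar>G\<bar> < 1 \<and> f w = f z * (cosh (g z w) + G * sinh (g z w)))" for f :: "complex \<times> complex \<Rightarrow> real"
  unfolding continuous_on_open_gen[of f torus UNIV, simplified] continuous_openin_preimage_eq using that by (simp add: vimage_def Int_def)
 have germ1: "\<bar>G t\<bar> < 1" if "conc_germ G dp dm t" for G dp dm t
 proof -
  have "(G t)\<^sup>2 + (dp t)\<^sup>2 < 1" using that by (simp add: conc_germ_def)
  hence "(G t)\<^sup>2 < 1\<^sup>2" using zero_le_power2[of "dp t"] unfolding one_power2 by linarith
  thus ?thesis by (simp add: abs_square_less_1)
 qed
 show ?thesis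
 proof (rule cont)
  fix z assume z: "z \<in> torus"
  obtain \<alpha> eps0 R where chart: "polar_chart torus g z \<alpha> eps0 R" using chart_exists[OF met z] by blast
  interpret polar_chart torus g z \<alpha> eps0 R by (rule chart)
  obtain eps G dp dm where c: "0 < eps" "eps \<le> eps0" "\<And>t. conc_germ G dp dm t"
   "\<And>r t. 0 \<le> r ==> r < eps ==> Fb (R r t) = Fb z * (cosh r + G t * sinh r)" by (rule cusp_profile[OF chart z]) blast
  have "\<exists>G. \<bar>G\<bar> < 1 \<and> Fb w = Fb z * (cosh (g z w) + G * sinh (g z w))" if w: "w \<in> torus" "g z w < eps" for w
  proof -
   obtain t where t: "w = R (g z w) t" using R_onto[OF w(1)] w(2) c(2) by fastforce
   show ?thesis by (rule exI, rule conjI[OF germ1[OF c(3)] c(4)[OF M.nonneg w(2), of t, folded t]])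
  qed
  thus "\<exists>eps>0. \<forall>w\<in>torus. g z w < eps --> (\<exists>G. \<bar>G\<bar> < 1 \<and> Fb w = Fb z * (cosh (g z w) + G * sinh (g z w)))"
   using c(1) by blast
 qed
qed

end

section \<open>Two cusps with the same boundary metric\<close>

locale two_cusps = A: marked_cusp C g Sing \<phi> + B: marked_cusp D g Sing \<psi>
 for C :: "'i cuspidal_complex" and D :: "'j cuspidal_complex"
  and g :: "complex \<times> complex \<Rightarrow> complex \<times> complex \<Rightarrow> real" and Sing \<phi> \<psi>
begin

lemma torus_compact: "compact (torus :: (complex \<times> complex) set)" and torus_connected: "connected (torus :: (complex \<times> complex) set)"
 unfolding torus_def by (intro compact_Times compact_sphere) (intro connected_Times connected_sphere; simp)

lemma torus_ne: "(torus :: (complex \<times> complex) set) \<noteq> {}"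
proof -
 have "(1, 1) \<in> (torus :: (complex \<times> complex) set)" by (simp add: torus_def)
 thus ?thesis by blast
qed

text \<open>The chart depends only on \<open>g\<close>, so one circle of directions serves both
  cusps whatever their decompositions; only the radius has to be reduced to a common one.\<close>

lemma profiles:
 assumes z: "z \<in> torus" and angle: "z \<in> Sing ==> particle_angle C (\<phi> z) = particle_angle D (\<psi> z)"
 obtains \<alpha> eps R G0 p0 m0 G1 p1 m1 where "polar_chart torus g z \<alpha> eps R"
  "\<And>t. conc_germ G0 p0 m0 t" "\<And>t. conc_germ G1 p1 m1 t"
  "\<And>t. G0 (t + \<alpha>) = G0 t" "\<And>t. p0 (t + \<alpha>) = p0 t" "\<And>t. m0 (t + \<alpha>) = m0 t"
  "\<And>t. G1 (t + \<alpha>) = G1 t" "\<And>t. p1 (t + \<alpha>) = p1 t" "\<And>t. m1 (t + \<alpha>) = m1 t"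
  "\<And>r t. 0 \<le> r ==> r < eps ==> A.Fb (R r t) = A.Fb z * (cosh r + G0 t * sinh r)"
  "\<And>r t. 0 \<le> r ==> r < eps ==> B.Fb (R r t) = B.Fb z * (cosh r + G1 t * sinh r)"
  "\<And>u. integral {u..u+\<alpha>} (\<lambda>t. angle_density (G0 t) (p0 t)) = integral {u..u+\<alpha>} (\<lambda>t. angle_density (G1 t) (p1 t))"
proof -
 obtain \<alpha> eps0 R where chart: "polar_chart torus g z \<alpha> eps0 R" using chart_exists[OF A.met z] by blast
 obtain eps1 G0 p0 m0 where a: "0 < eps1" "eps1 \<le> eps0"
  "\<And>t. conc_germ G0 p0 m0 t" "\<And>t. G0 (t + \<alpha>) = G0 t" "\<And>t. p0 (t + \<alpha>) = p0 t" "\<And>t. m0 (t + \<alpha>) = m0 t"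
  "\<And>r t. 0 \<le> r ==> r < eps1 ==> A.Fb (R r t) = A.Fb z * (cosh r + G0 t * sinh r)"
  "\<And>u. ((\<lambda>t. angle_density (G0 t) (p0 t)) has_integral (if z \<in> Sing then particle_angle C (\<phi> z) else \<alpha>)) {u..u+\<alpha>}"
  by (rule A.cusp_profile[OF chart z]) blast
 obtain eps2 G1 p1 m1 where b: "0 < eps2" "eps2 \<le> eps0"
  "\<And>t. conc_germ G1 p1 m1 t" "\<And>t. G1 (t + \<alpha>) = G1 t" "\<And>t. p1 (t + \<alpha>) = p1 t" "\<And>t. m1 (t + \<alpha>) = m1 t"
  "\<And>r t. 0 \<le> r ==> r < eps2 ==> B.Fb (R r t) = B.Fb z * (cosh r + G1 t * sinh r)"
  "\<And>u. ((\<lambda>t. angle_density (G1 t) (p1 t)) has_integral (if z \<in> Sing then particle_angle D (\<psi> z) else \<alpha>)) {u..u+\<alpha>}"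
  by (rule B.cusp_profile[OF chart z]) blast
 interpret P: polar_chart torus g z \<alpha> eps0 R by (rule chart)
 have c: "polar_chart torus g z \<alpha> (min eps1 eps2) R"
  by unfold_locales (use a(1,2) b(1,2) P.\<alpha> P.R_T P.R_per P.R_0 P.R_dist P.R_onto in auto)
 have i: "integral {u..u+\<alpha>} (\<lambda>t. angle_density (G0 t) (p0 t)) = integral {u..u+\<alpha>} (\<lambda>t. angle_density (G1 t) (p1 t))" for u
  unfolding integral_unique[OF a(8)] integral_unique[OF b(8)] using angle by auto
 have f: "A.Fb (R r t) = A.Fb z * (cosh r + G0 t * sinh r)" "B.Fb (R r t) = B.Fb z * (cosh r + G1 t * sinh r)"
  if "0 \<le> r" "r < min eps1 eps2" for r t using a(7) b(7) that by auto
 show thesis by (rule that[OF c a(3) b(3) a(4-6) b(4-6) f i])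
qed

lemma horofunctions_proportional:
 assumes angle: "\<And>z. z \<in> Sing ==> particle_angle C (\<phi> z) = particle_angle D (\<psi> z)"
 shows "\<exists>\<kappa>>0. \<forall>w\<in>torus. B.Fb w = \<kappa> * A.Fb w"
proof -
 note cont = A.Fb_continuous B.Fb_continuous and top = A.top
 have pos: "\<And>w. w \<in> torus ==> A.Fb w > 0" "\<And>w. w \<in> torus ==> B.Fb w > 0" using A.Fb_pos B.Fb_pos by auto
 have "A.Fb w \<noteq> 0" if "w \<in> torus" for w using pos(1)[OF that] by simp
 hence rc: "continuous_on torus (\<lambda>w. B.Fb w / A.Fb w)" using continuous_on_divide[OF cont(2) cont(1)] by blast
 obtain z0 where z0: "z0 \<in> torus" "\<And>w. w \<in> torus ==> B.Fb z0 / A.Fb z0 \<le> B.Fb w / A.Fb w"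
  using continuous_attains_inf[OF torus_compact torus_ne rc] by blast
 define \<kappa> where "\<kappa> = B.Fb z0 / A.Fb z0"
 have \<kappa>: "\<kappa> > 0" using pos z0(1) by (simp add: \<kappa>_def)
 have le: "\<kappa> * A.Fb w \<le> B.Fb w" if "w \<in> torus" for w
  using z0(2)[OF that] pos(1)[OF that] by (simp add: \<kappa>_def[symmetric] pos_le_divide_eq)
 define E where "E = {w \<in> torus. B.Fb w - \<kappa> * A.Fb w = 0}"
 have Ecl: "closedin (top_of_set torus) E" unfolding E_def by (rule continuous_closedin_preimage_constant) (intro continuous_intros cont)
 have z0E: "z0 \<in> E" using z0(1) pos(1)[OF z0(1)] by (simp add: E_def \<kappa>_def)
 \<comment> \<open>\<open>E\<close> is closed and nonempty and the torus is connected, so it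
   suffices to show that \<open>E\<close> is open, that is, \<open>E = I\<close>.\<close>
 define I where "I = (top_of_set torus) interior_of E"
 have Iop: "openin (top_of_set torus) I" and IE: "I \<subseteq> E" unfolding I_def by (auto simp: interior_of_subset)
 have toI: "z \<in> I" if "r > 0" "z \<in> torus" "A.M.mball z r \<subseteq> E" for z r
 proof -
  have "openin (top_of_set torus) (A.M.mball z r)" using A.M.openin_mball[of z r] by (simp only: top)
  hence "A.M.mball z r \<subseteq> I" unfolding I_def by (rule interior_of_maximal[OF that(3)])
  thus ?thesis using that(1,2) by auto
 qed
 have fromI: "\<exists>r>0. A.M.mball z r \<subseteq> E" if "z \<in> I" for z
  using Iop that IE unfolding top[symmetric] A.M.openin_mtopology by blast
 have "E \<subseteq> I"
 proof (rule ccontr)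
  assume "\<not> E \<subseteq> I"
  hence ne: "E - I \<noteq> {}" by blast
  have "closedin (top_of_set torus) (E - I)" using Ecl Iop by blast
  hence cp: "compact (E - I)" by (rule closedin_compact[OF torus_compact])
  have "continuous_on (E - I) A.Fb" by (rule continuous_on_subset[OF cont(1)]) (auto simp: E_def)
  \<comment> \<open>Maximising over the frontier \<open>E - I\<close>, and not over
    \<open>E\<close>, is possible because removing the open set \<open>I\<close> keeps the set
    compact.\<close>
  from continuous_attains_sup[OF cp ne this] obtain z where z: "z \<in> E" "z \<notin> I" "\<And>w. w \<in> E ==> w \<notin> I ==> A.Fb w \<le> A.Fb z" by blast
  have zT: "z \<in> torus" and zE: "B.Fb z = \<kappa> * A.Fb z" using z(1) by (auto simp: E_def)
  obtain \<alpha> eps R G0 p0 m0 G1 p1 m1 where c: "polar_chart torus g z \<alpha> eps R" and pr: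
  "\<And>t. conc_germ G0 p0 m0 t" "\<And>t. conc_germ G1 p1 m1 t"
  "\<And>t. G0 (t + \<alpha>) = G0 t" "\<And>t. p0 (t + \<alpha>) = p0 t" "\<And>t. m0 (t + \<alpha>) = m0 t"
  "\<And>t. G1 (t + \<alpha>) = G1 t" "\<And>t. p1 (t + \<alpha>) = p1 t" "\<And>t. m1 (t + \<alpha>) = m1 t"
  "\<And>r t. 0 \<le> r ==> r < eps ==> A.Fb (R r t) = A.Fb z * (cosh r + G0 t * sinh r)"
  "\<And>r t. 0 \<le> r ==> r < eps ==> B.Fb (R r t) = B.Fb z * (cosh r + G1 t * sinh r)"
  "\<And>u. integral {u..u+\<alpha>} (\<lambda>t. angle_density (G0 t) (p0 t)) = integral {u..u+\<alpha>} (\<lambda>t. angle_density (G1 t) (p1 t))"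
   by (rule profiles[OF zT angle]) blast+
  interpret polar_chart torus g z \<alpha> eps R by (rule c)
  have diff: "B.Fb (R r t) - \<kappa> * A.Fb (R r t) = \<kappa> * A.Fb z * sinh r * (G1 t - G0 t)" if "0 \<le> r" "r < eps" for r t
   unfolding pr(9)[OF that] pr(10)[OF that] zE by (simp add: algebra_simps)
  define r where "r = eps / 2"
  have r: "0 < r" "0 \<le> r" "r < eps" using eps by (auto simp: r_def)
  have cpos: "\<kappa> * A.Fb z * sinh r > 0" using \<kappa> pos(1)[OF zT] r(1) by simp
  have G01: "G0 t \<le> G1 t" for t
  proof -
   have "0 \<le> \<kappa> * A.Fb z * sinh r * (G1 t - G0 t)" using diff[OF r(2,3), of t] le[OF R_T[OF r(2,3), of t]] by linarith
   thus ?thesis using cpos by (simp add: zero_le_mult_iff)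
  qed
  from cone_angle_rigid[OF \<alpha>(1) pr(1,2) G01 pr(3) pr(6) pr(4) pr(7) pr(5) pr(8) pr(11)]
  consider (eq) "\<And>t. G1 t = G0 t" | (sep) t where "G0 t \<ge> 0" "G1 t = G0 t" "\<And>\<eta>. \<eta> > 0 ==> \<exists>t'. \<bar>t' - t\<bar> < \<eta> \<and> G0 t' < G1 t'" by metis
  thus False
  proof cases
   case eq
   have "A.M.mball z eps \<subseteq> E"
   proof
    fix w assume "w \<in> A.M.mball z eps"
    hence w: "w \<in> torus" "g z w < eps" by (auto simp: A.M.in_mball)
    obtain t where t: "w = R (g z w) t" using R_onto[OF w] by blast
    have "B.Fb (R (g z w) t) - \<kappa> * A.Fb (R (g z w) t) = 0" unfolding diff[OF A.M.nonneg w(2)] eq by simp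
    thus "w \<in> E" using w(1) unfolding t[symmetric] by (simp add: E_def)
   qed
   thus False using toI[OF eps zT] z(2) by blast
  next
   case sep
   define w where "w = R r t"
   have wT: "w \<in> torus" unfolding w_def by (rule R_T[OF r(2,3)])
   have wE: "w \<in> E" using diff[OF r(2,3), of t] wT sep(2) by (simp add: E_def w_def)
   \<comment> \<open>Directions arbitrarily close to \<open>t\<close> have strictly larger
     \<open>G1\<close>, so points of the same radius arbitrarily close to \<open>w\<close> are
     outside \<open>E\<close>.\<close>
   have wI: "w \<notin> I"
   proof
    assume "w \<in> I"
    then obtain d where d: "d > 0" "A.M.mball w d \<subseteq> E" using fromI by blast
    obtain \<rho> where \<rho>: "\<rho> > 0" "\<And>t. \<bar>t\<bar> < \<rho> ==> cosine_law r r t < d" using cosine_law_small[OF d(1), of r] by blast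
    obtain t' where t': "\<bar>t' - t\<bar> < min \<rho> (\<alpha> / 2)" "G0 t' < G1 t'" using sep(3)[of "min \<rho> (\<alpha> / 2)"] \<rho>(1) \<alpha>(1) by auto
    have "g w (R r t') = cosine_law r r (t - t')" unfolding w_def
     by (rule R_dist[OF r(2,3) r(2,3)]) (use t'(1) in \<open>simp add: abs_minus_commute\<close>)
    also have "\<dots> < d" by (rule \<rho>(2)) (use t'(1) in \<open>simp add: abs_minus_commute\<close>)
    finally have "R r t' \<in> E" using d(2) wT R_T[OF r(2,3), of t'] by (auto simp: A.M.in_mball)
    hence "\<kappa> * A.Fb z * sinh r * (G1 t' - G0 t') = 0" using diff[OF r(2,3), of t'] by (simp add: E_def)
    thus False using cpos t'(2) by auto
   qed
   \<comment> \<open>\<open>cosh r > 1\<close> makes the growth strict even when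
     \<open>G0 t = 0\<close>.\<close>
   have "A.Fb z * 1 < A.Fb z * (cosh r + G0 t * sinh r)"
   proof (rule mult_strict_left_mono[OF _ pos(1)[OF zT]])
    have "cosh r > 1" using cosh_real_nonneg_less_iff[of 0 r] r by simp
    moreover have "G0 t * sinh r \<ge> 0" using sep(1) r by simp
    ultimately show "1 < cosh r + G0 t * sinh r" by linarith
   qed
   thus False using z(3)[OF wE wI] pr(9)[OF r(2,3), of t] by (simp add: w_def)
  qed
 qed
 hence "I = E" using IE by blast
 hence "E = torus" using Iop Ecl z0E torus_connected unfolding connected_clopen by blast
 hence "\<forall>w\<in>torus. B.Fb w = \<kappa> * A.Fb w" by (auto simp: E_def)
 thus ?thesis using \<kappa> by blast
qed

end

section \<open>Cusps with proportional horofunctions\<close>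

context cusp
begin

text \<open>Inside one cell the normalising heights cancel, so the distance formula involves only
  ratios of \<open>N\<close>.\<close>

lemma cosh_dist_N:
 assumes i: "i \<in> cells C" and x: "x \<in> hyp_space" "y \<in> hyp_space" and t: "0 < t" "t \<le> 1" "0 < t'" "t' \<le> 1"
 shows "cosh (hyp_dist (vertical (apex C i) x t) (vertical (apex C i) y t')) =
  t * t' * cosh (hyp_dist x y) + t' * (1 - t\<^sup>2) / (2 * t) * (N (i, y) / N (i, x)) + t * (1 - t'\<^sup>2) / (2 * t') * (N (i, x) / N (i, y))"
proof -
 have h: "height i > 0" "horofn (apex C i) x > 0" "horofn (apex C i) y > 0"
  using height(1)[OF i] horofn_pos[OF x(1) apex_sphere[OF i]] horofn_pos[OF x(2) apex_sphere[OF i]] by auto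
 show ?thesis unfolding cosh_dist_verticals[OF x apex_sphere[OF i] t] using h t by (simp add: N_def divide_simps)
qed

lemma N_vertical:
 assumes "i \<in> cells C" "x \<in> hyp_space" "0 < t" "t \<le> 1"
 shows "N (i, vertical (apex C i) x t) = t * N (i, x)"
 using lift_vertical(3)[OF assms(2) apex_sphere[OF assms(1)] assms(3,4)] by (simp add: N_def)

text \<open>Both sides have the same distances to two points of the edge and the same value of
  \<open>N\<close>, and such a point of a lateral face is unique. Hence gluings respect feet and
  depths.\<close>

lemma gluing_vertical:
 assumes s: "s \<in> sides C" and x: "x \<in> snd s" and t: "0 < t" "t \<le> 1"
 shows "gluing C s (vertical (apex C (fst s)) x t) = vertical (apex C (fst (mate C s))) (gluing C s x) t"
proof -
 define i j where "i = fst s" and "j = fst (mate C s)"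
 note E = side_edge[OF s] and s' = mate(1)[OF s]
 note E' = side_edge[OF s']
 have ij: "i \<in> cells C" "j \<in> cells C" using sidesD[OF s] sidesD[OF s'] by (simp_all add: i_def j_def)
 obtain x1 x2 where x12: "x1 \<in> snd s" "x2 \<in> snd s" "x1 \<noteq> x2"
 proof -
  have "\<not> (\<exists>c. snd s \<subseteq> {c})"
  proof
   assume "\<exists>c. snd s \<subseteq> {c}"
   then obtain c where "snd s \<subseteq> {c}" by blast
   thus False using aff_dim_subset[of "snd s" "{c}"] E(5) by simp
  qed
  thus thesis using that x by blast
 qed
 have vl: "vertical (apex C i) x t \<in> lateral_face C s" unfolding i_def by (rule vertical_lf[OF s x t])
 have gx: "gluing C s y \<in> snd (mate C s)" if "y \<in> snd s" for y using gl_edge[OF s] that by blast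
 have xh: "y \<in> hyp_space" "gluing C s y \<in> hyp_space" if "y \<in> snd s" for y using that E(3) E'(3) gx by auto
 have gN: "N (j, gluing C s y) = N (i, y)" if "y \<in> snd s" for y unfolding i_def j_def by (rule N_glue[OF s edge_lf[OF s that]])
 have dd: "hyp_dist (gluing C s (vertical (apex C i) x t)) (gluing C s y) = hyp_dist (vertical (apex C j) (gluing C s x) t) (gluing C s y)"
  if y: "y \<in> snd s" for y
 proof -
  have "cosh (hyp_dist (vertical (apex C i) x t) y) = cosh (hyp_dist (vertical (apex C j) (gluing C s x) t) (gluing C s y))"
   using cosh_dist_N[OF ij(1) xh(1)[OF x] xh(1)[OF y] t, of 1] cosh_dist_N[OF ij(2) xh(2)[OF x] xh(2)[OF y] t, of 1]
    gl_dist[OF s edge_lf[OF s x] edge_lf[OF s y]] by (simp add: vertical_1 xh[OF y] gN[OF x] gN[OF y])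
  hence "hyp_dist (vertical (apex C i) x t) y = hyp_dist (vertical (apex C j) (gluing C s x) t) (gluing C s y)"
   using hyp_dist_nonneg[OF lift_vertical(2)[OF xh(1)[OF x] apex_sphere[OF ij(1)] t] xh(1)[OF y]]
    hyp_dist_nonneg[OF lift_vertical(2)[OF xh(2)[OF x] apex_sphere[OF ij(2)] t] xh(2)[OF y]] by (metis arcosh_cosh_real)
  thus ?thesis using gl_dist[OF s vl edge_lf[OF s y]] by simp
 qed
 have ne: "gluing C s x1 \<noteq> gluing C s x2" using gl_inv[OF s edge_lf[OF s]] x12 by metis
 have "N (j, gluing C s (vertical (apex C i) x t)) = N (i, vertical (apex C i) x t)" unfolding i_def j_def by (rule N_glue[OF s vl[unfolded i_def]])
 also have "\<dots> = N (j, vertical (apex C j) (gluing C s x) t)"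
  using N_vertical[OF ij(1) xh(1)[OF x] t] N_vertical[OF ij(2) xh(2)[OF x] t] gN[OF x] by simp
 finally have ho: "horofn (apex C j) (gluing C s (vertical (apex C i) x t)) = horofn (apex C j) (vertical (apex C j) (gluing C s x) t)"
  using height(1)[OF ij(2)] by (simp add: N_def)
 have g1: "gluing C s (vertical (apex C i) x t) \<in> pyramid (snd (mate C s)) (apex C j) - {apex C j}"
  using gl_in[OF s vl] unfolding E'(7) by (simp add: j_def)
 have g2: "vertical (apex C j) (gluing C s x) t \<in> pyramid (snd (mate C s)) (apex C j) - {apex C j}"
  using vertical_lf[OF s' gx[OF x] t] unfolding E'(7) by (simp add: j_def)
 have "gluing C s (vertical (apex C i) x t) = vertical (apex C j) (gluing C s x) t"
  by (rule vertical_unique[OF E'(1,3,4,5) apex_sphere[OF ij(2)] g1 g2 gx[OF x12(1)] gx[OF x12(2)] ne dd[OF x12(1)] dd[OF x12(2)] ho])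
 thus ?thesis by (simp add: i_def j_def)
qed

definition vpt :: "'i \<times> (real^3) \<Rightarrow> real \<Rightarrow> 'i \<times> (real^3)" where
 "vpt b t = (fst b, vertical (apex C (fst b)) (snd b) t)"

text \<open>An affine function that is 0 on the plane of the base and 1 at the apex: the barycentric
  weight of the apex.\<close>

definition fpar :: "'i \<Rightarrow> real^3 \<Rightarrow> real" where
 "fpar i q = lorentz (nu i) (q, 1) / lorentz (nu i) (apex C i, 1)"

text \<open>The projection from the apex to the plane of the base.\<close>
definition foot :: "'i \<Rightarrow> real^3 \<Rightarrow> real^3" where
 "foot i q = (1 / (1 - fpar i q)) *\<^sub>R (q - fpar i q *\<^sub>R apex C i)"

lemma foot_vertical:
 assumes i: "i \<in> cells C" and x: "x \<in> base C i" and t: "0 < t" "t \<le> 1"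
 shows "fpar i (vertical (apex C i) x t) < 1" "foot i (vertical (apex C i) x t) = x"
proof -
 interpret apexed_polygon "base C i" "nu i" "apex C i" by (rule ap[OF i])
 define a q where "a = apex C i" and "q = vertical a x t"
 have xh: "x \<in> hyp_space" by (rule A_hyp[OF x])
 have as: "a \<in> sphere 0 1" using apex by (simp add: a_def)
 have qh: "q \<in> hyp_space" unfolding q_def by (rule lift_vertical(2)[OF xh as t])
 define G where "G = (1 - t\<^sup>2) / (2 * t * horofn a x)"
 obtain c where c: "c > 0" "lift x = c *\<^sub>R (x, 1)" using lift_point[OF xh] by blast
 obtain d where d: "d > 0" "lift q = d *\<^sub>R (q, 1)" using lift_point[OF qh] by blast
 have e: "d *\<^sub>R (q, 1::real) = (t * c) *\<^sub>R (x, 1) + G *\<^sub>R (a, 1)"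
  using lift_vertical(1)[OF xh as t] unfolding q_def[symmetric] d(2) c(2) G_def[symmetric] by (simp del: scaleR_Pair)
 have l: "lorentz (nu i) (a, 1) \<noteq> 0" using apex_side by (simp add: a_def)
 have "lorentz (nu i) (x, 1) = 0" using \<nu>(2) hull_inc[OF x, of affine] by blast
 hence "d * lorentz (nu i) (q, 1) = G * lorentz (nu i) (a, 1)" using arg_cong[OF e, of "lorentz (nu i)"] by (simp only: lorentz_simps)
 hence f: "fpar i q = G / d" using l d(1) by (simp add: fpar_def a_def[symmetric] field_simps)
 have dG1: "d = t * c + G" using arg_cong[OF e, of snd] by simp
 have dG2: "d *\<^sub>R q = (t * c) *\<^sub>R x + G *\<^sub>R a" using arg_cong[OF e, of fst] by simp
 have tc: "t * c > 0" using t c by simp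
 have f1: "1 - fpar i q = t * c / d" using dG1 d(1) unfolding f by (simp add: field_simps)
 show "fpar i (vertical (apex C i) x t) < 1" using f1 tc d(1) divide_pos_pos[OF tc d(1)] unfolding q_def a_def by linarith
 have "(1 / (1 - fpar i q)) *\<^sub>R (q - fpar i q *\<^sub>R a) = (1 / (t * c)) *\<^sub>R (d *\<^sub>R q - G *\<^sub>R a)"
  unfolding f1 unfolding f using d(1) tc by (simp add: scaleR_right_diff_distrib)
 also have "\<dots> = x" unfolding dG2 using t(1) c(1) by simp
 finally show "foot i (vertical (apex C i) x t) = x" by (simp add: foot_def q_def a_def)
qed

lemma vpt_exists:
 assumes p: "p \<in> pyramid_points C"
 shows "\<exists>b\<in>base_points C. \<exists>t. 0 < t \<and> t \<le> 1 \<and> p = vpt b t"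
proof -
 have i: "fst p \<in> cells C" "snd p \<in> pyramid (base C (fst p)) (apex C (fst p)) - {apex C (fst p)}" using p by (simp_all add: pyramid_pointsD)
 interpret polygon "base C (fst p)" "nu (fst p)" by (rule pg[OF i(1)])
 have "convex (base C (fst p))" "base C (fst p) \<subseteq> hyp_space" "base C (fst p) \<noteq> {}" using A_facts A_hyp by auto
 from pyramid_vertical[OF this apex_sphere[OF i(1)] i(2)]
 obtain y t where y: "y \<in> base C (fst p)" "0 < t" "t \<le> 1" "snd p = vertical (apex C (fst p)) y t" by blast
 show ?thesis using y i by (intro bexI[of _ "(fst p, y)"] exI[of _ t]) (simp_all add: vpt_def base_pointsD prod_eq_iff)
qed

lemma vpt_pyramid:
 assumes b: "b \<in> base_points C" and t: "0 < t" "t \<le> 1"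
 shows "vpt b t \<in> pyramid_points C"
proof -
 have i: "fst b \<in> cells C" "snd b \<in> base C (fst b)" using b by (simp_all add: base_pointsD)
 interpret polygon "base C (fst b)" "nu (fst b)" by (rule pg[OF i(1)])
 have "convex (base C (fst b))" "base C (fst b) \<subseteq> hyp_space" using A_facts A_hyp by auto
 from vertical_pyramid[OF this i(2) apex_sphere[OF i(1)] t] show ?thesis using i by (simp add: vpt_def pyramid_pointsD)
qed

lemma vpt_1: "b \<in> base_points C ==> vpt b 1 = b" using base_points_hyp[of b] by (simp add: vpt_def vertical_1)

lemma base_pyramid: "b \<in> base_points C ==> b \<in> pyramid_points C" using vpt_pyramid[of b 1] vpt_1[of b] by simp

lemma pyramid_points_hyp: assumes "p \<in> pyramid_points C" shows "snd p \<in> hyp_space"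
proof -
 obtain b t where b: "b \<in> base_points C" "0 < t" "t \<le> 1" "p = vpt b t" using vpt_exists[OF assms] by blast
 show ?thesis unfolding b(4) vpt_def snd_conv
  by (rule lift_vertical(2)[OF base_points_hyp[OF b(1)] apex_sphere b(2,3)]) (use b(1) in \<open>simp add: base_pointsD\<close>)
qed

lemma vpt_unique:
 assumes b: "b \<in> base_points C" "b' \<in> base_points C" and t: "0 < t" "t \<le> 1" "0 < t'" "t' \<le> 1" and e: "vpt b t = vpt b' t'"
 shows "b = b' \<and> t = t'"
proof -
 have i: "fst b \<in> cells C" "snd b \<in> base C (fst b)" "fst b' \<in> cells C" "snd b' \<in> base C (fst b')" using b by (simp_all add: base_pointsD)
 have f: "fst b = fst b'" and v: "vertical (apex C (fst b)) (snd b) t = vertical (apex C (fst b')) (snd b') t'"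
  using arg_cong[OF e, of fst] arg_cong[OF e, of snd] by (simp_all only: vpt_def fst_conv snd_conv)
 have "snd b = snd b'" using foot_vertical(2)[OF i(1,2) t(1,2)] foot_vertical(2)[OF i(3,4) t(3,4)] v f by simp
 hence bb: "b = b'" using f by (simp add: prod_eq_iff)
 have h: "snd b \<in> hyp_space" by (rule base_points_hyp[OF b(1)])
 have vv: "vertical (apex C (fst b)) (snd b) t = vertical (apex C (fst b)) (snd b) t'" using v unfolding bb .
 have "t * N (fst b, snd b) = t' * N (fst b, snd b)"
  unfolding N_vertical[OF i(1) h t(1,2), symmetric] N_vertical[OF i(1) h t(3,4), symmetric] vv ..
 moreover have "N (fst b, snd b) > 0" using N_pos[of b] i(1) h by simp
 ultimately show ?thesis using bb by simp
qed

text \<open>Gluings commute with vertical motion, so the relation on the pyramids is the one on the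
  bases carried along at constant depth.\<close>

lemma vpt_step:
 assumes b: "b \<in> base_points C" and t: "0 < t" "t \<le> 1" and st: "(vpt b t, q) \<in> gstep"
 shows "\<exists>b'. (b, b') \<in> gstep \<and> q = vpt b' t"
proof -
 obtain s x where s: "s \<in> sides C" "x \<in> lateral_face C s" "vpt b t = (fst s, x)" "q = (fst (mate C s), gluing C s x)"
  using st unfolding gstep_def by blast
 obtain y t' where y: "y \<in> snd s" "0 < t'" "t' \<le> 1" "x = vertical (apex C (fst s)) y t'" using lf_vertical[OF s(1,2)] by blast
 have yb: "(fst s, y) \<in> base_points C" using side_edge(6)[OF s(1)] y(1) sidesD[OF s(1)] by (auto simp: base_pointsD)
 have "vpt b t = vpt (fst s, y) t'" unfolding s(3) y(4) by (simp add: vpt_def)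
 from vpt_unique[OF b yb t y(2,3) this] have b': "b = (fst s, y)" "t' = t" by auto
 have "(b, (fst (mate C s), gluing C s y)) \<in> gstep" unfolding b'(1) by (rule gstep_edge[OF s(1) y(1)])
 moreover have "q = vpt (fst (mate C s), gluing C s y) t"
  unfolding s(4) y(4) b'(2) vpt_def fst_conv snd_conv using gluing_vertical[OF s(1) y(1) t] by simp
 ultimately show ?thesis by blast
qed

lemma vpt_glued:
 assumes "(vpt b t, q) \<in> glued C" and b: "b \<in> base_points C" and t: "0 < t" "t \<le> 1"
 shows "\<exists>b'. (b, b') \<in> glued C \<and> q = vpt b' t" using assms(1) unfolding glued_gstep
proof (induction rule: rtrancl_induct)
 case (step y z)
 then obtain b' where b': "(b, b') \<in> gstep\<^sup>*" "y = vpt b' t" by blast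
 have "b' \<in> base_points C" using glued_base[of b b'] b b'(1) by (simp add: glued_gstep)
 from vpt_step[OF this t] step(2) b'(2) obtain b'' where b'': "(b', b'') \<in> gstep" "z = vpt b'' t" by blast
 show ?case using rtrancl.rtrancl_into_rtrancl[OF b'(1) b''(1)] b''(2) by blast
qed blast

lemma glued_vpt:
 assumes "(b, b') \<in> glued C" and b: "b \<in> base_points C" and t: "0 < t" "t \<le> 1"
 shows "(vpt b t, vpt b' t) \<in> glued C" using assms(1) unfolding glued_gstep
proof (induction rule: rtrancl_induct)
 case (step y z)
 have yb: "y \<in> base_points C" using glued_base[of b y] b step(1) by (simp add: glued_gstep)
 obtain s where s: "s \<in> sides C" "fst y = fst s" "snd y \<in> snd s" "z = (fst (mate C s), gluing C s (snd y))"
  using gstep_base[OF step(2) yb] by metis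
 have "((fst s, vertical (apex C (fst s)) (snd y) t), (fst (mate C s), gluing C s (vertical (apex C (fst s)) (snd y) t))) \<in> gstep"
  unfolding gstep_def using s(1) vertical_lf[OF s(1,3) t] by blast
 hence "(vpt y t, vpt z t) \<in> gstep" unfolding gluing_vertical[OF s(1,3) t] using s by (simp add: vpt_def)
 thus ?case using step(3) by (meson rtrancl.rtrancl_into_rtrancl)
qed simp

lemma chain_exists_less:
 assumes "is_chain S ch0 X Y" "e > 0"
 shows "\<exists>ch. is_chain S ch X Y \<and> chain_length ch < gluing_dist S (glued C) X Y + e"
 using gluing_dist_less[of S X Y "gluing_dist S (glued C) X Y + e" ch0] assms by simp

text \<open>The existence of chains is assumed because an infimum over no chains would be an
  arbitrary real number.\<close>

lemma gluing_dist_triangle: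
 assumes S: "\<And>p. p \<in> S ==> snd p \<in> hyp_space" and "is_chain S c1 X (cls y)" "is_chain S c2 (cls y) Z"
 shows "gluing_dist S (glued C) X Z \<le> gluing_dist S (glued C) X (cls y) + gluing_dist S (glued C) (cls y) Z"
proof (rule field_le_epsilon)
 fix e :: real assume "e > 0"
 hence e: "e / 2 > 0" by simp
 obtain ch1 where c1: "is_chain S ch1 X (cls y)" "chain_length ch1 < gluing_dist S (glued C) X (cls y) + e / 2"
  using chain_exists_less[OF assms(2) e] by blast
 obtain ch2 where c2: "is_chain S ch2 (cls y) Z" "chain_length ch2 < gluing_dist S (glued C) (cls y) Z + e / 2"
  using chain_exists_less[OF assms(3) e] by blast
 note a = chain_append[OF c1(1) c2(1)]
 have "gluing_dist S (glued C) X Z \<le> chain_length (ch1 @ ch2)" by (rule gluing_dist_le[OF S a[THEN conjunct1]])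
 thus "gluing_dist S (glued C) X Z \<le> gluing_dist S (glued C) X (cls y) + gluing_dist S (glued C) (cls y) Z + e"
  using a c1(2) c2(2) by linarith
qed

lemma cusp_space_cls: "cusp_space C = cls ` pyramid_points C" by (auto simp: cusp_space_def quotient_def cls_def)

lemma vpt_to_base:
 assumes b: "b \<in> base_points C" and t: "0 < t" "t \<le> 1"
 shows "is_chain (pyramid_points C) [(vpt b t, b)] (cls (vpt b t)) (cls b)" "is_chain (pyramid_points C) [(b, vpt b t)] (cls b) (cls (vpt b t))"
 using chain_singleton[OF vpt_pyramid[OF b t] base_pyramid[OF b]] chain_singleton[OF base_pyramid[OF b] vpt_pyramid[OF b t]]
 by (simp_all add: vpt_def)

lemma pyramid_segment:
 assumes i: "i \<in> cells C" and p: "(i, x) \<in> pyramid_points C" "(i, y) \<in> pyramid_points C" and m: "m \<in> closed_segment x y"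
 shows "(i, m) \<in> pyramid_points C"
proof -
 have "convex (pyramid (base C i) (apex C i))" unfolding pyramid_def by (rule convex_convex_hull)
 hence "m \<in> pyramid (base C i) (apex C i)" using p m unfolding pyramid_pointsD convex_contains_segment by auto
 moreover have "m \<in> hyp_space" by (rule hyp_dist_segment(1)[OF _ _ m]) (use pyramid_points_hyp[OF p(1)] pyramid_points_hyp[OF p(2)] in simp_all)
 hence "m \<noteq> apex C i" using apex_sphere[OF i] by (auto simp: mem_ball_0)
 ultimately show ?thesis using i by (simp add: pyramid_pointsD)
qed

text \<open>Continuity of the foot along a segment. It brings nearby points of a segment over a
  small star of the boundary, where distances of feet are understood.\<close>

lemma foot_near:
 assumes i: "i \<in> cells C" and p: "(i, x) \<in> pyramid_points C" "(i, y) \<in> pyramid_points C" and s: "s \<in> {0..1}" and e: "e > 0"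
 defines "m \<equiv> \<lambda>s::real. (1 - s) *\<^sub>R x + s *\<^sub>R y"
 shows "\<exists>\<delta>>0. \<forall>s'\<in>{0..1}. \<bar>s' - s\<bar> < \<delta> --> hyp_dist (foot i (m s)) (foot i (m s')) < e"
proof -
 have mp: "(i, m s) \<in> pyramid_points C" if "s \<in> {0..1}" for s
  by (rule pyramid_segment[OF i p]) (use that in \<open>auto simp: m_def closed_segment_def\<close>)
 have f: "fpar i (m s) < 1" "foot i (m s) \<in> base C i" if s: "s \<in> {0..1}" for s
 proof -
  obtain b t where b: "b \<in> base_points C" "0 < t" "t \<le> 1" "(i, m s) = vpt b t" using vpt_exists[OF mp[OF s]] by blast
  have "snd b \<in> base C i" "m s = vertical (apex C i) (snd b) t" using b(1,4) by (simp_all add: vpt_def base_pointsD)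
  thus "fpar i (m s) < 1" "foot i (m s) \<in> base C i" using foot_vertical[OF i _ b(2,3), of "snd b"] by simp_all
 qed
 have fh: "foot i (m s) \<in> hyp_space" if "s \<in> {0..1}" for s using base_hyp[OF i f(2)[OF that]] .
 have "continuous_on {0..1} (\<lambda>s. lorentz (nu i) (m s, 1))"
  unfolding m_def lorentz_eq fst_conv snd_conv by (intro continuous_intros)
 hence "continuous_on {0..1} (\<lambda>s. fpar i (m s))" unfolding fpar_def divide_inverse by (intro continuous_intros)
 moreover have "continuous_on {0..1} m" unfolding m_def by (intro continuous_intros)
 ultimately have "continuous_on {0..1} (\<lambda>s. foot i (m s))" unfolding foot_def by (intro continuous_intros) (use f(1) in force)+
 hence "continuous_on {0..1} (\<lambda>s'. hyp_dist (foot i (m s)) (foot i (m s')))"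
  by (rule continuous_on_compose2[OF continuous_on_hyp_dist[OF fh[OF s]]]) (use fh in blast)
 then obtain \<delta> where "\<delta> > 0" "\<And>s'. s' \<in> {0..1} ==> dist s' s < \<delta> ==>
   dist (hyp_dist (foot i (m s)) (foot i (m s'))) (hyp_dist (foot i (m s)) (foot i (m s))) < e"
  unfolding continuous_on_iff using s e by meson
 thus ?thesis using hyp_dist_self[OF fh[OF s]] by (intro exI[of _ \<delta>]) (auto simp: dist_real_def intro: order.strict_trans1[OF abs_ge_self])
qed

end

context marked_cusp
begin

text \<open>Go down to the base, along a boundary chain, and up again.\<close>

lemma pyramid_chain:
 assumes p: "p \<in> pyramid_points C" and q: "q \<in> pyramid_points C"
 shows "\<exists>ch. is_chain (pyramid_points C) ch (cls p) (cls q)"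
proof -
 obtain b t where b: "b \<in> base_points C" "0 < t" "t \<le> 1" "p = vpt b t" using vpt_exists[OF p] by blast
 obtain b' t' where b': "b' \<in> base_points C" "0 < t'" "t' \<le> 1" "q = vpt b' t'" using vpt_exists[OF q] by blast
 obtain ch where "is_chain (base_points C) ch (cls b) (cls b')" using chain_exists[OF b(1) b'(1)] by blast
 hence "is_chain (pyramid_points C) ch (cls b) (cls b')" using base_pyramid unfolding is_chain_def by blast
 from chain_append[OF vpt_to_base(1)[OF b(1-3)] this] chain_append[OF _ vpt_to_base(2)[OF b'(1-3)]]
 show ?thesis unfolding b(4) b'(4) by blast
qed

end

section \<open>The correspondence between the two cusps\<close>

locale proportional_cusps = two_cusps C D g Sing \<phi> \<psi>
 for C :: "'i cuspidal_complex" and D :: "'j cuspidal_complex"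
  and g :: "complex \<times> complex \<Rightarrow> complex \<times> complex \<Rightarrow> real" and Sing \<phi> \<psi> +
 fixes \<kappa> :: real
 assumes \<kappa>: "\<kappa> > 0" and ratio: "\<And>w. w \<in> torus ==> B.Fb w = \<kappa> * A.Fb w"
begin

text \<open>A relation and not a function: a boundary point can have several representatives in
  \<open>D\<close>, and the right one depends on the cell in which distances are to be
  compared.\<close>

definition corr :: "'i \<times> (real^3) \<Rightarrow> 'j \<times> (real^3) \<Rightarrow> bool" where
 "corr p q \<longleftrightarrow> (\<exists>b\<in>base_points C. \<exists>b'\<in>base_points D. \<exists>t. 0 < t \<and> t \<le> 1 \<and> A.pt b = B.pt b' \<and> p = A.vpt b t \<and> q = B.vpt b' t)"

lemma corr_points: "corr p q ==> p \<in> pyramid_points C \<and> q \<in> pyramid_points D"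
 unfolding corr_def using A.vpt_pyramid B.vpt_pyramid by blast

lemma corr_exists: assumes "p \<in> pyramid_points C" shows "\<exists>q. corr p q"
proof -
 obtain b t where b: "b \<in> base_points C" "0 < t" "t \<le> 1" "p = A.vpt b t" using A.vpt_exists[OF assms] by blast
 obtain b' where "b' \<in> base_points D" "A.pt b = B.pt b'" using B.pt_surj[OF A.pt(1)[OF b(1)]] by blast
 thus ?thesis using b unfolding corr_def by blast
qed

lemma corr_glued_left:
 assumes "corr p q" "(p, p') \<in> glued C" shows "corr p' q"
proof -
 obtain b b' t where b: "b \<in> base_points C" "b' \<in> base_points D" "0 < t" "t \<le> 1" "A.pt b = B.pt b'" "p = A.vpt b t" "q = B.vpt b' t"
  using assms(1) unfolding corr_def by blast
 obtain b2 where b2: "(b, b2) \<in> glued C" "p' = A.vpt b2 t" using A.vpt_glued[OF _ b(1,3,4)] assms(2) b(6) by blast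
 have b2b: "b2 \<in> base_points C" by (rule A.glued_base[OF b2(1) b(1)])
 have "A.pt b = A.pt b2" using A.pt_eq[OF b(1) b2b] b2(1) by simp
 thus ?thesis unfolding corr_def using b b2(2) b2b by metis
qed

lemma corr_unique:
 assumes "corr p q" "corr p q'" shows "(q, q') \<in> glued D"
proof -
 obtain b b' t where b: "b \<in> base_points C" "b' \<in> base_points D" "0 < t" "t \<le> 1" "A.pt b = B.pt b'" "p = A.vpt b t" "q = B.vpt b' t"
  using assms(1) unfolding corr_def by blast
 obtain c c' s where c: "c \<in> base_points C" "c' \<in> base_points D" "0 < s" "s \<le> 1" "A.pt c = B.pt c'" "p = A.vpt c s" "q' = B.vpt c' s"
  using assms(2) unfolding corr_def by blast
 have "b = c \<and> t = s" by (rule A.vpt_unique[OF b(1) c(1) b(3,4) c(3,4)]) (use b(6) c(6) in simp)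
 moreover from this have "(b', c') \<in> glued D" using B.pt_eq[OF b(2) c(2)] b(5) c(5) by simp
 ultimately show ?thesis using B.glued_vpt[OF _ b(2-4)] b(7) c(7) by simp
qed

text \<open>\<open>cosh_dist_N\<close> involves \<open>N\<close> only through ratios, in which the
  factor \<open>\<kappa>\<close> cancels.\<close>

lemma corr_dist:
 assumes b: "b \<in> base_points C" "c \<in> base_points C" "fst b = fst c" and b': "b' \<in> base_points D" "c' \<in> base_points D" "fst b' = fst c'"
  and pt: "A.pt b = B.pt b'" "A.pt c = B.pt c'" and d: "hyp_dist (snd b) (snd c) = hyp_dist (snd b') (snd c')"
  and t: "0 < t" "t \<le> 1" "0 < s" "s \<le> 1"
 shows "hyp_dist (snd (B.vpt b' t)) (snd (B.vpt c' s)) = hyp_dist (snd (A.vpt b t)) (snd (A.vpt c s))"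
proof -
 have N: "B.N b' = \<kappa> * A.N b" "B.N c' = \<kappa> * A.N c"
  using ratio[OF A.pt(1)[OF b(1)]] ratio[OF A.pt(1)[OF b(2)]] A.Fb_pt[OF b(1)] A.Fb_pt[OF b(2)] B.Fb_pt[OF b'(1)] B.Fb_pt[OF b'(2)] pt by simp_all
 define x y x' y' i j where "x = snd b" and "y = snd c" and "x' = snd b'" and "y' = snd c'" and "i = fst b" and "j = fst b'"
 have bc: "b = (i, x)" "c = (i, y)" "b' = (j, x')" "c' = (j, y')" using b(3) b'(3) by (simp_all add: x_def y_def x'_def y'_def i_def j_def prod_eq_iff)
 have ij: "i \<in> cells C" "j \<in> cells D" using b(1) b'(1) by (simp_all add: A.base_pointsD B.base_pointsD i_def j_def)
 have h: "x \<in> hyp_space" "y \<in> hyp_space" "x' \<in> hyp_space" "y' \<in> hyp_space"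
  using A.base_points_hyp[OF b(1)] A.base_points_hyp[OF b(2)] B.base_points_hyp[OF b'(1)] B.base_points_hyp[OF b'(2)]
  by (simp_all add: x_def y_def x'_def y'_def)
 have "B.N (j, y') / B.N (j, x') = A.N (i, y) / A.N (i, x)" "B.N (j, x') / B.N (j, y') = A.N (i, x) / A.N (i, y)"
  using N \<kappa> by (simp_all add: bc)
 moreover have "hyp_dist x' y' = hyp_dist x y" using d by (simp add: x_def y_def x'_def y'_def)
 ultimately have "cosh (hyp_dist (vertical (apex D j) x' t) (vertical (apex D j) y' s)) = cosh (hyp_dist (vertical (apex C i) x t) (vertical (apex C i) y s))"
  unfolding A.cosh_dist_N[OF ij(1) h(1,2) t] B.cosh_dist_N[OF ij(2) h(3,4) t] by simp
 hence "hyp_dist (vertical (apex D j) x' t) (vertical (apex D j) y' s) = hyp_dist (vertical (apex C i) x t) (vertical (apex C i) y s)"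
  using hyp_dist_nonneg[OF lift_vertical(2)[OF h(3) B.apex_sphere[OF ij(2)] t(1,2)] lift_vertical(2)[OF h(4) B.apex_sphere[OF ij(2)] t(3,4)]]
   hyp_dist_nonneg[OF lift_vertical(2)[OF h(1) A.apex_sphere[OF ij(1)] t(1,2)] lift_vertical(2)[OF h(2) A.apex_sphere[OF ij(1)] t(3,4)]]
  by (metis arcosh_cosh_real)
 thus ?thesis by (simp add: A.vpt_def B.vpt_def bc)
qed

abbreviation "dD \<equiv> gluing_dist (pyramid_points D) (glued D)"

lemma dD_triangle:
 assumes "p \<in> pyramid_points D" "q \<in> pyramid_points D" "r \<in> pyramid_points D"
 shows "dD (B.cls p) (B.cls r) \<le> dD (B.cls p) (B.cls q) + dD (B.cls q) (B.cls r)"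
proof -
 obtain c1 where c1: "B.is_chain (pyramid_points D) c1 (B.cls p) (B.cls q)" using B.pyramid_chain[OF assms(1,2)] by blast
 obtain c2 where c2: "B.is_chain (pyramid_points D) c2 (B.cls q) (B.cls r)" using B.pyramid_chain[OF assms(2,3)] by blast
 show ?thesis by (rule B.gluing_dist_triangle[OF B.pyramid_points_hyp c1 c2])
qed

lemma corr_cls: "corr p q ==> corr p q' ==> B.cls q = B.cls q'" using corr_unique by (simp add: B.cls_eq)

text \<open>Lengths are compared locally along the segment, where both boundary metrics are realised inside single cells.\<close>
lemma corr_link:
 assumes p: "(i, x) \<in> pyramid_points C" "(i, y) \<in> pyramid_points C" and q: "corr (i, x) q" "corr (i, y) q'"
 shows "dD (B.cls q) (B.cls q') \<le> hyp_dist x y"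
proof -
 have i: "i \<in> cells C" using p(1) by (simp add: A.pyramid_pointsD)
 have xy: "x \<in> hyp_space" "y \<in> hyp_space" using A.pyramid_points_hyp[OF p(1)] A.pyramid_points_hyp[OF p(2)] by simp_all
 define m where "m s = (1 - s) *\<^sub>R x + s *\<^sub>R y" for s :: real
 have mp: "(i, m s) \<in> pyramid_points C" if "s \<in> {0..1}" for s
  by (rule A.pyramid_segment[OF i p]) (use that in \<open>auto simp: m_def closed_segment_def\<close>)
 have mh: "m s \<in> hyp_space" if "s \<in> {0..1}" for s using A.pyramid_points_hyp[OF mp[OF that]] by simp
 have "\<forall>s\<in>{0..1}. \<exists>w. corr (i, m s) w" using corr_exists mp by blast
 from bchoice[OF this] obtain w where w: "\<And>s. s \<in> {0..1} ==> corr (i, m s) (w s)" by blast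
 have wp: "w s \<in> pyramid_points D" if "s \<in> {0..1}" for s using corr_points[OF w[OF that]] by blast
 have loc: "\<exists>\<delta>>0. \<forall>s'\<in>{0..1}. \<bar>s' - s\<bar> < \<delta> --> dD (B.cls (w s)) (B.cls (w s')) \<le> hyp_dist (m s) (m s') \<and>
   dD (B.cls (w s')) (B.cls (w s)) \<le> hyp_dist (m s) (m s')" if s: "s \<in> {0..1}" for s
 proof -
  obtain b b' t where b: "b \<in> base_points C" "b' \<in> base_points D" "0 < t" "t \<le> 1" "A.pt b = B.pt b'" "(i, m s) = A.vpt b t" "w s = B.vpt b' t"
   using w[OF s] unfolding corr_def by blast
  obtain Ca epsa where ga: "A.good_radius (A.cls b) Ca epsa" using A.good_radius_exists[OF b(1) zero_less_one] by blast
  obtain Cb epsb where gb: "B.good_radius (B.cls b') Cb epsb" using B.good_radius_exists[OF b(2) zero_less_one] by blast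
  have pos: "epsa > 0" "epsb > 0" using ga gb unfolding A.good_radius_def B.good_radius_def by blast+
  \<comment> \<open>The feet must stay within the good radii of both cusps, since the distance is
    read in a cell of \<open>C\<close> and has to be realised in a cell of \<open>D\<close>.\<close>
  obtain \<delta> where \<delta>: "\<delta> > 0" "\<And>s'. s' \<in> {0..1} ==> \<bar>s' - s\<bar> < \<delta> ==> hyp_dist (A.foot i (m s)) (A.foot i (m s')) < min epsa epsb"
   using A.foot_near[OF i p s, of "min epsa epsb"] pos unfolding m_def by auto
  have fb: "fst b = i" "snd b \<in> base C i" "m s = vertical (apex C i) (snd b) t" using b(1,6) by (simp_all add: A.vpt_def A.base_pointsD)
  have fs: "A.foot i (m s) = snd b" using A.foot_vertical(2)[OF i fb(2) b(3,4)] fb(3) by simp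
  have "dD (B.cls (w s)) (B.cls (w s')) \<le> hyp_dist (m s) (m s') \<and> dD (B.cls (w s')) (B.cls (w s)) \<le> hyp_dist (m s) (m s')"
   if s': "s' \<in> {0..1}" "\<bar>s' - s\<bar> < \<delta>" for s'
  proof -
   obtain c c' r where c: "c \<in> base_points C" "c' \<in> base_points D" "0 < r" "r \<le> 1" "A.pt c = B.pt c'" "(i, m s') = A.vpt c r" "w s' = B.vpt c' r"
    using w[OF s'(1)] unfolding corr_def by blast
   have fc: "fst c = i" "snd c \<in> base C i" "m s' = vertical (apex C i) (snd c) r" using c(1,6) by (simp_all add: A.vpt_def A.base_pointsD)
   have "A.foot i (m s') = snd c" using A.foot_vertical(2)[OF i fc(2) c(3,4)] fc(3) by simp
   hence d: "hyp_dist (snd b) (snd c) < epsa" "hyp_dist (snd b) (snd c) < epsb" using \<delta>(2)[OF s'] fs by simp_all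
   have gd: "g (A.pt b) (A.pt c) = hyp_dist (snd b) (snd c)" by (rule A.near_dist[OF ga b(1) A.cls_self c(1) _ d(1)]) (simp add: fb fc)
   \<comment> \<open>The chosen representative \<open>b'\<close> may lie in another cell than
     \<open>c'\<close>. It is replaced by the representative \<open>v\<close> in the cell of
     \<open>c'\<close> that realises the boundary distance.\<close>
   obtain v where v: "v \<in> B.cls b'" "fst v = fst c'" "hyp_dist (snd v) (snd c') = hyp_dist (snd b) (snd c)"
    using B.near_rep[OF gb b(2) c(2)] gd d(2) unfolding b(5) c(5) by auto
   have vb: "v \<in> base_points D" using v(1) B.cls_base[OF b(2)] by blast
   have "(b', v) \<in> glued D" using v(1) by (simp add: B.cls_iff)
   hence pv: "A.pt b = B.pt v" using B.pt_eq[OF b(2) vb] b(5) by simp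
   have cv: "corr (i, m s) (B.vpt v t)" unfolding corr_def using b vb pv by blast
   have e: "B.cls (w s) = B.cls (B.vpt v t)" by (rule corr_cls[OF w[OF s] cv])
   have hd: "hyp_dist (snd (B.vpt v t)) (snd (B.vpt c' r)) = hyp_dist (m s) (m s')"
    using corr_dist[OF b(1) c(1) _ vb c(2) v(2) pv c(5) _ b(3,4) c(3,4)] v(3) fb(1) fc(1) b(6)[symmetric] c(6)[symmetric] by simp
   have fv: "fst (B.vpt v t) = fst (B.vpt c' r)" using v(2) by (simp add: B.vpt_def)
   have P: "B.vpt v t \<in> pyramid_points D" "B.vpt c' r \<in> pyramid_points D" using B.vpt_pyramid vb c b(3,4) by auto
   show ?thesis unfolding e unfolding c(7)
    using B.gluing_dist_pair[OF B.pyramid_points_hyp P fv] B.gluing_dist_pair[OF B.pyramid_points_hyp P(2,1) fv[symmetric]] hd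
     hyp_dist_commute[of "snd (B.vpt c' r)"] by simp
  qed
  thus ?thesis using \<delta>(1) by blast
 qed
 have add: "hyp_dist (m a) (m b) + hyp_dist (m b) (m c) = hyp_dist (m a) (m c)" if "0 \<le> a" "a \<le> b" "b \<le> c" "c \<le> 1" for a b c
 proof (rule hyp_dist_segment(2))
  show "m a \<in> hyp_space" "m c \<in> hyp_space" using mh that by auto
  show "m b \<in> closed_segment (m a) (m c)"
  proof (cases "a = c")
   case True thus ?thesis using that by simp
  next
   case False
   define u where "u = (b - a) / (c - a)"
   have u: "0 \<le> u" "u \<le> 1" using that False by (auto simp: u_def divide_le_eq)
   have "u * (c - a) = b - a" using False by (simp add: u_def)
   hence "b = (1 - u) * a + u * c" by (simp add: algebra_simps)
   moreover have "m s = x + s *\<^sub>R (y - x)" for s by (simp add: m_def algebra_simps)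
   moreover have "x + ((1 - u) * a + u * c) *\<^sub>R v = (1 - u) *\<^sub>R (x + a *\<^sub>R v) + u *\<^sub>R (x + c *\<^sub>R v)" for v
    by (simp add: algebra_simps)
   ultimately have "m b = (1 - u) *\<^sub>R m a + u *\<^sub>R m c" by metis
   thus ?thesis using u unfolding closed_segment_def by blast
  qed
 qed
 \<comment> \<open>Bisection along the segment: the local estimates at a point are two-sided, and
   distances add up along a geodesic, so the bound passes from short pieces to the whole
   segment.\<close>
 define short where "short a b \<longleftrightarrow> (0 \<le> a \<and> b \<le> 1 --> dD (B.cls (w a)) (B.cls (w b)) \<le> hyp_dist (m a) (m b))" for a b
 have "short 0 1"
 proof (rule Bolzano[where P = short])
  fix a b c :: real
  assume h: "short a b" "short b c" "a \<le> b" "b \<le> c"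
  show "short a c" unfolding short_def
  proof
   assume ac: "0 \<le> a \<and> c \<le> 1"
   have P: "w a \<in> pyramid_points D" "w b \<in> pyramid_points D" "w c \<in> pyramid_points D" using wp ac h(3,4) by auto
   show "dD (B.cls (w a)) (B.cls (w c)) \<le> hyp_dist (m a) (m c)"
    using dD_triangle[OF P] add[of a b c] h ac unfolding short_def by linarith
  qed
 next
  fix s :: real assume s: "0 \<le> s" "s \<le> 1"
  then obtain \<delta> where \<delta>: "\<delta> > 0" "\<And>s'. s' \<in> {0..1} ==> \<bar>s' - s\<bar> < \<delta> ==> dD (B.cls (w s)) (B.cls (w s')) \<le> hyp_dist (m s) (m s') \<and>
   dD (B.cls (w s')) (B.cls (w s)) \<le> hyp_dist (m s) (m s')" using loc[of s] by auto
  have "dD (B.cls (w a)) (B.cls (w b)) \<le> hyp_dist (m a) (m b)" if h: "a \<le> s" "s \<le> b" "b - a < \<delta>" "0 \<le> a" "b \<le> 1" for a b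
  proof -
   have P: "w a \<in> pyramid_points D" "w s \<in> pyramid_points D" "w b \<in> pyramid_points D" using wp h by auto
   have "dD (B.cls (w a)) (B.cls (w s)) \<le> hyp_dist (m s) (m a)" "dD (B.cls (w s)) (B.cls (w b)) \<le> hyp_dist (m s) (m b)"
    using \<delta>(2)[of a] \<delta>(2)[of b] h by auto
   thus ?thesis using dD_triangle[OF P] add[of a s b] h hyp_dist_commute[of "m s" "m a"] by linarith
  qed
  thus "\<exists>d>0. \<forall>a b. a \<le> s \<and> s \<le> b \<and> b - a < d --> short a b"
   unfolding short_def using \<delta>(1) by blast
 qed simp
 hence "dD (B.cls (w 0)) (B.cls (w 1)) \<le> hyp_dist (m 0) (m 1)" unfolding short_def by simp
 moreover have m01: "m 0 = x" "m 1 = y" by (simp_all add: m_def)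
 moreover have "corr (i, x) (w 0)" "corr (i, y) (w 1)" using w[of 0] w[of 1] m01 by simp_all
 hence "B.cls (w 0) = B.cls q" "B.cls (w 1) = B.cls q'" using corr_cls q by blast+
 ultimately show ?thesis by simp
qed

lemma corr_chain:
 "ch \<noteq> [] ==> (\<forall>(p, q) \<in> set ch. p \<in> pyramid_points C \<and> q \<in> pyramid_points C \<and> fst p = fst q) ==>
   successively (\<lambda>(_, q) (p', _). (q, p') \<in> glued C) ch ==> corr (fst (hd ch)) q ==> corr (snd (last ch)) q' ==>
   dD (B.cls q) (B.cls q') \<le> A.chain_length ch"
proof (induction ch arbitrary: q)
 case (Cons uv ch)
 obtain u v where uv: "uv = (u, v)" by (cases uv)
 have b: "u \<in> pyramid_points C" "v \<in> pyramid_points C" "fst u = fst v" using Cons.prems(2) uv by auto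
 have link: "dD (B.cls q) (B.cls r) \<le> hyp_dist (snd u) (snd v)" if "corr v r" for r
 proof -
  have e: "(fst v, snd u) = u" using b(3) by (simp add: prod_eq_iff)
  have "corr u q" using Cons.prems(4) uv by simp
  thus ?thesis using corr_link[of "fst v" "snd u" "snd v" q r] b(1,2) that unfolding e by simp
 qed
 have len: "A.chain_length (uv # ch) = hyp_dist (snd u) (snd v) + A.chain_length ch" by (simp add: A.chain_length_def uv)
 show ?case
 proof (cases "ch = []")
  case True thus ?thesis using link[of q'] Cons.prems(5) uv by (simp add: len) (simp add: A.chain_length_def)
 next
  case False
  obtain r where r: "corr v r" using corr_exists[OF b(2)] by blast
  have "(v, fst (hd ch)) \<in> glued C" using Cons.prems(3) False uv by (cases ch) (auto simp: case_prod_beta)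
  hence r': "corr (fst (hd ch)) r" by (rule corr_glued_left[OF r])
  have su: "successively (\<lambda>(_, q) (p', _). (q, p') \<in> glued C) ch" using Cons.prems(3) by (cases ch) auto
  have al: "\<forall>(p, q) \<in> set ch. p \<in> pyramid_points C \<and> q \<in> pyramid_points C \<and> fst p = fst q" using Cons.prems(2) by simp
  have la: "corr (snd (last ch)) q'" using Cons.prems(5) False by simp
  have "dD (B.cls r) (B.cls q') \<le> A.chain_length ch" by (rule Cons.IH[OF False al su r' la])
  moreover have "dD (B.cls q) (B.cls q') \<le> dD (B.cls q) (B.cls r) + dD (B.cls r) (B.cls q')"
   by (rule dD_triangle[OF corr_points[OF Cons.prems(4), THEN conjunct2] corr_points[OF r, THEN conjunct2] corr_points[OF Cons.prems(5), THEN conjunct2]])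
  ultimately show ?thesis using link[OF r] len by linarith
 qed
qed simp

lemma corr_short:
 assumes "corr p q" "corr p' q'"
 shows "cusp_dist D (B.cls q) (B.cls q') \<le> cusp_dist C (A.cls p) (A.cls p')" unfolding cusp_dist_def A.gluing_dist_chain
proof (rule cInf_greatest)
 show "{A.chain_length ch | ch. A.is_chain (pyramid_points C) ch (A.cls p) (A.cls p')} \<noteq> {}"
  using A.pyramid_chain[of p p'] corr_points assms by blast
 fix l assume "l \<in> {A.chain_length ch | ch. A.is_chain (pyramid_points C) ch (A.cls p) (A.cls p')}"
 then obtain ch where l: "l = A.chain_length ch" and ch: "A.is_chain (pyramid_points C) ch (A.cls p) (A.cls p')" by blast
 have "corr (fst (hd ch)) q" "corr (snd (last ch)) q'"
  using ch corr_glued_left[OF assms(1)] corr_glued_left[OF assms(2)] unfolding A.is_chain_def A.cls_iff by blast+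
 thus "dD (B.cls q) (B.cls q') \<le> l" unfolding l using ch corr_chain unfolding A.is_chain_def by blast
qed

lemma isometric: "isometric_cusps C D"
proof -
 \<comment> \<open>The situation is symmetric with factor \<open>1 / \<kappa>\<close>, so the
   inequality of \<open>corr_short\<close> holds in both directions.\<close>
 interpret swap: proportional_cusps D C g Sing \<psi> \<phi> "1 / \<kappa>" by unfold_locales (use \<kappa> ratio in auto)
 have swap_corr: "swap.corr q p \<longleftrightarrow> corr p q" for p q
  unfolding swap.corr_def corr_def by (rule iffI; elim bexE exE conjE; metis)
 \<comment> \<open>Any corresponding point will do, since all points that correspond to members of
   one class are glued in \<open>D\<close>.\<close>
 define f where "f X = B.cls (SOME q. \<exists>p\<in>X. corr p q)" for X
 have f: "f (A.cls p) = B.cls q" if pq: "corr p q" for p q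
 proof -
  have "\<exists>q. \<exists>p'\<in>A.cls p. corr p' q" using pq A.cls_self by blast
  from someI_ex[OF this] obtain p' where p': "(p, p') \<in> glued C" "corr p' (SOME q. \<exists>p'\<in>A.cls p. corr p' q)" by (auto simp: A.cls_iff)
  have "corr p' q" by (rule corr_glued_left[OF pq p'(1)])
  thus ?thesis unfolding f_def using corr_cls p'(2) by blast
 qed
 have "isometry_between (cusp_space C) (cusp_dist C) (cusp_space D) (cusp_dist D) f" unfolding isometry_between_def
 proof (intro conjI ballI)
  fix X Y assume "X \<in> cusp_space C" "Y \<in> cusp_space C"
  then obtain p p' where p: "p \<in> pyramid_points C" "X = A.cls p" "p' \<in> pyramid_points C" "Y = A.cls p'" unfolding A.cusp_space_cls by blast
  obtain q q' where q: "corr p q" "corr p' q'" using corr_exists p(1,3) by blast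
  show "cusp_dist D (f X) (f Y) = cusp_dist C X Y" unfolding p(2,4) f[OF q(1)] f[OF q(2)]
   using corr_short[OF q] swap.corr_short[of q p q' p'] q by (simp add: swap_corr)
 next
  show "bij_betw f (cusp_space C) (cusp_space D)" unfolding bij_betw_def
  proof
   show "inj_on f (cusp_space C)"
   proof (rule inj_onI)
    fix X Y assume "X \<in> cusp_space C" "Y \<in> cusp_space C" and e: "f X = f Y"
    then obtain p p' where p: "p \<in> pyramid_points C" "X = A.cls p" "p' \<in> pyramid_points C" "Y = A.cls p'" unfolding A.cusp_space_cls by blast
    obtain q q' where q: "corr p q" "corr p' q'" using corr_exists p(1,3) by blast
    have "(q, q') \<in> glued D" using e unfolding p(2,4) f[OF q(1)] f[OF q(2)] B.cls_eq .
    hence "swap.corr q' p" using swap.corr_glued_left[of q p q'] q(1) by (simp add: swap_corr)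
    moreover have "swap.corr q' p'" using q(2) by (simp add: swap_corr)
    ultimately have "(p, p') \<in> glued C" by (rule swap.corr_unique)
    thus "X = Y" unfolding p(2,4) A.cls_eq .
   qed
   show "f ` cusp_space C = cusp_space D"
   proof
    show "f ` cusp_space C \<subseteq> cusp_space D"
    proof
     fix Y assume "Y \<in> f ` cusp_space C"
     then obtain p where p: "p \<in> pyramid_points C" "Y = f (A.cls p)" unfolding A.cusp_space_cls by blast
     obtain q where q: "corr p q" using corr_exists[OF p(1)] by blast
     show "Y \<in> cusp_space D" unfolding B.cusp_space_cls p(2) f[OF q] using corr_points[OF q] by blast
    qed
    show "cusp_space D \<subseteq> f ` cusp_space C"
    proof
     fix Y assume "Y \<in> cusp_space D"
     then obtain q where q: "q \<in> pyramid_points D" "Y = B.cls q" unfolding B.cusp_space_cls by blast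
     obtain p where "corr p q" using swap.corr_exists[OF q(1)] by (auto simp: swap_corr)
     thus "Y \<in> f ` cusp_space C" unfolding A.cusp_space_cls q(2) using f corr_points by blast
    qed
   qed
  qed
 qed
 thus ?thesis unfolding isometric_cusps_def by blast
qed

end

theorem theoremC:
  fixes g :: "complex \<times> complex \<Rightarrow> complex \<times> complex \<Rightarrow> real"
    and Sing :: "(complex \<times> complex) set"
    and M :: "'i cuspidal_complex"
    and M' :: "'j cuspidal_complex"
    and \<phi> :: "complex \<times> complex \<Rightarrow> ('i \<times> (real^3)) set"
    and \<phi>' :: "complex \<times> complex \<Rightarrow> ('j \<times> (real^3)) set"
  assumes "hyp_cone_metric_on_torus g Sing"
    and "polyhedral_cusp M" and "convex_cusp M"
    and "polyhedral_cusp M'" and "convex_cusp M'"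
    and "boundary_identification g Sing M \<phi>"
    and "boundary_identification g Sing M' \<phi>'"
    and "\<forall>x \<in> Sing. singular_curvature M (\<phi> x) = singular_curvature M' (\<phi>' x)"
  shows "isometric_cusps M M'"
proof -
  interpret two_cusps M M' g Sing \<phi> \<phi>'
    by unfold_locales (use assms in auto)
  have "particle_angle M (\<phi> x) = particle_angle M' (\<phi>' x)" if "x \<in> Sing" for x
    using assms(8) that by (auto simp: singular_curvature_def)
  then obtain \<kappa> where \<kappa>: "\<kappa> > 0" "\<forall>w\<in>torus. B.Fb w = \<kappa> * A.Fb w" using horofunctions_proportional by blast
  interpret proportional_cusps M M' g Sing \<phi> \<phi>' \<kappa> by unfold_locales (use \<kappa> in auto)
  show ?thesis by (rule isometric)
qed

end
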